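(* Let $A=k_{-1}[x_1,x_2]$ and let $B=A_{\{-1,0\}}[y_1,y_2;\sigma]$ be the $\mathbb{Z}$-graded double Ore extension of $A$ (with $p_{12}=-1$, $p_{11}=0$, $\deg x_i=\deg y_i=1$) where the algebra homomorphism $\sigma=(\sigma_{ij}):A\to M_2(A)$ satisfies $$\begin{array}{llll}\sigma_{11}(x_1)=x_1+x_2,&\sigma_{12}(x_1)=x_1,&\sigma_{21}(x_1)=x_2,&\sigma_{22}(x_1)=0,\\ \sigma_{11}(x_2)=0,&\sigma_{12}(x_2)=x_1,&\sigma_{21}(x_2)=-x_2,&\sigma_{22}(x_2)=-x_1+x_2.\end{array}$$ Then $B/(x_1^2+x_2^2+y_1^2+y_2^2)$ is not a noncommutative graded isolated singularity.
   Context: $k$ is an algebraically closed field of characteristic $0$. $k_{-1}[x_1,x_2]=k\langle x_1,x_2\rangle/(x_1x_2+x_2x_1)$. $B=A_{\{p_{12},p_{11}\}}[y_1,y_2;\sigma]$ denotes a $\mathbb{Z}$-graded (trimmed) double Ore extension of $A$: $B$ is generated by $A$ and homogeneous $y_1,y_2$; $y_2y_1=p_{12}y_1y_2+p_{11}y_1^2$; $B$ is a free left $A$-module with basis $\{y_1^iy_2^j\}_{i,j\ge0}$; $y_ia=\sigma_{i1}(a)y_1+\sigma_{i2}(a)y_2$ for $a\in A$; and $B$ is also a left double Ore extension with the same $y_1,y_2$ (i.e. the left-right mirrored conditions hold). So here $B$ is generated by $x_1,x_2,y_1,y_2$ with relations $x_1x_2+x_2x_1=0$, $y_2y_1=-y_1y_2$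 and $y_ix_j=\sigma_{i1}(x_j)y_1+\sigma_{i2}(x_j)y_2$. For a noetherian connected graded algebra $S$, $\mathrm{qgr}\,S=\mathrm{gr}_{\mathbb{Z}}S/\mathrm{tors}_{\mathbb{Z}}S$, where $\mathrm{gr}_{\mathbb{Z}}S$ is the category of finitely generated $\mathbb{Z}$-graded right $S$-modules and $\mathrm{tors}_{\mathbb{Z}}S$ its full subcategory of finite-dimensional modules. $S$ is a noncommutative graded isolated singularity if $\mathrm{qgr}\,S$ has finite global dimension. *)

theory Defs
  imports
    "HOL-Algebra.QuotRing"
    "HOL-Algebra.Generated_Rings"
    "HOL-Computational_Algebra.Polynomial"
    "HOL-Library.Extended_Nat"
begin

section \<open>Categories, Yoneda Ext and global dimension\<close>

record ('o, 'a) cat =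
  Obj :: "'o set"
  Arr :: "'a set"
  Dom :: "'a \<Rightarrow> 'o"
  Cod :: "'a \<Rightarrow> 'o"
  Ident :: "'o \<Rightarrow> 'a"
  Comp :: "'a \<Rightarrow> 'a \<Rightarrow> 'a"  (infixr \<open>\<star>\<index>\<close> 75)

text \<open>\<open>g \<star>\<^bsub>C\<^esub> f\<close> is \<open>g\<close> after \<open>f\<close>; it is meaningful only if \<open>Cod C f = Dom C g\<close>.\<close>

definition hom_set :: "('o, 'a) cat \<Rightarrow> 'o \<Rightarrow> 'o \<Rightarrow> 'a set" where
  "hom_set C X Y = {f \<in> Arr C. Dom C f = X \<and> Cod C f = Y}"

definition zero_object :: "('o, 'a) cat \<Rightarrow> 'o \<Rightarrow> bool" where
  "zero_object C Z \<longleftrightarrow> Z \<in> Obj C \<and>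
     (\<forall>X\<in>Obj C. (\<exists>!f. f \<in> hom_set C X Z) \<and> (\<exists>!f. f \<in> hom_set C Z X))"

definition zero_arrow :: "('o, 'a) cat \<Rightarrow> 'a \<Rightarrow> bool" where
  "zero_arrow C f \<longleftrightarrow> f \<in> Arr C \<and>
     (\<exists>Z g h. zero_object C Z \<and> g \<in> hom_set C (Dom C f) Z \<and> h \<in> hom_set C Z (Cod C f) \<and>
        f = h \<star>\<^bsub>C\<^esub> g)"

definition mono_arrow :: "('o, 'a) cat \<Rightarrow> 'a \<Rightarrow> bool" where
  "mono_arrow C f \<longleftrightarrow> f \<in> Arr C \<and>
     (\<forall>X\<in>Obj C. \<forall>g\<in>hom_set C X (Dom C f). \<forall>h\<in>hom_set C X (Dom C f).
        f \<star>\<^bsub>C\<^esub> g = f \<star>\<^bsub>C\<^esub> h \<longrightarrow> g = h)"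

definition epi_arrow :: "('o, 'a) cat \<Rightarrow> 'a \<Rightarrow> bool" where
  "epi_arrow C f \<longleftrightarrow> f \<in> Arr C \<and>
     (\<forall>X\<in>Obj C. \<forall>g\<in>hom_set C (Cod C f) X. \<forall>h\<in>hom_set C (Cod C f) X.
        g \<star>\<^bsub>C\<^esub> f = h \<star>\<^bsub>C\<^esub> f \<longrightarrow> g = h)"

definition is_kernel :: "('o, 'a) cat \<Rightarrow> 'a \<Rightarrow> 'a \<Rightarrow> bool" where
  "is_kernel C k f \<longleftrightarrow> k \<in> Arr C \<and> f \<in> Arr C \<and> Cod C k = Dom C f \<and> zero_arrow C (f \<star>\<^bsub>C\<^esub> k) \<and>
     (\<forall>g\<in>Arr C. Cod C g = Dom C f \<and> zero_arrow C (f \<star>\<^bsub>C\<^esub> g) \<longrightarrow>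
        (\<exists>!h. h \<in> hom_set C (Dom C g) (Dom C k) \<and> k \<star>\<^bsub>C\<^esub> h = g))"

definition is_cokernel :: "('o, 'a) cat \<Rightarrow> 'a \<Rightarrow> 'a \<Rightarrow> bool" where
  "is_cokernel C c f \<longleftrightarrow> c \<in> Arr C \<and> f \<in> Arr C \<and> Dom C c = Cod C f \<and> zero_arrow C (c \<star>\<^bsub>C\<^esub> f) \<and>
     (\<forall>g\<in>Arr C. Dom C g = Cod C f \<and> zero_arrow C (g \<star>\<^bsub>C\<^esub> f) \<longrightarrow>
        (\<exists>!h. h \<in> hom_set C (Cod C c) (Cod C g) \<and> h \<star>\<^bsub>C\<^esub> c = g))"

text \<open>In an abelian category the image of \<open>f\<close> is the kernel of its cokernel, so the following
  says that the image of \<open>f\<close> is the kernel of \<open>g\<close>.\<close>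

definition exact_at :: "('o, 'a) cat \<Rightarrow> 'a \<Rightarrow> 'a \<Rightarrow> bool" where
  "exact_at C f g \<longleftrightarrow> Cod C f = Dom C g \<and>
     (\<exists>c m. is_cokernel C c f \<and> is_kernel C m c \<and> is_kernel C m g)"

text \<open>An \<open>n\<close>-fold extension (\<open>n \<ge> 1\<close>) of \<open>M\<close> by \<open>N\<close>, that is, an exact sequence
  \<open>0 \<rightarrow> N \<rightarrow> E\<^sub>n \<rightarrow> \<dots> \<rightarrow> E\<^sub>1 \<rightarrow> M \<rightarrow> 0\<close>, is encoded by the list of its \<open>n + 1\<close> inner arrows.\<close>

definition extensions :: "('o, 'a) cat \<Rightarrow> nat \<Rightarrow> 'o \<Rightarrow> 'o \<Rightarrow> 'a list set" where
  "extensions C n M N = {d. length d = n + 1 \<and> set d \<subseteq> Arr C \<and>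
     Dom C (d ! 0) = N \<and> Cod C (d ! n) = M \<and>
     mono_arrow C (d ! 0) \<and> epi_arrow C (d ! n) \<and>
     (\<forall>i<n. exact_at C (d ! i) (d ! (i + 1)))}"

text \<open>Pairs of \<open>n\<close>-fold extensions connected by a morphism that is the identity on \<open>N\<close> and \<open>M\<close>.\<close>

definition extension_morphism ::
    "('o, 'a) cat \<Rightarrow> nat \<Rightarrow> 'o \<Rightarrow> 'o \<Rightarrow> ('a list \<times> 'a list) set" where
  "extension_morphism C n M N =
     {(d, e). d \<in> extensions C n M N \<and> e \<in> extensions C n M N \<and>
        (\<exists>h :: nat \<Rightarrow> 'a. h 0 = Ident C N \<and> h (n + 1) = Ident C M \<and>
           (\<forall>i\<le>n. h i \<in> hom_set C (Dom C (d ! i)) (Dom C (e ! i)) \<and>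
                  h (i + 1) \<star>\<^bsub>C\<^esub> (d ! i) = (e ! i) \<star>\<^bsub>C\<^esub> h i))}"

text \<open>\<open>Ext\<^sup>n(M, N)\<close> for \<open>n \<ge> 1\<close> as a set: \<open>n\<close>-fold extensions modulo the equivalence relation
  generated by morphisms of extensions. In an abelian category it is an abelian group under
  the Baer sum, hence it vanishes iff it is a singleton.\<close>

definition yoneda_Ext :: "('o, 'a) cat \<Rightarrow> nat \<Rightarrow> 'o \<Rightarrow> 'o \<Rightarrow> 'a list set set" where
  "yoneda_Ext C n M N =
     extensions C n M N //
       rtrancl (extension_morphism C n M N \<union> (extension_morphism C n M N)\<inverse>)"

text \<open>The supremum of all \<open>n\<close> with \<open>Ext\<^sup>n(M, N) \<noteq> 0\<close> for some objects \<open>M, N\<close>. Degree \<open>0\<close> may be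
  left out, since it cannot contribute more than \<open>0 = Sup {}\<close>.\<close>

definition gldim :: "('o, 'a) cat \<Rightarrow> enat" where
  "gldim C = Sup {enat n | n. n \<ge> 1 \<and>
     (\<exists>M\<in>Obj C. \<exists>N\<in>Obj C. \<not> is_singleton (yoneda_Ext C n M N))}"


section \<open>Quotient categories\<close>

text \<open>Let \<open>C\<close> be abelian and \<open>T\<close> (the objects of) a Serre subcategory. The quotient \<open>C/T\<close> is the
  localization of \<open>C\<close> at the class of arrows with kernel and cokernel in \<open>T\<close>. This class admits
  a calculus of fractions, so an arrow \<open>X \<rightarrow> Y\<close> of \<open>C/T\<close> is an equivalence class of roofs
  \<open>(s, f)\<close>, representing \<open>f \<circ> s\<^sup>-\<^sup>1\<close>, where \<open>s : W \<rightarrow> X\<close> lies in this class and \<open>f : W \<rightarrow> Y\<close>.\<close>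

definition iso_mod :: "('o, 'a) cat \<Rightarrow> 'o set \<Rightarrow> 'a set" where
  "iso_mod C T = {s \<in> Arr C. (\<exists>k. is_kernel C k s \<and> Dom C k \<in> T) \<and>
                             (\<exists>c. is_cokernel C c s \<and> Cod C c \<in> T)}"

definition roofs :: "('o, 'a) cat \<Rightarrow> 'o set \<Rightarrow> 'o \<Rightarrow> 'o \<Rightarrow> ('a \<times> 'a) set" where
  "roofs C T X Y = {(s, f). s \<in> iso_mod C T \<and> f \<in> Arr C \<and>
     Dom C s = Dom C f \<and> Cod C s = X \<and> Cod C f = Y}"

definition roof_rel :: "('o, 'a) cat \<Rightarrow> 'o set \<Rightarrow> 'o \<Rightarrow> 'o \<Rightarrow> (('a \<times> 'a) \<times> ('a \<times> 'a)) set" where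
  "roof_rel C T X Y = {((s, f), (t, g)). (s, f) \<in> roofs C T X Y \<and> (t, g) \<in> roofs C T X Y \<and>
     (\<exists>u\<in>Arr C. \<exists>v\<in>Arr C. Dom C u = Dom C v \<and> Cod C u = Dom C s \<and> Cod C v = Dom C t \<and>
        s \<star>\<^bsub>C\<^esub> u \<in> iso_mod C T \<and> s \<star>\<^bsub>C\<^esub> u = t \<star>\<^bsub>C\<^esub> v \<and> f \<star>\<^bsub>C\<^esub> u = g \<star>\<^bsub>C\<^esub> v)}"

text \<open>Roofs \<open>(s, f)\<close> and \<open>(t, g)\<close> are composed by completing \<open>f, t\<close> to a commutative square
  \<open>f \<circ> u = t \<circ> v\<close> with \<open>u\<close> in the class that is inverted; the result is \<open>(s \<circ> u, g \<circ> v)\<close>.\<close>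

definition comp_roofs ::
    "('o, 'a) cat \<Rightarrow> 'o set \<Rightarrow> 'o \<Rightarrow> 'o \<Rightarrow> ('a \<times> 'a) set \<Rightarrow> ('a \<times> 'a) set \<Rightarrow> ('a \<times> 'a) set" where
  "comp_roofs C T X Z q p =
     {r. \<exists>s f t g u v. (s, f) \<in> p \<and> (t, g) \<in> q \<and> u \<in> iso_mod C T \<and> v \<in> Arr C \<and>
        Dom C u = Dom C v \<and> Cod C u = Dom C f \<and> Cod C v = Dom C t \<and>
        f \<star>\<^bsub>C\<^esub> u = t \<star>\<^bsub>C\<^esub> v \<and> ((s \<star>\<^bsub>C\<^esub> u, g \<star>\<^bsub>C\<^esub> v), r) \<in> roof_rel C T X Z}"

definition quotient_cat ::
    "('o, 'a) cat \<Rightarrow> 'o set \<Rightarrow> ('o, 'o \<times> ('a \<times> 'a) set \<times> 'o) cat" where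
  "quotient_cat C T =
     \<lparr>Obj = Obj C,
      Arr = {(X, p, Y). X \<in> Obj C \<and> Y \<in> Obj C \<and> p \<in> roofs C T X Y // roof_rel C T X Y},
      Dom = (\<lambda>(X, p, Y). X),
      Cod = (\<lambda>(X, p, Y). Y),
      Ident = (\<lambda>X. (X, roof_rel C T X X `` {(Ident C X, Ident C X)}, X)),
      Comp = (\<lambda>(Y', q, Z) (X, p, Y). (X, comp_roofs C T X Z q p, Z))\<rparr>"


section \<open>Graded algebras\<close>

text \<open>The additive group of \<open>R\<close> is the internal direct sum of the subgroups \<open>D i\<close>, \<open>i \<in> \<int>\<close>.\<close>

definition grading :: "('a, 'm) ring_scheme \<Rightarrow> (int \<Rightarrow> 'a set) \<Rightarrow> bool" where
  "grading R D \<longleftrightarrow> (\<forall>i. subgroup (D i) (add_monoid R)) \<and>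
     (\<forall>a\<in>carrier R. \<exists>!c. (\<forall>i. c i \<in> D i) \<and> finite {i. c i \<noteq> \<zero>\<^bsub>R\<^esub>} \<and>
        a = (\<Oplus>\<^bsub>R\<^esub>i\<in>{i. c i \<noteq> \<zero>\<^bsub>R\<^esub>}. c i))"

record ('k, 'a) graded_alg = "'a ring" +
  ascale :: "'k \<Rightarrow> 'a \<Rightarrow> 'a"  (infixr \<open>\<bullet>\<index>\<close> 76)
  hcomp :: "int \<Rightarrow> 'a set"

locale graded_algebra = ring S for S :: "('k::field, 'a) graded_alg" (structure) +
  assumes ascale_closed: "a \<in> carrier S \<Longrightarrow> c \<bullet> a \<in> carrier S"
    and ascale_add: "a \<in> carrier S \<Longrightarrow> b \<in> carrier S \<Longrightarrow> c \<bullet> (a \<oplus> b) = c \<bullet> a \<oplus> c \<bullet> b"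
    and add_ascale: "a \<in> carrier S \<Longrightarrow> (c + d) \<bullet> a = c \<bullet> a \<oplus> d \<bullet> a"
    and ascale_ascale: "a \<in> carrier S \<Longrightarrow> (c * d) \<bullet> a = c \<bullet> d \<bullet> a"
    and ascale_one: "a \<in> carrier S \<Longrightarrow> 1 \<bullet> a = a"
    and ascale_mult_left: "a \<in> carrier S \<Longrightarrow> b \<in> carrier S \<Longrightarrow> c \<bullet> (a \<otimes> b) = (c \<bullet> a) \<otimes> b"
    and ascale_mult_right: "a \<in> carrier S \<Longrightarrow> b \<in> carrier S \<Longrightarrow> c \<bullet> (a \<otimes> b) = a \<otimes> (c \<bullet> b)"
    and grading: "grading S (hcomp S)"
    and ascale_hcomp: "a \<in> hcomp S i \<Longrightarrow> c \<bullet> a \<in> hcomp S i"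
    and one_hcomp: "\<one> \<in> hcomp S 0"
    and mult_hcomp: "a \<in> hcomp S i \<Longrightarrow> b \<in> hcomp S j \<Longrightarrow> a \<otimes> b \<in> hcomp S (i + j)"

definition graded_algebra_hom ::
    "('k, 'a) graded_alg \<Rightarrow> ('k, 'b) graded_alg \<Rightarrow> ('a \<Rightarrow> 'b) set" where
  "graded_algebra_hom R S = {f \<in> ring_hom R S.
     (\<forall>c. \<forall>a\<in>carrier R. f (c \<bullet>\<^bsub>R\<^esub> a) = c \<bullet>\<^bsub>S\<^esub> f a) \<and> (\<forall>i. f ` hcomp R i \<subseteq> hcomp S i)}"

text \<open>The quotient by a homogeneous two-sided ideal \<open>I\<close>. The union defining the scalar action
  is over representatives of the coset \<open>X\<close>, all of which give the same coset.\<close>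

definition graded_quotient :: "('k, 'a) graded_alg \<Rightarrow> 'a set \<Rightarrow> ('k, 'a set) graded_alg" where
  "graded_quotient S I = ring.extend (S Quot I)
     (graded_alg.fields (\<lambda>c X. \<Union>a\<in>X. I +>\<^bsub>S\<^esub> (c \<bullet>\<^bsub>S\<^esub> a)) (\<lambda>i. (+>\<^bsub>S\<^esub>) I ` hcomp S i))"

text \<open>The free algebra \<open>k\<langle>v | v :: 'v\<rangle>\<close>: finitely supported coefficient functions on words, graded
  by word length.\<close>

definition free_alg :: "('k::field, 'v list \<Rightarrow> 'k) graded_alg" where
  "free_alg =
     \<lparr>carrier = {f. finite {w. f w \<noteq> 0}},
      monoid.mult = (\<lambda>f g w. \<Sum>i\<le>length w. f (take i w) * g (drop i w)),
      one = (\<lambda>w. if w = [] then 1 else 0),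
      zero = (\<lambda>w. 0),
      add = (\<lambda>f g w. f w + g w),
      ascale = (\<lambda>c f w. c * f w),
      hcomp = (\<lambda>n. {f. finite {w. f w \<noteq> 0} \<and> (\<forall>w. f w \<noteq> 0 \<longrightarrow> int (length w) = n)})\<rparr>"

definition free_var :: "'v \<Rightarrow> 'v list \<Rightarrow> 'k::field" where
  "free_var v = (\<lambda>w. if w = [v] then 1 else 0)"

datatype xvar = X1 | X2

definition skew_rel_ideal :: "(xvar list \<Rightarrow> 'k::field) set" where
  "skew_rel_ideal = Idl\<^bsub>free_alg\<^esub>
     {free_var X1 \<otimes>\<^bsub>free_alg\<^esub> free_var X2 \<oplus>\<^bsub>free_alg\<^esub> free_var X2 \<otimes>\<^bsub>free_alg\<^esub> free_var X1}"

text \<open>The algebra \<open>k\<^sub>-\<^sub>1[x\<^sub>1, x\<^sub>2]\<close> with \<open>deg x\<^sub>1 = deg x\<^sub>2 = 1\<close>, and its generators.\<close>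

definition skew_plane :: "('k::field, (xvar list \<Rightarrow> 'k) set) graded_alg" where
  "skew_plane = graded_quotient free_alg skew_rel_ideal"

definition x1 :: "(xvar list \<Rightarrow> 'k::field) set" where
  "x1 = skew_rel_ideal +>\<^bsub>free_alg\<^esub> free_var X1"

definition x2 :: "(xvar list \<Rightarrow> 'k::field) set" where
  "x2 = skew_rel_ideal +>\<^bsub>free_alg\<^esub> free_var X2"


section \<open>Double Ore extensions\<close>

text \<open>\<open>\<sigma> = (\<sigma>\<^sub>i\<^sub>j)\<close>, \<open>i, j \<in> {1, 2}\<close>, is a homomorphism of algebras \<open>A \<rightarrow> M\<^sub>2(A)\<close>; values of \<open>\<sigma>\<close> at
  other indices are irrelevant.\<close>

definition matrix_hom :: "('k, 'a) graded_alg \<Rightarrow> (nat \<Rightarrow> nat \<Rightarrow> 'a \<Rightarrow> 'a) \<Rightarrow> bool" where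
  "matrix_hom A \<sigma> \<longleftrightarrow> (\<forall>i\<in>{1, 2}. \<forall>j\<in>{1, 2}.
     \<sigma> i j \<in> carrier A \<rightarrow> carrier A \<and>
     \<sigma> i j \<one>\<^bsub>A\<^esub> = (if i = j then \<one>\<^bsub>A\<^esub> else \<zero>\<^bsub>A\<^esub>) \<and>
     (\<forall>a\<in>carrier A. \<forall>c. \<sigma> i j (c \<bullet>\<^bsub>A\<^esub> a) = c \<bullet>\<^bsub>A\<^esub> \<sigma> i j a) \<and>
     (\<forall>a\<in>carrier A. \<forall>b\<in>carrier A.
        \<sigma> i j (a \<oplus>\<^bsub>A\<^esub> b) = \<sigma> i j a \<oplus>\<^bsub>A\<^esub> \<sigma> i j b \<and>
        \<sigma> i j (a \<otimes>\<^bsub>A\<^esub> b) = \<sigma> i 1 a \<otimes>\<^bsub>A\<^esub> \<sigma> 1 j b \<oplus>\<^bsub>A\<^esub> \<sigma> i 2 a \<otimes>\<^bsub>A\<^esub> \<sigma> 2 j b))"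

text \<open>\<open>B = A\<^bsub>{p12, p11}\<^esub>[y\<^sub>1, y\<^sub>2; \<sigma>]\<close>, trimmed and \<open>\<int>\<close>-graded. The algebra \<open>A\<close> is regarded as a graded
  subalgebra of \<open>B\<close> through \<open>\<iota>\<close>. The first predicate is the right double Ore extension property
  and the second one its left-right mirror image, where the parameters are left unspecified.\<close>

definition right_double_ore ::
    "('k::field, 'a) graded_alg \<Rightarrow> ('a \<Rightarrow> 'b) \<Rightarrow> ('k, 'b) graded_alg \<Rightarrow> (nat \<Rightarrow> 'b) \<Rightarrow>
     'k \<Rightarrow> 'k \<Rightarrow> (nat \<Rightarrow> nat \<Rightarrow> 'a \<Rightarrow> 'a) \<Rightarrow> bool" where
  "right_double_ore A \<iota> B y p12 p11 \<sigma> \<longleftrightarrow>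
     y 2 \<otimes>\<^bsub>B\<^esub> y 1 = p12 \<bullet>\<^bsub>B\<^esub> (y 1 \<otimes>\<^bsub>B\<^esub> y 2) \<oplus>\<^bsub>B\<^esub> p11 \<bullet>\<^bsub>B\<^esub> (y 1 \<otimes>\<^bsub>B\<^esub> y 1) \<and>
     (\<forall>b\<in>carrier B. \<exists>!c :: nat \<times> nat \<Rightarrow> 'a.
        range c \<subseteq> carrier A \<and> finite {n. c n \<noteq> \<zero>\<^bsub>A\<^esub>} \<and>
        b = (\<Oplus>\<^bsub>B\<^esub>n\<in>{n. c n \<noteq> \<zero>\<^bsub>A\<^esub>}.
               \<iota> (c n) \<otimes>\<^bsub>B\<^esub> (y 1 [^]\<^bsub>B\<^esub> fst n \<otimes>\<^bsub>B\<^esub> y 2 [^]\<^bsub>B\<^esub> snd n))) \<and>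
     (\<forall>i\<in>{1, 2}. \<forall>a\<in>carrier A.
        y i \<otimes>\<^bsub>B\<^esub> \<iota> a = \<iota> (\<sigma> i 1 a) \<otimes>\<^bsub>B\<^esub> y 1 \<oplus>\<^bsub>B\<^esub> \<iota> (\<sigma> i 2 a) \<otimes>\<^bsub>B\<^esub> y 2)"

definition left_double_ore ::
    "('k::field, 'a) graded_alg \<Rightarrow> ('a \<Rightarrow> 'b) \<Rightarrow> ('k, 'b) graded_alg \<Rightarrow> (nat \<Rightarrow> 'b) \<Rightarrow> bool" where
  "left_double_ore A \<iota> B y \<longleftrightarrow>
     (\<exists>q12 q11.
        y 1 \<otimes>\<^bsub>B\<^esub> y 2 = q12 \<bullet>\<^bsub>B\<^esub> (y 2 \<otimes>\<^bsub>B\<^esub> y 1) \<oplus>\<^bsub>B\<^esub> q11 \<bullet>\<^bsub>B\<^esub> (y 1 \<otimes>\<^bsub>B\<^esub> y 1)) \<and>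
     (\<forall>b\<in>carrier B. \<exists>!c :: nat \<times> nat \<Rightarrow> 'a.
        range c \<subseteq> carrier A \<and> finite {n. c n \<noteq> \<zero>\<^bsub>A\<^esub>} \<and>
        b = (\<Oplus>\<^bsub>B\<^esub>n\<in>{n. c n \<noteq> \<zero>\<^bsub>A\<^esub>}.
               (y 2 [^]\<^bsub>B\<^esub> fst n \<otimes>\<^bsub>B\<^esub> y 1 [^]\<^bsub>B\<^esub> snd n) \<otimes>\<^bsub>B\<^esub> \<iota> (c n))) \<and>
     (\<exists>\<tau> :: nat \<Rightarrow> nat \<Rightarrow> 'a \<Rightarrow> 'a. \<forall>i\<in>{1, 2}. \<forall>a\<in>carrier A.
        \<tau> 1 i a \<in> carrier A \<and> \<tau> 2 i a \<in> carrier A \<and>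
        \<iota> a \<otimes>\<^bsub>B\<^esub> y i = y 1 \<otimes>\<^bsub>B\<^esub> \<iota> (\<tau> 1 i a) \<oplus>\<^bsub>B\<^esub> y 2 \<otimes>\<^bsub>B\<^esub> \<iota> (\<tau> 2 i a))"

definition double_ore_extension ::
    "('k::field, 'a) graded_alg \<Rightarrow> ('a \<Rightarrow> 'b) \<Rightarrow> ('k, 'b) graded_alg \<Rightarrow> (nat \<Rightarrow> 'b) \<Rightarrow>
     'k \<Rightarrow> 'k \<Rightarrow> (nat \<Rightarrow> nat \<Rightarrow> 'a \<Rightarrow> 'a) \<Rightarrow> bool" where
  "double_ore_extension A \<iota> B y p12 p11 \<sigma> \<longleftrightarrow>
     graded_algebra A \<and> graded_algebra B \<and>
     \<iota> \<in> graded_algebra_hom A B \<and> inj_on \<iota> (carrier A) \<and>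
     (\<forall>i\<in>{1, 2}. \<exists>d. y i \<in> hcomp B d) \<and>
     generate_ring B (\<iota> ` carrier A \<union> {y 1, y 2}) = carrier B \<and>
     matrix_hom A \<sigma> \<and>
     right_double_ore A \<iota> B y p12 p11 \<sigma> \<and> left_double_ore A \<iota> B y"


section \<open>Graded right modules and noncommutative graded isolated singularities\<close>

text \<open>As in the record for modules of the library, the fields \<open>mult\<close> and \<open>one\<close> inherited from
  rings are not used.\<close>

record ('s, 'm) graded_rmod = "'m ring" +
  ract :: "'m \<Rightarrow> 's \<Rightarrow> 'm"  (infixl \<open>\<triangleleft>\<index>\<close> 70)
  mcomp :: "int \<Rightarrow> 'm set"

locale graded_right_module = S?: graded_algebra S + M?: abelian_group M
  for S :: "('k::field, 's) graded_alg" and M :: "('s, 'm) graded_rmod" (structure) +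
  assumes ract_closed: "m \<in> carrier M \<Longrightarrow> a \<in> carrier S \<Longrightarrow> m \<triangleleft> a \<in> carrier M"
    and add_ract: "m \<in> carrier M \<Longrightarrow> n \<in> carrier M \<Longrightarrow> a \<in> carrier S \<Longrightarrow>
      (m \<oplus> n) \<triangleleft> a = (m \<triangleleft> a) \<oplus> (n \<triangleleft> a)"
    and ract_add: "m \<in> carrier M \<Longrightarrow> a \<in> carrier S \<Longrightarrow> b \<in> carrier S \<Longrightarrow>
      m \<triangleleft> (a \<oplus>\<^bsub>S\<^esub> b) = (m \<triangleleft> a) \<oplus> (m \<triangleleft> b)"
    and ract_mult: "m \<in> carrier M \<Longrightarrow> a \<in> carrier S \<Longrightarrow> b \<in> carrier S \<Longrightarrow>
      m \<triangleleft> (a \<otimes>\<^bsub>S\<^esub> b) = m \<triangleleft> a \<triangleleft> b"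
    and ract_one: "m \<in> carrier M \<Longrightarrow> m \<triangleleft> \<one>\<^bsub>S\<^esub> = m"
    and module_grading: "grading M (mcomp M)"
    and ract_mcomp: "m \<in> mcomp M i \<Longrightarrow> a \<in> hcomp S j \<Longrightarrow> m \<triangleleft> a \<in> mcomp M (i + j)"

definition finitely_generated :: "('k, 's) graded_alg \<Rightarrow> ('s, 'm) graded_rmod \<Rightarrow> bool" where
  "finitely_generated S M \<longleftrightarrow> (\<exists>G. finite G \<and> G \<subseteq> carrier M \<and>
     (\<forall>m\<in>carrier M. \<exists>a. a \<in> G \<rightarrow> carrier S \<and> m = (\<Oplus>\<^bsub>M\<^esub>g\<in>G. g \<triangleleft>\<^bsub>M\<^esub> a g)))"

definition finite_dimensional :: "('k, 's) graded_alg \<Rightarrow> ('s, 'm) graded_rmod \<Rightarrow> bool" where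
  "finite_dimensional S M \<longleftrightarrow> (\<exists>G. finite G \<and> G \<subseteq> carrier M \<and>
     (\<forall>m\<in>carrier M. \<exists>c :: 'm \<Rightarrow> 'k. m = (\<Oplus>\<^bsub>M\<^esub>g\<in>G. g \<triangleleft>\<^bsub>M\<^esub> (c g \<bullet>\<^bsub>S\<^esub> \<one>\<^bsub>S\<^esub>))))"

definition graded_module_hom ::
    "('k, 's) graded_alg \<Rightarrow> ('s, 'm) graded_rmod \<Rightarrow> ('s, 'm) graded_rmod \<Rightarrow> ('m \<Rightarrow> 'm) set" where
  "graded_module_hom S M N = {f \<in> carrier M \<rightarrow>\<^sub>E carrier N.
     (\<forall>m\<in>carrier M. \<forall>n\<in>carrier M. f (m \<oplus>\<^bsub>M\<^esub> n) = f m \<oplus>\<^bsub>N\<^esub> f n) \<and>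
     (\<forall>m\<in>carrier M. \<forall>a\<in>carrier S. f (m \<triangleleft>\<^bsub>M\<^esub> a) = f m \<triangleleft>\<^bsub>N\<^esub> a) \<and>
     (\<forall>i. f ` mcomp M i \<subseteq> mcomp N i)}"

text \<open>Every finitely generated module is isomorphic to \<open>S\<^sup>r/K\<close> for some \<open>r\<close> and some submodule \<open>K\<close>,
  whose elements are cosets, that is, sets of lists (of length \<open>r\<close>) over \<open>S\<close>. So modules with
  carrier a set of sets of lists over \<open>S\<close> represent all isomorphism classes, and the category
  below is equivalent to the category of all finitely generated graded right \<open>S\<close>-modules.\<close>

type_synonym 's gmod = "('s, 's list set) graded_rmod"
type_synonym 's gmod_arr = "'s gmod \<times> ('s list set \<Rightarrow> 's list set) \<times> 's gmod"

definition gr :: "('k::field, 's) graded_alg \<Rightarrow> ('s gmod, 's gmod_arr) cat" where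
  "gr S =
     \<lparr>Obj = {M. graded_right_module S M \<and> finitely_generated S M},
      Arr = {(M, f, N). graded_right_module S M \<and> finitely_generated S M \<and>
               graded_right_module S N \<and> finitely_generated S N \<and> f \<in> graded_module_hom S M N},
      Dom = (\<lambda>(M, f, N). M),
      Cod = (\<lambda>(M, f, N). N),
      Ident = (\<lambda>M. (M, restrict id (carrier M), M)),
      Comp = (\<lambda>(N', g, P) (M, f, N). (M, compose (carrier M) g f, P))\<rparr>"

definition tors :: "('k::field, 's) graded_alg \<Rightarrow> 's gmod set" where
  "tors S = {M \<in> Obj (gr S). finite_dimensional S M}"

definition qgr ::
    "('k::field, 's) graded_alg \<Rightarrow>
     ('s gmod, 's gmod \<times> ('s gmod_arr \<times> 's gmod_arr) set \<times> 's gmod) cat" where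
  "qgr S = quotient_cat (gr S) (tors S)"

text \<open>Intended for noetherian connected graded algebras \<open>S\<close>.\<close>

definition graded_isolated_singularity :: "('k::field, 's) graded_alg \<Rightarrow> bool" where
  "graded_isolated_singularity S \<longleftrightarrow> gldim (qgr S) < \<infinity>"

end

theory Submission
  imports Defs
begin

text \<open>Put \<open>X = x\<^sub>1 + x\<^sub>2\<close>, \<open>Y = y\<^sub>1 + y\<^sub>2\<close> and let \<open>i\<^sup>2 = -1\<close>. Then \<open>X\<close> and \<open>Y\<close> commute, and
 \<open>f = x\<^sub>1\<^sup>2 + x\<^sub>2\<^sup>2 + y\<^sub>1\<^sup>2 + y\<^sub>2\<^sup>2 = X\<^sup>2 + Y\<^sup>2 = u v = v u\<close> with \<open>u = X + i Y\<close> and \<open>v = X - i Y\<close>. Since \<open>f\<close> is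
 central and regular, the right annihilators of \<open>u\<close> and \<open>v\<close> in \<open>S = B/(f)\<close> are \<open>v S\<close> and \<open>u S\<close>, and
 multiplication by \<open>u\<close> and \<open>v\<close> in turn gives, for every \<open>n\<close>, an exact sequence
 \<open>0 \<rightarrow> v S \<rightarrow> S \<rightarrow> \<dots> \<rightarrow> S \<rightarrow> w S \<rightarrow> 0\<close> with \<open>w \<in> {u, v}\<close>, up to shifts.

 Its class in the Yoneda Ext of \<open>qgr S\<close> differs from the class of the same sequence with the sign of
 its first map changed. Indeed, right multiplication by \<open>u\<close> and \<open>v\<close> in turn makes every graded module
 a complex, and chasing \<open>w\<close> through an \<open>n\<close>-fold extension yields an element of \<open>v S\<close> modulo \<open>v S v\<close>
 that is invariant under morphisms of extensions. To be insensitive to finite-dimensional modules,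
 everything is taken up to multiplication by powers of \<open>h = (x\<^sub>1 + x\<^sub>2) y\<^sub>1 + (x\<^sub>1 - x\<^sub>2) y\<^sub>2\<close>, which commutes
 with \<open>u\<close> and \<open>v\<close>. The two sequences yield \<open>v\<close> and \<open>-v\<close>, so if they were equivalent, then \<open>2 h\<^sup>k\<close> would
 lie in \<open>u B + B v\<close> for some \<open>k\<close>. This is impossible: \<open>B\<close> acts on a plane in such a way that \<open>u\<close> acts
 as \<open>0\<close>, \<open>v\<close> kills a vector, and \<open>h\<close> acts as the scalar \<open>2 i\<close>.\<close>

text \<open>Ext is defined here by Yoneda classes in a localization, so inequivalence of two
  extensions must be seen directly on zigzags of morphisms. Two devices make this possible. First,
  an arrow X \<rightarrow> Y of \<open>qgr S\<close> is the same as a germ at infinity of linear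
  maps X_d \<rightarrow> Y_d; after this translation roofs no longer occur. Second, comparing a
  sequence with its own sign change only asks for two inequivalent extensions, so neither the zero
  class nor the Baer sum enters. The element h must have positive degree, so that its powers reach
  the degrees in which germs are defined, and no power of it may vanish modulo u B + B v, where the
  invariants are compared. The plane comes from letting y_1 and y_2 act as i x_1 and i x_2: then i Y
  acts as -X, which forces u to act as 0. Algebraic closedness supplies i, and characteristic 0
  makes 2 (2 i)^k nonzero.\<close>

notation ract (infixl "\<cdot>\<index>" 70)

abbreviation (input) zero_in ("\<zero>[_]") where "\<zero>[R] \<equiv> zero R"
abbreviation (input) add_in ("_ \<oplus>[_] _" [65, 0, 66] 65) where "x \<oplus>[R] y \<equiv> add R x y"
abbreviation (input) mult_in ("_ \<otimes>[_] _" [70, 0, 71] 70) where "x \<otimes>[R] y \<equiv> monoid.mult R x y"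
abbreviation (input) ract_in ("_ \<cdot>[_] _" [70, 0, 71] 70) where "m \<cdot>[M] a \<equiv> ract M m a"
abbreviation (input) comp_in ("_ \<star>[_] _" [76, 0, 75] 75) where "g \<star>[C] f \<equiv> Comp C g f"

abbreviation Hom where "Hom S \<equiv> hom_set (gr S)"
abbreviation QHom where "QHom S \<equiv> hom_set (qgr S)"

section \<open>Graded modules\<close>

definition cmp :: "('a, 'm) ring_scheme \<Rightarrow> (int \<Rightarrow> 'a set) \<Rightarrow> 'a \<Rightarrow> int \<Rightarrow> 'a" where
 "cmp R D a = (THE c. (\<forall>i. c i \<in> D i) \<and> finite {i. c i \<noteq> \<zero>[R]} \<and>
   a = (\<Oplus>\<^bsub>R\<^esub>i\<in>{i. c i \<noteq> \<zero>[R]}. c i))"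

text \<open>Only the additive structure is involved, so that algebras and modules share these facts.
  \<open>grading\<close> asks for a unique family of components, which is what makes the description
  in \<open>cmp\<close> proper.\<close>

locale graded_group = abelian_group R for R (structure) + fixes D :: "int \<Rightarrow> 'a set"
 assumes gr: "grading R D"
begin

lemma comp_subgroup: "subgroup (D i) (add_monoid R)"
 using gr by (simp add: grading_def)

lemma comp_closed: "a \<in> D i \<Longrightarrow> a \<in> carrier R"
 using subgroup.mem_carrier[OF comp_subgroup] by simp

lemma comp_zero: "\<zero> \<in> D i"
 using subgroup.one_closed[OF comp_subgroup] by simp

lemma comp_add: "a \<in> D i \<Longrightarrow> b \<in> D i \<Longrightarrow> a \<oplus> b \<in> D i"
 using subgroup.m_closed[OF comp_subgroup] by simp

lemma comp_minus: "a \<in> D i \<Longrightarrow> \<ominus> a \<in> D i"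
 using subgroup.m_inv_closed[OF comp_subgroup] by (simp add: a_inv_def)

lemma finsum_supp:
 assumes "\<And>i. c i \<in> D i" "finite F" "{i. c i \<noteq> \<zero>} \<subseteq> F"
 shows "(\<Oplus>i\<in>{i. c i \<noteq> \<zero>}. c i) = (\<Oplus>i\<in>F. c i)"
 by (rule add.finprod_mono_neutral_cong_left) (use assms comp_closed in auto)

lemma cmp_props:
 assumes "a \<in> carrier R"
 shows "cmp R D a i \<in> D i" "finite {i. cmp R D a i \<noteq> \<zero>}"
  "a = (\<Oplus>i\<in>{i. cmp R D a i \<noteq> \<zero>}. cmp R D a i)"
proof -
 let ?P = "\<lambda>c. (\<forall>i. c i \<in> D i) \<and> finite {i. c i \<noteq> \<zero>} \<and> a = (\<Oplus>i\<in>{i. c i \<noteq> \<zero>}. c i)"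
 have "\<exists>!c. ?P c" using gr assms by (simp add: grading_def)
 from theI'[OF this] have "?P (cmp R D a)" unfolding cmp_def .
 then show "cmp R D a i \<in> D i" "finite {i. cmp R D a i \<noteq> \<zero>}"
  "a = (\<Oplus>i\<in>{i. cmp R D a i \<noteq> \<zero>}. cmp R D a i)" by auto
qed

lemma cmp_closed: "a \<in> carrier R \<Longrightarrow> cmp R D a i \<in> carrier R"
 using cmp_props(1) comp_closed by blast

lemma cmp_eqI:
 assumes c: "\<And>i. c i \<in> D i" and F: "finite F" "{i. c i \<noteq> \<zero>} \<subseteq> F" and a: "a = (\<Oplus>i\<in>F. c i)"
 shows "cmp R D a = c"
proof -
 have ac: "a \<in> carrier R" unfolding a using c comp_closed by (intro finsum_closed) auto
 let ?P = "\<lambda>c. (\<forall>i. c i \<in> D i) \<and> finite {i. c i \<noteq> \<zero>} \<and> a = (\<Oplus>i\<in>{i. c i \<noteq> \<zero>}. c i)"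
 have ex: "\<exists>!c. ?P c" using gr ac by (simp add: grading_def)
 have "?P c" using c F a finsum_supp[OF c F] finite_subset by auto
 from the1_equality[of ?P, OF ex this] show ?thesis unfolding cmp_def .
qed

lemma finsum_cmp:
 assumes "a \<in> carrier R" "finite F" "{i. cmp R D a i \<noteq> \<zero>} \<subseteq> F"
 shows "(\<Oplus>i\<in>F. cmp R D a i) = a"
 using finsum_supp[of "cmp R D a" F] cmp_props[OF assms(1)] assms by simp

lemma cmp_add:
 assumes "a \<in> carrier R" "b \<in> carrier R"
 shows "cmp R D (a \<oplus> b) i = cmp R D a i \<oplus> cmp R D b i"
proof -
 let ?F = "{i. cmp R D a i \<noteq> \<zero>} \<union> {i. cmp R D b i \<noteq> \<zero>}"
 have F: "finite ?F" using cmp_props(2) assms by blast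
 have "cmp R D (a \<oplus> b) = (\<lambda>i. cmp R D a i \<oplus> cmp R D b i)"
 proof (rule cmp_eqI[OF _ F])
  show "a \<oplus> b = (\<Oplus>i\<in>?F. cmp R D a i \<oplus> cmp R D b i)"
   using finsum_cmp[OF assms(1) F] finsum_cmp[OF assms(2) F] assms
   by (subst finsum_addf) (auto simp: cmp_closed)
 qed (auto simp: cmp_props assms comp_add)
 then show ?thesis by simp
qed

lemma cmp_homog:
 assumes "a \<in> D j" shows "cmp R D a i = (if i = j then a else \<zero>)"
proof -
 have "cmp R D a = (\<lambda>i. if i = j then a else \<zero>)"
  by (rule cmp_eqI[of _ "{j}"])
   (use assms comp_zero comp_closed[OF assms] in auto)
 then show ?thesis by simp
qed

lemma cmp_zero: "cmp R D \<zero> i = \<zero>"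
 using cmp_homog[OF comp_zero, of i] by simp

text \<open>Each element is the finite sum of its components, so an additive property only has to be
  followed along homogeneous summands.\<close>

lemma graded_induct [consumes 1, case_names zero add]:
 assumes a: "a \<in> carrier R" and z: "P \<zero>"
  and step: "\<And>i a b. a \<in> D i \<Longrightarrow> b \<in> carrier R \<Longrightarrow> P b \<Longrightarrow> P (a \<oplus> b)"
 shows "P a"
proof -
 have "P (\<Oplus>i\<in>F. cmp R D a i)" if "finite F" for F
  using that
 proof induction
  case (insert x F)
  then show ?case
   using a by (subst finsum_insert) (auto simp: cmp_closed intro!: step cmp_props)
 qed (simp add: z)
 from this[OF cmp_props(2)[OF a]] show ?thesis using cmp_props(3)[OF a] by simp
qed

lemma cmp_ext:
 assumes "a \<in> carrier R" "b \<in> carrier R" "\<And>i. cmp R D a i = cmp R D b i"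
 shows "a = b"
 by (metis assms cmp_props(3) ext)

lemma cmp_sum_exists:
 assumes "\<And>i. c i \<in> D i" "finite {i. c i \<noteq> \<zero>}"
 shows "\<exists>a\<in>carrier R. \<forall>i. cmp R D a i = c i"
proof (intro bexI allI)
 show "cmp R D (\<Oplus>i\<in>{i. c i \<noteq> \<zero>}. c i) i = c i" for i
  using cmp_eqI[OF assms] by auto
 show "(\<Oplus>i\<in>{i. c i \<noteq> \<zero>}. c i) \<in> carrier R"
  using assms comp_closed by (intro finsum_closed) auto
qed

end

text \<open>Subtracting two decompositions over a common finite index set turns uniqueness into
  independence of the subgroups, which is easier to check.\<close>

lemma gradingI:
 fixes R (structure)
 assumes "abelian_group R" and sub: "\<And>i. subgroup (D i) (add_monoid R)"
  and ex: "\<And>a. a \<in> carrier R \<Longrightarrow> \<exists>F. finite F \<and> (\<exists>c. (\<forall>i. c i \<in> D i) \<and> a = (\<Oplus>i\<in>F. c i))"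
  and uniq: "\<And>c F i. \<lbrakk>\<And>i. c i \<in> D i; finite F; (\<Oplus>i\<in>F. c i) = \<zero>; i \<in> F\<rbrakk> \<Longrightarrow> c i = \<zero>"
 shows "grading R D"
proof -
 interpret abelian_group R by fact
 have cl: "a \<in> D i \<Longrightarrow> a \<in> carrier R" for a i
  using subgroup.mem_carrier[OF sub] by simp
 have z: "\<zero> \<in> D i" for i using subgroup.one_closed[OF sub] by simp
 have mi: "a \<in> D i \<Longrightarrow> b \<in> D i \<Longrightarrow> a \<ominus> b \<in> D i" for a b i
  using subgroup.m_closed[OF sub] subgroup.m_inv_closed[OF sub]
  by (simp add: minus_eq a_inv_def)
 have supp: "(\<Oplus>i\<in>{i. c i \<noteq> \<zero>}. c i) = (\<Oplus>i\<in>F. c i)"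
  if "\<And>i. c i \<in> D i" "finite F" "{i. c i \<noteq> \<zero>} \<subseteq> F" for c F
  by (rule add.finprod_mono_neutral_cong_left) (use that cl in auto)
 show ?thesis unfolding grading_def
 proof (intro conjI allI ballI sub)
  fix a assume "a \<in> carrier R"
  from ex[OF this] obtain F c where F: "finite F" and c: "\<And>i. c i \<in> D i" "a = (\<Oplus>i\<in>F. c i)"
   by blast
  \<comment> \<open>Outside F the family c is arbitrary; it is cut off so that its support is
    finite.\<close>
  define c' where "c' = (\<lambda>i. if i \<in> F then c i else \<zero>)"
  have c'D: "\<And>i. c' i \<in> D i" using c z by (auto simp: c'_def)
  have c'F: "{i. c' i \<noteq> \<zero>} \<subseteq> F" by (auto simp: c'_def)
  have a: "a = (\<Oplus>i\<in>F. c' i)" unfolding c'_def c(2)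
   by (rule finsum_cong') (auto intro: cl[OF c(1)])
  show "\<exists>!c. (\<forall>i. c i \<in> D i) \<and> finite {i. c i \<noteq> \<zero>} \<and> a = (\<Oplus>i\<in>{i. c i \<noteq> \<zero>}. c i)"
  proof (rule ex1I[of _ c'])
   show "(\<forall>i. c' i \<in> D i) \<and> finite {i. c' i \<noteq> \<zero>} \<and> a = (\<Oplus>i\<in>{i. c' i \<noteq> \<zero>}. c' i)"
    using c'D c'F F a supp[OF c'D F c'F] finite_subset by auto
  next
   fix e assume e: "(\<forall>i. e i \<in> D i) \<and> finite {i. e i \<noteq> \<zero>} \<and> a = (\<Oplus>i\<in>{i. e i \<noteq> \<zero>}. e i)"
   let ?G = "F \<union> {i. e i \<noteq> \<zero>}"
   have G: "finite ?G" using e F by auto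
   have e1: "a = (\<Oplus>i\<in>?G. e i)" using e supp[of e ?G] G by auto
   have e2: "a = (\<Oplus>i\<in>?G. c' i)" using supp[OF c'D F c'F] supp[OF c'D G] c'F a by auto
   have cl': "\<And>i. e i \<in> carrier R" "\<And>i. c' i \<in> carrier R" using e c'D cl by blast+
   have "(\<Oplus>i\<in>?G. e i \<ominus> c' i) \<oplus> (\<Oplus>i\<in>?G. c' i) = (\<Oplus>i\<in>?G. (e i \<ominus> c' i) \<oplus> c' i)"
    by (rule finsum_addf[symmetric]) (use cl' in auto)
   also have "\<dots> = (\<Oplus>i\<in>?G. e i)"
    by (rule finsum_cong') (use cl' in \<open>auto simp: minus_eq a_assoc l_neg\<close>)
   finally have s: "(\<Oplus>i\<in>?G. e i \<ominus> c' i) \<oplus> a = a" using e1 e2 by simp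
   have "(\<Oplus>i\<in>?G. e i \<ominus> c' i) \<in> carrier R" using cl' by (intro finsum_closed) auto
   then have s0: "(\<Oplus>i\<in>?G. e i \<ominus> c' i) = \<zero>"
    using s \<open>a \<in> carrier R\<close> by (metis a_comm add.l_cancel_one)
   have "e i = c' i" for i
   proof (cases "i \<in> ?G")
    case True
    have "e i \<ominus> c' i = \<zero>"
     by (rule uniq[of "\<lambda>i. e i \<ominus> c' i", OF _ G s0 True]) (use e c'D mi in auto)
    then show ?thesis using cl' by (metis add.inv_solve_right' minus_eq l_zero zero_closed)
   next
    case False then show ?thesis by (auto simp: c'_def)
   qed
   then show "e = c'" by auto
  qed
 qed
qed

lemma (in graded_group) finsum_homog_zero:
 assumes "\<And>i. c i \<in> D i" "finite F" "(\<Oplus>i\<in>F. c i) = \<zero>" "i \<in> F" shows "c i = \<zero>"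
proof -
 define c' where "c' = (\<lambda>i. if i \<in> F then c i else \<zero>)"
 have "cmp R D (\<Oplus>i\<in>F. c' i) = c'"
  by (rule cmp_eqI[of _ F]) (use assms comp_zero in \<open>auto simp: c'_def\<close>)
 moreover have "(\<Oplus>i\<in>F. c' i) = (\<Oplus>i\<in>F. c i)"
  by (rule finsum_cong') (use assms comp_closed in \<open>auto simp: c'_def\<close>)
 ultimately have "c' i = \<zero>" using assms(3) cmp_zero by metis
 then show ?thesis using assms(4) by (simp add: c'_def)
qed

text \<open>If the kernel of p contains the components of its elements, a relation between images of
  homogeneous elements lifts to an element of the kernel and holds component by component. Quotient
  algebras, principal right ideals and cokernels receive their gradings in this way.\<close>

lemma grading_image:
 fixes R :: "('a, 'm) ring_scheme" and Q :: "('b, 'n) ring_scheme"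
 assumes "graded_group R D" "abelian_group Q"
  and surj: "p ` carrier R = carrier Q"
  and add: "\<And>a b. a \<in> carrier R \<Longrightarrow> b \<in> carrier R \<Longrightarrow> p (a \<oplus>[R] b) = p a \<oplus>[Q] p b"
  and ker: "\<And>a i. a \<in> carrier R \<Longrightarrow> p a = \<zero>[Q] \<Longrightarrow> p (cmp R D a i) = \<zero>[Q]"
 shows "grading Q (\<lambda>i. p ` D i)"
proof -
 interpret R: graded_group R D by fact
 interpret Q: abelian_group Q by fact
 have pc: "a \<in> carrier R \<Longrightarrow> p a \<in> carrier Q" for a using surj by blast
 have p0: "p \<zero>[R] = \<zero>[Q]"
  using add[of "\<zero>[R]" "\<zero>[R]"] pc[of "\<zero>[R]"] by (metis Q.add.r_cancel_one R.l_zero R.zero_closed)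
 have pm: "p (\<ominus>\<^bsub>R\<^esub> a) = \<ominus>\<^bsub>Q\<^esub> p a" if "a \<in> carrier R" for a
  using add[of "\<ominus>\<^bsub>R\<^esub> a" a] that p0 pc
  by (metis Q.minus_equality R.a_inv_closed R.l_neg)
 have ps: "p (\<Oplus>\<^bsub>R\<^esub>i\<in>F. c i) = (\<Oplus>\<^bsub>Q\<^esub>i\<in>F. p (c i))"
  if "finite F" "\<And>i. c i \<in> carrier R" for c F
  using that by induction (simp_all add: p0 add pc Pi_I)
 show ?thesis
 proof (rule gradingI)
  show "subgroup (p ` D i) (add_monoid Q)" for i
  proof (rule group.subgroupI)
   show "group (add_monoid Q)" by (rule Q.a_group)
   show "p ` D i \<noteq> {}" using R.comp_zero by blast
   show "p ` D i \<subseteq> carrier (add_monoid Q)" using R.comp_closed pc by auto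
  next
   fix a assume "a \<in> p ` D i"
   then obtain b where "b \<in> D i" "a = p b" by blast
   then show "inv\<^bsub>add_monoid Q\<^esub> a \<in> p ` D i"
    using pm[of b] R.comp_closed[of b i] R.comp_minus[of b i]
    by (auto simp: a_inv_def[symmetric] intro!: image_eqI[of _ _ "\<ominus>\<^bsub>R\<^esub> b"])
  next
   fix a a' assume "a \<in> p ` D i" "a' \<in> p ` D i"
   then obtain b b' where "b \<in> D i" "a = p b" "b' \<in> D i" "a' = p b'" by blast
   then show "a \<otimes>[add_monoid Q] a' \<in> p ` D i"
    using add[of b b'] R.comp_closed[of _ i] R.comp_add[of b i b'] by (metis imageI monoid.select_convs(1))
  qed
 next
  fix a assume "a \<in> carrier Q"
  then obtain b where b: "b \<in> carrier R" "a = p b" using surj by blast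
  let ?F = "{i. cmp R D b i \<noteq> \<zero>[R]}"
  have "a = (\<Oplus>\<^bsub>Q\<^esub>i\<in>?F. p (cmp R D b i))"
   using ps[of ?F "cmp R D b", OF R.cmp_props(2)[OF b(1)] R.cmp_closed[OF b(1)]]
   by (simp only: b(2) R.cmp_props(3)[OF b(1), symmetric])
  moreover have "\<forall>i. p (cmp R D b i) \<in> p ` D i" using R.cmp_props(1)[OF b(1)] by (intro allI imageI)
  ultimately show "\<exists>F. finite F \<and> (\<exists>c. (\<forall>i. c i \<in> p ` D i) \<and> a = (\<Oplus>\<^bsub>Q\<^esub>i\<in>F. c i))"
   by (intro exI[of _ ?F] exI[of _ "\<lambda>i. p (cmp R D b i)"] conjI R.cmp_props(2)[OF b(1)])
 next
  fix c F i assume c: "\<And>i. c i \<in> p ` D i" and F: "finite F" "(\<Oplus>\<^bsub>Q\<^esub>i\<in>F. c i) = \<zero>[Q]" "i \<in> F"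
  define b where "b = (\<lambda>i. inv_into (D i) p (c i))"
  have b: "b i \<in> D i" "p (b i) = c i" for i
   unfolding b_def using c[of i] by (simp_all add: inv_into_into f_inv_into_f)
  have cc: "c i \<in> carrier Q" for i using pc[OF R.comp_closed[OF b(1)]] b(2) by metis
  \<comment> \<open>Cut off outside F, so that b' is exactly the family of components of its sum and
    \<open>ker\<close> can be applied to that sum.\<close>
  define b' where "b' = (\<lambda>i. if i \<in> F then b i else \<zero>[R])"
  have b'D: "\<And>i. b' i \<in> D i" using b R.comp_zero by (simp add: b'_def)
  let ?a = "\<Oplus>\<^bsub>R\<^esub>i\<in>F. b' i"
  have cm: "cmp R D ?a = b'"
   by (rule R.cmp_eqI[of _ F]) (use b'D F in \<open>auto simp: b'_def\<close>)
  have "p ?a = (\<Oplus>\<^bsub>Q\<^esub>i\<in>F. p (b' i))" using ps[OF F(1)] b'D R.comp_closed by blast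
  also have "\<dots> = (\<Oplus>\<^bsub>Q\<^esub>i\<in>F. c i)"
   by (rule Q.finsum_cong') (use b(2) cc in \<open>auto simp: b'_def\<close>)
  finally have "p (cmp R D ?a i) = \<zero>[Q]"
   using F b'D R.comp_closed by (intro ker R.finsum_closed) auto
  then show "c i = \<zero>[Q]" using cm F(3) b(2)[of i] by (simp add: b'_def)
 qed (rule Q.abelian_group_axioms)
qed

sublocale graded_algebra \<subseteq> SG: graded_group S "hcomp S"
 by unfold_locales (rule grading)

sublocale graded_right_module \<subseteq> MG: graded_group M "mcomp M"
 by unfold_locales (rule module_grading)

lemma (in graded_algebra) zero_ascale: "a \<in> carrier S \<Longrightarrow> 0 \<bullet> a = \<zero>"
 using add_ascale[of a 0 0] ascale_closed[of a 0] by simp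

lemma (in graded_algebra) ascale_zero: "c \<bullet> \<zero> = \<zero>"
 using ascale_add[of \<zero> \<zero> c] ascale_closed[of \<zero> c] by simp

lemma (in graded_algebra) ascale_minus: "a \<in> carrier S \<Longrightarrow> (- c) \<bullet> a = \<ominus> (c \<bullet> a)"
 using add_ascale[of a "- c" c] zero_ascale[of a] ascale_closed
 by (simp add: minus_equality[symmetric])

section \<open>Spans, generation and dimension\<close>

definition scal :: "('k::field, 's) graded_alg \<Rightarrow> 's set" where
 "scal S = range (\<lambda>c. c \<bullet>\<^bsub>S\<^esub> \<one>\<^bsub>S\<^esub>)"

lemma (in graded_algebra) scal_closed: "scal S \<subseteq> carrier S"
 by (auto simp: scal_def ascale_closed)

lemma (in graded_algebra) scal_add: "a \<in> scal S \<Longrightarrow> b \<in> scal S \<Longrightarrow> a \<oplus> b \<in> scal S"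
 by (auto simp: scal_def add_ascale[symmetric])

lemma (in graded_algebra) scal_zero: "\<zero> \<in> scal S"
 unfolding scal_def using zero_ascale[OF one_closed] by (metis rangeI)

lemma (in graded_algebra) scal_mult: "a \<in> scal S \<Longrightarrow> b \<in> scal S \<Longrightarrow> a \<otimes> b \<in> scal S"
 by (auto simp: scal_def ascale_mult_left[symmetric] ascale_closed ascale_ascale[symmetric])

lemma (in graded_algebra) scal_hcomp: "a \<in> scal S \<Longrightarrow> a \<in> hcomp S 0"
 by (auto simp: scal_def ascale_hcomp one_hcomp)

text \<open>With A the whole algebra this is the submodule generated by G, with A =
  \<open>scal S\<close> the linear span; finite generation and finite dimension become instances of
  one notion. Sums are built one term at a time, which allows induction without coefficient
  families.\<close>

inductive_set lspan :: "('s, 'm) graded_rmod \<Rightarrow> 's set \<Rightarrow> 'm set \<Rightarrow> 'm set" for M A G where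
 zero: "\<zero>[M] \<in> lspan M A G"
| step: "x \<in> lspan M A G \<Longrightarrow> g \<in> G \<Longrightarrow> a \<in> A \<Longrightarrow> x \<oplus>[M] (g \<cdot>[M] a) \<in> lspan M A G"

context graded_right_module
begin

lemma zero_ract: "a \<in> carrier S \<Longrightarrow> \<zero> \<cdot> a = \<zero>"
 using add_ract[of \<zero> \<zero> a] ract_closed[of \<zero> a] by simp

lemma ract_zero: "m \<in> carrier M \<Longrightarrow> m \<cdot> \<zero>[S] = \<zero>"
 using ract_add[of m "\<zero>[S]" "\<zero>[S]"] ract_closed[of m "\<zero>[S]"] by simp

lemma minus_ract: "m \<in> carrier M \<Longrightarrow> a \<in> carrier S \<Longrightarrow> (\<ominus> m) \<cdot> a = \<ominus> (m \<cdot> a)"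
 using add_ract[of "\<ominus> m" m a] zero_ract[of a]
 by (metis M.a_inv_closed M.l_neg M.minus_equality ract_closed)

lemma mcomp_closed: "m \<in> mcomp M i \<Longrightarrow> m \<in> carrier M"
 by (rule MG.comp_closed)

lemma cmp_ract_homog:
 assumes m: "m \<in> carrier M" and a: "a \<in> hcomp S j"
 shows "cmp M (mcomp M) (m \<cdot> a) i = cmp M (mcomp M) m (i - j) \<cdot> a"
 using m
proof (induction rule: MG.graded_induct)
 case zero
 then show ?case using a S.SG.comp_closed by (simp add: zero_ract MG.cmp_zero)
next
 case (add l b c)
 have ac: "a \<in> carrier S" using a by (rule S.SG.comp_closed)
 have bc: "b \<in> carrier M" using add(1) by (rule mcomp_closed)
 have "b \<cdot> a \<in> mcomp M (l + j)" using ract_mcomp[OF add(1) a] .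
 then show ?case using add ac bc
  by (auto simp: add_ract MG.cmp_add ract_closed MG.cmp_homog zero_ract MG.cmp_closed
    MG.cmp_homog[OF \<open>b \<cdot> a \<in> mcomp M (l + j)\<close>] MG.cmp_homog[OF add(1)])
qed

lemma cmp_homog_ract:
 assumes m: "m \<in> mcomp M e" and a: "a \<in> carrier S"
 shows "cmp M (mcomp M) (m \<cdot> a) i = m \<cdot> cmp S (hcomp S) a (i - e)"
 using a
proof (induction rule: S.SG.graded_induct)
 case zero
 then show ?case using m mcomp_closed by (simp add: ract_zero MG.cmp_zero S.SG.cmp_zero)
next
 case (add l b c)
 have mc: "m \<in> carrier M" using m by (rule mcomp_closed)
 have bc: "b \<in> carrier S" using add(1) by (rule S.SG.comp_closed)
 have mb: "m \<cdot> b \<in> mcomp M (e + l)" using ract_mcomp[OF m add(1)] .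
 show ?case using add bc mc
  by (auto simp: ract_add MG.cmp_add S.SG.cmp_add ract_closed S.SG.cmp_closed
    MG.cmp_homog[OF mb] S.SG.cmp_homog[OF add(1)] ract_zero)
qed

lemma lspan_closed: "x \<in> lspan M A G \<Longrightarrow> A \<subseteq> carrier S \<Longrightarrow> G \<subseteq> carrier M \<Longrightarrow> x \<in> carrier M"
 by (induction rule: lspan.induct) (auto intro!: ract_closed)

lemma lspan_base: "A \<subseteq> carrier S \<Longrightarrow> G \<subseteq> carrier M \<Longrightarrow> g \<in> G \<Longrightarrow> a \<in> A \<Longrightarrow> g \<cdot> a \<in> lspan M A G"
 using lspan.step[OF lspan.zero, of g G a A M] by (simp add: ract_closed subset_iff)

lemma lspan_add:
 assumes "A \<subseteq> carrier S" "G \<subseteq> carrier M" "x \<in> lspan M A G" "y \<in> lspan M A G"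
 shows "x \<oplus> y \<in> lspan M A G"
 using assms(4)
proof (induction rule: lspan.induct)
 case zero
 then show ?case using lspan_closed[OF assms(3,1,2)] assms(3) by simp
next
 case (step z g a)
 have "x \<oplus> (z \<oplus> g \<cdot> a) = (x \<oplus> z) \<oplus> g \<cdot> a"
  using lspan_closed[OF assms(3,1,2)] lspan_closed[OF step(1) assms(1,2)] step(2,3) assms(1,2)
  by (simp add: M.a_assoc ract_closed subset_iff)
 then show ?case using lspan.step[OF step.IH step(2,3)] by simp
qed

lemma lspan_ract:
 assumes "A \<subseteq> carrier S" "G \<subseteq> carrier M" "x \<in> lspan M A G" "b \<in> carrier S"
  "\<And>a. a \<in> A \<Longrightarrow> a \<otimes>[S] b \<in> A"
 shows "x \<cdot> b \<in> lspan M A G"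
 using assms(3)
proof (induction rule: lspan.induct)
 case zero
 then show ?case using assms(4) by (simp add: zero_ract lspan.zero)
next
 case (step z g a)
 have "(z \<oplus> g \<cdot> a) \<cdot> b = (z \<cdot> b) \<oplus> g \<cdot> (a \<otimes>[S] b)"
  using lspan_closed[OF step(1) assms(1,2)] step(2,3) assms(1,2,4)
  by (simp add: add_ract ract_mult ract_closed subset_iff)
 then show ?case using lspan.step[OF step.IH step(2) assms(5)[OF step(3)]] by simp
qed

lemma lspan_trans:
 assumes "A \<subseteq> carrier S" "G \<subseteq> carrier M" "x \<in> lspan M A H" "H \<subseteq> lspan M A G"
  "\<And>a b. a \<in> A \<Longrightarrow> b \<in> A \<Longrightarrow> a \<otimes>[S] b \<in> A"
 shows "x \<in> lspan M A G"
 using assms(3)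
proof (induction rule: lspan.induct)
 case (step z g a)
 then show ?case using assms by (auto intro!: lspan_add lspan_ract)
qed (rule lspan.zero)

lemma lspan_finsum:
 assumes "A \<subseteq> carrier S" "G \<subseteq> carrier M" "finite I" "\<And>i. i \<in> I \<Longrightarrow> f i \<in> lspan M A G"
 shows "(\<Oplus>i\<in>I. f i) \<in> lspan M A G"
 using assms(3,4)
proof (induction)
 case (insert i I)
 have "f \<in> I \<rightarrow> carrier M" "f i \<in> carrier M" using insert lspan_closed[OF _ assms(1,2)] by auto
 then show ?case using insert lspan_add[OF assms(1,2)] by simp
qed (simp add: lspan.zero)

lemma lspan_eq_finsum:
 assumes A: "A \<subseteq> carrier S" "\<zero>[S] \<in> A" "\<And>a b. a \<in> A \<Longrightarrow> b \<in> A \<Longrightarrow> a \<oplus>[S] b \<in> A"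
  and G: "finite G" "G \<subseteq> carrier M"
 shows "x \<in> lspan M A G \<longleftrightarrow> (\<exists>a. a \<in> G \<rightarrow> A \<and> x = (\<Oplus>g\<in>G. g \<cdot> a g))"
proof
 assume "x \<in> lspan M A G"
 then show "\<exists>a. a \<in> G \<rightarrow> A \<and> x = (\<Oplus>g\<in>G. g \<cdot> a g)"
 proof (induction rule: lspan.induct)
  case zero
  have "(\<Oplus>g\<in>G. g \<cdot> \<zero>[S]) = \<zero>"
   by (rule M.add.finprod_one_eqI) (use G in \<open>auto simp: ract_zero\<close>)
  then show ?case using A by (intro exI[of _ "\<lambda>_. \<zero>[S]"]) auto
 next
  case (step x g a)
  then obtain b where b: "b \<in> G \<rightarrow> A" "x = (\<Oplus>g\<in>G. g \<cdot> b g)" by blast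
  \<comment> \<open>A further multiple of a generator already present is absorbed into its
    coefficient.\<close>
  let ?b = "b(g := b g \<oplus>[S] a)"
  have bG: "?b \<in> G \<rightarrow> A" using b(1) A(3) step(2,3) by (auto simp: Pi_iff)
  have cl: "h \<in> G \<Longrightarrow> b h \<in> carrier S" "h \<in> G \<Longrightarrow> h \<in> carrier M" for h using b(1) A(1) G(2) by auto
  have ac: "a \<in> carrier S" using A(1) step(3) by blast
  have GE: "G = insert g (G - {g})" using step(2) by blast
  have "(\<Oplus>h\<in>G. h \<cdot> ?b h) = (g \<cdot> ?b g) \<oplus> (\<Oplus>h\<in>G - {g}. h \<cdot> ?b h)"
   by (subst GE, subst M.finsum_insert) (use G cl ac step(2) in \<open>auto intro!: ract_closed\<close>)
  also have "(\<Oplus>h\<in>G - {g}. h \<cdot> ?b h) = (\<Oplus>h\<in>G - {g}. h \<cdot> b h)"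
   by (rule M.finsum_cong') (use cl in \<open>auto intro!: ract_closed\<close>)
  also have "(g \<cdot> ?b g) \<oplus> (\<Oplus>h\<in>G - {g}. h \<cdot> b h)
    = ((g \<cdot> b g) \<oplus> (\<Oplus>h\<in>G - {g}. h \<cdot> b h)) \<oplus> g \<cdot> a"
  proof -
   have "(\<Oplus>h\<in>G - {g}. h \<cdot> b h) \<in> carrier M"
    by (rule M.finsum_closed) (use cl in \<open>auto intro!: ract_closed\<close>)
   then show ?thesis using cl[OF step(2)] ac by (simp add: ract_add ract_closed M.a_ac)
  qed
  also have "(g \<cdot> b g) \<oplus> (\<Oplus>h\<in>G - {g}. h \<cdot> b h) = x"
   unfolding b(2)
   by (subst (2) GE, subst M.finsum_insert) (use G cl step(2) in \<open>auto intro!: ract_closed\<close>)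
  finally show ?case using bG by (intro exI[of _ ?b]) auto
 qed
next
 assume "\<exists>a. a \<in> G \<rightarrow> A \<and> x = (\<Oplus>g\<in>G. g \<cdot> a g)"
 then show "x \<in> lspan M A G"
  using A G by (auto intro!: lspan_finsum lspan_base)
qed

lemma finitely_generated_iff:
 "finitely_generated S M \<longleftrightarrow> (\<exists>G. finite G \<and> G \<subseteq> carrier M \<and> carrier M \<subseteq> lspan M (carrier S) G)"
 unfolding finitely_generated_def
 by (intro ex_cong1 conj_cong refl) (simp add: subset_iff lspan_eq_finsum Ball_def)

lemma finite_dimensional_iff:
 "finite_dimensional S M \<longleftrightarrow> (\<exists>G. finite G \<and> G \<subseteq> carrier M \<and> carrier M \<subseteq> lspan M (scal S) G)"
proof -
 have "(\<exists>c :: 'm \<Rightarrow> 'k. m = (\<Oplus>g\<in>G. g \<cdot> (c g \<bullet>\<^bsub>S\<^esub> \<one>\<^bsub>S\<^esub>))) \<longleftrightarrow> m \<in> lspan M (scal S) G"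
  if G: "finite G" "G \<subseteq> carrier M" for G m
 proof -
  have "m \<in> lspan M (scal S) G \<longleftrightarrow> (\<exists>a. a \<in> G \<rightarrow> scal S \<and> m = (\<Oplus>g\<in>G. g \<cdot> a g))"
   by (rule lspan_eq_finsum) (use G S.scal_closed S.scal_zero S.scal_add in auto)
  also have "\<dots> \<longleftrightarrow> (\<exists>c :: 'm \<Rightarrow> 'k. m = (\<Oplus>g\<in>G. g \<cdot> (c g \<bullet>\<^bsub>S\<^esub> \<one>\<^bsub>S\<^esub>)))"
  proof
   assume "\<exists>a. a \<in> G \<rightarrow> scal S \<and> m = (\<Oplus>g\<in>G. g \<cdot> a g)"
   then obtain a where a: "a \<in> G \<rightarrow> scal S" "m = (\<Oplus>g\<in>G. g \<cdot> a g)" by blast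
   then have "\<forall>g\<in>G. \<exists>c. a g = c \<bullet>\<^bsub>S\<^esub> \<one>\<^bsub>S\<^esub>" by (auto simp: scal_def)
   then obtain c where c: "\<And>g. g \<in> G \<Longrightarrow> a g = c g \<bullet>\<^bsub>S\<^esub> \<one>\<^bsub>S\<^esub>" by metis
   have "(\<Oplus>g\<in>G. g \<cdot> (c g \<bullet>\<^bsub>S\<^esub> \<one>\<^bsub>S\<^esub>)) = (\<Oplus>g\<in>G. g \<cdot> a g)"
    by (rule M.finsum_cong') (use c a(1) G S.scal_closed in \<open>auto intro!: ract_closed\<close>)
   then show "\<exists>c :: 'm \<Rightarrow> 'k. m = (\<Oplus>g\<in>G. g \<cdot> (c g \<bullet>\<^bsub>S\<^esub> \<one>\<^bsub>S\<^esub>))" using a(2) by metis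
  next
   assume "\<exists>c :: 'm \<Rightarrow> 'k. m = (\<Oplus>g\<in>G. g \<cdot> (c g \<bullet>\<^bsub>S\<^esub> \<one>\<^bsub>S\<^esub>))"
   then obtain c :: "'m \<Rightarrow> 'k" where "m = (\<Oplus>g\<in>G. g \<cdot> (c g \<bullet>\<^bsub>S\<^esub> \<one>\<^bsub>S\<^esub>))" by blast
   then show "\<exists>a. a \<in> G \<rightarrow> scal S \<and> m = (\<Oplus>g\<in>G. g \<cdot> a g)"
    by (intro exI[of _ "\<lambda>g. c g \<bullet>\<^bsub>S\<^esub> \<one>\<^bsub>S\<^esub>"]) (auto simp: scal_def)
  qed
  finally show ?thesis by simp
 qed
 then show ?thesis unfolding finite_dimensional_def by (intro ex_cong1 conj_cong refl) auto
qed

text \<open>Each generator is the sum of its finitely many nonzero components, so these components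
  generate as well. The conditions on A hold for the whole algebra and for the scalars.\<close>

lemma homog_generators:
 assumes A: "A \<subseteq> carrier S" "\<one>\<^bsub>S\<^esub> \<in> A" "\<And>a b. a \<in> A \<Longrightarrow> b \<in> A \<Longrightarrow> a \<otimes>[S] b \<in> A"
  and G: "finite G" "G \<subseteq> carrier M" "carrier M \<subseteq> lspan M A G"
 shows "\<exists>H. finite H \<and> H \<subseteq> carrier M \<and> carrier M \<subseteq> lspan M A H \<and> (\<forall>h\<in>H. \<exists>e. h \<in> mcomp M e)"
proof -
 define H where "H = (\<Union>g\<in>G. cmp M (mcomp M) g ` {i. cmp M (mcomp M) g i \<noteq> \<zero>})"
 have fin: "finite H" unfolding H_def using G MG.cmp_props(2) by auto
 have hom: "\<exists>e. h \<in> mcomp M e" if "h \<in> H" for h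
  using that G(2) MG.cmp_props(1) unfolding H_def by blast
 have HM: "H \<subseteq> carrier M" using hom mcomp_closed by blast
 have "g \<in> lspan M A H" if g: "g \<in> G" for g
 proof -
  have gc: "g \<in> carrier M" using g G by blast
  have "cmp M (mcomp M) g i \<in> lspan M A H" if "cmp M (mcomp M) g i \<noteq> \<zero>" for i
  proof -
   have "cmp M (mcomp M) g i \<in> H" unfolding H_def using g that by blast
   from lspan_base[OF A(1) HM this A(2)] show ?thesis
    using ract_one MG.cmp_closed[OF gc] by simp
  qed
  then have "(\<Oplus>i\<in>{i. cmp M (mcomp M) g i \<noteq> \<zero>}. cmp M (mcomp M) g i) \<in> lspan M A H"
   by (intro lspan_finsum[OF A(1) HM MG.cmp_props(2)[OF gc]]) auto
  then show ?thesis by (simp only: MG.cmp_props(3)[OF gc, symmetric])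
 qed
 then have "G \<subseteq> lspan M A H" by blast
 then have "carrier M \<subseteq> lspan M A H"
  using G(3) lspan_trans[OF A(1) HM _ _ A(3)] by blast
 with fin hom HM show ?thesis by blast
qed

text \<open>The record Q carries bare operations; all module laws are pulled back along the
  surjection p. Principal right ideals are images of shifted free modules, and a cokernel is an
  image of the target of the map.\<close>

lemma image_module:
 fixes Q :: "('s, 'e) graded_rmod" and p :: "'m \<Rightarrow> 'e"
 assumes surj: "p ` carrier M = carrier Q"
  and add: "\<And>a b. a \<in> carrier M \<Longrightarrow> b \<in> carrier M \<Longrightarrow> p (a \<oplus> b) = p a \<oplus>[Q] p b"
  and pzero: "p \<zero> = \<zero>[Q]"
  and act: "\<And>m a. m \<in> carrier M \<Longrightarrow> a \<in> carrier S \<Longrightarrow> p (m \<cdot> a) = p m \<cdot>[Q] a"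
  and comp: "\<And>i. mcomp Q i = p ` mcomp M i"
  and ker: "\<And>a i. a \<in> carrier M \<Longrightarrow> p a = \<zero>[Q] \<Longrightarrow> p (cmp M (mcomp M) a i) = \<zero>[Q]"
 shows "graded_right_module S Q"
  and "finitely_generated S M \<Longrightarrow> finitely_generated S Q"
proof -
 have pc: "a \<in> carrier M \<Longrightarrow> p a \<in> carrier Q" for a using surj by blast
 have ob: "\<exists>a\<in>carrier M. x = p a" if "x \<in> carrier Q" for x using that surj by blast
 have ag: "abelian_group Q"
 proof (rule abelian_groupI)
  fix x y assume "x \<in> carrier Q" "y \<in> carrier Q"
  then obtain a b where "a \<in> carrier M" "b \<in> carrier M" "x = p a" "y = p b" using ob by metis
  then show "x \<oplus>[Q] y \<in> carrier Q" "x \<oplus>[Q] y = y \<oplus>[Q] x"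
   using add[symmetric] pc by (simp_all add: M.a_comm)
 next
  fix x y z assume "x \<in> carrier Q" "y \<in> carrier Q" "z \<in> carrier Q"
  then obtain a b c where "a \<in> carrier M" "b \<in> carrier M" "c \<in> carrier M"
   "x = p a" "y = p b" "z = p c" using ob by metis
  then show "x \<oplus>[Q] y \<oplus>[Q] z = x \<oplus>[Q] (y \<oplus>[Q] z)"
   using add[symmetric] by (simp add: M.a_assoc)
 next
  show "\<zero>[Q] \<in> carrier Q" using pc pzero by (metis M.zero_closed)
 next
  fix x assume "x \<in> carrier Q"
  then obtain a where a: "a \<in> carrier M" "x = p a" using ob by metis
  then show "\<zero>[Q] \<oplus>[Q] x = x" using add[of \<zero> a] pzero by simp
  show "\<exists>y\<in>carrier Q. y \<oplus>[Q] x = \<zero>[Q]"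
   using a add[of "\<ominus> a" a] pzero pc[of "\<ominus> a"] by (intro bexI[of _ "p (\<ominus> a)"]) (auto simp: M.l_neg)
 qed
 show Q: "graded_right_module S Q"
 proof (intro graded_right_module.intro graded_right_module_axioms.intro ag S.graded_algebra_axioms)
  fix x a assume "x \<in> carrier Q" and a: "a \<in> carrier S"
  then obtain m where m: "m \<in> carrier M" "x = p m" using ob by metis
  show "x \<cdot>[Q] a \<in> carrier Q" using act[OF m(1) a, symmetric] m pc ract_closed a by simp
 next
  fix x y a assume "x \<in> carrier Q" "y \<in> carrier Q" and a: "a \<in> carrier S"
  then obtain m n where m: "m \<in> carrier M" "x = p m" "n \<in> carrier M" "y = p n" using ob by metis
  show "(x \<oplus>[Q] y) \<cdot>[Q] a = x \<cdot>[Q] a \<oplus>[Q] y \<cdot>[Q] a"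
   using m a by (simp add: act[symmetric] add[symmetric] ract_closed add_ract)
 next
  fix x a b assume "x \<in> carrier Q" and a: "a \<in> carrier S" "b \<in> carrier S"
  then obtain m where m: "m \<in> carrier M" "x = p m" using ob by metis
  show "x \<cdot>[Q] (a \<oplus>[S] b) = x \<cdot>[Q] a \<oplus>[Q] x \<cdot>[Q] b"
   "x \<cdot>[Q] (a \<otimes>[S] b) = x \<cdot>[Q] a \<cdot>[Q] b"
   using m a by (simp_all add: act[symmetric] add[symmetric] ract_closed ract_add ract_mult)
 next
  fix x assume "x \<in> carrier Q"
  then obtain m where m: "m \<in> carrier M" "x = p m" using ob by metis
  show "x \<cdot>[Q] \<one>\<^bsub>S\<^esub> = x" using m by (simp add: act[symmetric] ract_one)
 next
  have "grading Q (\<lambda>i. p ` mcomp M i)"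
   by (rule grading_image[OF MG.graded_group_axioms ag surj]) (use add ker in auto)
  then show "grading Q (mcomp Q)" using comp by (metis (no_types, lifting) ext)
 next
  fix x i a j assume "x \<in> mcomp Q i" and a: "a \<in> hcomp S j"
  then obtain m where m: "m \<in> mcomp M i" "x = p m" using comp by auto
  show "x \<cdot>[Q] a \<in> mcomp Q (i + j)"
   using ract_mcomp[OF m(1) a] act[OF mcomp_closed[OF m(1)] S.SG.comp_closed[OF a]]
   unfolding m(2) comp by (metis imageI)
 qed
 assume "finitely_generated S M"
 then obtain G where G: "finite G" "G \<subseteq> carrier M" "carrier M \<subseteq> lspan M (carrier S) G"
  using finitely_generated_iff by blast
 have "p x \<in> lspan Q (carrier S) (p ` G)" if "x \<in> lspan M (carrier S) G" for x
  using that
 proof (induction rule: lspan.induct)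
  case zero then show ?case by (simp add: pzero lspan.zero)
 next
  case (step x g a)
  have "x \<in> carrier M" using lspan_closed[OF step(1)] G by simp
  then show ?case using step G lspan.step[OF step.IH, of "p g" a]
   by (auto simp: add act ract_closed subset_iff)
 qed
 then have "carrier Q \<subseteq> lspan Q (carrier S) (p ` G)" using G(3) ob by blast
 moreover have "p ` G \<subseteq> carrier Q" using G(2) pc by blast
 ultimately show "finitely_generated S Q"
  unfolding graded_right_module.finitely_generated_iff[OF Q]
  using G(1) by (intro exI[of _ "p ` G"]) simp
qed

lemma submodule:
 assumes N: "N \<subseteq> carrier M" "\<zero> \<in> N" "\<And>a b. a \<in> N \<Longrightarrow> b \<in> N \<Longrightarrow> a \<oplus> b \<in> N"
  "\<And>m a. m \<in> N \<Longrightarrow> a \<in> carrier S \<Longrightarrow> m \<cdot> a \<in> N"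
  and hom: "\<And>m i. m \<in> N \<Longrightarrow> cmp M (mcomp M) m i \<in> N"
 shows "graded_right_module S (M\<lparr>carrier := N, mcomp := \<lambda>i. mcomp M i \<inter> N\<rparr>)"
proof -
 let ?N = "M\<lparr>carrier := N, mcomp := \<lambda>i. mcomp M i \<inter> N\<rparr>"
 \<comment> \<open>Closure under negation follows from closure under the action of -1.\<close>
 have inv: "\<ominus> m \<in> N" if "m \<in> N" for m
 proof -
  have "m \<cdot> (\<ominus>\<^bsub>S\<^esub> \<one>\<^bsub>S\<^esub>) \<oplus> m = m \<cdot> (\<ominus>\<^bsub>S\<^esub> \<one>\<^bsub>S\<^esub> \<oplus>[S] \<one>\<^bsub>S\<^esub>)"
   using that N(1) by (subst ract_add) (auto simp: ract_one)
  also have "\<dots> = \<zero>" using that N(1) by (auto simp: S.l_neg ract_zero)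
  finally have "\<ominus> m = m \<cdot> (\<ominus>\<^bsub>S\<^esub> \<one>\<^bsub>S\<^esub>)" using that N(1) by (intro M.minus_equality) (auto simp: ract_closed)
  then show ?thesis using N(4)[OF that] by simp
 qed
 have mem: "m \<in> N \<Longrightarrow> m \<in> carrier M" for m using N(1) by blast
 have ag: "abelian_group ?N"
 proof (rule abelian_groupI)
  fix x assume "x \<in> carrier ?N"
  then show "\<exists>y\<in>carrier ?N. y \<oplus>[?N] x = \<zero>[?N]"
   using inv[of x] mem[of x] by (intro bexI[of _ "\<ominus> x"]) (auto simp: M.l_neg)
 qed (use N mem in \<open>auto simp: M.a_ac\<close>)
 \<comment> \<open>The carrier enters the definition of \<open>finsum\<close>, so sums in the
   submodule and in M have to be compared.\<close>
 have fs: "finsum ?N f F = finsum M f F" if "finite F" "\<And>i. i \<in> F \<Longrightarrow> f i \<in> N" for f :: "int \<Rightarrow> 'm" and F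
  using that
 proof (induction)
  case empty show ?case using abelian_monoid.finsum_empty[OF abelian_group.axioms(1)[OF ag]] by simp
 next
  case (insert i F)
  have "finsum ?N f (insert i F) = f i \<oplus>[?N] finsum ?N f F"
   by (rule abelian_monoid.finsum_insert[OF abelian_group.axioms(1)[OF ag]]) (use insert in auto)
  also have "\<dots> = f i \<oplus> finsum M f F" using insert by simp
  also have "\<dots> = finsum M f (insert i F)"
   by (rule M.finsum_insert[symmetric]) (use insert mem in auto)
  finally show ?case .
 qed
 show ?thesis
 proof (intro graded_right_module.intro graded_right_module_axioms.intro ag S.graded_algebra_axioms)
  show "grading ?N (mcomp ?N)"
  proof (rule gradingI[OF ag])
   fix i show "subgroup (mcomp ?N i) (add_monoid ?N)"
   proof (rule group.subgroupI[OF abelian_group.a_group[OF ag]])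
    show "mcomp ?N i \<noteq> {}" using MG.comp_zero N(2) by auto
    fix a assume a: "a \<in> mcomp ?N i"
    then have aN: "a \<in> N" "a \<in> mcomp M i" by auto
    have "inv\<^bsub>add_monoid ?N\<^esub> a = \<ominus>\<^bsub>?N\<^esub> a" by (simp add: a_inv_def)
    also have "\<dots> = \<ominus> a"
     by (rule abelian_group.minus_equality[OF ag]) (use aN inv mem in \<open>auto simp: M.l_neg\<close>)
    finally show "inv\<^bsub>add_monoid ?N\<^esub> a \<in> mcomp ?N i"
     using aN inv MG.comp_minus by simp
   qed (use N MG.comp_add in auto)
  next
   fix a assume "a \<in> carrier ?N"
   then have a: "a \<in> N" "a \<in> carrier M" using mem by auto
   let ?F = "{i. cmp M (mcomp M) a i \<noteq> \<zero>}"
   have "a = finsum ?N (cmp M (mcomp M) a) ?F"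
    using fs[OF MG.cmp_props(2)[OF a(2)] hom[OF a(1)]] MG.cmp_props(3)[OF a(2)] by simp
   then show "\<exists>F. finite F \<and> (\<exists>c. (\<forall>i. c i \<in> mcomp ?N i) \<and> a = finsum ?N c F)"
    using hom[OF a(1)] MG.cmp_props(1)[OF a(2)]
    by (intro exI[of _ ?F] exI[of _ "cmp M (mcomp M) a"] conjI MG.cmp_props(2)[OF a(2)] allI) auto
  next
   fix c F i assume c: "\<And>i. c i \<in> mcomp ?N i" "finite F" "finsum ?N c F = \<zero>[?N]" "i \<in> F"
   then have "finsum M c F = \<zero>" using fs[of F c] by simp
   then show "c i = \<zero>[?N]" using MG.finsum_homog_zero[of c F i] c by simp
  qed
 qed (use N mem ract_mcomp S.SG.comp_closed in
   \<open>auto simp: add_ract ract_add ract_mult ract_one\<close>)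
qed

lemma lspan_carrier_update:
 "lspan (M\<lparr>carrier := N, mcomp := D\<rparr>) A G = lspan M A G"
proof (intro Set.set_eqI iffI)
 fix x assume "x \<in> lspan (M\<lparr>carrier := N, mcomp := D\<rparr>) A G"
 then show "x \<in> lspan M A G"
 proof (induction rule: lspan.induct)
  case zero show ?case using lspan.zero[of M] by simp
 next
  case (step x g a) then show ?case using lspan.step[of x M A G g a] by simp
 qed
next
 fix x assume "x \<in> lspan M A G"
 then show "x \<in> lspan (M\<lparr>carrier := N, mcomp := D\<rparr>) A G"
 proof (induction rule: lspan.induct)
  case zero show ?case using lspan.zero[of "M\<lparr>carrier := N, mcomp := D\<rparr>"] by simp
 next
  case (step x g a)
  then show ?case using lspan.step[of x "M\<lparr>carrier := N, mcomp := D\<rparr>" A G g a] by simp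
 qed
qed

end

section \<open>The category of finitely generated graded modules\<close>

definition reg :: "('k::field, 's) graded_alg \<Rightarrow> int \<Rightarrow> ('s, 's) graded_rmod" where
 "reg S j = \<lparr>carrier = carrier S, monoid.mult = monoid.mult S, one = one S, zero = zero S,
   add = add S, ract = monoid.mult S, mcomp = (\<lambda>d. hcomp S (d + j))\<rparr>"

lemma reg_simps [simp]:
 "carrier (reg S j) = carrier S" "zero (reg S j) = zero S" "add (reg S j) = add S"
 "ract (reg S j) = monoid.mult S" "mcomp (reg S j) = (\<lambda>d. hcomp S (d + j))"
 by (simp_all add: reg_def)

lemma finsum_reg [simp]: "finsum (reg S j) = finsum S"
 by (intro ext) (simp add: finsum_def finprod_def)

context graded_algebra
begin

lemma reg_abelian_group: "abelian_group (reg S j)"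
 by (rule abelian_groupI) (auto simp: a_ac intro: l_neg)

lemma reg_module: "graded_right_module S (reg S j)"
proof (intro graded_right_module.intro graded_right_module_axioms.intro reg_abelian_group
  graded_algebra_axioms)
 show "grading (reg S j) (mcomp (reg S j))"
 proof (rule gradingI[OF reg_abelian_group])
  show "subgroup (mcomp (reg S j) i) (add_monoid (reg S j))" for i
   using SG.comp_subgroup[of "i + j"] by (simp add: subgroup_def m_inv_def)
 next
  fix a assume "a \<in> carrier (reg S j)"
  then have a: "a \<in> carrier S" by simp
  let ?F = "{i. cmp S (hcomp S) a i \<noteq> \<zero>}" and ?c = "\<lambda>i. cmp S (hcomp S) a (i + j)"
  have "a = (\<Oplus>i\<in>?F. cmp S (hcomp S) a i)" by (rule SG.cmp_props(3)[OF a])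
  also have "?F = (\<lambda>i. i + j) ` (\<lambda>i. i - j) ` ?F" by (auto simp: image_iff)
  also have "(\<Oplus>i\<in>(\<lambda>i. i + j) ` (\<lambda>i. i - j) ` ?F. cmp S (hcomp S) a i) = (\<Oplus>i\<in>(\<lambda>i. i - j) ` ?F. ?c i)"
   by (rule add.finprod_reindex) (auto simp: inj_on_def SG.cmp_closed[OF a])
  finally have "a = finsum (reg S j) ?c ((\<lambda>i. i - j) ` ?F)" by simp
  moreover have "finite ((\<lambda>i. i - j) ` ?F)" using SG.cmp_props(2)[OF a] by simp
  moreover have "\<forall>i. ?c i \<in> mcomp (reg S j) i" using SG.cmp_props(1)[OF a] by simp
  ultimately show "\<exists>F. finite F \<and> (\<exists>c. (\<forall>i. c i \<in> mcomp (reg S j) i) \<and> a = finsum (reg S j) c F)"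
   by (intro exI[of _ "(\<lambda>i. i - j) ` ?F"] exI[of _ ?c] conjI)
 next
  fix c F i assume c: "\<And>i. c i \<in> mcomp (reg S j) i" "finite F"
   "finsum (reg S j) c F = \<zero>[reg S j]" "i \<in> F"
  have c1: "c (i - j) \<in> hcomp S i" for i using c(1)[of "i - j"] by simp
  have cc: "c i \<in> carrier S" for i using SG.comp_closed[OF c1[of "i + j"]] by simp
  have "(\<Oplus>i\<in>(\<lambda>i. i + j) ` F. c (i - j)) = (\<Oplus>i\<in>F. c (i + j - j))"
   by (rule add.finprod_reindex) (auto simp: inj_on_def cc)
  also have "\<dots> = \<zero>" using c(3) by simp
  finally have "c (i + j - j) = \<zero>"
   by (intro SG.finsum_homog_zero[of "\<lambda>i. c (i - j)" "(\<lambda>i. i + j) ` F"]) (use c1 c in auto)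
  then show "c i = \<zero>[reg S j]" by simp
 qed
next
 fix m i a l assume "m \<in> mcomp (reg S j) i" "a \<in> hcomp S l"
 then show "m \<cdot>[reg S j] a \<in> mcomp (reg S j) (i + l)"
  using mult_hcomp[of m "i + j" a l] by (simp add: ac_simps)
qed (auto simp: l_distr r_distr m_assoc)

lemma reg_finitely_generated: "finitely_generated S (reg S j)"
 unfolding graded_right_module.finitely_generated_iff[OF reg_module]
 using graded_right_module.lspan_base[OF reg_module, of "carrier S" "{\<one>}" j \<one>]
 by (intro exI[of _ "{\<one>}"]) auto

lemma cmp_reg: "cmp (reg S 0) (hcomp S) = cmp S (hcomp S)"
 by (intro ext) (simp add: cmp_def)

lemma cmp_mult_left:
 assumes "w \<in> hcomp S e" "s \<in> carrier S"
 shows "cmp S (hcomp S) (w \<otimes> s) i = w \<otimes> cmp S (hcomp S) s (i - e)"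
 using graded_right_module.cmp_homog_ract[OF reg_module, of w 0 e s i] assms
 by (simp add: cmp_reg)

lemma cmp_shift:
 assumes "s \<in> carrier S"
 shows "cmp (reg S j) (mcomp (reg S j)) s i = cmp S (hcomp S) s (i + j)"
proof -
 interpret R: graded_right_module S "reg S j" by (rule reg_module)
 show ?thesis using assms
 proof (induction rule: SG.graded_induct)
  case zero
  then show ?case using R.MG.cmp_zero[of i] by (simp add: SG.cmp_zero)
 next
  case (add l b c)
  have b: "b \<in> mcomp (reg S j) (l - j)" using add(1) by simp
  show ?case using R.MG.cmp_add[of b c i] R.MG.cmp_homog[OF b, of i] add SG.comp_closed[OF add(1)]
   by (simp add: SG.cmp_add SG.cmp_homog[OF add(1)] eq_diff_eq)
 qed
qed

end

definition emb :: "'s \<Rightarrow> 's list set" where "emb s = {[s]}"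
definition unemb :: "'s list set \<Rightarrow> 's" where "unemb X = hd (the_elem X)"

lemma unemb_emb [simp]: "unemb (emb s) = s" by (simp add: unemb_def emb_def)
lemma emb_eq [simp]: "emb s = emb t \<longleftrightarrow> s = t" by (simp add: emb_def)

text \<open>To fit the type of module elements, \<open>s\<close> is encoded as \<open>emb s = {[s]}\<close>; the fields \<open>mult\<close> and
 \<open>one\<close> are junk.\<close>

definition rideal :: "('k::field, 's) graded_alg \<Rightarrow> 's \<Rightarrow> int \<Rightarrow> int \<Rightarrow> 's gmod" where
 "rideal S w e j = \<lparr>carrier = (\<lambda>s. emb (w \<otimes>[S] s)) ` carrier S,
   monoid.mult = (\<lambda>x y. x), one = emb \<zero>[S], zero = emb \<zero>[S],
   add = (\<lambda>x y. emb (unemb x \<oplus>[S] unemb y)),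
   ract = (\<lambda>x a. emb (unemb x \<otimes>[S] a)),
   mcomp = (\<lambda>d. (\<lambda>s. emb (w \<otimes>[S] s)) ` hcomp S (d + (j - e)))\<rparr>"

text \<open>For w of degree e, an element w s of degree d has degree d + j in S. The module is
  therefore w S inside the shift S(j), and w = 1, e = 0 gives the free module S(j) itself.\<close>

lemma rideal_simps [simp]:
 "carrier (rideal S w e j) = (\<lambda>s. emb (w \<otimes>[S] s)) ` carrier S"
 "zero (rideal S w e j) = emb \<zero>[S]"
 "add (rideal S w e j) x y = emb (unemb x \<oplus>[S] unemb y)"
 "ract (rideal S w e j) x a = emb (unemb x \<otimes>[S] a)"
 "mcomp (rideal S w e j) = (\<lambda>d. (\<lambda>s. emb (w \<otimes>[S] s)) ` hcomp S (d + (j - e)))"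
 by (simp_all add: rideal_def)

lemma Obj_gr: "M \<in> Obj (gr S) \<longleftrightarrow> graded_right_module S M \<and> finitely_generated S M"
 by (simp add: gr_def)

definition fn :: "'o \<times> 'f \<times> 'o \<Rightarrow> 'f" where "fn a = fst (snd a)"

lemma fn_simp [simp]: "fn (M, f, N) = f" by (simp add: fn_def)

lemma gr_simps [simp]: "Dom (gr S) (M, f, N) = M" "Cod (gr S) (M, f, N) = N"
 "Ident (gr S) M = (M, restrict id (carrier M), M)"
 "(N', g, P) \<star>[gr S] (M, f, N) = (M, compose (carrier M) g f, P)"
 by (simp_all add: gr_def)

lemma hom_gr: "a \<in> Hom S M N \<longleftrightarrow>
  M \<in> Obj (gr S) \<and> N \<in> Obj (gr S) \<and> (\<exists>f. a = (M, f, N) \<and> f \<in> graded_module_hom S M N)"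
 by (auto simp: hom_set_def gr_def)

lemma Arr_gr_hom: "a \<in> Arr (gr S) \<Longrightarrow> Dom (gr S) a = M \<Longrightarrow> Cod (gr S) a = N \<Longrightarrow> a \<in> Hom S M N"
 by (simp add: hom_set_def)

lemma hom_setD: "a \<in> hom_set C M N \<Longrightarrow> a \<in> Arr C" "a \<in> hom_set C M N \<Longrightarrow> Dom C a = M"
 "a \<in> hom_set C M N \<Longrightarrow> Cod C a = N"
 by (auto simp: hom_set_def)

lemma hom_gr_props:
 assumes "a \<in> Hom S M N"
 shows "M \<in> Obj (gr S)" "N \<in> Obj (gr S)" "graded_right_module S M" "graded_right_module S N"
  "a = (M, fn a, N)"
  "\<And>x. x \<in> carrier M \<Longrightarrow> fn a x \<in> carrier N"
  "\<And>x y. x \<in> carrier M \<Longrightarrow> y \<in> carrier M \<Longrightarrow> fn a (x \<oplus>[M] y) = fn a x \<oplus>[N] fn a y"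
  "\<And>x s. x \<in> carrier M \<Longrightarrow> s \<in> carrier S \<Longrightarrow> fn a (x \<cdot>[M] s) = fn a x \<cdot>[N] s"
  "\<And>x d. x \<in> mcomp M d \<Longrightarrow> fn a x \<in> mcomp N d"
  "fn a \<in> extensional (carrier M)"
  "fn a \<zero>[M] = \<zero>[N]"
  "\<And>x i. x \<in> carrier M \<Longrightarrow> cmp N (mcomp N) (fn a x) i = fn a (cmp M (mcomp M) x i)"
  "\<And>x. x \<in> carrier M \<Longrightarrow> fn a (\<ominus>\<^bsub>M\<^esub> x) = \<ominus>\<^bsub>N\<^esub> fn a x"
proof -
 from assms obtain f where f: "a = (M, f, N)" "f \<in> graded_module_hom S M N"
  and M: "M \<in> Obj (gr S)" "N \<in> Obj (gr S)" unfolding hom_gr by blast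
 show "M \<in> Obj (gr S)" "N \<in> Obj (gr S)" by fact+
 show grm: "graded_right_module S M" "graded_right_module S N" using M by (simp_all add: Obj_gr)
 show a: "a = (M, fn a, N)" using f by simp
 interpret M: graded_right_module S M by fact
 interpret N: graded_right_module S N by fact
 show cl: "\<And>x. x \<in> carrier M \<Longrightarrow> fn a x \<in> carrier N"
  using f by (auto simp: graded_module_hom_def)
 show add: "\<And>x y. x \<in> carrier M \<Longrightarrow> y \<in> carrier M \<Longrightarrow> fn a (x \<oplus>[M] y) = fn a x \<oplus>[N] fn a y"
  and "\<And>x s. x \<in> carrier M \<Longrightarrow> s \<in> carrier S \<Longrightarrow> fn a (x \<cdot>[M] s) = fn a x \<cdot>[N] s"
  and deg: "\<And>x d. x \<in> mcomp M d \<Longrightarrow> fn a x \<in> mcomp N d"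
  and "fn a \<in> extensional (carrier M)"
  using f by (auto simp: graded_module_hom_def PiE_iff image_subset_iff)
 show z: "fn a \<zero>[M] = \<zero>[N]"
  using add[of "\<zero>[M]" "\<zero>[M]"] cl[of "\<zero>[M]"] by (metis N.M.add.r_cancel_one M.M.l_zero M.M.zero_closed)
 show "\<And>x i. x \<in> carrier M \<Longrightarrow> cmp N (mcomp N) (fn a x) i = fn a (cmp M (mcomp M) x i)"
 proof -
  fix x i assume "x \<in> carrier M"
  then show "cmp N (mcomp N) (fn a x) i = fn a (cmp M (mcomp M) x i)"
  proof (induction rule: M.MG.graded_induct)
   case zero then show ?case by (simp add: z M.MG.cmp_zero N.MG.cmp_zero)
  next
   case (add l b c)
   have b: "b \<in> carrier M" using add(1) by (rule M.mcomp_closed)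
   show ?case
    using add b by (simp add: M.MG.cmp_add N.MG.cmp_add \<open>\<And>x y. x \<in> carrier M \<Longrightarrow> y \<in> carrier M \<Longrightarrow> fn a (x \<oplus>[M] y) = fn a x \<oplus>[N] fn a y\<close> cl M.MG.cmp_closed
      M.MG.cmp_homog[OF add(1)] N.MG.cmp_homog[OF deg[OF add(1)]] z)
  qed
 qed
 show "fn a (\<ominus>\<^bsub>M\<^esub> x) = \<ominus>\<^bsub>N\<^esub> fn a x" if "x \<in> carrier M" for x
  using add[of "\<ominus>\<^bsub>M\<^esub> x" x] that cl z by (metis M.M.a_inv_closed M.M.l_neg N.M.minus_equality)
qed

lemma hom_grI:
 assumes "M \<in> Obj (gr S)" "N \<in> Obj (gr S)"
  "\<And>x. x \<in> carrier M \<Longrightarrow> f x \<in> carrier N"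
  "\<And>x y. x \<in> carrier M \<Longrightarrow> y \<in> carrier M \<Longrightarrow> f (x \<oplus>[M] y) = f x \<oplus>[N] f y"
  "\<And>x s. x \<in> carrier M \<Longrightarrow> s \<in> carrier S \<Longrightarrow> f (x \<cdot>[M] s) = f x \<cdot>[N] s"
  "\<And>x d. x \<in> mcomp M d \<Longrightarrow> f x \<in> mcomp N d"
 shows "(M, restrict f (carrier M), N) \<in> Hom S M N"
proof -
 interpret M: graded_right_module S M using assms by (simp add: Obj_gr)
 show ?thesis unfolding hom_gr graded_module_hom_def
  using assms M.mcomp_closed M.ract_closed by (auto simp: image_subset_iff)
qed

lemma hom_gr_comp:
 assumes "a \<in> Hom S M N" "b \<in> Hom S N P"
 shows "b \<star>[gr S] a \<in> Hom S M P"
  and "\<And>x. x \<in> carrier M \<Longrightarrow> fn (b \<star>[gr S] a) x = fn b (fn a x)"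
proof -
 note a = hom_gr_props[OF assms(1)] and b = hom_gr_props[OF assms(2)]
 have e: "b \<star>[gr S] a = (M, restrict (\<lambda>x. fn b (fn a x)) (carrier M), P)"
  by (subst a(5), subst b(5)) (simp add: compose_def)
 show "b \<star>[gr S] a \<in> Hom S M P" unfolding e
  by (rule hom_grI) (simp_all add: a(1,6-9) b(2,6-9))
 show "\<And>x. x \<in> carrier M \<Longrightarrow> fn (b \<star>[gr S] a) x = fn b (fn a x)" by (simp add: e)
qed

lemma hom_gr_id:
 assumes "M \<in> Obj (gr S)"
 shows "Ident (gr S) M \<in> Hom S M M" "\<And>x. x \<in> carrier M \<Longrightarrow> fn (Ident (gr S) M) x = x"
 using hom_grI[OF assms assms, of id] by simp_all

text \<open>Additivity reduces equality to homogeneous elements, and the functions have a default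
  value outside the carrier, so agreement on the carrier is equality of arrows.\<close>

lemma hom_gr_eqI:
 assumes a: "a \<in> Hom S M N" and b: "b \<in> Hom S M N"
  and eq: "\<And>x d. x \<in> mcomp M d \<Longrightarrow> fn a x = fn b x"
 shows "a = b"
proof -
 note a' = hom_gr_props[OF a] and b' = hom_gr_props[OF b]
 interpret M: graded_right_module S M by (rule a')
 have "fn a x = fn b x" if "x \<in> carrier M" for x
  using that
 proof (induction rule: M.MG.graded_induct)
  case zero then show ?case by (simp add: a'(11) b'(11))
 next
  case (add l u v)
  then show ?case using M.mcomp_closed[OF add(1)] eq[OF add(1)] by (simp add: a'(7) b'(7))
 qed
 then have "fn a = fn b" by (intro extensionalityI[OF a'(10) b'(10)])
 then show ?thesis using a'(5) b'(5) by metis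
qed

text \<open>An element is determined by its components, and any finitely supported family of
  components occurs; hence x can be sent to the element with components \<phi>_i(x_i). This is how
  maps known degree by degree become arrows.\<close>

lemma hom_gr_extend:
 assumes X: "X \<in> Obj (gr S)" and Y: "Y \<in> Obj (gr S)"
  and deg: "\<And>d x. x \<in> mcomp X d \<Longrightarrow> \<phi> d x \<in> mcomp Y d"
  and add: "\<And>d x y. x \<in> mcomp X d \<Longrightarrow> y \<in> mcomp X d \<Longrightarrow> \<phi> d (x \<oplus>[X] y) = \<phi> d x \<oplus>[Y] \<phi> d y"
  and lin: "\<And>d x j s. x \<in> mcomp X d \<Longrightarrow> s \<in> hcomp S j \<Longrightarrow> \<phi> (d + j) (x \<cdot>[X] s) = \<phi> d x \<cdot>[Y] s"
 shows "\<exists>a\<in>Hom S X Y. \<forall>d. \<forall>x\<in>mcomp X d. fn a x = \<phi> d x"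
proof -
 interpret X: graded_right_module S X using X by (simp add: Obj_gr)
 interpret Y: graded_right_module S Y using Y by (simp add: Obj_gr)
 have \<phi>0: "\<phi> d \<zero>[X] = \<zero>[Y]" for d
 proof -
  have z: "\<zero>[X] \<in> mcomp X d" by (rule X.MG.comp_zero)
  show ?thesis
   using add[OF z z] Y.mcomp_closed[OF deg[OF z]] by (metis X.M.l_zero X.M.zero_closed Y.M.add.r_cancel_one)
 qed
 have ex: "\<exists>y\<in>carrier Y. \<forall>i. cmp Y (mcomp Y) y i = \<phi> i (cmp X (mcomp X) x i)" if x: "x \<in> carrier X" for x
 proof (rule Y.MG.cmp_sum_exists)
  show "\<phi> i (cmp X (mcomp X) x i) \<in> mcomp Y i" for i by (rule deg[OF X.MG.cmp_props(1)[OF x]])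
  have "{i. \<phi> i (cmp X (mcomp X) x i) \<noteq> \<zero>[Y]} \<subseteq> {i. cmp X (mcomp X) x i \<noteq> \<zero>[X]}"
   using \<phi>0 by auto
  then show "finite {i. \<phi> i (cmp X (mcomp X) x i) \<noteq> \<zero>[Y]}"
   using X.MG.cmp_props(2)[OF x] by (rule finite_subset)
 qed
 define f where "f = (\<lambda>x. SOME y. y \<in> carrier Y \<and> (\<forall>i. cmp Y (mcomp Y) y i = \<phi> i (cmp X (mcomp X) x i)))"
 have f: "f x \<in> carrier Y" "cmp Y (mcomp Y) (f x) i = \<phi> i (cmp X (mcomp X) x i)" if "x \<in> carrier X" for x i
  using someI_ex[OF ex[OF that, unfolded Bex_def]] unfolding f_def by auto
 have fadd: "f (x \<oplus>[X] y) = f x \<oplus>[Y] f y" if "x \<in> carrier X" "y \<in> carrier X" for x y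
  by (rule Y.MG.cmp_ext)
   (use that in \<open>simp_all add: f Y.MG.cmp_add X.MG.cmp_add add X.MG.cmp_props(1)\<close>)
 have fh: "f x = \<phi> d x" if x: "x \<in> mcomp X d" for x d
  by (rule Y.MG.cmp_ext)
   (use x in \<open>auto simp: f X.mcomp_closed Y.mcomp_closed[OF deg] X.MG.cmp_homog[OF x] Y.MG.cmp_homog[OF deg[OF x]] \<phi>0\<close>)
 have f0: "f \<zero>[X] = \<zero>[Y]" using fh[OF X.MG.comp_zero] \<phi>0 by simp
 have flin1: "f (x \<cdot>[X] s) = f x \<cdot>[Y] s" if x: "x \<in> mcomp X d" and s: "s \<in> carrier S" for x s d
  using s
 proof (induction rule: X.S.SG.graded_induct)
  case zero
  then show ?case using x X.mcomp_closed[OF x] by (simp add: f0 X.ract_zero Y.ract_zero f)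
 next
  case (add l b c)
  have xb: "x \<cdot>[X] b \<in> mcomp X (d + l)" using X.ract_mcomp[OF x add(1)] .
  have bc: "b \<in> carrier S" using add(1) by (rule X.S.SG.comp_closed)
  show ?case using add bc X.mcomp_closed[OF x] fh[OF xb] lin[OF x add(1)] fh[OF x]
   by (simp add: X.ract_add Y.ract_add fadd X.ract_closed Y.mcomp_closed[OF deg[OF x]])
 qed
 have flin: "f (x \<cdot>[X] s) = f x \<cdot>[Y] s" if x: "x \<in> carrier X" and s: "s \<in> carrier S" for x s
  using x
 proof (induction rule: X.MG.graded_induct)
  case zero
  then show ?case using s by (simp add: f0 X.zero_ract Y.zero_ract)
 next
  case (add l b c)
  then show ?case using s X.mcomp_closed[OF add(1)] flin1[OF add(1) s]
   by (simp add: X.add_ract Y.add_ract fadd X.ract_closed f)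
 qed
 have "(X, restrict f (carrier X), Y) \<in> Hom S X Y"
  by (rule hom_grI[OF X Y]) (use f fadd flin fh deg in auto)
 then show ?thesis using fh X.mcomp_closed by (intro bexI[of _ "(X, restrict f (carrier X), Y)"]) auto
qed

context graded_algebra
begin

lemma rideal_Obj:
 assumes w: "w \<in> hcomp S e" shows "rideal S w e j \<in> Obj (gr S)"
proof -
 have wc: "w \<in> carrier S" using w by (rule SG.comp_closed)
 interpret R: graded_right_module S "reg S (j - e)" by (rule reg_module)
 let ?p = "\<lambda>s. emb (w \<otimes> s)"
 have ker: "?p (cmp (reg S (j - e)) (mcomp (reg S (j - e))) a i) = \<zero>[rideal S w e j]"
  if a: "a \<in> carrier (reg S (j - e))" "?p a = \<zero>[rideal S w e j]" for a i
 proof -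
  have "w \<otimes> cmp S (hcomp S) a (i + (j - e)) = \<zero>"
   using cmp_mult_left[OF w, of a "i + j"] SG.cmp_zero[of "i + j"] a by (simp add: algebra_simps)
  then show ?thesis using a(1) cmp_shift[of a "j - e" i] by simp
 qed
 have "graded_right_module S (rideal S w e j)"
  "finitely_generated S (reg S (j - e)) \<Longrightarrow> finitely_generated S (rideal S w e j)"
 proof -
  have 1: "?p ` carrier (reg S (j - e)) = carrier (rideal S w e j)" by simp
  have 2: "?p (a \<oplus>[reg S (j - e)] b) = ?p a \<oplus>[rideal S w e j] ?p b"
   if "a \<in> carrier (reg S (j - e))" "b \<in> carrier (reg S (j - e))" for a b
   using that wc by (simp add: r_distr)
  have 3: "?p \<zero>[reg S (j - e)] = \<zero>[rideal S w e j]" using wc by simp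
  have 4: "?p (m \<cdot>[reg S (j - e)] a) = ?p m \<cdot>[rideal S w e j] a"
   if "m \<in> carrier (reg S (j - e))" "a \<in> carrier S" for m a
   using that wc by (simp add: m_assoc)
  have 5: "mcomp (rideal S w e j) i = ?p ` mcomp (reg S (j - e)) i" for i by simp
  show "graded_right_module S (rideal S w e j)"
   by (rule R.image_module(1)[of ?p "rideal S w e j"], rule 1, erule (1) 2, rule 3,
     erule (1) 4, rule 5, erule (1) ker)
  show "finitely_generated S (rideal S w e j)" if "finitely_generated S (reg S (j - e))"
   by (rule R.image_module(2)[of ?p "rideal S w e j"], rule 1, erule (1) 2, rule 3,
     erule (1) 4, rule 5, erule (1) ker, rule that)
 qed
 then show ?thesis using reg_finitely_generated by (simp add: Obj_gr)
qed

text \<open>Left multiplication by a is right linear, and a w = w' b is what keeps the values in w'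
  S. It raises degrees in S by l, which the change of shift from j to j + l compensates.\<close>

lemma rideal_hom:
 assumes w: "w \<in> hcomp S e" and w': "w' \<in> hcomp S e'" and a: "a \<in> hcomp S l" and j: "j' = j + l"
  and b: "b \<in> hcomp S (e + l - e')" and ab: "a \<otimes> w = w' \<otimes> b"
 shows "\<exists>f\<in>Hom S (rideal S w e j) (rideal S w' e' j').
  \<forall>s\<in>carrier S. fn f (emb (w \<otimes> s)) = emb (a \<otimes> (w \<otimes> s))"
proof -
 have cl [simp]: "w \<in> carrier S" "w' \<in> carrier S" "a \<in> carrier S" "b \<in> carrier S"
  using assms SG.comp_closed by blast+
 let ?f = "\<lambda>x. emb (a \<otimes> unemb x)" and ?M = "rideal S w e j" and ?N = "rideal S w' e' j'"
 have abs: "a \<otimes> (w \<otimes> s) = w' \<otimes> (b \<otimes> s)" if "s \<in> carrier S" for s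
  using ab that by (simp add: m_assoc[symmetric])
 have "(?M, restrict ?f (carrier ?M), ?N) \<in> Hom S ?M ?N"
 proof (rule hom_grI[OF rideal_Obj[OF w] rideal_Obj[OF w']])
  show "?f x \<in> mcomp ?N d" if "x \<in> mcomp ?M d" for x d
  proof -
   from that obtain s where s: "s \<in> hcomp S (d + (j - e))" "x = emb (w \<otimes> s)" by auto
   have "e + l - e' + (d + (j - e)) = d + (j' - e')" using j by simp
   then have "b \<otimes> s \<in> hcomp S (d + (j' - e'))" using mult_hcomp[OF b s(1)] by metis
   then show ?thesis using s SG.comp_closed[OF s(1)] by (auto simp: abs)
  qed
 qed (auto simp: abs r_distr m_assoc)
 then show ?thesis by (intro bexI[of _ "(?M, restrict ?f (carrier ?M), ?N)"]) auto
qed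

text \<open>The unit of S(-d) sits in degree d, so S(-d) is free on one generator of degree d. Maps
  from it pick out single elements, which is how abstract kernels are tested later.\<close>

lemma free_hom:
 assumes X: "X \<in> Obj (gr S)" and x: "x \<in> mcomp X d"
 shows "\<exists>f\<in>Hom S (rideal S \<one> 0 (- d)) X. \<forall>s\<in>carrier S. fn f (emb s) = x \<cdot>[X] s"
proof -
 interpret X: graded_right_module S X using X by (simp add: Obj_gr)
 have xc: "x \<in> carrier X" using x by (rule X.mcomp_closed)
 let ?f = "\<lambda>y. x \<cdot>[X] unemb y" and ?M = "rideal S \<one> 0 (- d)"
 have "(?M, restrict ?f (carrier ?M), X) \<in> Hom S ?M X"
 proof (rule hom_grI[OF rideal_Obj[OF one_hcomp] X])
  show "?f y \<in> mcomp X i" if "y \<in> mcomp ?M i" for y i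
  proof -
   from that obtain s where s: "s \<in> hcomp S (i - d)" "y = emb s"
    using SG.comp_closed by auto
   then show ?thesis using X.ract_mcomp[OF x s(1)] by simp
  qed
 qed (use xc in \<open>auto simp: X.ract_closed X.ract_add X.ract_mult\<close>)
 then show ?thesis
  by (intro bexI[of _ "(?M, restrict ?f (carrier ?M), X)"]) (auto simp: image_iff)
qed

lemma zero_module: "rideal S \<zero> 0 0 \<in> Obj (gr S)" "carrier (rideal S \<zero> 0 0) = {emb \<zero>}"
 using rideal_Obj[OF SG.comp_zero] by (auto simp: image_iff)

lemma const_hom:
 assumes X: "X \<in> Obj (gr S)" and Y: "Y \<in> Obj (gr S)"
 shows "\<exists>f\<in>Hom S X Y. \<forall>x\<in>carrier X. fn f x = \<zero>[Y]"
proof -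
 interpret Y: graded_right_module S Y using Y by (simp add: Obj_gr)
 have "(X, restrict (\<lambda>_. \<zero>[Y]) (carrier X), Y) \<in> Hom S X Y"
  by (rule hom_grI[OF X Y]) (auto simp: Y.zero_ract Y.MG.comp_zero)
 then show ?thesis by (intro bexI[of _ "(X, restrict (\<lambda>_. \<zero>[Y]) (carrier X), Y)"]) auto
qed

lemma zero_object_gr:
 "zero_object (gr S) Z \<longleftrightarrow> Z \<in> Obj (gr S) \<and> carrier Z = {\<zero>[Z]}"
proof
 assume z: "zero_object (gr S) Z"
 then have Z: "Z \<in> Obj (gr S)" by (simp add: zero_object_def)
 interpret Z: graded_right_module S Z using Z by (simp add: Obj_gr)
 have uq: "\<exists>!f. f \<in> Hom S Z Z" using z Z by (simp add: zero_object_def)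
 obtain f where f: "f \<in> Hom S Z Z" "\<forall>x\<in>carrier Z. fn f x = \<zero>[Z]"
  using const_hom[OF Z Z] by blast
 \<comment> \<open>The zero map and the identity are both endomorphisms of Z, of which there is only
   one.\<close>
 have "f = Ident (gr S) Z" using uq f(1) hom_gr_id(1)[OF Z] by metis
 then have "x = \<zero>[Z]" if "x \<in> carrier Z" for x using f(2) hom_gr_id(2)[OF Z that] that by simp
 then show "Z \<in> Obj (gr S) \<and> carrier Z = {\<zero>[Z]}" using Z Z.M.zero_closed by blast
next
 assume Z: "Z \<in> Obj (gr S) \<and> carrier Z = {\<zero>[Z]}"
 show "zero_object (gr S) Z" unfolding zero_object_def
 proof (intro conjI ballI)
  show "Z \<in> Obj (gr S)" using Z by simp
  fix X assume X: "X \<in> Obj (gr S)"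
  from const_hom[OF X conjunct1[OF Z]] const_hom[OF conjunct1[OF Z] X] obtain f g where f: "f \<in> Hom S X Z" and g: "g \<in> Hom S Z X" by auto
  interpret X: graded_right_module S X using X by (simp add: Obj_gr)
  interpret Z: graded_right_module S Z using Z by (simp add: Obj_gr)
  show "\<exists>!f. f \<in> Hom S X Z"
  proof (rule ex1I, rule f)
   fix h assume h: "h \<in> Hom S X Z"
   have "fn k x = \<zero>[Z]" if "k \<in> Hom S X Z" "x \<in> mcomp X d" for k x d
    using hom_gr_props(6)[OF that(1) X.mcomp_closed[OF that(2)]] Z by simp
   then show "h = f" using f h by (intro hom_gr_eqI[OF h f]) simp
  qed
  show "\<exists>!f. f \<in> Hom S Z X"
  proof (rule ex1I, rule g)
   fix h assume h: "h \<in> Hom S Z X"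
   have "fn k x = \<zero>[X]" if "k \<in> Hom S Z X" "x \<in> mcomp Z d" for k x d
    using hom_gr_props(11)[OF that(1)] Z.mcomp_closed[OF that(2)] Z by auto
   then show "h = g" using g h by (intro hom_gr_eqI[OF h g]) simp
  qed
 qed
qed

lemma zero_arrow_gr:
 assumes f: "f \<in> Hom S X Y"
 shows "zero_arrow (gr S) f \<longleftrightarrow> (\<forall>x\<in>carrier X. fn f x = \<zero>[Y])"
proof
 assume "zero_arrow (gr S) f"
 then obtain Z g h where Z: "zero_object (gr S) Z" and g: "g \<in> Hom S X Z"
  and h: "h \<in> Hom S Z Y" and fgh: "f = h \<star>[gr S] g"
  using hom_setD[OF f] by (auto simp: zero_arrow_def)
 show "\<forall>x\<in>carrier X. fn f x = \<zero>[Y]"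
 proof
  fix x assume x: "x \<in> carrier X"
  then have "fn g x = \<zero>[Z]" using hom_gr_props(6)[OF g x] Z by (simp add: zero_object_gr)
  then show "fn f x = \<zero>[Y]" using hom_gr_comp(2)[OF g h x] hom_gr_props(11)[OF h] fgh by simp
 qed
next
 assume z: "\<forall>x\<in>carrier X. fn f x = \<zero>[Y]"
 let ?Z = "rideal S \<zero> 0 0"
 note f' = hom_gr_props[OF f]
 interpret X: graded_right_module S X by (rule f')
 have Z: "zero_object (gr S) ?Z" using zero_module by (simp add: zero_object_gr)
 obtain g where g: "g \<in> Hom S X ?Z" using const_hom[OF f'(1) zero_module(1)] by blast
 obtain h where h: "h \<in> Hom S ?Z Y" "\<forall>x\<in>carrier ?Z. fn h x = \<zero>[Y]"
  using const_hom[OF zero_module(1) f'(2)] by blast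
 have "f = h \<star>[gr S] g"
 proof (rule hom_gr_eqI[OF f hom_gr_comp(1)[OF g h(1)]])
  fix x d assume "x \<in> mcomp X d"
  then have x: "x \<in> carrier X" by (rule X.mcomp_closed)
  show "fn f x = fn (h \<star>[gr S] g) x"
   using hom_gr_comp(2)[OF g h(1) x] h(2)[rule_format, OF hom_gr_props(6)[OF g x]] z x by simp
 qed
 moreover have "g \<in> Hom S (Dom (gr S) f) ?Z" "h \<in> Hom S ?Z (Cod (gr S) f)"
  using g h(1) hom_setD[OF f] by simp_all
 ultimately show "zero_arrow (gr S) f" unfolding zero_arrow_def
  using hom_setD(1)[OF f] Z by blast
qed

text \<open>To stay within the fixed type of module elements, cosets are represented by chosen elements.\<close>

lemma cokernel_gr:
 assumes f: "f \<in> Hom S W X"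
 shows "\<exists>Q p. p \<in> Hom S X Q \<and> fn p ` carrier X = carrier Q \<and>
  (\<forall>i. mcomp Q i = fn p ` mcomp X i) \<and>
  (\<forall>x\<in>carrier X. fn p x = \<zero>[Q] \<longleftrightarrow> x \<in> fn f ` carrier W)"
proof -
 note f' = hom_gr_props[OF f]
 interpret W: graded_right_module S W by (rule f')
 interpret X: graded_right_module S X by (rule f')
 let ?N = "fn f ` carrier W"
 have N: "?N \<subseteq> carrier X" using f'(6) by blast
 have N0: "\<zero>[X] \<in> ?N" using f'(11) by (metis W.M.zero_closed image_eqI)
 have Na: "a \<oplus>[X] b \<in> ?N" if "a \<in> ?N" "b \<in> ?N" for a b
  using that f'(7)[symmetric] by auto
 have Nm: "\<ominus>\<^bsub>X\<^esub> a \<in> ?N" if "a \<in> ?N" for a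
  using that f'(13)[symmetric] by auto
 have Nr: "a \<cdot>[X] s \<in> ?N" if "a \<in> ?N" "s \<in> carrier S" for a s
  using that f'(8)[symmetric] by (auto simp: W.ract_closed)
 have Nc: "cmp X (mcomp X) a i \<in> ?N" if "a \<in> ?N" for a i
  using that f'(12) by (auto simp: W.MG.cmp_closed)
 define r where "r = (\<lambda>x. SOME y. y \<in> carrier X \<and> x \<ominus>\<^bsub>X\<^esub> y \<in> ?N)"
 have r: "r x \<in> carrier X" "x \<ominus>\<^bsub>X\<^esub> r x \<in> ?N" if "x \<in> carrier X" for x
 proof -
  have "\<exists>y. y \<in> carrier X \<and> x \<ominus>\<^bsub>X\<^esub> y \<in> ?N"
   using that N0 by (intro exI[of _ x]) (simp add: X.M.r_neg X.M.minus_eq)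
  from someI_ex[OF this] show "r x \<in> carrier X" "x \<ominus>\<^bsub>X\<^esub> r x \<in> ?N" unfolding r_def by auto
 qed
 have tr: "x \<ominus>\<^bsub>X\<^esub> z \<in> ?N" if "x \<ominus>\<^bsub>X\<^esub> y \<in> ?N" "y \<ominus>\<^bsub>X\<^esub> z \<in> ?N"
  "x \<in> carrier X" "y \<in> carrier X" "z \<in> carrier X" for x y z
 proof -
  have "(x \<ominus>\<^bsub>X\<^esub> y) \<oplus>[X] (y \<ominus>\<^bsub>X\<^esub> z) = x \<ominus>\<^bsub>X\<^esub> z"
   using that(3-5) by (simp add: X.M.minus_eq X.M.a_assoc X.M.r_neg1)
  then show ?thesis using Na[OF that(1,2)] by simp
 qed
 have sy: "y \<ominus>\<^bsub>X\<^esub> x \<in> ?N" if "x \<ominus>\<^bsub>X\<^esub> y \<in> ?N" "x \<in> carrier X" "y \<in> carrier X" for x y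
 proof -
  have "\<ominus>\<^bsub>X\<^esub> (x \<ominus>\<^bsub>X\<^esub> y) = y \<ominus>\<^bsub>X\<^esub> x"
   using that(2,3) by (simp add: X.M.minus_eq X.M.minus_add X.M.a_comm)
  then show ?thesis using Nm[OF that(1)] by simp
 qed
 have req: "r x = r y \<longleftrightarrow> x \<ominus>\<^bsub>X\<^esub> y \<in> ?N" if "x \<in> carrier X" "y \<in> carrier X" for x y
 proof
  assume e: "r x = r y"
  have "r y \<ominus>\<^bsub>X\<^esub> y \<in> ?N" by (rule sy[OF r(2) _ r(1)]) (rule that)+
  moreover have "x \<ominus>\<^bsub>X\<^esub> r y \<in> ?N" unfolding e[symmetric] by (rule r(2)[OF that(1)])
  ultimately show "x \<ominus>\<^bsub>X\<^esub> y \<in> ?N" using tr that r(1)[OF that(2)] by blast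
 next
  \<comment> \<open>Congruent elements satisfy the same defining predicate, so \<open>SOME\<close>
    returns the same representative for both.\<close>
  assume xy: "x \<ominus>\<^bsub>X\<^esub> y \<in> ?N"
  have yx: "y \<ominus>\<^bsub>X\<^esub> x \<in> ?N" by (rule sy[OF xy that])
  have "x \<ominus>\<^bsub>X\<^esub> z \<in> ?N \<longleftrightarrow> y \<ominus>\<^bsub>X\<^esub> z \<in> ?N" if z: "z \<in> carrier X" for z
   using tr[OF xy _ \<open>x \<in> carrier X\<close> \<open>y \<in> carrier X\<close> z] tr[OF yx _ \<open>y \<in> carrier X\<close> \<open>x \<in> carrier X\<close> z]
   by blast
  then have "(\<lambda>z. z \<in> carrier X \<and> x \<ominus>\<^bsub>X\<^esub> z \<in> ?N) = (\<lambda>z. z \<in> carrier X \<and> y \<ominus>\<^bsub>X\<^esub> z \<in> ?N)"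
   by (intro ext conj_cong refl)
  then show "r x = r y" unfolding r_def by (rule arg_cong)
 qed
 have mem: "x \<ominus>\<^bsub>X\<^esub> \<zero>[X] = x" if "x \<in> carrier X" for x
  using that by (simp add: X.M.minus_eq)
 define Q :: "'a gmod" where "Q = \<lparr>carrier = r ` carrier X, monoid.mult = (\<lambda>x y. x),
   one = r \<zero>[X], zero = r \<zero>[X], add = (\<lambda>x y. r (x \<oplus>[X] y)), ract = (\<lambda>x a. r (x \<cdot>[X] a)),
   mcomp = (\<lambda>i. r ` mcomp X i)\<rparr>"
 have Q [simp]: "carrier Q = r ` carrier X" "zero Q = r \<zero>[X]" "add Q x y = r (x \<oplus>[X] y)"
  "ract Q x a = r (x \<cdot>[X] a)" "mcomp Q = (\<lambda>i. r ` mcomp X i)" for x y a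
  by (simp_all add: Q_def)
 have radd: "r (x \<oplus>[X] y) = r (r x \<oplus>[X] r y)" if "x \<in> carrier X" "y \<in> carrier X" for x y
 proof (subst req)
  have "(x \<ominus>\<^bsub>X\<^esub> r x) \<oplus>[X] (y \<ominus>\<^bsub>X\<^esub> r y) \<in> ?N" by (intro Na r that)
  also have "(x \<ominus>\<^bsub>X\<^esub> r x) \<oplus>[X] (y \<ominus>\<^bsub>X\<^esub> r y) = (x \<oplus>[X] y) \<ominus>\<^bsub>X\<^esub> (r x \<oplus>[X] r y)"
   using that r(1)[of x] r(1)[of y] by (simp add: X.M.minus_eq X.M.minus_add X.M.a_ac)
  finally show "(x \<oplus>[X] y) \<ominus>\<^bsub>X\<^esub> (r x \<oplus>[X] r y) \<in> ?N" .
 qed (use that r(1)[of x] r(1)[of y] in auto)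
 have ract: "r (x \<cdot>[X] s) = r (r x \<cdot>[X] s)" if "x \<in> carrier X" "s \<in> carrier S" for x s
 proof (subst req)
  have "(x \<ominus>\<^bsub>X\<^esub> r x) \<cdot>[X] s \<in> ?N" by (intro Nr r that)
  also have "(x \<ominus>\<^bsub>X\<^esub> r x) \<cdot>[X] s = (x \<cdot>[X] s) \<ominus>\<^bsub>X\<^esub> (r x \<cdot>[X] s)"
   using that r(1)[of x] by (simp add: X.M.minus_eq X.add_ract X.minus_ract)
  finally show "(x \<cdot>[X] s) \<ominus>\<^bsub>X\<^esub> (r x \<cdot>[X] s) \<in> ?N" .
 qed (use that r(1)[of x] in \<open>auto simp: X.ract_closed\<close>)
 have r0: "r x = r \<zero>[X] \<longleftrightarrow> x \<in> ?N" if "x \<in> carrier X" for x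
  using req[OF that, of "\<zero>[X]"] mem[OF that] by simp
 have ker: "r (cmp X (mcomp X) a i) = \<zero>[Q]" if a: "a \<in> carrier X" "r a = \<zero>[Q]" for a i
 proof -
  have "a \<in> ?N" using a r0[OF a(1)] by (simp only: Q)
  then have "cmp X (mcomp X) a i \<in> ?N" by (rule Nc)
  then show ?thesis using r0[OF X.MG.cmp_closed[OF a(1)]] by (simp only: Q)
 qed
 have "graded_right_module S Q" "finitely_generated S X \<Longrightarrow> finitely_generated S Q"
 proof -
  have 1: "r ` carrier X = carrier Q" by simp
  have 2: "r (a \<oplus>[X] b) = r a \<oplus>[Q] r b" if "a \<in> carrier X" "b \<in> carrier X" for a b
   by (simp only: Q radd[OF that, symmetric])
  have 3: "r \<zero>[X] = \<zero>[Q]" by simp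
  have 4: "r (m \<cdot>[X] a) = r m \<cdot>[Q] a" if "m \<in> carrier X" "a \<in> carrier S" for m a
   by (simp only: Q ract[OF that, symmetric])
  have 5: "mcomp Q i = r ` mcomp X i" for i by simp
  show "graded_right_module S Q" by (rule X.image_module(1)[of r Q], rule 1, erule (1) 2, rule 3, erule (1) 4, rule 5,
     erule (1) ker)
  show "finitely_generated S Q" if "finitely_generated S X"
   by (rule X.image_module(2)[of r Q], rule 1, erule (1) 2, rule 3, erule (1) 4, rule 5,
     erule (1) ker, rule that)
 qed
 then have QO: "Q \<in> Obj (gr S)" using f'(2) by (simp add: Obj_gr)
 let ?p = "(X, restrict r (carrier X), Q)"
 have p: "?p \<in> Hom S X Q"
  by (rule hom_grI[OF f'(2) QO]; simp only: Q radd[symmetric] ract[symmetric] imageI)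
 have "fn ?p ` carrier X = carrier Q" by simp
 moreover have "\<forall>i. mcomp Q i = fn ?p ` mcomp X i"
 proof
  fix i have "restrict r (carrier X) ` mcomp X i = r ` mcomp X i"
   by (rule image_cong[OF refl]) (simp add: X.mcomp_closed)
  then show "mcomp Q i = fn ?p ` mcomp X i" by simp
 qed
 moreover have "\<forall>x\<in>carrier X. fn ?p x = \<zero>[Q] \<longleftrightarrow> x \<in> ?N" using r0 by simp
 ultimately show ?thesis using p by blast
qed

end

text \<open>Satisfied by every graded algebra generated by finitely many elements of degree \<open>1\<close>.\<close>

locale std_algebra = graded_algebra S for S :: "('k::field, 's) graded_alg" (structure) +
 fixes F :: "nat \<Rightarrow> 's set"
 assumes neg: "i < 0 \<Longrightarrow> a \<in> hcomp S i \<Longrightarrow> a = \<zero>"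
  and F_finite: "finite (F j)" and F_hcomp: "F j \<subseteq> hcomp S (int j)"
  and F_span: "a \<in> hcomp S (int j) \<Longrightarrow> a \<in> lspan (reg S 0) (scal S) (F j)"
  and F_gen: "a \<in> hcomp S (int m) \<Longrightarrow> j \<le> m \<Longrightarrow> a \<in> lspan (reg S 0) (carrier S) (F j)"
begin

section \<open>Torsion modules and tails\<close>

lemma lspan_reg_ract:
 assumes "graded_right_module S X" "h \<in> carrier X" "a \<in> lspan (reg S 0) A B" "A \<subseteq> carrier S"
  "B \<subseteq> carrier S" "\<And>b. b \<in> B \<Longrightarrow> h \<cdot>[X] b \<in> G"
 shows "h \<cdot>[X] a \<in> lspan X A G"
proof -
 interpret X: graded_right_module S X by fact
 interpret R: graded_right_module S "reg S 0" by (rule reg_module)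
 show ?thesis using assms(3)
 proof (induction rule: lspan.induct)
  case zero show ?case using assms(2) lspan.zero[of X] by (simp add: X.ract_zero)
 next
  case (step x g a)
  have "x \<in> carrier S" using R.lspan_closed[OF step(1)] assms by simp
  then have "h \<cdot>[X] (x \<oplus>[reg S 0] g \<cdot>[reg S 0] a) = (h \<cdot>[X] x) \<oplus>[X] (h \<cdot>[X] g) \<cdot>[X] a"
   using step assms by (auto simp: X.ract_add X.ract_mult subset_iff)
  then show ?case using lspan.step[OF step.IH assms(6)[OF step(2)] step(3)] by simp
 qed
qed

lemma homog_generators_Obj:
 assumes "X \<in> Obj (gr S)"
 shows "\<exists>H e. finite H \<and> H \<subseteq> carrier X \<and> carrier X \<subseteq> lspan X (carrier S) H \<and> (\<forall>h\<in>H. h \<in> mcomp X (e h))"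
proof -
 interpret X: graded_right_module S X using assms by (simp add: Obj_gr)
 obtain G where "finite G" "G \<subseteq> carrier X" "carrier X \<subseteq> lspan X (carrier S) G"
  using assms X.finitely_generated_iff by (auto simp: Obj_gr)
 from X.homog_generators[OF _ _ _ this] obtain H where H: "finite H" "H \<subseteq> carrier X"
  "carrier X \<subseteq> lspan X (carrier S) H" "\<forall>h\<in>H. \<exists>e. h \<in> mcomp X e" by auto
 from bchoice[OF H(4)] obtain e where "\<forall>h\<in>H. h \<in> mcomp X (e h)" by blast
 with H show ?thesis by blast
qed

text \<open>A generator h of degree e h contributes h S_j only for 0 \<le> j < n - e h, and each S_j
  has a finite spanning set. With the converse below, torsion modules are those that vanish in all
  large degrees.\<close>

lemma eventually_zero_finite_dimensional:
 assumes X: "X \<in> Obj (gr S)" and z: "\<And>d x. n \<le> d \<Longrightarrow> x \<in> mcomp X d \<Longrightarrow> x = \<zero>[X]"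
 shows "finite_dimensional S X"
proof -
 interpret X: graded_right_module S X using X by (simp add: Obj_gr)
 obtain H e where H: "finite H" "H \<subseteq> carrier X" "carrier X \<subseteq> lspan X (carrier S) H"
  "\<And>h. h \<in> H \<Longrightarrow> h \<in> mcomp X (e h)" using homog_generators_Obj[OF X] by blast
 define G where "G = (\<Union>h\<in>H. \<Union>j<nat (n - e h). (\<lambda>b. h \<cdot>[X] b) ` F j)"
 have G: "finite G" unfolding G_def using H F_finite by auto
 have FS: "F j \<subseteq> carrier S" for j using F_hcomp SG.comp_closed by blast
 have GX: "G \<subseteq> carrier X" unfolding G_def using H(2) FS by (auto intro!: X.ract_closed)
 have hc: "h \<in> carrier X" if "h \<in> H" for h using that H(2) by blast
 have hom: "h \<cdot>[X] a \<in> lspan X (scal S) G" if h: "h \<in> H" and a: "a \<in> hcomp S i" for h a i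
 proof (cases "i < 0")
  case True
  then have "a = \<zero>" using neg a by blast
  then show ?thesis using X.ract_zero[OF hc[OF h]] lspan.zero[of X] by simp
 next
  case i: False
  show ?thesis
  proof (cases "n \<le> e h + i")
   case True
   then have "h \<cdot>[X] a = \<zero>[X]" by (intro z[OF _ X.ract_mcomp[OF H(4)[OF h] a]])
   then show ?thesis using lspan.zero[of X] by simp
  next
   case False
   then have j: "nat i < nat (n - e h)" "int (nat i) = i" using i by auto
   then have "a \<in> lspan (reg S 0) (scal S) (F (nat i))" using F_span[of a "nat i"] a by simp
   moreover have "h \<cdot>[X] b \<in> G" if "b \<in> F (nat i)" for b
    unfolding G_def using that h j(1) by (intro UN_I[of h] UN_I[of "nat i"] imageI) simp_all
   ultimately show ?thesis
    by (rule lspan_reg_ract[OF X.graded_right_module_axioms hc[OF h] _ scal_closed FS])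
  qed
 qed
 have hs: "h \<cdot>[X] a \<in> lspan X (scal S) G" if h: "h \<in> H" and a: "a \<in> carrier S" for h a
  using a
 proof (induction rule: SG.graded_induct)
  case zero show ?case using X.ract_zero[OF hc[OF h]] lspan.zero[of X] by simp
 next
  case (add i b c)
  show ?case unfolding X.ract_add[OF hc[OF h] SG.comp_closed[OF add(1)] add(2)]
   by (rule X.lspan_add[OF scal_closed GX hom[OF h add(1)] add(3)])
 qed
 have "x \<in> lspan X (scal S) G" if "x \<in> lspan X (carrier S) H" for x
  using that
 proof (induction rule: lspan.induct)
  case (step x g a)
  then show ?case using hs by (intro X.lspan_add[OF scal_closed GX])
 qed (rule lspan.zero)
 then have "carrier X \<subseteq> lspan X (scal S) G" using H(3) by blast
 then show ?thesis unfolding X.finite_dimensional_iff using G GX by blast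
qed

lemma finite_dimensional_eventually_zero:
 assumes X: "X \<in> Obj (gr S)" and fd: "finite_dimensional S X"
 shows "\<exists>n. \<forall>d\<ge>n. \<forall>x\<in>mcomp X d. x = \<zero>[X]"
proof -
 interpret X: graded_right_module S X using X by (simp add: Obj_gr)
 obtain G where G: "finite G" "G \<subseteq> carrier X" "carrier X \<subseteq> lspan X (scal S) G"
  using fd unfolding X.finite_dimensional_iff by blast
 have "\<one> = 1 \<bullet> \<one>" by (simp add: ascale_one)
 then have one: "\<one> \<in> scal S" unfolding scal_def by (rule range_eqI)
 obtain H where H: "finite H" "H \<subseteq> carrier X" "carrier X \<subseteq> lspan X (scal S) H"
  "\<forall>h\<in>H. \<exists>e. h \<in> mcomp X e"
  using X.homog_generators[OF scal_closed one scal_mult G] by blast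
 from bchoice[OF H(4)] obtain e where e: "\<And>h. h \<in> H \<Longrightarrow> h \<in> mcomp X (e h)" by blast
 \<comment> \<open>The inserted 0 keeps \<open>Max\<close> meaningful when H is empty.\<close>
 define n where "n = Max (insert 0 (e ` H)) + 1"
 have en: "e h < n" if "h \<in> H" for h
 proof -
  have "e h \<le> Max (insert 0 (e ` H))" using that H(1) by (intro Max_ge) auto
  then show ?thesis by (simp add: n_def)
 qed
 have "cmp X (mcomp X) x d = \<zero>[X]" if "x \<in> lspan X (scal S) H" "n \<le> d" for x d
  using that(1)
 proof (induction rule: lspan.induct)
  case zero show ?case by (rule X.MG.cmp_zero)
 next
  case (step x g a)
  have "g \<cdot>[X] a \<in> mcomp X (e g)" using X.ract_mcomp[OF e[OF step(2)] scal_hcomp[OF step(3)]] by simp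
  then have "cmp X (mcomp X) (g \<cdot>[X] a) d = \<zero>[X]" "g \<cdot>[X] a \<in> carrier X"
   using en[OF step(2)] that(2) by (simp_all add: X.MG.cmp_homog X.mcomp_closed)
  then show ?case using step X.lspan_closed[OF step(1) scal_closed H(2)] by (simp add: X.MG.cmp_add)
 qed
 then have z: "cmp X (mcomp X) x d = \<zero>[X]" if "x \<in> carrier X" "n \<le> d" for x d
  using H(3) that by blast
 have "x = \<zero>[X]" if "n \<le> d" "x \<in> mcomp X d" for x d
  using X.MG.cmp_homog[OF that(2), of d] z[OF X.mcomp_closed[OF that(2)] that(1)] by simp
 then show ?thesis by blast
qed

text \<open>The tail of X in degrees at least n. Inclusions of tails are among the inverted arrows,
  and each arrow of the quotient category has a representative defined on a tail.\<close>

definition trunc_set :: "'s gmod \<Rightarrow> int \<Rightarrow> 's list set set" where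
 "trunc_set X n = {x \<in> carrier X. \<forall>i<n. cmp X (mcomp X) x i = \<zero>[X]}"

definition trunc :: "'s gmod \<Rightarrow> int \<Rightarrow> 's gmod" where
 "trunc X n = X\<lparr>carrier := trunc_set X n, mcomp := \<lambda>i. mcomp X i \<inter> trunc_set X n\<rparr>"

lemma trunc_simps [simp]: "zero (trunc X n) = zero X" "add (trunc X n) = add X"
 "ract (trunc X n) = ract X" "carrier (trunc X n) = trunc_set X n"
 by (simp_all add: trunc_def)

lemma trunc_mcomp:
 assumes "X \<in> Obj (gr S)"
 shows "mcomp (trunc X n) i = (if n \<le> i then mcomp X i else {\<zero>[X]})"
proof -
 interpret X: graded_right_module S X using assms by (simp add: Obj_gr)
 have "x \<in> trunc_set X n \<longleftrightarrow> n \<le> i \<or> x = \<zero>[X]" if x: "x \<in> mcomp X i" for x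
  using X.MG.cmp_homog[OF x] X.mcomp_closed[OF x] by (auto simp: trunc_set_def)
 then show ?thesis using X.MG.comp_zero by (auto simp: trunc_def)
qed

text \<open>The tail is stable because S lives in degrees at least 0. It is finitely generated
  because, by \<open>F_gen\<close>, the products h b with h a generator of X and b in F of degree n
  - e h reach everything that h contributes in degrees at least n.\<close>

lemma trunc_Obj:
 assumes X: "X \<in> Obj (gr S)" shows "trunc X n \<in> Obj (gr S)"
proof -
 interpret X: graded_right_module S X using X by (simp add: Obj_gr)
 have TX: "trunc_set X n \<subseteq> carrier X" by (auto simp: trunc_set_def)
 have Ta: "x \<oplus>[X] y \<in> trunc_set X n" if "x \<in> trunc_set X n" "y \<in> trunc_set X n" for x y
  using that by (auto simp: trunc_set_def X.MG.cmp_add)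
 have Tm: "x \<cdot>[X] a \<in> trunc_set X n" if x: "x \<in> trunc_set X n" and a: "a \<in> carrier S" for x a
  using a
 proof (induction rule: SG.graded_induct)
  case zero show ?case using x by (auto simp: trunc_set_def X.ract_zero X.MG.cmp_zero)
 next
  case (add i b c)
  have bc: "b \<in> carrier S" by (rule SG.comp_closed[OF add(1)])
  have "x \<cdot>[X] b \<in> trunc_set X n"
  proof (cases "i < 0")
   case True
   then have "b = \<zero>" using neg add(1) by blast
   then show ?thesis using x by (auto simp: trunc_set_def X.ract_zero X.MG.cmp_zero)
  next
   case False
   then show ?thesis using x bc
    by (auto simp: trunc_set_def X.cmp_ract_homog[OF _ add(1)] X.ract_closed X.zero_ract)
  qed
  then show ?case using Ta[OF _ add(3)] x TX add(2) bc by (auto simp: X.ract_add)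
 qed
 have Tc: "cmp X (mcomp X) x i \<in> trunc_set X n" if x: "x \<in> trunc_set X n" for x i
  using x X.MG.cmp_homog[OF X.MG.cmp_props(1)] by (auto simp: trunc_set_def X.MG.cmp_closed)
 have T: "graded_right_module S (trunc X n)" unfolding trunc_def
  by (rule X.submodule[OF TX _ Ta Tm Tc]) (auto simp: trunc_set_def X.MG.cmp_zero)
 interpret T: graded_right_module S "trunc X n" by (rule T)
 obtain H e where H: "finite H" "H \<subseteq> carrier X" "carrier X \<subseteq> lspan X (carrier S) H"
  "\<And>h. h \<in> H \<Longrightarrow> h \<in> mcomp X (e h)" using homog_generators_Obj[OF X] by blast
 \<comment> \<open>For generators already of degree at least n, \<open>nat\<close> gives degree 0,
   and h times \<open>F 0\<close> generates all that h does.\<close>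
 define G where "G = (\<Union>h\<in>H. (\<lambda>b. h \<cdot>[X] b) ` F (nat (n - e h)))"
 have G: "finite G" unfolding G_def using H F_finite by auto
 have FS: "F j \<subseteq> carrier S" for j using F_hcomp SG.comp_closed by blast
 have GX: "G \<subseteq> carrier X" unfolding G_def using H(2) FS by (auto intro!: X.ract_closed)
 have GT: "G \<subseteq> trunc_set X n"
 proof
  fix g assume "g \<in> G"
  then obtain h b where h: "h \<in> H" "b \<in> F (nat (n - e h))" "g = h \<cdot>[X] b" by (auto simp: G_def)
  have "g \<in> mcomp X (e h + int (nat (n - e h)))"
   using X.ract_mcomp[OF H(4)[OF h(1)]] F_hcomp h by blast
  from X.MG.cmp_homog[OF this] X.mcomp_closed[OF this]
  show "g \<in> trunc_set X n" by (auto simp: trunc_set_def)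
 qed
 have hc: "h \<in> carrier X" if "h \<in> H" for h using that H(2) by blast
 have hom: "h \<cdot>[X] a \<in> lspan X (carrier S) G"
  if h: "h \<in> H" and a: "a \<in> hcomp S i" and i: "n \<le> e h + i" for h a i
 proof (cases "i < 0")
  case True
  then have "a = \<zero>" using neg a by blast
  then show ?thesis using X.ract_zero[OF hc[OF h]] lspan.zero[of X] by simp
 next
  case False
  then have "nat (n - e h) \<le> nat i" "int (nat i) = i" using i by auto
  then have "a \<in> lspan (reg S 0) (carrier S) (F (nat (n - e h)))" using F_gen[of a "nat i"] a by simp
  moreover have "h \<cdot>[X] b \<in> G" if "b \<in> F (nat (n - e h))" for b
   unfolding G_def using that h by (intro UN_I[of h] imageI)
  ultimately show ?thesis
   by (rule lspan_reg_ract[OF X.graded_right_module_axioms hc[OF h] _ subset_refl FS])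
 qed
 have cm: "cmp X (mcomp X) x i \<in> lspan X (carrier S) G" if "x \<in> lspan X (carrier S) H" "n \<le> i" for x i
  using that(1)
 proof (induction rule: lspan.induct)
  case zero show ?case using lspan.zero[of X] by (simp add: X.MG.cmp_zero)
 next
  case (step x g a)
  have x: "x \<in> carrier X" using X.lspan_closed[OF step(1) _ H(2)] by simp
  have gl: "g \<cdot>[X] cmp S (hcomp S) a (i - e g) \<in> lspan X (carrier S) G"
   by (rule hom[OF step(2) SG.cmp_props(1)[OF step(3)]]) (use that(2) in simp)
  have "cmp X (mcomp X) (x \<oplus>[X] g \<cdot>[X] a) i
    = cmp X (mcomp X) x i \<oplus>[X] g \<cdot>[X] cmp S (hcomp S) a (i - e g)"
   using x X.ract_closed[OF hc[OF step(2)] step(3)]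
   by (simp add: X.MG.cmp_add X.cmp_homog_ract[OF H(4)[OF step(2)] step(3)])
  then show ?case using X.lspan_add[OF subset_refl GX step.IH gl] by simp
 qed
 have "x \<in> lspan X (carrier S) G" if x: "x \<in> trunc_set X n" for x
 proof -
  have xc: "x \<in> carrier X" using x TX by blast
  have "cmp X (mcomp X) x i \<in> lspan X (carrier S) G" for i
  proof (cases "n \<le> i")
   case True then show ?thesis using cm[of x i] xc H(3) by blast
  next
   case False then show ?thesis using x lspan.zero[of X] by (simp add: trunc_set_def)
  qed
  then have "(\<Oplus>\<^bsub>X\<^esub>i\<in>{i. cmp X (mcomp X) x i \<noteq> \<zero>[X]}. cmp X (mcomp X) x i) \<in> lspan X (carrier S) G"
   by (intro X.lspan_finsum[OF subset_refl GX X.MG.cmp_props(2)[OF xc]])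
  then show ?thesis by (simp only: X.MG.cmp_props(3)[OF xc, symmetric])
 qed
 moreover have "lspan (trunc X n) (carrier S) G = lspan X (carrier S) G"
  unfolding trunc_def by (rule X.lspan_carrier_update)
 ultimately have "carrier (trunc X n) \<subseteq> lspan (trunc X n) (carrier S) G" by (simp add: subset_iff)
 then have "finitely_generated S (trunc X n)"
  unfolding T.finitely_generated_iff using G GT by (intro exI[of _ G]) simp
 then show ?thesis using T by (simp add: Obj_gr)
qed

lemma trunc_inclusion:
 assumes X: "X \<in> Obj (gr S)"
 shows "\<exists>f\<in>Hom S (trunc X n) X. \<forall>x\<in>carrier (trunc X n). fn f x = x"
proof -
 have "(trunc X n, restrict id (carrier (trunc X n)), X) \<in> Hom S (trunc X n) X"
  by (rule hom_grI[OF trunc_Obj[OF X] X]) (auto simp: trunc_set_def trunc_def)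
 then show ?thesis
  by (intro bexI[of _ "(trunc X n, restrict id (carrier (trunc X n)), X)"]) auto
qed

end

section \<open>Kernels, cokernels and the arrows to be inverted\<close>

lemma kernel_factor:
 assumes k: "is_kernel C k f" "k \<in> hom_set C K W" and f: "f \<in> hom_set C W X"
  and g: "g \<in> hom_set C V W" "zero_arrow C (f \<star>[C] g)"
 obtains h where "h \<in> hom_set C V K" "k \<star>[C] h = g"
proof -
 have "\<forall>g\<in>Arr C. Cod C g = Dom C f \<and> zero_arrow C (f \<star>[C] g) \<longrightarrow>
   (\<exists>!h. h \<in> hom_set C (Dom C g) (Dom C k) \<and> k \<star>[C] h = g)"
  using k(1) unfolding is_kernel_def by (elim conjE)
 from bspec[OF this hom_setD(1)[OF g(1)]]
 have "\<exists>!h. h \<in> hom_set C V K \<and> k \<star>[C] h = g"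
  unfolding hom_setD(2)[OF g(1)] hom_setD(3)[OF g(1)] hom_setD(2)[OF f] hom_setD(2)[OF k(2)]
  using g(2) by simp
 then show thesis using that by (elim ex1E conjE)
qed

lemma cokernel_factor:
 assumes c: "is_cokernel C c f" "c \<in> hom_set C W K" and f: "f \<in> hom_set C X W"
  and g: "g \<in> hom_set C W V" "zero_arrow C (g \<star>[C] f)"
 obtains h where "h \<in> hom_set C K V" "h \<star>[C] c = g"
proof -
 have "\<forall>g\<in>Arr C. Dom C g = Cod C f \<and> zero_arrow C (g \<star>[C] f) \<longrightarrow>
   (\<exists>!h. h \<in> hom_set C (Cod C c) (Cod C g) \<and> h \<star>[C] c = g)"
  using c(1) unfolding is_cokernel_def by (elim conjE)
 from bspec[OF this hom_setD(1)[OF g(1)]]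
 have "\<exists>!h. h \<in> hom_set C K V \<and> h \<star>[C] c = g"
  unfolding hom_setD(2)[OF g(1)] hom_setD(3)[OF g(1)] hom_setD(3)[OF f] hom_setD(3)[OF c(2)]
  using g(2) by simp
 then show thesis using that by (elim ex1E conjE)
qed

text \<open>Homomorphisms commute with taking components, so the degree d component of any preimage
  will do.\<close>

lemma hom_gr_mcomp_preimage:
 assumes f: "f \<in> Hom S M N" and y: "y \<in> mcomp N d" and i: "y \<in> fn f ` carrier M"
 shows "\<exists>x\<in>mcomp M d. fn f x = y"
proof -
 note f' = hom_gr_props[OF f]
 interpret M: graded_right_module S M by (rule f'(3))
 interpret N: graded_right_module S N by (rule f'(4))
 obtain x where x: "x \<in> carrier M" "y = fn f x" using i by blast
 have "fn f (cmp M (mcomp M) x d) = y"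
  using f'(12)[OF x(1), of d] N.MG.cmp_homog[OF y, of d] x(2) by simp
 then show ?thesis using M.MG.cmp_props(1)[OF x(1)] by blast
qed

lemma hom_gr_minus:
 assumes f: "f \<in> Hom S M N" and x: "x \<in> carrier M" "y \<in> carrier M"
 shows "fn f (x \<ominus>\<^bsub>M\<^esub> y) = fn f x \<ominus>\<^bsub>N\<^esub> fn f y"
proof -
 note f' = hom_gr_props[OF f]
 interpret M: graded_right_module S M by (rule f'(3))
 interpret N: graded_right_module S N by (rule f'(4))
 show ?thesis using x by (simp add: M.M.minus_eq N.M.minus_eq f'(7) f'(13))
qed

lemma (in graded_right_module) minus_eq_zero:
 "x \<in> carrier M \<Longrightarrow> y \<in> carrier M \<Longrightarrow> x \<ominus> y = \<zero> \<longleftrightarrow> x = y"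
proof
 assume x: "x \<in> carrier M" "y \<in> carrier M" and z: "x \<ominus> y = \<zero>"
 have "x = (x \<ominus> y) \<oplus> y" using x by (simp add: M.minus_eq M.a_assoc M.l_neg)
 then show "x = y" using x z by simp
next
 assume "x \<in> carrier M" "y \<in> carrier M" "x = y"
 then show "x \<ominus> y = \<zero>" by (simp add: M.minus_eq M.r_neg)
qed

context std_algebra
begin

text \<open>The homomorphism theorem: g factors by evaluating it on an arbitrary preimage under p,
  and two preimages differ by an element of the image of s, which g kills.\<close>

lemma is_cokernelI_gr:
 assumes s: "s \<in> Hom S W X" and p: "p \<in> Hom S X Q"
  and surj: "fn p ` carrier X = carrier Q" and comp: "\<forall>i. mcomp Q i = fn p ` mcomp X i"
  and ker: "\<forall>x\<in>carrier X. fn p x = \<zero>[Q] \<longleftrightarrow> x \<in> fn s ` carrier W"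
 shows "is_cokernel (gr S) p s"
 unfolding is_cokernel_def
proof (intro conjI ballI impI)
 note s' = hom_gr_props[OF s] and p' = hom_gr_props[OF p]
 interpret X: graded_right_module S X by (rule s'(4))
 interpret Q: graded_right_module S Q by (rule p'(4))
 show "p \<in> Arr (gr S)" "s \<in> Arr (gr S)" "Dom (gr S) p = Cod (gr S) s"
  using hom_setD[OF s] hom_setD[OF p] by simp_all
 show "zero_arrow (gr S) (p \<star>[gr S] s)"
  unfolding zero_arrow_gr[OF hom_gr_comp(1)[OF s p]] using hom_gr_comp(2)[OF s p] ker s'(6) by simp
 fix g assume g: "g \<in> Arr (gr S)" and gs: "Dom (gr S) g = Cod (gr S) s \<and> zero_arrow (gr S) (g \<star>[gr S] s)"
 define Y where "Y = Cod (gr S) g"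
 have gh: "g \<in> Hom S X Y" using g gs hom_setD(3)[OF s] by (simp add: hom_set_def Y_def)
 note g' = hom_gr_props[OF gh]
 interpret Y: graded_right_module S Y by (rule g'(4))
 have gz: "fn g (fn s w) = \<zero>[Y]" if "w \<in> carrier W" for w
  using gs that unfolding zero_arrow_gr[OF hom_gr_comp(1)[OF s gh]]
  by (simp add: hom_gr_comp(2)[OF s gh])
 have wd: "fn g x = fn g y" if "x \<in> carrier X" "y \<in> carrier X" "fn p x = fn p y" for x y
 proof -
  have "fn p (x \<ominus>\<^bsub>X\<^esub> y) = \<zero>[Q]"
   unfolding hom_gr_minus[OF p that(1,2)] using that p'(6) by (simp add: Q.minus_eq_zero)
  then have "x \<ominus>\<^bsub>X\<^esub> y \<in> fn s ` carrier W" using ker X.M.minus_closed[OF that(1,2)] by blast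
  then obtain w where "w \<in> carrier W" "x \<ominus>\<^bsub>X\<^esub> y = fn s w" by blast
  then have "fn g x \<ominus>\<^bsub>Y\<^esub> fn g y = \<zero>[Y]" using hom_gr_minus[OF gh that(1,2)] gz by simp
  then show ?thesis using that g'(6) by (simp add: Y.minus_eq_zero)
 qed
 have surjD: "\<exists>x\<in>carrier X. y = fn p x" if "y \<in> carrier Q" for y using that surj by auto
 define k where "k = (\<lambda>y. fn g (inv_into (carrier X) (fn p) y))"
 have kp: "k (fn p x) = fn g x" if "x \<in> carrier X" for x
  unfolding k_def
  by (rule wd[OF inv_into_into[OF imageI[OF that]] that f_inv_into_f[OF imageI[OF that]]])
 have kh: "(Q, restrict k (carrier Q), Y) \<in> Hom S Q Y"
 proof (rule hom_grI[OF p'(2) g'(2)])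
  fix x y assume x: "x \<in> carrier Q" and y: "y \<in> carrier Q"
  from surjD[OF x] surjD[OF y]
  obtain a b where ab: "a \<in> carrier X" "x = fn p a" "b \<in> carrier X" "y = fn p b"
   by (elim bexE) (rule that)
  show "k x \<in> carrier Y" using ab g'(6) kp by simp
  show "k (x \<oplus>[Q] y) = k x \<oplus>[Y] k y"
   unfolding ab(2,4) p'(7)[OF ab(1,3), symmetric] using ab by (simp add: kp g'(7))
 next
  fix x t assume x: "x \<in> carrier Q" and t: "t \<in> carrier S"
  from surjD[OF x] obtain a where ab: "a \<in> carrier X" "x = fn p a" by (elim bexE)
  show "k (x \<cdot>[Q] t) = k x \<cdot>[Y] t"
   unfolding ab(2) p'(8)[OF ab(1) t, symmetric] using ab t by (simp add: kp g'(8) X.ract_closed)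
 next
  fix x d assume "x \<in> mcomp Q d"
  then obtain a where "a \<in> mcomp X d" "x = fn p a" using comp by auto
  then show "k x \<in> mcomp Y d" using g'(9) kp X.mcomp_closed by simp
 qed
 let ?h = "(Q, restrict k (carrier Q), Y)"
 have hp: "h \<star>[gr S] p = g \<longleftrightarrow> (\<forall>x\<in>carrier X. fn h (fn p x) = fn g x)" if h: "h \<in> Hom S Q Y" for h
 proof
  assume "h \<star>[gr S] p = g"
  then show "\<forall>x\<in>carrier X. fn h (fn p x) = fn g x" using hom_gr_comp(2)[OF p h] by simp
 next
  assume "\<forall>x\<in>carrier X. fn h (fn p x) = fn g x"
  then show "h \<star>[gr S] p = g"
   using hom_gr_comp[OF p h] X.mcomp_closed by (intro hom_gr_eqI[OF _ gh]) simp_all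
 qed
 show "\<exists>!h. h \<in> Hom S (Cod (gr S) p) (Cod (gr S) g) \<and> h \<star>[gr S] p = g"
  unfolding hom_setD(3)[OF p] Y_def[symmetric]
 proof (rule ex1I)
  show "?h \<in> Hom S Q Y \<and> ?h \<star>[gr S] p = g"
   using kh iffD2[OF hp[OF kh]] kp p'(6) by simp
 next
  fix h assume h: "h \<in> Hom S Q Y \<and> h \<star>[gr S] p = g"
  show "h = ?h"
  proof (rule hom_gr_eqI[OF conjunct1[OF h] kh])
   fix y d assume "y \<in> mcomp Q d"
   then have "y \<in> fn p ` mcomp X d" using comp by simp
   then obtain x where x: "x \<in> carrier X" "y = fn p x" using X.mcomp_closed by blast
   have "\<forall>x\<in>carrier X. fn h (fn p x) = fn g x"
    by (rule iffD1[OF hp[OF conjunct1[OF h]] conjunct2[OF h]])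
   then show "fn h y = fn ?h y" unfolding x(2) using x(1) kp[OF x(1)] p'(6)[OF x(1)] by simp
  qed
 qed
qed

lemma cokernel_gr_exists:
 assumes "s \<in> Hom S W X"
 obtains Q p where "p \<in> Hom S X Q" "fn p ` carrier X = carrier Q"
  "\<forall>i. mcomp Q i = fn p ` mcomp X i"
  "\<forall>x\<in>carrier X. fn p x = \<zero>[Q] \<longleftrightarrow> x \<in> fn s ` carrier W"
  "is_cokernel (gr S) p s"
proof -
 obtain Q p where p: "p \<in> Hom S X Q" "fn p ` carrier X = carrier Q"
  "\<forall>i. mcomp Q i = fn p ` mcomp X i"
  "\<forall>x\<in>carrier X. fn p x = \<zero>[Q] \<longleftrightarrow> x \<in> fn s ` carrier W"
  using cokernel_gr[OF assms] by (elim exE conjE)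
 show thesis by (rule that[OF p is_cokernelI_gr[OF assms p]])
qed

lemma unit_free: "emb \<one> \<in> mcomp (rideal S \<one> 0 (- d)) d" "emb \<one> \<in> carrier (rideal S \<one> 0 (- d))"
 "t \<in> carrier S \<Longrightarrow> emb t \<in> carrier (rideal S \<one> 0 (- d))"
 "t \<in> hcomp S i \<Longrightarrow> emb t \<in> mcomp (rideal S \<one> 0 (- d)) (d + i)"
 using one_hcomp SG.comp_closed by (auto simp: image_iff intro!: bexI[of _ \<one>] bexI[of _ t])

text \<open>A categorical kernel or cokernel has unknown elements and must be compared with
  something explicit: kernels with maps from free modules, cokernels with the quotient constructed
  above.\<close>

lemma iso_modD:
 assumes iso: "s \<in> iso_mod (gr S) (tors S)" and s: "s \<in> Hom S W X"
 shows "\<exists>n. \<forall>d\<ge>n. bij_betw (fn s) (mcomp W d) (mcomp X d)"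
proof -
 note s' = hom_gr_props[OF s]
 interpret W: graded_right_module S W by (rule s'(3))
 interpret X: graded_right_module S X by (rule s'(4))
 from iso obtain k c where k: "is_kernel (gr S) k s" "Dom (gr S) k \<in> tors S"
  and c: "is_cokernel (gr S) c s" "Cod (gr S) c \<in> tors S" by (auto simp: iso_mod_def)
 define K where "K = Dom (gr S) k"
 define C where "C = Cod (gr S) c"
 have kh: "k \<in> Hom S K W" using k(1) hom_setD[OF s] by (simp add: is_kernel_def hom_set_def K_def)
 have ch: "c \<in> Hom S X C" using c(1) hom_setD[OF s] by (simp add: is_cokernel_def hom_set_def C_def)
 note k' = hom_gr_props[OF kh] and c' = hom_gr_props[OF ch]
 obtain n1 where n1: "\<And>d x. n1 \<le> d \<Longrightarrow> x \<in> mcomp K d \<Longrightarrow> x = \<zero>[K]"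
  using finite_dimensional_eventually_zero[of K] k(2) by (auto simp: tors_def K_def)
 obtain n2 where n2: "\<And>d x. n2 \<le> d \<Longrightarrow> x \<in> mcomp C d \<Longrightarrow> x = \<zero>[C]"
  using finite_dimensional_eventually_zero[of C] c(2) by (auto simp: tors_def C_def)
 \<comment> \<open>The map S(-d) \<rightarrow> W sending 1 to w is killed by s, hence factors
   through K, and K vanishes in degree d.\<close>
 have ker0: "w = \<zero>[W]" if d: "n1 \<le> d" and w: "w \<in> mcomp W d" and sw: "fn s w = \<zero>[X]" for w d
 proof -
  let ?R = "rideal S \<one> 0 (- d)"
  obtain \<omega> where \<omega>: "\<omega> \<in> Hom S ?R W" "\<And>t. t \<in> carrier S \<Longrightarrow> fn \<omega> (emb t) = w \<cdot>[W] t"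
   using free_hom[OF s'(1) w] by blast
  have "zero_arrow (gr S) (s \<star>[gr S] \<omega>)"
   unfolding zero_arrow_gr[OF hom_gr_comp(1)[OF \<omega>(1) s]]
  proof
   fix x assume x: "x \<in> carrier ?R"
   then obtain t where t: "t \<in> carrier S" "x = emb t" by auto
   show "fn (s \<star>[gr S] \<omega>) x = \<zero>[X]"
    using hom_gr_comp(2)[OF \<omega>(1) s x] \<omega>(2)[OF t(1)] s'(8)[OF W.mcomp_closed[OF w] t(1)]
     X.zero_ract[OF t(1)] by (simp only: t(2) sw)
  qed
  then obtain h where h: "h \<in> Hom S ?R K" "k \<star>[gr S] h = \<omega>"
   by (rule kernel_factor[OF k(1) kh s \<omega>(1)])
  have "fn h (emb \<one>) = \<zero>[K]" by (rule n1[OF d hom_gr_props(9)[OF h(1) unit_free(1)]])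
  then have "fn \<omega> (emb \<one>) = \<zero>[W]"
   using hom_gr_comp(2)[OF h(1) kh unit_free(2)] h(2) k'(11) by simp
  then show ?thesis using \<omega>(2)[OF one_closed] W.ract_one[OF W.mcomp_closed[OF w]] by simp
 qed
 obtain Q p where p: "p \<in> Hom S X Q" and pk: "\<forall>x\<in>carrier X. fn p x = \<zero>[Q] \<longleftrightarrow> x \<in> fn s ` carrier W"
  by (rule cokernel_gr_exists[OF s]) (rule that)
 have "zero_arrow (gr S) (p \<star>[gr S] s)"
  unfolding zero_arrow_gr[OF hom_gr_comp(1)[OF s p]] using hom_gr_comp(2)[OF s p] pk s'(6) by simp
 then obtain h where h: "h \<in> Hom S C Q" "h \<star>[gr S] c = p"
  by (rule cokernel_factor[OF c(1) ch s p])
 \<comment> \<open>The explicit quotient map p factors through c, and c kills x because C vanishes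
   in degree d; so x lies in the kernel of p, the image of s.\<close>
 have sur: "x \<in> fn s ` mcomp W d" if d: "n2 \<le> d" and x: "x \<in> mcomp X d" for x d
 proof -
  have "fn c x = \<zero>[C]" by (rule n2[OF d c'(9)[OF x]])
  then have "fn p x = \<zero>[Q]"
   using hom_gr_comp(2)[OF ch h(1) X.mcomp_closed[OF x]] h(2) hom_gr_props(11)[OF h(1)] by simp
  then have "x \<in> fn s ` carrier W" using pk X.mcomp_closed[OF x] by blast
  then show ?thesis using hom_gr_mcomp_preimage[OF s x] by blast
 qed
 show ?thesis
 proof (intro exI[of _ "max n1 n2"] allI impI)
  fix d assume d: "max n1 n2 \<le> d"
  show "bij_betw (fn s) (mcomp W d) (mcomp X d)"
  proof (rule bij_betw_imageI)
   show "inj_on (fn s) (mcomp W d)"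
   proof (rule inj_onI)
    fix w v assume w: "w \<in> mcomp W d" and v: "v \<in> mcomp W d" and e: "fn s w = fn s v"
    have wc: "w \<in> carrier W" "v \<in> carrier W" using w v W.mcomp_closed by auto
    have m: "w \<ominus>\<^bsub>W\<^esub> v \<in> mcomp W d"
     unfolding W.M.minus_eq by (intro W.MG.comp_add W.MG.comp_minus w v)
    have "fn s (w \<ominus>\<^bsub>W\<^esub> v) = \<zero>[X]"
     unfolding hom_gr_minus[OF s wc] e using s'(6)[OF wc(2)] by (simp add: X.minus_eq_zero)
    then have "w \<ominus>\<^bsub>W\<^esub> v = \<zero>[W]" by (intro ker0[OF _ m]) (use d in auto)
    then show "w = v" using wc by (simp add: W.minus_eq_zero)
   qed
   show "fn s ` mcomp W d = mcomp X d" using s'(9) sur d by fastforce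
  qed
 qed
qed

text \<open>A converse in the injective case, which covers inclusions of tails: the zero module is a
  kernel, and the explicit cokernel vanishes in degrees at least n.\<close>

lemma iso_modI:
 assumes s: "s \<in> Hom S W X" and inj: "\<And>w. w \<in> carrier W \<Longrightarrow> fn s w = \<zero>[X] \<Longrightarrow> w = \<zero>[W]"
  and sur: "\<And>d. n \<le> d \<Longrightarrow> mcomp X d \<subseteq> fn s ` carrier W"
 shows "s \<in> iso_mod (gr S) (tors S)"
proof -
 note s' = hom_gr_props[OF s]
 interpret W: graded_right_module S W by (rule s'(3))
 interpret X: graded_right_module S X by (rule s'(4))
 let ?Z = "rideal S \<zero> 0 0"
 obtain k where k: "k \<in> Hom S ?Z W" "\<And>x. x \<in> carrier ?Z \<Longrightarrow> fn k x = \<zero>[W]"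
  using const_hom[OF zero_module(1) s'(1)] by blast
 have Zzo: "zero_object (gr S) ?Z" unfolding zero_object_gr using zero_module by simp
 have "is_kernel (gr S) k s" unfolding is_kernel_def
 proof (intro conjI ballI impI)
  show "k \<in> Arr (gr S)" "s \<in> Arr (gr S)" "Cod (gr S) k = Dom (gr S) s"
   using hom_setD[OF k(1)] hom_setD[OF s] by simp_all
  show "zero_arrow (gr S) (s \<star>[gr S] k)"
   unfolding zero_arrow_gr[OF hom_gr_comp(1)[OF k(1) s]]
   using hom_gr_comp(2)[OF k(1) s] k(2) s'(11) by simp
  fix g assume g: "g \<in> Arr (gr S)" and gs: "Cod (gr S) g = Dom (gr S) s \<and> zero_arrow (gr S) (s \<star>[gr S] g)"
  define Y where "Y = Dom (gr S) g"
  have gh: "g \<in> Hom S Y W" using g gs hom_setD(2)[OF s] by (simp add: hom_set_def Y_def)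
  note g' = hom_gr_props[OF gh]
  interpret Y: graded_right_module S Y by (rule g'(3))
  have gz: "fn g y = \<zero>[W]" if "y \<in> carrier Y" for y
   using gs that g'(6) unfolding zero_arrow_gr[OF hom_gr_comp(1)[OF gh s]]
   by (intro inj) (simp_all add: hom_gr_comp(2)[OF gh s])
  have ex1: "\<exists>!h. h \<in> Hom S Y ?Z" using Zzo g'(1) by (simp add: zero_object_def)
  have "k \<star>[gr S] h = g" if h: "h \<in> Hom S Y ?Z" for h
   using hom_gr_comp[OF h k(1)] k(2)[OF hom_gr_props(6)[OF h]] gz Y.mcomp_closed
   by (intro hom_gr_eqI[OF _ gh]) simp_all
  then show "\<exists>!h. h \<in> Hom S (Dom (gr S) g) (Dom (gr S) k) \<and> k \<star>[gr S] h = g"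
   unfolding hom_setD(2)[OF k(1)] Y_def[symmetric] using ex1 by metis
 qed
 moreover have "Dom (gr S) k \<in> tors S"
 proof -
  have "finite_dimensional S ?Z"
   by (rule eventually_zero_finite_dimensional[OF zero_module(1), of 0]) (auto simp: SG.comp_closed)
  then show ?thesis using zero_module(1) hom_setD(2)[OF k(1)] by (simp add: tors_def)
 qed
 moreover obtain Q p where p: "p \<in> Hom S X Q" "\<forall>i. mcomp Q i = fn p ` mcomp X i"
  "\<forall>x\<in>carrier X. fn p x = \<zero>[Q] \<longleftrightarrow> x \<in> fn s ` carrier W" "is_cokernel (gr S) p s"
  by (rule cokernel_gr_exists[OF s]) (rule that)
 moreover have "Cod (gr S) p \<in> tors S"
 proof -
  note p' = hom_gr_props[OF p(1)]
  have "finite_dimensional S Q"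
  proof (rule eventually_zero_finite_dimensional[OF p'(2)])
   fix d y assume d: "n \<le> d" and "y \<in> mcomp Q d"
   then obtain x where x: "x \<in> mcomp X d" "y = fn p x" using p(2) by auto
   then show "y = \<zero>[Q]" using sur[OF d] p(3) X.mcomp_closed by blast
  qed
  then show ?thesis using p'(2) hom_setD(3)[OF p(1)] by (simp add: tors_def)
 qed
 ultimately show ?thesis using hom_setD(1)[OF s] unfolding iso_mod_def by blast
qed

end

section \<open>Arrows of the quotient category\<close>

text \<open>The germ f s^(-1) of a roof (s, f). The description is proper only where s is bijective,
  which for a roof is the case in all large degrees.\<close>

definition act :: "'s gmod_arr \<times> 's gmod_arr \<Rightarrow> int \<Rightarrow> 's list set \<Rightarrow> 's list set" where
 "act r d x = fn (snd r) (THE w. w \<in> mcomp (fst (fst r)) d \<and> fn (fst r) w = x)"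

definition eveq :: "'s gmod \<Rightarrow> (int \<Rightarrow> 's list set \<Rightarrow> 's list set) \<Rightarrow> (int \<Rightarrow> 's list set \<Rightarrow> 's list set) \<Rightarrow> bool" where
 "eveq X \<phi> \<psi> \<longleftrightarrow> (\<forall>\<^sub>F d in at_top. \<forall>x\<in>mcomp X d. \<phi> d x = \<psi> d x)"

text \<open>Homomorphisms defined in sufficiently large degrees; these are the arrows of the quotient
 category.\<close>

definition evhom :: "('k::field, 's) graded_alg \<Rightarrow> 's gmod \<Rightarrow> 's gmod \<Rightarrow> (int \<Rightarrow> 's list set \<Rightarrow> 's list set) \<Rightarrow> bool" where
 "evhom S X Y \<phi> \<longleftrightarrow> (\<forall>\<^sub>F d in at_top. (\<forall>x\<in>mcomp X d. \<phi> d x \<in> mcomp Y d) \<and>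
   (\<forall>x\<in>mcomp X d. \<forall>y\<in>mcomp X d. \<phi> d (x \<oplus>[X] y) = \<phi> d x \<oplus>[Y] \<phi> d y) \<and>
   (\<forall>x\<in>mcomp X d. \<forall>j\<ge>0. \<forall>s\<in>hcomp S j. \<phi> (d + j) (x \<cdot>[X] s) = \<phi> d x \<cdot>[Y] s))"

lemma eveq_refl: "eveq X \<phi> \<phi>"
 by (simp add: eveq_def)

lemma eveq_sym: "eveq X \<phi> \<psi> \<Longrightarrow> eveq X \<psi> \<phi>"
 unfolding eveq_def by (rule eventually_mono, assumption) simp

lemma eveq_trans:
 assumes "eveq X \<phi> \<psi>" "eveq X \<psi> \<chi>" shows "eveq X \<phi> \<chi>"
 using assms[unfolded eveq_def] unfolding eveq_def by eventually_elim simp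

lemma eveq_comp:
 assumes "eveq X \<phi> \<phi>'" "eveq Y \<psi> \<psi>'" "evhom S X Y \<phi>"
 shows "eveq X (\<lambda>d x. \<psi> d (\<phi> d x)) (\<lambda>d x. \<psi>' d (\<phi>' d x))"
 using assms[unfolded eveq_def evhom_def] unfolding eveq_def by eventually_elim auto

lemma evhom_comp:
 assumes \<phi>: "evhom S X Y \<phi>" and \<psi>: "evhom S Y Z \<psi>"
 shows "evhom S X Z (\<lambda>d x. \<psi> d (\<phi> d x))"
 using \<phi>[unfolded evhom_def] \<psi>[unfolded evhom_def] unfolding evhom_def
 by eventually_elim simp

text \<open>Linearity links degree d to all degrees d + j, so a property valid in large degrees is
  needed in all of these simultaneously.\<close>

lemma eventually_shift:
 "(\<forall>\<^sub>F d in at_top. P d) \<Longrightarrow> \<forall>\<^sub>F d in at_top. \<forall>j\<ge>(0::int). P (d + j)"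
 unfolding eventually_at_top_linorder by (metis add_increasing2)

lemma evhom_cong:
 assumes e: "eveq X \<phi> \<psi>" and \<phi>: "evhom S X Y \<phi>" and X: "graded_right_module S X"
 shows "evhom S X Y \<psi>"
proof -
 interpret X: graded_right_module S X by fact
 show ?thesis
  using \<phi>[unfolded evhom_def] eventually_shift[OF e[unfolded eveq_def]] unfolding evhom_def
 proof eventually_elim
  case (elim d)
  have e: "\<phi> d x = \<psi> d x" if "x \<in> mcomp X d" for x using elim(2)[rule_format, of 0] that by simp
  have e': "\<phi> (d + j) x = \<psi> (d + j) x" if "x \<in> mcomp X (d + j)" "0 \<le> j" for x j using elim(2) that by blast
  have "\<psi> d (x \<oplus>[X] y) = \<psi> d x \<oplus>[Y] \<psi> d y" if "x \<in> mcomp X d" "y \<in> mcomp X d" for x y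
   using elim(1) that e[OF that(1)] e[OF that(2)] e[OF X.MG.comp_add[OF that]] by metis
  moreover have "\<psi> (d + j) (x \<cdot>[X] s) = \<psi> d x \<cdot>[Y] s" if "x \<in> mcomp X d" "s \<in> hcomp S j" "0 \<le> j" for x s j
   using elim(1) that e[OF that(1)] e'[OF X.ract_mcomp[OF that(1,2)] that(3)] by metis
  ultimately show ?case using elim(1) e by auto
 qed
qed

lemma (in std_algebra) evhom_zero:
 assumes "evhom S X Y \<phi>" "graded_right_module S X" "graded_right_module S Y"
 shows "\<forall>\<^sub>F d in at_top. \<phi> d \<zero>[X] = \<zero>[Y]"
 using assms(1)[unfolded evhom_def]
proof eventually_elim
 case (elim d)
 interpret X: graded_right_module S X by fact
 interpret Y: graded_right_module S Y by fact
 have z: "\<zero>[X] \<in> mcomp X d" by (rule X.MG.comp_zero)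
 have a: "\<phi> d (\<zero>[X] \<oplus>[X] \<zero>[X]) = \<phi> d \<zero>[X] \<oplus>[Y] \<phi> d \<zero>[X]" using elim z by blast
 have c: "\<phi> d \<zero>[X] \<in> carrier Y" using elim z Y.mcomp_closed by blast
 show ?case using a c by (metis X.M.l_zero X.M.zero_closed Y.M.add.r_cancel_one)
qed

lemma act_eq:
 assumes s: "s \<in> Hom S W X" and b: "bij_betw (fn s) (mcomp W d) (mcomp X d)" and w: "w \<in> mcomp W d"
 shows "act (s, f) d (fn s w) = fn f w"
proof -
 have "fst s = W" using hom_gr_props(5)[OF s] by (metis fst_conv)
 moreover have "(THE v. v \<in> mcomp W d \<and> fn s v = fn s w) = w"
  using w inj_onD[OF bij_betw_imp_inj_on[OF b]] by (intro the_equality) auto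
 ultimately show ?thesis by (simp add: act_def)
qed

lemma bij_betwE':
 assumes "bij_betw f A B" "y \<in> B" obtains x where "x \<in> A" "y = f x"
 using assms unfolding bij_betw_def by (metis imageE)

context std_algebra
begin

lemma roofs_gr:
 "(s, f) \<in> roofs (gr S) (tors S) X Y \<longleftrightarrow>
  (\<exists>W. s \<in> iso_mod (gr S) (tors S) \<and> s \<in> Hom S W X \<and> f \<in> Hom S W Y)"
 by (auto simp: roofs_def hom_set_def iso_mod_def)

lemma roof_bij:
 assumes "s \<in> iso_mod (gr S) (tors S)" "s \<in> Hom S W X"
 shows "\<forall>\<^sub>F d in at_top. bij_betw (fn s) (mcomp W d) (mcomp X d)"
 using iso_modD[OF assms] unfolding eventually_at_top_linorder .

lemma roof_evhom:
 assumes s: "s \<in> iso_mod (gr S) (tors S)" "s \<in> Hom S W X" and f: "f \<in> Hom S W Y"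
 shows "evhom S X Y (act (s, f))"
 using eventually_shift[OF roof_bij[OF s]] unfolding evhom_def
proof eventually_elim
 case (elim d)
 note s' = hom_gr_props[OF s(2)] and f' = hom_gr_props[OF f]
 interpret W: graded_right_module S W by (rule s'(3))
 have b0: "bij_betw (fn s) (mcomp W d) (mcomp X d)" using elim[rule_format, of 0] by simp
 note a = act_eq[OF s(2) b0]
 show ?case
 proof (intro conjI ballI allI impI)
  fix x assume "x \<in> mcomp X d"
  then obtain w where w: "w \<in> mcomp W d" "x = fn s w" by (rule bij_betwE'[OF b0])
  show "act (s, f) d x \<in> mcomp Y d" unfolding w(2) a[OF w(1)] by (rule f'(9)[OF w(1)])
  {
   fix y assume "y \<in> mcomp X d"
   then obtain v where v: "v \<in> mcomp W d" "y = fn s v" by (rule bij_betwE'[OF b0])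
   have "x \<oplus>[X] y = fn s (w \<oplus>[W] v)"
    unfolding w(2) v(2) by (rule s'(7)[symmetric]) (rule W.mcomp_closed[OF w(1)] W.mcomp_closed[OF v(1)])+
   then show "act (s, f) d (x \<oplus>[X] y) = act (s, f) d x \<oplus>[Y] act (s, f) d y"
    using a[OF w(1)] a[OF v(1)] a[OF W.MG.comp_add[OF w(1) v(1)]]
     f'(7)[OF W.mcomp_closed[OF w(1)] W.mcomp_closed[OF v(1)]] w(2) v(2) by simp
  next
   fix j t assume j: "0 \<le> j" and t: "t \<in> hcomp S j"
   have tc: "t \<in> carrier S" using t by (rule SG.comp_closed)
   have bj: "bij_betw (fn s) (mcomp W (d + j)) (mcomp X (d + j))" using elim j by blast
   have e: "x \<cdot>[X] t = fn s (w \<cdot>[W] t)"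
    unfolding w(2) by (rule s'(8)[symmetric, OF W.mcomp_closed[OF w(1)] tc])
   show "act (s, f) (d + j) (x \<cdot>[X] t) = act (s, f) d x \<cdot>[Y] t"
    unfolding e act_eq[OF s(2) bj W.ract_mcomp[OF w(1) t]] unfolding w(2) a[OF w(1)]
    by (rule f'(8)[OF W.mcomp_closed[OF w(1)] tc])
  }
 qed
qed

text \<open>The roof (s, id) represents the inverse of s in the localization.\<close>

lemma inverse_roof:
 assumes s: "s \<in> iso_mod (gr S) (tors S)" "s \<in> Hom S W X"
 shows "evhom S X W (act (s, Ident (gr S) W))"
  and "\<forall>\<^sub>F d in at_top. (\<forall>x\<in>mcomp X d. act (s, Ident (gr S) W) d x \<in> mcomp W d \<and> fn s (act (s, Ident (gr S) W) d x) = x) \<and>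
   (\<forall>w\<in>mcomp W d. act (s, Ident (gr S) W) d (fn s w) = w)"
proof -
 note s' = hom_gr_props[OF s(2)]
 interpret W: graded_right_module S W by (rule s'(3))
 show "evhom S X W (act (s, Ident (gr S) W))"
  by (rule roof_evhom[OF s hom_gr_id(1)[OF s'(1)]])
 show "\<forall>\<^sub>F d in at_top. (\<forall>x\<in>mcomp X d. act (s, Ident (gr S) W) d x \<in> mcomp W d \<and> fn s (act (s, Ident (gr S) W) d x) = x) \<and>
   (\<forall>w\<in>mcomp W d. act (s, Ident (gr S) W) d (fn s w) = w)"
  using roof_bij[OF s]
 proof eventually_elim
  case (elim d)
  have a: "act (s, Ident (gr S) W) d (fn s w) = w" if "w \<in> mcomp W d" for w
   using act_eq[OF s(2) elim that, of "Ident (gr S) W"] hom_gr_id(2)[OF s'(1) W.mcomp_closed[OF that]] by (simp del: gr_simps)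
  have "act (s, Ident (gr S) W) d x \<in> mcomp W d \<and> fn s (act (s, Ident (gr S) W) d x) = x" if "x \<in> mcomp X d" for x
  proof -
   from that obtain w where w: "w \<in> mcomp W d" "x = fn s w" by (rule bij_betwE'[OF elim])
   show ?thesis unfolding w(2) a[OF w(1)] using w(1) by simp
  qed
  then show ?case using a by blast
 qed
qed

text \<open>Below degree n a tail has only the zero element, so degrees at least n decide.\<close>

lemma trunc_eqI:
 assumes X: "X \<in> Obj (gr S)" and a: "a \<in> Hom S (trunc X n) Y" and b: "b \<in> Hom S (trunc X n) Y"
  and eq: "\<And>d x. n \<le> d \<Longrightarrow> x \<in> mcomp X d \<Longrightarrow> fn a x = fn b x"
 shows "a = b"
proof (rule hom_gr_eqI[OF a b])
 fix x d assume "x \<in> mcomp (trunc X n) d"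
 then consider "n \<le> d" "x \<in> mcomp X d" | "x = \<zero>[X]"
  unfolding trunc_mcomp[OF X] by (auto split: if_splits)
 then show "fn a x = fn b x"
 proof cases
  case 1 then show ?thesis by (rule eq)
 next
  case 2 then show ?thesis using hom_gr_props(11)[OF a] hom_gr_props(11)[OF b] by simp
 qed
qed

text \<open>Cut off below n, the germ becomes a family of maps on the tail that is linear in all
  degrees, and such a family glues to an arrow. The conclusion holds for all large n, so that
  several germs can be extended to one common tail.\<close>

lemma evhom_extend:
 assumes X: "X \<in> Obj (gr S)" and Y: "Y \<in> Obj (gr S)" and \<phi>: "evhom S X Y \<phi>"
 shows "\<forall>\<^sub>F n in at_top. \<exists>f\<in>Hom S (trunc X n) Y. \<forall>d\<ge>n. \<forall>x\<in>mcomp X d. fn f x = \<phi> d x"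
proof -
 interpret X: graded_right_module S X using X by (simp add: Obj_gr)
 interpret Y: graded_right_module S Y using Y by (simp add: Obj_gr)
 from \<phi> evhom_zero[OF \<phi> X.graded_right_module_axioms Y.graded_right_module_axioms]
 have "\<forall>\<^sub>F d in at_top. ((\<forall>x\<in>mcomp X d. \<phi> d x \<in> mcomp Y d) \<and>
   (\<forall>x\<in>mcomp X d. \<forall>y\<in>mcomp X d. \<phi> d (x \<oplus>[X] y) = \<phi> d x \<oplus>[Y] \<phi> d y) \<and>
   (\<forall>x\<in>mcomp X d. \<forall>j\<ge>0. \<forall>s\<in>hcomp S j. \<phi> (d + j) (x \<cdot>[X] s) = \<phi> d x \<cdot>[Y] s)) \<and>
   \<phi> d \<zero>[X] = \<zero>[Y]" unfolding evhom_def by (rule eventually_conj)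
 then obtain n0 where N: "\<forall>d\<ge>n0. ((\<forall>x\<in>mcomp X d. \<phi> d x \<in> mcomp Y d) \<and>
   (\<forall>x\<in>mcomp X d. \<forall>y\<in>mcomp X d. \<phi> d (x \<oplus>[X] y) = \<phi> d x \<oplus>[Y] \<phi> d y) \<and>
   (\<forall>x\<in>mcomp X d. \<forall>j\<ge>0. \<forall>s\<in>hcomp S j. \<phi> (d + j) (x \<cdot>[X] s) = \<phi> d x \<cdot>[Y] s)) \<and>
   \<phi> d \<zero>[X] = \<zero>[Y]" unfolding eventually_at_top_linorder by (elim exE)
 have n0: "(\<forall>x\<in>mcomp X d. \<phi> d x \<in> mcomp Y d) \<and>
   (\<forall>x\<in>mcomp X d. \<forall>y\<in>mcomp X d. \<phi> d (x \<oplus>[X] y) = \<phi> d x \<oplus>[Y] \<phi> d y) \<and>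
   (\<forall>x\<in>mcomp X d. \<forall>j\<ge>0. \<forall>s\<in>hcomp S j. \<phi> (d + j) (x \<cdot>[X] s) = \<phi> d x \<cdot>[Y] s)"
  "\<phi> d \<zero>[X] = \<zero>[Y]" if "n0 \<le> d" for d
  using mp[OF spec[OF N] that] by (rule conjunct1, rule conjunct2)
 show ?thesis unfolding eventually_at_top_linorder
 proof (intro exI[of _ n0] allI impI)
  fix n assume n: "n0 \<le> n"
  define \<psi> where "\<psi> = (\<lambda>d x. if n \<le> d then \<phi> d x else \<zero>[Y])"
  have \<psi>0: "\<psi> d \<zero>[X] = \<zero>[Y]" for d using n0(2)[of d] n by (simp add: \<psi>_def)
  have cas: "(n \<le> d \<and> x \<in> mcomp X d) \<or> x = \<zero>[X]" if "x \<in> mcomp (trunc X n) d" for d x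
   using that unfolding trunc_mcomp[OF X] by (auto split: if_splits)
  have "\<exists>a\<in>Hom S (trunc X n) Y. \<forall>d. \<forall>x\<in>mcomp (trunc X n) d. fn a x = \<psi> d x"
  proof (rule hom_gr_extend[OF trunc_Obj[OF X] Y])
   show "\<psi> d x \<in> mcomp Y d" if "x \<in> mcomp (trunc X n) d" for d x
    using cas[OF that] n0(1)[of d] n \<psi>0[of d] Y.MG.comp_zero[of d] by (auto simp: \<psi>_def)
  next
   fix d x y assume xy: "x \<in> mcomp (trunc X n) d" "y \<in> mcomp (trunc X n) d"
   show "\<psi> d (x \<oplus>[trunc X n] y) = \<psi> d x \<oplus>[Y] \<psi> d y"
   proof (cases "n \<le> d")
    case True
    then have "x \<in> mcomp X d" "y \<in> mcomp X d" using xy by (simp_all add: trunc_mcomp[OF X])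
    then show ?thesis using n0(1)[of d] n True by (simp add: \<psi>_def)
   next
    case False
    then show ?thesis by (simp add: \<psi>_def)
   qed
  next
   fix d x j s assume x: "x \<in> mcomp (trunc X n) d" and s: "s \<in> hcomp S j"
   have sc: "s \<in> carrier S" using s by (rule SG.comp_closed)
   show "\<psi> (d + j) (x \<cdot>[trunc X n] s) = \<psi> d x \<cdot>[Y] s"
   proof (cases "x = \<zero>[X]")
    case True
    then show ?thesis using \<psi>0 X.zero_ract[OF sc] Y.zero_ract[OF sc] by simp
   next
    case False
    then have x': "n \<le> d" "x \<in> mcomp X d" using cas[OF x] by auto
    have "\<phi> d x \<in> mcomp Y d" using n0(1)[of d] n x' by simp
    then have px: "\<psi> d x \<in> carrier Y" using x'(1) Y.mcomp_closed by (simp add: \<psi>_def)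
    show ?thesis
    proof (cases "0 \<le> j")
     case True
     then show ?thesis using n0(1)[of d] n x' s by (simp add: \<psi>_def)
    next
     case False
     \<comment> \<open>Negative shifts could leave the range in which the germ is linear, but S has
       no nonzero elements of negative degree.\<close>
     then have "s = \<zero>" using neg[of j s] s by simp
     then show ?thesis
      using \<psi>0 X.ract_zero[OF X.mcomp_closed[OF x'(2)]] Y.ract_zero[OF px] by simp
    qed
   qed
  qed
  then obtain a where a: "a \<in> Hom S (trunc X n) Y"
   "\<And>d x. x \<in> mcomp (trunc X n) d \<Longrightarrow> fn a x = \<psi> d x" by blast
  have "fn a x = \<phi> d x" if "n \<le> d" "x \<in> mcomp X d" for d x
   using a(2)[of x d] that by (simp add: trunc_mcomp[OF X] \<psi>_def)
  then show "\<exists>f\<in>Hom S (trunc X n) Y. \<forall>d\<ge>n. \<forall>x\<in>mcomp X d. fn f x = \<phi> d x"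
   using a(1) by blast
 qed
qed

text \<open>An arrow that fixes the homogeneous elements of degree at least n is the inclusion of
  the tail. It is injective, and its image contains these degrees.\<close>

lemma inclusion_iso_mod:
 assumes X: "X \<in> Obj (gr S)" and i: "i \<in> Hom S (trunc X n) X"
  and e: "\<And>d x. n \<le> d \<Longrightarrow> x \<in> mcomp X d \<Longrightarrow> fn i x = x"
 shows "i \<in> iso_mod (gr S) (tors S)"
proof -
 obtain k where k0: "k \<in> Hom S (trunc X n) X" "\<forall>x\<in>carrier (trunc X n). fn k x = x"
  using trunc_inclusion[OF X, of n] by (elim bexE)
 note k = k0(1) bspec[OF k0(2)]
 interpret X: graded_right_module S X using X by (simp add: Obj_gr)
 interpret T: graded_right_module S "trunc X n" using trunc_Obj[OF X] by (simp add: Obj_gr)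
 have T: "x \<in> carrier (trunc X n)" if "n \<le> d" "x \<in> mcomp X d" for d x
  using T.mcomp_closed[of x d] that by (simp add: trunc_mcomp[OF X])
 have ik: "i = k" by (rule trunc_eqI[OF X i k(1)]) (simp add: e k(2)[OF T])
 show ?thesis
 proof (rule iso_modI[OF i])
  show "w = \<zero>[trunc X n]" if "w \<in> carrier (trunc X n)" "fn i w = \<zero>[X]" for w
   using that k(2)[OF that(1)] ik by simp
  show "mcomp X d \<subseteq> fn i ` carrier (trunc X n)" if d: "n \<le> d" for d
  proof
   fix x assume x: "x \<in> mcomp X d"
   show "x \<in> fn i ` carrier (trunc X n)"
    by (rule image_eqI[OF _ T[OF d x]]) (simp add: e[OF d x])
  qed
 qed
qed

text \<open>The left leg of the roof is the inclusion of a tail, the right leg the extension of the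
  germ to this tail.\<close>

lemma evhom_roof:
 assumes X: "X \<in> Obj (gr S)" and Y: "Y \<in> Obj (gr S)" and \<phi>: "evhom S X Y \<phi>"
 shows "\<exists>r\<in>roofs (gr S) (tors S) X Y. eveq X (act r) \<phi>"
proof -
 obtain n f where f: "f \<in> Hom S (trunc X n) Y" "\<And>d x. n \<le> d \<Longrightarrow> x \<in> mcomp X d \<Longrightarrow> fn f x = \<phi> d x"
  using eventually_happens[OF evhom_extend[OF X Y \<phi>]] by auto
 obtain i where i0: "i \<in> Hom S (trunc X n) X" "\<forall>x\<in>carrier (trunc X n). fn i x = x"
  using trunc_inclusion[OF X, of n] by (elim bexE)
 note i = i0(1) bspec[OF i0(2)]
 interpret T: graded_right_module S "trunc X n" using trunc_Obj[OF X] by (simp add: Obj_gr)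
 have T: "x \<in> mcomp (trunc X n) d" if "n \<le> d" "x \<in> mcomp X d" for d x
  using that by (simp add: trunc_mcomp[OF X])
 have ix: "fn i x = x" if "n \<le> d" "x \<in> mcomp X d" for d x
  using i(2)[OF T.mcomp_closed[OF T[OF that]]] .
 have iso: "i \<in> iso_mod (gr S) (tors S)" by (rule inclusion_iso_mod[OF X i(1) ix])
 show ?thesis
 proof (rule bexI[of _ "(i, f)"])
  show "(i, f) \<in> roofs (gr S) (tors S) X Y" using roofs_gr iso i(1) f(1) by blast
  show "eveq X (act (i, f)) \<phi>" unfolding eveq_def
   using roof_bij[OF iso i(1)] eventually_ge_at_top[of n]
  proof eventually_elim
   case (elim d)
   show ?case
   proof
    fix x assume x: "x \<in> mcomp X d"
    show "act (i, f) d x = \<phi> d x"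
     using act_eq[OF i(1) elim(1) T[OF elim(2) x], of f] ix[OF elim(2) x] f(2)[OF elim(2) x] by simp
   qed
  qed
 qed
qed

text \<open>If the roofs have a common refinement, evaluating there gives the same germ. If the
  germs agree, a tail of X is a common refinement, with the inverses of s and t extended to it as u
  and v. The category of fractions is thereby reduced to germs.\<close>

lemma roof_rel_iff:
 "(r, r') \<in> roof_rel (gr S) (tors S) X Y \<longleftrightarrow>
   r \<in> roofs (gr S) (tors S) X Y \<and> r' \<in> roofs (gr S) (tors S) X Y \<and> eveq X (act r) (act r')"
proof -
 obtain s f t g where r: "r = (s, f)" "r' = (t, g)" by (metis surj_pair)
 show ?thesis
 proof (cases "r \<in> roofs (gr S) (tors S) X Y \<and> r' \<in> roofs (gr S) (tors S) X Y")
  case False then show ?thesis by (auto simp: roof_rel_def)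
 next
  case True
  then obtain W V where s: "s \<in> iso_mod (gr S) (tors S)" "s \<in> Hom S W X" "f \<in> Hom S W Y"
   and t: "t \<in> iso_mod (gr S) (tors S)" "t \<in> Hom S V X" "g \<in> Hom S V Y"
   unfolding r roofs_gr by (elim conjE exE)
  note s' = hom_gr_props[OF s(2)] and t' = hom_gr_props[OF t(2)]
  note X = s'(2) and W = s'(1) and V = t'(1)
  have rel: "(r, r') \<in> roof_rel (gr S) (tors S) X Y \<longleftrightarrow>
   (\<exists>U u v. u \<in> Hom S U W \<and> v \<in> Hom S U V \<and> s \<star>[gr S] u \<in> iso_mod (gr S) (tors S) \<and>
    s \<star>[gr S] u = t \<star>[gr S] v \<and> f \<star>[gr S] u = g \<star>[gr S] v)" (is "_ \<longleftrightarrow> ?R")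
  proof
   assume "(r, r') \<in> roof_rel (gr S) (tors S) X Y"
   then obtain u v where uv: "u \<in> Arr (gr S)" "v \<in> Arr (gr S)" "Dom (gr S) u = Dom (gr S) v"
    "Cod (gr S) u = Dom (gr S) s" "Cod (gr S) v = Dom (gr S) t"
    "s \<star>[gr S] u \<in> iso_mod (gr S) (tors S)" "s \<star>[gr S] u = t \<star>[gr S] v" "f \<star>[gr S] u = g \<star>[gr S] v"
    unfolding r roof_rel_def
    by (simp del: gr_simps) (elim conjE bexE, rule that, simp_all del: gr_simps)
   then show ?R
    using hom_setD(2)[OF s(2)] hom_setD(2)[OF t(2)]
    by (intro exI[of _ "Dom (gr S) u"] exI[of _ u] exI[of _ v]) (simp add: hom_set_def)
  next
   assume ?R
   then obtain U u v where uv: "u \<in> Hom S U W" "v \<in> Hom S U V"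
    "s \<star>[gr S] u \<in> iso_mod (gr S) (tors S)" "s \<star>[gr S] u = t \<star>[gr S] v" "f \<star>[gr S] u = g \<star>[gr S] v"
    by (elim exE conjE)
   have "\<exists>u\<in>Arr (gr S). \<exists>v\<in>Arr (gr S). Dom (gr S) u = Dom (gr S) v \<and> Cod (gr S) u = Dom (gr S) s \<and> Cod (gr S) v = Dom (gr S) t \<and>
    s \<star>[gr S] u \<in> iso_mod (gr S) (tors S) \<and> s \<star>[gr S] u = t \<star>[gr S] v \<and> f \<star>[gr S] u = g \<star>[gr S] v"
    by (rule bexI[OF _ hom_setD(1)[OF uv(1)]], rule bexI[OF _ hom_setD(1)[OF uv(2)]])
     (simp only: hom_setD(2)[OF uv(1)] hom_setD(3)[OF uv(1)] hom_setD(2)[OF uv(2)] hom_setD(3)[OF uv(2)]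
      hom_setD(2)[OF s(2)] hom_setD(2)[OF t(2)] uv(3) uv(4)[symmetric] uv(5) simp_thms)
   then show "(r, r') \<in> roof_rel (gr S) (tors S) X Y"
    using True unfolding r roof_rel_def by simp
  qed
  have "?R \<longleftrightarrow> eveq X (act r) (act r')"
  proof
   assume ?R
   then obtain U u v where u: "u \<in> Hom S U W" and v: "v \<in> Hom S U V"
    and su: "s \<star>[gr S] u \<in> iso_mod (gr S) (tors S)" and sutv: "s \<star>[gr S] u = t \<star>[gr S] v"
    and fugv: "f \<star>[gr S] u = g \<star>[gr S] v" by (elim exE conjE)
   interpret U: graded_right_module S U by (rule hom_gr_props(3)[OF u])
   show "eveq X (act r) (act r')" unfolding eveq_def
    using roof_bij[OF su hom_gr_comp(1)[OF u s(2)]] roof_bij[OF s(1,2)] roof_bij[OF t(1,2)]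
   proof eventually_elim
    case (elim d)
    show ?case
    proof
     fix x assume "x \<in> mcomp X d"
     then obtain z where z: "z \<in> mcomp U d" "x = fn (s \<star>[gr S] u) z" by (rule bij_betwE'[OF elim(1)])
     have zc: "z \<in> carrier U" by (rule U.mcomp_closed[OF z(1)])
     have xs: "x = fn s (fn u z)" using z(2) hom_gr_comp(2)[OF u s(2) zc] by simp
     have xt: "x = fn t (fn v z)" using z(2) sutv hom_gr_comp(2)[OF v t(2) zc] by simp
     have "act r d x = fn f (fn u z)"
      unfolding r xs by (rule act_eq[OF s(2) elim(2) hom_gr_props(9)[OF u z(1)]])
     also have "\<dots> = fn g (fn v z)"
      using hom_gr_comp(2)[OF u s(3) zc] hom_gr_comp(2)[OF v t(3) zc] fugv by simp
     also have "\<dots> = act r' d x"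
      unfolding r xt by (rule act_eq[symmetric, OF t(2) elim(3) hom_gr_props(9)[OF v z(1)]])
     finally show "act r d x = act r' d x" .
    qed
   qed
  next
   assume e: "eveq X (act r) (act r')"
   let ?si = "act (s, Ident (gr S) W)" and ?ti = "act (t, Ident (gr S) V)"
   have "\<forall>\<^sub>F d in at_top. (\<forall>x\<in>mcomp X d. act r d x = act r' d x) \<and>
     bij_betw (fn s) (mcomp W d) (mcomp X d) \<and> bij_betw (fn t) (mcomp V d) (mcomp X d) \<and>
     (\<forall>x\<in>mcomp X d. ?si d x \<in> mcomp W d \<and> fn s (?si d x) = x) \<and>
     (\<forall>x\<in>mcomp X d. ?ti d x \<in> mcomp V d \<and> fn t (?ti d x) = x)"
    using e[unfolded eveq_def] roof_bij[OF s(1,2)] roof_bij[OF t(1,2)] inverse_roof(2)[OF s(1,2)] inverse_roof(2)[OF t(1,2)]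
    by eventually_elim (intro conjI; (elim conjE)?; assumption)
   \<comment> \<open>One n is large enough for the conditions in all degrees from n on and for both
     extensions to the tail.\<close>
   from eventually_happens'[OF trivial_limit_at_top_linorder eventually_conj[OF eventually_all_ge_at_top[OF this]
     eventually_conj[OF evhom_extend[OF X W inverse_roof(1)[OF s(1,2)]]
     evhom_extend[OF X V inverse_roof(1)[OF t(1,2)]]]]]
   obtain n u v where N: "\<forall>d\<ge>n. (\<forall>x\<in>mcomp X d. act r d x = act r' d x) \<and>
     bij_betw (fn s) (mcomp W d) (mcomp X d) \<and> bij_betw (fn t) (mcomp V d) (mcomp X d) \<and>
     (\<forall>x\<in>mcomp X d. ?si d x \<in> mcomp W d \<and> fn s (?si d x) = x) \<and>
     (\<forall>x\<in>mcomp X d. ?ti d x \<in> mcomp V d \<and> fn t (?ti d x) = x)"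
    and u: "u \<in> Hom S (trunc X n) W" and u0: "\<forall>d\<ge>n. \<forall>x\<in>mcomp X d. fn u x = ?si d x"
    and v: "v \<in> Hom S (trunc X n) V" and v0: "\<forall>d\<ge>n. \<forall>x\<in>mcomp X d. fn v x = ?ti d x"
    by (elim exE conjE bexE) (rule that)
   have n: "x \<in> mcomp X d \<Longrightarrow> act r d x = act r' d x" "bij_betw (fn s) (mcomp W d) (mcomp X d)"
     "bij_betw (fn t) (mcomp V d) (mcomp X d)"
     "x \<in> mcomp X d \<Longrightarrow> ?si d x \<in> mcomp W d \<and> fn s (?si d x) = x"
     "x \<in> mcomp X d \<Longrightarrow> ?ti d x \<in> mcomp V d \<and> fn t (?ti d x) = x"
     "x \<in> mcomp X d \<Longrightarrow> fn u x = ?si d x" "x \<in> mcomp X d \<Longrightarrow> fn v x = ?ti d x"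
    if d: "n \<le> d" for d x
   proof -
    note A = mp[OF spec[OF N] d]
    note A2 = conjunct2[OF A] note A3 = conjunct2[OF A2] note A4 = conjunct2[OF A3]
    show "x \<in> mcomp X d \<Longrightarrow> act r d x = act r' d x" by (rule bspec[OF conjunct1[OF A]])
    show "bij_betw (fn s) (mcomp W d) (mcomp X d)" by (rule conjunct1[OF A2])
    show "bij_betw (fn t) (mcomp V d) (mcomp X d)" by (rule conjunct1[OF A3])
    show "x \<in> mcomp X d \<Longrightarrow> ?si d x \<in> mcomp W d \<and> fn s (?si d x) = x"
     by (rule bspec[OF conjunct1[OF A4]])
    show "x \<in> mcomp X d \<Longrightarrow> ?ti d x \<in> mcomp V d \<and> fn t (?ti d x) = x"
     by (rule bspec[OF conjunct2[OF A4]])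
    show "x \<in> mcomp X d \<Longrightarrow> fn u x = ?si d x" by (rule bspec[OF mp[OF spec[OF u0] d]])
    show "x \<in> mcomp X d \<Longrightarrow> fn v x = ?ti d x" by (rule bspec[OF mp[OF spec[OF v0] d]])
   qed
   interpret T: graded_right_module S "trunc X n" using trunc_Obj[OF X] by (simp add: Obj_gr)
   have T: "x \<in> carrier (trunc X n)" if "n \<le> d" "x \<in> mcomp X d" for d x
    by (rule T.mcomp_closed[of _ d]) (use that in \<open>simp add: trunc_mcomp[OF X]\<close>)
   have su: "fn (s \<star>[gr S] u) x = x" if "n \<le> d" "x \<in> mcomp X d" for d x
    using hom_gr_comp(2)[OF u s(2) T[OF that]] n(6)[OF that] n(4)[OF that] by simp
   have tv: "fn (t \<star>[gr S] v) x = x" if "n \<le> d" "x \<in> mcomp X d" for d x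
    using hom_gr_comp(2)[OF v t(2) T[OF that]] n(7)[OF that] n(5)[OF that] by simp
   have 1: "s \<star>[gr S] u \<in> iso_mod (gr S) (tors S)"
    by (rule inclusion_iso_mod[OF X hom_gr_comp(1)[OF u s(2)] su])
   have 2: "s \<star>[gr S] u = t \<star>[gr S] v"
    by (rule trunc_eqI[OF X hom_gr_comp(1)[OF u s(2)] hom_gr_comp(1)[OF v t(2)]]) (simp add: su tv)
   have 3: "f \<star>[gr S] u = g \<star>[gr S] v"
   proof (rule trunc_eqI[OF X hom_gr_comp(1)[OF u s(3)] hom_gr_comp(1)[OF v t(3)]])
    fix d x assume dx: "n \<le> d" "x \<in> mcomp X d"
    have "act r d x = fn f (fn u x)"
     using act_eq[OF s(2) n(2)[OF dx(1)], of "?si d x" f] n(4)[OF dx] n(6)[OF dx] r by simp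
    moreover have "act r' d x = fn g (fn v x)"
     using act_eq[OF t(2) n(3)[OF dx(1)], of "?ti d x" g] n(5)[OF dx] n(7)[OF dx] r by simp
    ultimately show "fn (f \<star>[gr S] u) x = fn (g \<star>[gr S] v) x"
     using hom_gr_comp(2)[OF u s(3) T[OF dx]] hom_gr_comp(2)[OF v t(3) T[OF dx]] n(1)[OF dx] by simp
   qed
   show ?R using u v 1 2 3 by blast
  qed
  then show ?thesis using rel True by blast
 qed
qed

end

text \<open>The germ of an arrow, read off from a chosen representative; by
  \<open>roof_rel_iff\<close> another choice changes it only up to \<open>eveq\<close>.\<close>

definition qact :: "'s gmod \<times> ('s gmod_arr \<times> 's gmod_arr) set \<times> 's gmod \<Rightarrow> int \<Rightarrow> 's list set \<Rightarrow> 's list set" where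
 "qact \<alpha> = act (SOME r. r \<in> fst (snd \<alpha>))"

lemma qgr_simps: "Obj (qgr S) = Obj (gr S)" "Dom (qgr S) (X, p, Y) = X" "Cod (qgr S) (X, p, Y) = Y"
 "Ident (qgr S) X = (X, roof_rel (gr S) (tors S) X X `` {(Ident (gr S) X, Ident (gr S) X)}, X)"
 "(Y', q, Z) \<star>[qgr S] (X, p, Y) = (X, comp_roofs (gr S) (tors S) X Z q p, Z)"
 by (simp_all add: qgr_def quotient_cat_def)

lemma hom_qgr:
 "\<alpha> \<in> QHom S X Y \<longleftrightarrow> X \<in> Obj (gr S) \<and> Y \<in> Obj (gr S) \<and>
   (\<exists>p. p \<in> roofs (gr S) (tors S) X Y // roof_rel (gr S) (tors S) X Y \<and> \<alpha> = (X, p, Y))"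
 unfolding hom_set_def qgr_def quotient_cat_def by auto

lemma hom_qgr_Obj:
 assumes "\<alpha> \<in> QHom S X Y"
 shows "X \<in> Obj (gr S)" "Y \<in> Obj (gr S)" "graded_right_module S X" "graded_right_module S Y"
 using assms by (simp_all add: hom_qgr Obj_gr)

lemma Arr_qgr: "\<alpha> \<in> Arr (qgr S) \<Longrightarrow> Dom (qgr S) \<alpha> = X \<Longrightarrow> Cod (qgr S) \<alpha> = Y \<Longrightarrow> \<alpha> \<in> QHom S X Y"
 by (simp add: hom_set_def)

context std_algebra
begin

lemma roof_class_eq:
 assumes "r \<in> roofs (gr S) (tors S) X Y" "r' \<in> roofs (gr S) (tors S) X Y"
 shows "roof_rel (gr S) (tors S) X Y `` {r} = roof_rel (gr S) (tors S) X Y `` {r'} \<longleftrightarrow> eveq X (act r) (act r')"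
proof
 assume "roof_rel (gr S) (tors S) X Y `` {r} = roof_rel (gr S) (tors S) X Y `` {r'}"
 moreover have "r' \<in> roof_rel (gr S) (tors S) X Y `` {r'}"
  using assms eveq_refl by (simp add: roof_rel_iff)
 ultimately have "(r, r') \<in> roof_rel (gr S) (tors S) X Y" by blast
 then show "eveq X (act r) (act r')" by (simp add: roof_rel_iff)
next
 assume e: "eveq X (act r) (act r')"
 have "eveq X (act r) (act q) \<longleftrightarrow> eveq X (act r') (act q)" for q
  using e eveq_trans eveq_sym by blast
 then show "roof_rel (gr S) (tors S) X Y `` {r} = roof_rel (gr S) (tors S) X Y `` {r'}"
  using assms by (auto simp: roof_rel_iff)
qed

lemma roof_in_class:
 "r' \<in> roof_rel (gr S) (tors S) X Y `` {r} \<Longrightarrow> r' \<in> roofs (gr S) (tors S) X Y \<and> eveq X (act r) (act r')"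
 by (simp add: roof_rel_iff)

lemma qact_class:
 assumes "r \<in> roofs (gr S) (tors S) X Y"
 shows "eveq X (qact (X, roof_rel (gr S) (tors S) X Y `` {r}, Y)) (act r)"
proof -
 let ?p = "roof_rel (gr S) (tors S) X Y `` {r}"
 have "r \<in> ?p" using assms eveq_refl by (simp add: roof_rel_iff)
 then have "(SOME r. r \<in> ?p) \<in> ?p" by (rule someI)
 then show ?thesis unfolding qact_def using roof_in_class eveq_sym by (metis fst_conv snd_conv)
qed

lemma hom_qgrI:
 assumes "X \<in> Obj (gr S)" "Y \<in> Obj (gr S)" "r \<in> roofs (gr S) (tors S) X Y"
 shows "(X, roof_rel (gr S) (tors S) X Y `` {r}, Y) \<in> QHom S X Y"
 unfolding hom_qgr using assms by (blast intro: quotientI)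

lemma hom_qgrE:
 assumes "\<alpha> \<in> QHom S X Y"
 obtains r where "r \<in> roofs (gr S) (tors S) X Y" "\<alpha> = (X, roof_rel (gr S) (tors S) X Y `` {r}, Y)"
  "eveq X (qact \<alpha>) (act r)"
proof -
 from assms obtain p where p: "p \<in> roofs (gr S) (tors S) X Y // roof_rel (gr S) (tors S) X Y" "\<alpha> = (X, p, Y)"
  unfolding hom_qgr by (elim conjE exE)
 from p(1) obtain r where "r \<in> roofs (gr S) (tors S) X Y" "p = roof_rel (gr S) (tors S) X Y `` {r}"
  by (rule quotientE)
 then show thesis using that p(2) qact_class by metis
qed

lemma qact_evhom:
 assumes "\<alpha> \<in> QHom S X Y" shows "evhom S X Y (qact \<alpha>)"
proof -
 obtain r where r: "r \<in> roofs (gr S) (tors S) X Y" "eveq X (qact \<alpha>) (act r)"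
  by (rule hom_qgrE[OF assms])
 obtain s f where sf: "r = (s, f)" by (metis surj_pair)
 from r(1) have "evhom S X Y (act r)" unfolding sf roofs_gr using roof_evhom by (elim exE conjE)
 then show ?thesis by (rule evhom_cong[OF eveq_sym[OF r(2)] _ hom_qgr_Obj(3)[OF assms]])
qed

text \<open>Together with \<open>qgr_full\<close> this says that arrows of the quotient category are
  germs modulo \<open>eveq\<close>: roofs with the same germ are equivalent, and every germ has a
  roof.\<close>

lemma qgr_eqI:
 assumes "\<alpha> \<in> QHom S X Y" "\<beta> \<in> QHom S X Y" "eveq X (qact \<alpha>) (qact \<beta>)"
 shows "\<alpha> = \<beta>"
proof -
 obtain r where r: "r \<in> roofs (gr S) (tors S) X Y" "\<alpha> = (X, roof_rel (gr S) (tors S) X Y `` {r}, Y)"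
  "eveq X (qact \<alpha>) (act r)" by (rule hom_qgrE[OF assms(1)])
 obtain q where q: "q \<in> roofs (gr S) (tors S) X Y" "\<beta> = (X, roof_rel (gr S) (tors S) X Y `` {q}, Y)"
  "eveq X (qact \<beta>) (act q)" by (rule hom_qgrE[OF assms(2)])
 have "eveq X (act r) (act q)"
  by (rule eveq_trans[OF eveq_trans[OF eveq_sym[OF r(3)] assms(3)] q(3)])
 then show ?thesis using roof_class_eq[OF r(1) q(1)] r(2) q(2) by simp
qed

lemma qgr_full:
 assumes "X \<in> Obj (gr S)" "Y \<in> Obj (gr S)" "evhom S X Y \<phi>"
 obtains \<alpha> where "\<alpha> \<in> QHom S X Y" "eveq X (qact \<alpha>) \<phi>"
proof -
 obtain r where r: "r \<in> roofs (gr S) (tors S) X Y" "eveq X (act r) \<phi>"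
  using evhom_roof[OF assms] by (elim bexE)
 show thesis by (rule that[OF hom_qgrI[OF assms(1,2) r(1)] eveq_trans[OF qact_class[OF r(1)] r(2)]])
qed

lemma qgr_ident:
 assumes X: "X \<in> Obj (gr S)"
 shows "Ident (qgr S) X \<in> QHom S X X" "eveq X (qact (Ident (qgr S) X)) (\<lambda>d x. x)"
proof -
 interpret X: graded_right_module S X using X by (simp add: Obj_gr)
 let ?i = "Ident (gr S) X"
 note i = hom_gr_id[OF X]
 have iso: "?i \<in> iso_mod (gr S) (tors S)"
 proof (rule iso_modI[OF i(1)])
  show "mcomp X d \<subseteq> fn ?i ` carrier X" for d
  proof
   fix x assume "x \<in> mcomp X d"
   then have "x \<in> carrier X" by (rule X.mcomp_closed)
   then show "x \<in> fn ?i ` carrier X" using i(2) by (metis image_eqI)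
  qed
 qed (simp only: i(2))
 have r: "(?i, ?i) \<in> roofs (gr S) (tors S) X X" unfolding roofs_gr using iso i(1) by blast
 show "Ident (qgr S) X \<in> QHom S X X" unfolding qgr_simps(4) by (rule hom_qgrI[OF X X r])
 have "eveq X (act (?i, ?i)) (\<lambda>d x. x)" unfolding eveq_def
  using inverse_roof(2)[OF iso i(1)]
 proof eventually_elim
  case (elim d)
  show ?case
  proof
   fix x assume x: "x \<in> mcomp X d"
   then have "act (?i, ?i) d (fn ?i x) = x" using elim by blast
   then show "act (?i, ?i) d x = x" using i(2)[OF X.mcomp_closed[OF x]] by (simp del: gr_simps)
  qed
 qed
 then show "eveq X (qact (Ident (qgr S) X)) (\<lambda>d x. x)" unfolding qgr_simps(4)
  by (rule eveq_trans[OF qact_class[OF r]])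
qed

text \<open>An element z of V is followed around the square: x = s u z goes to f u z = t v z and
  then to g v z.\<close>

lemma act_comp:
 assumes s: "s \<in> iso_mod (gr S) (tors S)" "s \<in> Hom S W X" "f \<in> Hom S W Y"
  and t: "t \<in> iso_mod (gr S) (tors S)" "t \<in> Hom S W' Y" "g \<in> Hom S W' Z"
  and u: "u \<in> iso_mod (gr S) (tors S)" "u \<in> Hom S V W" and v: "v \<in> Hom S V W'"
  and fu: "f \<star>[gr S] u = t \<star>[gr S] v"
 shows "eveq X (act (s \<star>[gr S] u, g \<star>[gr S] v)) (\<lambda>d x. act (t, g) d (act (s, f) d x))"
 unfolding eveq_def using roof_bij[OF s(1,2)] roof_bij[OF t(1,2)] roof_bij[OF u]
proof eventually_elim
 case (elim d)
 interpret V: graded_right_module S V by (rule hom_gr_props(3)[OF v])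
 note su = hom_gr_comp(2)[OF u(2) s(2) V.mcomp_closed] and gv = hom_gr_comp(2)[OF v t(3) V.mcomp_closed]
 have "bij_betw (fn s \<circ> fn u) (mcomp V d) (mcomp X d)" by (rule bij_betw_trans[OF elim(3) elim(1)])
 then have bsu: "bij_betw (fn (s \<star>[gr S] u)) (mcomp V d) (mcomp X d)"
  by (rule bij_betw_cong[THEN iffD1, rotated]) (simp add: su)
 show ?case
 proof
  fix x assume "x \<in> mcomp X d"
  then obtain z where z: "z \<in> mcomp V d" "x = fn (s \<star>[gr S] u) z" by (rule bij_betwE'[OF bsu])
  have x: "x = fn s (fn u z)" using z su[OF z(1)] by simp
  have ft: "fn f (fn u z) = fn t (fn v z)"
   using hom_gr_comp(2)[OF u(2) s(3) V.mcomp_closed[OF z(1)]]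
    hom_gr_comp(2)[OF v t(2) V.mcomp_closed[OF z(1)]] fu by simp
  have "act (s \<star>[gr S] u, g \<star>[gr S] v) d x = fn g (fn v z)"
   unfolding z(2) act_eq[OF hom_gr_comp(1)[OF u(2) s(2)] bsu z(1)] by (rule gv[OF z(1)])
  also have "\<dots> = act (t, g) d (fn t (fn v z))"
   by (rule act_eq[symmetric, OF t(2) elim(2) hom_gr_props(9)[OF v z(1)]])
  also have "\<dots> = act (t, g) d (act (s, f) d x)"
   unfolding x act_eq[OF s(2) elim(1) hom_gr_props(9)[OF u(2) z(1)]] ft ..
  finally show "act (s \<star>[gr S] u, g \<star>[gr S] v) d x = act (t, g) d (act (s, f) d x)" .
 qed
qed

text \<open>The Ore condition, solved on a tail of X: u is the inverse of s and v is t^(-1) f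
  s^(-1), both extended to the tail.\<close>

lemma roofs_composable:
 assumes s: "s \<in> iso_mod (gr S) (tors S)" "s \<in> Hom S W X" "f \<in> Hom S W Y"
  and t: "t \<in> iso_mod (gr S) (tors S)" "t \<in> Hom S W' Y"
 shows "\<exists>V u v. u \<in> iso_mod (gr S) (tors S) \<and> u \<in> Hom S V W \<and> v \<in> Hom S V W' \<and>
   f \<star>[gr S] u = t \<star>[gr S] v \<and> s \<star>[gr S] u \<in> iso_mod (gr S) (tors S)"
proof -
 let ?si = "act (s, Ident (gr S) W)" and ?ti = "act (t, Ident (gr S) W')"
 note s' = hom_gr_props[OF s(2)] and t' = hom_gr_props[OF t(2)] and f' = hom_gr_props[OF s(3)]
 note X = s'(2)
 interpret X: graded_right_module S X by (rule s'(4))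
 interpret W: graded_right_module S W by (rule s'(3))
 let ?v = "\<lambda>d x. ?ti d (act (s, f) d x)"
 have ev: "evhom S X W' ?v" by (rule evhom_comp[OF roof_evhom[OF s] inverse_roof(1)[OF t]])
 have "\<forall>\<^sub>F d in at_top. (\<forall>x\<in>mcomp X d. fn s (?si d x) = x) \<and> (\<forall>w\<in>mcomp W d. ?si d (fn s w) = w) \<and>
   (\<forall>x\<in>mcomp X d. fn f (?si d x) = fn t (?v d x))"
  using inverse_roof(2)[OF s(1,2)] inverse_roof(2)[OF t] roof_evhom[OF s, unfolded evhom_def] roof_bij[OF s(1,2)]
 proof eventually_elim
  case (elim d)
  have "fn f (?si d x) = fn t (?v d x)" if x: "x \<in> mcomp X d" for x
  proof -
   obtain w where w: "w \<in> mcomp W d" "x = fn s w" by (rule bij_betwE'[OF elim(4) x])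
   have "act (s, f) d x \<in> mcomp Y d" using elim(3) x by blast
   then have "fn t (?v d x) = act (s, f) d x" using elim(2) by blast
   also have "\<dots> = fn f w" unfolding w(2) by (rule act_eq[OF s(2) elim(4) w(1)])
   also have "w = ?si d x" using elim(1) w by simp
   finally show ?thesis by simp
  qed
  then show ?case using elim(1) by simp
 qed
 from eventually_happens'[OF trivial_limit_at_top_linorder eventually_conj[OF eventually_all_ge_at_top[OF this]
   eventually_conj[OF evhom_extend[OF X s'(1) inverse_roof(1)[OF s(1,2)]] evhom_extend[OF X t'(1) ev]]]]
 obtain n u v where N: "\<forall>d\<ge>n. (\<forall>x\<in>mcomp X d. fn s (?si d x) = x) \<and> (\<forall>w\<in>mcomp W d. ?si d (fn s w) = w) \<and>
   (\<forall>x\<in>mcomp X d. fn f (?si d x) = fn t (?v d x))"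
  and u: "u \<in> Hom S (trunc X n) W" and u0: "\<forall>d\<ge>n. \<forall>x\<in>mcomp X d. fn u x = ?si d x"
  and v: "v \<in> Hom S (trunc X n) W'" and v0: "\<forall>d\<ge>n. \<forall>x\<in>mcomp X d. fn v x = ?v d x"
  by (elim exE conjE bexE) (rule that)
 interpret T: graded_right_module S "trunc X n" using trunc_Obj[OF X] by (simp add: Obj_gr)
 have T: "x \<in> carrier (trunc X n)" if "n \<le> d" "x \<in> mcomp X d" for d x
  by (rule T.mcomp_closed[of _ d]) (use that in \<open>simp add: trunc_mcomp[OF X]\<close>)
 have su: "fn (s \<star>[gr S] u) x = x" if "n \<le> d" "x \<in> mcomp X d" for d x
  using hom_gr_comp(2)[OF u s(2) T[OF that]] u0 N that by simp
 have iso: "s \<star>[gr S] u \<in> iso_mod (gr S) (tors S)"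
  by (rule inclusion_iso_mod[OF X hom_gr_comp(1)[OF u s(2)] su])
 have eq: "f \<star>[gr S] u = t \<star>[gr S] v"
 proof (rule trunc_eqI[OF X hom_gr_comp(1)[OF u s(3)] hom_gr_comp(1)[OF v t(2)]])
  fix d x assume dx: "n \<le> d" "x \<in> mcomp X d"
  show "fn (f \<star>[gr S] u) x = fn (t \<star>[gr S] v) x"
   using hom_gr_comp(2)[OF u s(3) T[OF dx]] hom_gr_comp(2)[OF v t(2) T[OF dx]] u0 v0 N dx by simp
 qed
 have isou: "u \<in> iso_mod (gr S) (tors S)"
 proof (rule iso_modI[OF u])
  obtain i where i: "i \<in> Hom S (trunc X n) X" "\<forall>x\<in>carrier (trunc X n). fn i x = x"
   using trunc_inclusion[OF X, of n] by (elim bexE)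
  have ie: "s \<star>[gr S] u = i"
   by (rule trunc_eqI[OF X hom_gr_comp(1)[OF u s(2)] i(1)]) (simp add: su i(2)[rule_format, OF T])
  show "w = \<zero>[trunc X n]" if w: "w \<in> carrier (trunc X n)" and z: "fn u w = \<zero>[W]" for w
  proof -
   have "w = fn i w" using i(2) w by simp
   also have "\<dots> = fn s (fn u w)" using hom_gr_comp(2)[OF u s(2) w] ie by simp
   also have "\<dots> = \<zero>[X]" using z s'(11) by simp
   finally show ?thesis by simp
  qed
  show "mcomp W d \<subseteq> fn u ` carrier (trunc X n)" if d: "n \<le> d" for d
  proof
   fix w assume w: "w \<in> mcomp W d"
   have "fn s w \<in> mcomp X d" by (rule s'(9)[OF w])
   moreover from this have "fn u (fn s w) = w" using u0 N d w by simp
   ultimately show "w \<in> fn u ` carrier (trunc X n)" using T[OF d] by (metis image_eqI)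
  qed
 qed
 show ?thesis using isou u v eq iso by (intro exI conjI)
qed

text \<open>The definition of composition collects the roofs from all ways to complete the square.
  By \<open>act_comp\<close> they all have the same germ, so they form a single class, and
  \<open>roofs_composable\<close> provides one of them.\<close>

lemma qgr_comp:
 assumes \<alpha>: "\<alpha> \<in> QHom S X Y" and \<beta>: "\<beta> \<in> QHom S Y Z"
 shows "\<beta> \<star>[qgr S] \<alpha> \<in> QHom S X Z"
  and "eveq X (qact (\<beta> \<star>[qgr S] \<alpha>)) (\<lambda>d x. qact \<beta> d (qact \<alpha> d x))"
proof -
 let ?I = "iso_mod (gr S) (tors S)"
 obtain r where r: "r \<in> roofs (gr S) (tors S) X Y" "\<alpha> = (X, roof_rel (gr S) (tors S) X Y `` {r}, Y)"
  "eveq X (qact \<alpha>) (act r)" by (rule hom_qgrE[OF \<alpha>])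
 obtain q where q: "q \<in> roofs (gr S) (tors S) Y Z" "\<beta> = (Y, roof_rel (gr S) (tors S) Y Z `` {q}, Z)"
  "eveq Y (qact \<beta>) (act q)" by (rule hom_qgrE[OF \<beta>])
 obtain s f t g where rq: "r = (s, f)" "q = (t, g)" by (metis surj_pair)
 from r(1) obtain W where s: "s \<in> ?I" "s \<in> Hom S W X" "f \<in> Hom S W Y"
  unfolding rq roofs_gr by (elim exE conjE)
 from q(1) obtain W' where t: "t \<in> ?I" "t \<in> Hom S W' Y" "g \<in> Hom S W' Z"
  unfolding rq roofs_gr by (elim exE conjE)
 obtain V u v where u: "u \<in> ?I" "u \<in> Hom S V W" and v: "v \<in> Hom S V W'"
  and fu: "f \<star>[gr S] u = t \<star>[gr S] v" and su: "s \<star>[gr S] u \<in> ?I"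
  using roofs_composable[OF s t(1,2)] by (elim exE conjE)
 define c where "c = (s \<star>[gr S] u, g \<star>[gr S] v)"
 define C where "C = (\<lambda>d x. act q d (act r d x))"
 have evr: "evhom S X Y (act r)" unfolding rq by (rule roof_evhom[OF s])
 have c: "c \<in> roofs (gr S) (tors S) X Z" unfolding c_def roofs_gr
  using su hom_gr_comp(1)[OF u(2) s(2)] hom_gr_comp(1)[OF v t(3)] by (intro exI[of _ V] conjI)
 have cC: "eveq X (act c) C" unfolding c_def C_def rq by (rule act_comp[OF s t u v fu])
 let ?p = "roof_rel (gr S) (tors S) X Y `` {r}" and ?q = "roof_rel (gr S) (tors S) Y Z `` {q}"
 have "comp_roofs (gr S) (tors S) X Z ?q ?p = roof_rel (gr S) (tors S) X Z `` {c}"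
 proof (intro Set.set_eqI iffI)
  fix \<rho> assume "\<rho> \<in> roof_rel (gr S) (tors S) X Z `` {c}"
  then have \<rho>: "(c, \<rho>) \<in> roof_rel (gr S) (tors S) X Z" by blast
  have "(s, f) \<in> ?p" "(t, g) \<in> ?q" using r(1) q(1) eveq_refl unfolding rq by (simp_all add: roof_rel_iff)
  moreover have "v \<in> Arr (gr S)" "Dom (gr S) u = Dom (gr S) v" "Cod (gr S) u = Dom (gr S) f" "Cod (gr S) v = Dom (gr S) t"
   using hom_setD[OF v] hom_setD[OF u(2)] hom_setD[OF s(3)] hom_setD[OF t(2)] by simp_all
  ultimately show "\<rho> \<in> comp_roofs (gr S) (tors S) X Z ?q ?p" unfolding comp_roofs_def
   using u(1) fu \<rho>[unfolded c_def] by (intro CollectI exI conjI)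
 next
  fix \<rho> assume "\<rho> \<in> comp_roofs (gr S) (tors S) X Z ?q ?p"
  then obtain s1 f1 t1 g1 u1 v1 where 1: "(s1, f1) \<in> ?p" "(t1, g1) \<in> ?q" "u1 \<in> ?I" "v1 \<in> Arr (gr S)"
   "Dom (gr S) u1 = Dom (gr S) v1" "Cod (gr S) u1 = Dom (gr S) f1" "Cod (gr S) v1 = Dom (gr S) t1"
   "f1 \<star>[gr S] u1 = t1 \<star>[gr S] v1" "((s1 \<star>[gr S] u1, g1 \<star>[gr S] v1), \<rho>) \<in> roof_rel (gr S) (tors S) X Z"
   unfolding comp_roofs_def by (elim CollectE exE conjE)
  note p1 = roof_in_class[OF 1(1)] and q1 = roof_in_class[OF 1(2)]
  from p1 obtain W1 where s1: "s1 \<in> ?I" "s1 \<in> Hom S W1 X" "f1 \<in> Hom S W1 Y"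
   unfolding roofs_gr by (elim exE conjE)
  from q1 obtain W2 where t1: "t1 \<in> ?I" "t1 \<in> Hom S W2 Y" "g1 \<in> Hom S W2 Z"
   unfolding roofs_gr by (elim exE conjE)
  have u1: "u1 \<in> Hom S (Dom (gr S) v1) W1"
   by (rule Arr_gr_hom) (use 1(3,5,6) hom_setD(2)[OF s1(3)] in \<open>simp_all add: iso_mod_def\<close>)
  have v1: "v1 \<in> Hom S (Dom (gr S) v1) W2"
   by (rule Arr_gr_hom) (use 1(4,7) hom_setD(2)[OF t1(2)] in simp_all)
  have "eveq X (act (s1 \<star>[gr S] u1, g1 \<star>[gr S] v1)) (\<lambda>d x. act (t1, g1) d (act (s1, f1) d x))"
   by (rule act_comp[OF s1 t1 1(3) u1 v1 1(8)])
  moreover have "eveq X C (\<lambda>d x. act (t1, g1) d (act (s1, f1) d x))" unfolding C_def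
   by (rule eveq_comp[OF conjunct2[OF p1] conjunct2[OF q1] evr])
  ultimately have e: "eveq X (act c) (act (s1 \<star>[gr S] u1, g1 \<star>[gr S] v1))"
   by (intro eveq_trans[OF cC eveq_trans[OF _ eveq_sym]])
  note \<rho> = 1(9)[unfolded roof_rel_iff, THEN conjunct2]
  have "(c, \<rho>) \<in> roof_rel (gr S) (tors S) X Z" unfolding roof_rel_iff
   by (intro conjI c conjunct1[OF \<rho>] eveq_trans[OF e conjunct2[OF \<rho>]])
  then show "\<rho> \<in> roof_rel (gr S) (tors S) X Z `` {c}" by blast
 qed
 then have comp: "\<beta> \<star>[qgr S] \<alpha> = (X, roof_rel (gr S) (tors S) X Z `` {c}, Z)"
  unfolding r(2) q(2) qgr_simps by simp
 show "\<beta> \<star>[qgr S] \<alpha> \<in> QHom S X Z" unfolding comp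
  by (rule hom_qgrI[OF hom_qgr_Obj(1)[OF \<alpha>] hom_qgr_Obj(2)[OF \<beta>] c])
 have "eveq X C (\<lambda>d x. qact \<beta> d (qact \<alpha> d x))" unfolding C_def
  by (rule eveq_comp[OF eveq_sym[OF r(3)] eveq_sym[OF q(3)] evr])
 then show "eveq X (qact (\<beta> \<star>[qgr S] \<alpha>)) (\<lambda>d x. qact \<beta> d (qact \<alpha> d x))" unfolding comp
  by (rule eveq_trans[OF eveq_trans[OF qact_class[OF c] cC]])
qed

end

section \<open>Zero arrows, kernels, cokernels and exactness in terms of germs\<close>

context std_algebra
begin

lemma gr_hom_evhom:
 assumes f: "f \<in> Hom S X Y" shows "evhom S X Y (\<lambda>d. fn f)"
proof -
 note f' = hom_gr_props[OF f]
 interpret X: graded_right_module S X by (rule f'(3))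
 have "(\<forall>x\<in>mcomp X d. fn f x \<in> mcomp Y d) \<and>
   (\<forall>x\<in>mcomp X d. \<forall>y\<in>mcomp X d. fn f (x \<oplus>[X] y) = fn f x \<oplus>[Y] fn f y) \<and>
   (\<forall>x\<in>mcomp X d. \<forall>j\<ge>0. \<forall>s\<in>hcomp S j. fn f (x \<cdot>[X] s) = fn f x \<cdot>[Y] s)" for d
  using f'(7)[OF X.mcomp_closed X.mcomp_closed] f'(8)[OF X.mcomp_closed SG.comp_closed] f'(9)
  by (intro conjI ballI allI impI) simp_all
 then show ?thesis unfolding evhom_def by (rule always_eventually[OF allI])
qed

lemma zero_evhom:
 assumes "Y \<in> Obj (gr S)" shows "evhom S X Y (\<lambda>d x. \<zero>[Y])"
proof -
 interpret Y: graded_right_module S Y using assms by (simp add: Obj_gr)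
 show ?thesis unfolding evhom_def
  by (rule always_eventually) (simp add: Y.MG.comp_zero Y.zero_ract SG.comp_closed)
qed

lemma qgr_of_gr:
 assumes f: "f \<in> Hom S X Y"
 obtains \<alpha> where "\<alpha> \<in> QHom S X Y" "eveq X (qact \<alpha>) (\<lambda>d. fn f)"
 by (rule qgr_full[OF hom_gr_props(1)[OF f] hom_gr_props(2)[OF f] gr_hom_evhom[OF f]])

text \<open>The zero germ and the identity both represent endomorphisms of Z, of which there is only
  one.\<close>

lemma zero_object_qgr:
 assumes "zero_object (qgr S) Z"
 shows "\<forall>\<^sub>F d in at_top. \<forall>x\<in>mcomp Z d. x = \<zero>[Z]"
proof -
 have Z: "Z \<in> Obj (gr S)" using assms by (simp add: zero_object_def qgr_simps)
 obtain z where z: "z \<in> QHom S Z Z" "eveq Z (qact z) (\<lambda>d x. \<zero>[Z])"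
  by (rule qgr_full[OF Z Z zero_evhom[OF Z]])
 have "\<exists>!f. f \<in> QHom S Z Z" using assms Z by (simp add: zero_object_def qgr_simps)
 then have "z = Ident (qgr S) Z" using z(1) qgr_ident(1)[OF Z] by (elim ex1E) metis
 then have "eveq Z (\<lambda>d x. x) (\<lambda>d x. \<zero>[Z])"
  using eveq_trans[OF eveq_sym[OF qgr_ident(2)[OF Z]]] z(2) by simp
 then show ?thesis unfolding eveq_def .
qed

lemma zero_module_qgr: "zero_object (qgr S) (rideal S \<zero> 0 0)"
 unfolding zero_object_def
proof (intro conjI ballI)
 let ?Z = "rideal S \<zero> 0 0"
 note Z = zero_module(1)
 interpret Z: graded_right_module S ?Z using Z by (simp add: Obj_gr)
 have Zd: "x = \<zero>[?Z]" if "x \<in> mcomp ?Z d" for x d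
  using Z.mcomp_closed[OF that] unfolding zero_module(2) by simp
 show "?Z \<in> Obj (qgr S)" using Z by (simp add: qgr_simps)
 fix X assume "X \<in> Obj (qgr S)"
 then have X: "X \<in> Obj (gr S)" by (simp add: qgr_simps)
 then have Xg: "graded_right_module S X" by (simp add: Obj_gr)
 show "\<exists>!f. f \<in> QHom S X ?Z"
 proof -
  obtain z where z: "z \<in> QHom S X ?Z" by (rule qgr_full[OF X Z zero_evhom[OF Z]])
  have "f = z" if f: "f \<in> QHom S X ?Z" for f
  proof (rule qgr_eqI[OF f z])
   show "eveq X (qact f) (qact z)" unfolding eveq_def
    using qact_evhom[OF f, unfolded evhom_def] qact_evhom[OF z, unfolded evhom_def]
    by eventually_elim (metis Zd)
  qed
  with z show ?thesis by (intro ex1I)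
 qed
 show "\<exists>!f. f \<in> QHom S ?Z X"
 proof -
  obtain z where z: "z \<in> QHom S ?Z X" by (rule qgr_full[OF Z X zero_evhom[OF X]])
  have "f = z" if f: "f \<in> QHom S ?Z X" for f
  proof (rule qgr_eqI[OF f z])
   show "eveq ?Z (qact f) (qact z)" unfolding eveq_def
    using evhom_zero[OF qact_evhom[OF f] Z.graded_right_module_axioms Xg]
     evhom_zero[OF qact_evhom[OF z] Z.graded_right_module_axioms Xg]
    by eventually_elim (metis Zd)
  qed
  with z show ?thesis by (intro ex1I)
 qed
qed

lemma zero_through:
 assumes Z: "zero_object (qgr S) Z" and g: "g \<in> QHom S X Z" and h: "h \<in> QHom S Z Y"
 shows "eveq X (qact (h \<star>[qgr S] g)) (\<lambda>d x. \<zero>[Y])"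
proof -
 have "eveq X (\<lambda>d x. qact h d (qact g d x)) (\<lambda>d x. \<zero>[Y])" unfolding eveq_def
  using qact_evhom[OF g, unfolded evhom_def] zero_object_qgr[OF Z]
   evhom_zero[OF qact_evhom[OF h] hom_qgr_Obj(3,4)[OF h]]
 proof eventually_elim
  case (elim d)
  show ?case
  proof
   fix x assume "x \<in> mcomp X d"
   then have "qact g d x \<in> mcomp Z d" using elim(1) by blast
   then have "qact g d x = \<zero>[Z]" using elim(2) by (rule bspec[rotated])
   then show "qact h d (qact g d x) = \<zero>[Y]" using elim(3) by simp
  qed
 qed
 then show ?thesis by (rule eveq_trans[OF qgr_comp(2)[OF g h]])
qed

text \<open>A factorization through a zero object makes the germ vanish; conversely the zero germ
  factors through the zero module.\<close>

lemma zero_arrow_qgr: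
 assumes \<alpha>: "\<alpha> \<in> QHom S X Y"
 shows "zero_arrow (qgr S) \<alpha> \<longleftrightarrow> eveq X (qact \<alpha>) (\<lambda>d x. \<zero>[Y])"
proof
 assume "zero_arrow (qgr S) \<alpha>"
 then obtain Z g h where Z: "zero_object (qgr S) Z" and g: "g \<in> QHom S X Z"
  and h: "h \<in> QHom S Z Y" and e: "\<alpha> = h \<star>[qgr S] g"
  unfolding zero_arrow_def hom_setD(2)[OF \<alpha>] hom_setD(3)[OF \<alpha>] by (elim conjE exE)
 show "eveq X (qact \<alpha>) (\<lambda>d x. \<zero>[Y])" unfolding e by (rule zero_through[OF Z g h])
next
 assume e: "eveq X (qact \<alpha>) (\<lambda>d x. \<zero>[Y])"
 let ?Z = "rideal S \<zero> 0 0"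
 note Z = zero_module_qgr
 note XY = hom_qgr_Obj[OF \<alpha>]
 obtain g where g: "g \<in> QHom S X ?Z"
  by (rule qgr_full[OF XY(1) zero_module(1) zero_evhom[OF zero_module(1)]])
 obtain h where h: "h \<in> QHom S ?Z Y"
  by (rule qgr_full[OF zero_module(1) XY(2) zero_evhom[OF XY(2)]])
 have "\<alpha> = h \<star>[qgr S] g"
  by (rule qgr_eqI[OF \<alpha> qgr_comp(1)[OF g h] eveq_trans[OF e eveq_sym[OF zero_through[OF Z g h]]]])
 then show "zero_arrow (qgr S) \<alpha>"
  unfolding zero_arrow_def hom_setD(2)[OF \<alpha>] hom_setD(3)[OF \<alpha>]
  using hom_setD(1)[OF \<alpha>] Z g h by blast
qed

lemma zero_comp_qgr:
 assumes \<alpha>: "\<alpha> \<in> QHom S X Y" and \<beta>: "\<beta> \<in> QHom S Y Z"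
 shows "zero_arrow (qgr S) (\<beta> \<star>[qgr S] \<alpha>) \<longleftrightarrow>
  (\<forall>\<^sub>F d in at_top. \<forall>x\<in>mcomp X d. qact \<beta> d (qact \<alpha> d x) = \<zero>[Z])"
 unfolding zero_arrow_qgr[OF qgr_comp(1)[OF \<alpha> \<beta>]]
 using eveq_trans[OF qgr_comp(2)[OF \<alpha> \<beta>]] eveq_trans[OF eveq_sym[OF qgr_comp(2)[OF \<alpha> \<beta>]]]
 unfolding eveq_def[of X "\<lambda>d x. qact \<beta> d (qact \<alpha> d x)" "\<lambda>d x. \<zero>[Z]", symmetric] by blast

lemma evhom_minus:
 assumes \<phi>: "evhom S X Y \<phi>" and X: "graded_right_module S X" and Y: "graded_right_module S Y"
 shows "\<forall>\<^sub>F d in at_top. \<forall>x\<in>mcomp X d. \<forall>y\<in>mcomp X d. \<phi> d (x \<ominus>\<^bsub>X\<^esub> y) = \<phi> d x \<ominus>\<^bsub>Y\<^esub> \<phi> d y"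
 using \<phi>[unfolded evhom_def] evhom_zero[OF \<phi> X Y]
proof eventually_elim
 case (elim d)
 interpret X: graded_right_module S X by fact
 interpret Y: graded_right_module S Y by fact
 show ?case
 proof (intro ballI)
  fix x y assume x: "x \<in> mcomp X d" and y: "y \<in> mcomp X d"
  have m: "\<ominus>\<^bsub>X\<^esub> y \<in> mcomp X d" by (rule X.MG.comp_minus[OF y])
  have c: "\<phi> d x \<in> carrier Y" "\<phi> d y \<in> carrier Y" "\<phi> d (\<ominus>\<^bsub>X\<^esub> y) \<in> carrier Y"
   using elim(1) x y m Y.mcomp_closed by blast+
  have "\<phi> d (\<ominus>\<^bsub>X\<^esub> y) \<oplus>[Y] \<phi> d y = \<phi> d (\<ominus>\<^bsub>X\<^esub> y \<oplus>[X] y)" using elim(1) m y by metis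
  also have "\<dots> = \<zero>[Y]" using elim(2) X.mcomp_closed[OF y] by (simp add: X.M.l_neg)
  finally have "\<phi> d (\<ominus>\<^bsub>X\<^esub> y) = \<ominus>\<^bsub>Y\<^esub> \<phi> d y" using Y.M.minus_equality c by metis
  moreover have "\<phi> d (x \<oplus>[X] \<ominus>\<^bsub>X\<^esub> y) = \<phi> d x \<oplus>[Y] \<phi> d (\<ominus>\<^bsub>X\<^esub> y)" using elim(1) x m by blast
  ultimately show "\<phi> d (x \<ominus>\<^bsub>X\<^esub> y) = \<phi> d x \<ominus>\<^bsub>Y\<^esub> \<phi> d y" by (simp add: X.M.minus_eq Y.M.minus_eq)
 qed
qed

text \<open>The factorization is m^(-1) g in each large degree; injectivity of m transfers linearity
  from g to it.\<close>

lemma evhom_factor_inj: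
 assumes m: "evhom S K X m" and g: "evhom S V X g" and K: "graded_right_module S K"
  and V: "graded_right_module S V"
  and inj: "\<forall>\<^sub>F d in at_top. inj_on (m d) (mcomp K d)"
  and im: "\<forall>\<^sub>F d in at_top. \<forall>v\<in>mcomp V d. g d v \<in> m d ` mcomp K d"
 obtains \<phi> where "evhom S V K \<phi>" "eveq V (\<lambda>d v. m d (\<phi> d v)) g"
proof
 interpret K: graded_right_module S K by fact
 interpret V: graded_right_module S V by fact
 define \<phi> where "\<phi> = (\<lambda>d v. inv_into (mcomp K d) (m d) (g d v))"
 have \<phi>: "\<forall>\<^sub>F d in at_top. \<forall>v\<in>mcomp V d. \<phi> d v \<in> mcomp K d \<and> m d (\<phi> d v) = g d v"
  using im by eventually_elim (simp add: \<phi>_def inv_into_into f_inv_into_f)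
 show "eveq V (\<lambda>d v. m d (\<phi> d v)) g" unfolding eveq_def using \<phi> by eventually_elim simp
 show "evhom S V K \<phi>" unfolding evhom_def
  using eventually_shift[OF \<phi>] eventually_shift[OF inj] m[unfolded evhom_def] g[unfolded evhom_def]
 proof eventually_elim
  case (elim d)
  have \<phi>j: "\<phi> (d + j) v \<in> mcomp K (d + j)" "m (d + j) (\<phi> (d + j) v) = g (d + j) v"
   if "v \<in> mcomp V (d + j)" "0 \<le> j" for v j using elim(1) that by blast+
  have injj: "inj_on (m (d + j)) (mcomp K (d + j))" if "0 \<le> j" for j using elim(2) that by blast
  note \<phi>0 = \<phi>j[of _ 0, simplified] and inj0 = injj[of 0, simplified]
  show ?case
  proof (intro conjI ballI allI impI)
   fix x assume x: "x \<in> mcomp V d"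
   show "\<phi> d x \<in> mcomp K d" by (rule \<phi>0(1)[OF x])
   {
    fix y assume y: "y \<in> mcomp V d"
    show "\<phi> d (x \<oplus>[V] y) = \<phi> d x \<oplus>[K] \<phi> d y"
    proof (rule inj_onD[OF inj0])
     show "m d (\<phi> d (x \<oplus>[V] y)) = m d (\<phi> d x \<oplus>[K] \<phi> d y)"
      using elim(3,4) \<phi>0 x y V.MG.comp_add[OF x y] by metis
    qed (use \<phi>0 x y V.MG.comp_add[OF x y] K.MG.comp_add in auto)
   next
    fix j s assume j: "0 \<le> j" and s: "s \<in> hcomp S j"
    note xs = V.ract_mcomp[OF x s]
    show "\<phi> (d + j) (x \<cdot>[V] s) = \<phi> d x \<cdot>[K] s"
    proof (rule inj_onD[OF injj[OF j]])
     have "m (d + j) (\<phi> (d + j) (x \<cdot>[V] s)) = g (d + j) (x \<cdot>[V] s)" by (rule \<phi>j(2)[OF xs j])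
     also have "\<dots> = g d x \<cdot>[X] s" using elim(4) x j s by blast
     also have "\<dots> = m d (\<phi> d x) \<cdot>[X] s" using \<phi>0(2)[OF x] by simp
     also have "\<dots> = m (d + j) (\<phi> d x \<cdot>[K] s)" using elim(3) \<phi>0(1)[OF x] j s by metis
     finally show "m (d + j) (\<phi> (d + j) (x \<cdot>[V] s)) = m (d + j) (\<phi> d x \<cdot>[K] s)" .
     show "\<phi> (d + j) (x \<cdot>[V] s) \<in> mcomp K (d + j)" by (rule \<phi>j(1)[OF xs j])
     show "\<phi> d x \<cdot>[K] s \<in> mcomp K (d + j)" by (rule K.ract_mcomp[OF \<phi>0(1)[OF x] s])
    qed
   }
  qed
 qed
qed

text \<open>Dually, \<phi> is g evaluated on an arbitrary preimage under c; the condition on kernels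
  makes the choice irrelevant.\<close>

lemma evhom_factor_surj:
 assumes c: "evhom S X Q c" and g: "evhom S X V g" and X: "graded_right_module S X"
  and Q: "graded_right_module S Q" and V: "graded_right_module S V"
  and surj: "\<forall>\<^sub>F d in at_top. mcomp Q d \<subseteq> c d ` mcomp X d"
  and ker: "\<forall>\<^sub>F d in at_top. \<forall>x\<in>mcomp X d. c d x = \<zero>[Q] \<longrightarrow> g d x = \<zero>[V]"
 obtains \<phi> where "evhom S Q V \<phi>" "eveq X (\<lambda>d x. \<phi> d (c d x)) g"
proof
 interpret X: graded_right_module S X by fact
 interpret Q: graded_right_module S Q by fact
 interpret V: graded_right_module S V by fact
 define \<phi> where "\<phi> = (\<lambda>d q. g d (inv_into (mcomp X d) (c d) q))"
 have \<phi>: "\<forall>\<^sub>F d in at_top. \<forall>x\<in>mcomp X d. \<phi> d (c d x) = g d x"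
  using evhom_minus[OF c X Q] evhom_minus[OF g X V] c[unfolded evhom_def] g[unfolded evhom_def] ker
 proof eventually_elim
  case (elim d)
  show ?case
  proof
   fix x assume x: "x \<in> mcomp X d"
   define y where "y = inv_into (mcomp X d) (c d) (c d x)"
   have y: "y \<in> mcomp X d" "c d y = c d x"
    unfolding y_def using x by (simp_all add: inv_into_into f_inv_into_f)
   have yx: "y \<ominus>\<^bsub>X\<^esub> x \<in> mcomp X d"
    unfolding X.M.minus_eq by (intro X.MG.comp_add X.MG.comp_minus y x)
   have cl: "c d x \<in> carrier Q" "g d x \<in> carrier V" "g d y \<in> carrier V"
    using elim(3,4) x y(1) Q.mcomp_closed V.mcomp_closed by blast+
   have "c d (y \<ominus>\<^bsub>X\<^esub> x) = \<zero>[Q]" using elim(1) x y cl by (simp add: Q.minus_eq_zero)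
   then have "g d (y \<ominus>\<^bsub>X\<^esub> x) = \<zero>[V]" using elim(5) yx by blast
   then have "g d y \<ominus>\<^bsub>V\<^esub> g d x = \<zero>[V]" using elim(2) x y(1) by simp
   then show "\<phi> d (c d x) = g d x" unfolding \<phi>_def y_def[symmetric]
    using cl by (simp add: V.minus_eq_zero)
  qed
 qed
 show "eveq X (\<lambda>d x. \<phi> d (c d x)) g" unfolding eveq_def using \<phi> .
 show "evhom S Q V \<phi>" unfolding evhom_def
  using eventually_shift[OF \<phi>] surj c[unfolded evhom_def] g[unfolded evhom_def]
 proof eventually_elim
  case (elim d)
  have \<phi>j: "\<phi> (d + j) (c (d + j) x) = g (d + j) x" if "x \<in> mcomp X (d + j)" "0 \<le> j" for x j
   using elim(1) that by blast
  note \<phi>0 = \<phi>j[of _ 0, simplified]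
  show ?case
  proof (intro conjI ballI allI impI)
   fix x assume x: "x \<in> mcomp Q d"
   from subsetD[OF elim(2) x] obtain a where a: "a \<in> mcomp X d" "x = c d a" by (elim imageE)
   show "\<phi> d x \<in> mcomp V d" unfolding a(2) \<phi>0[OF a(1)] using elim(4) a(1) by blast
   {
    fix y assume y: "y \<in> mcomp Q d"
    from subsetD[OF elim(2) y] obtain b where b: "b \<in> mcomp X d" "y = c d b" by (elim imageE)
    have "x \<oplus>[Q] y = c d (a \<oplus>[X] b)" unfolding a(2) b(2) using elim(3) a(1) b(1) by metis
    then have "\<phi> d (x \<oplus>[Q] y) = g d (a \<oplus>[X] b)" using \<phi>0[OF X.MG.comp_add[OF a(1) b(1)]] by simp
    also have "\<dots> = g d a \<oplus>[V] g d b" using elim(4) a(1) b(1) by blast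
    finally show "\<phi> d (x \<oplus>[Q] y) = \<phi> d x \<oplus>[V] \<phi> d y" unfolding a(2) b(2) \<phi>0[OF a(1)] \<phi>0[OF b(1)] .
   next
    fix j s assume j: "0 \<le> j" and s: "s \<in> hcomp S j"
    have "x \<cdot>[Q] s = c (d + j) (a \<cdot>[X] s)" unfolding a(2) using elim(3) a(1) j s by metis
    then have "\<phi> (d + j) (x \<cdot>[Q] s) = g (d + j) (a \<cdot>[X] s)"
     using \<phi>j[OF X.ract_mcomp[OF a(1) s] j] by simp
    also have "\<dots> = g d a \<cdot>[V] s" using elim(4) a(1) j s by blast
    finally show "\<phi> (d + j) (x \<cdot>[Q] s) = \<phi> d x \<cdot>[V] s" unfolding a(2) \<phi>0[OF a(1)] .
   }
  qed
 qed
qed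

lemma mono_qgrI:
 assumes m: "m \<in> QHom S K X" and inj: "\<forall>\<^sub>F d in at_top. inj_on (qact m d) (mcomp K d)"
 shows "mono_arrow (qgr S) m"
 unfolding mono_arrow_def hom_setD(2)[OF m]
proof (intro conjI ballI impI)
 show "m \<in> Arr (qgr S)" by (rule hom_setD(1)[OF m])
 fix V g h assume g: "g \<in> QHom S V K" and h: "h \<in> QHom S V K"
  and e: "m \<star>[qgr S] g = m \<star>[qgr S] h"
 have "eveq V (\<lambda>d v. qact m d (qact g d v)) (\<lambda>d v. qact m d (qact h d v))"
  using eveq_trans[OF eveq_sym[OF qgr_comp(2)[OF g m]]] qgr_comp(2)[OF h m] e by simp
 from this[unfolded eveq_def] have "eveq V (qact g) (qact h)" unfolding eveq_def
  using inj qact_evhom[OF g, unfolded evhom_def] qact_evhom[OF h, unfolded evhom_def]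
 proof eventually_elim
  case (elim d)
  show ?case
  proof
   fix v assume v: "v \<in> mcomp V d"
   have "qact g d v \<in> mcomp K d" "qact h d v \<in> mcomp K d" using elim(3,4) v by blast+
   then show "qact g d v = qact h d v" using inj_onD[OF elim(2)] elim(1) v by blast
  qed
 qed
 then show "g = h" by (rule qgr_eqI[OF g h])
qed

lemma epi_qgrI:
 assumes c: "c \<in> QHom S X Q" and surj: "\<forall>\<^sub>F d in at_top. mcomp Q d \<subseteq> qact c d ` mcomp X d"
 shows "epi_arrow (qgr S) c"
 unfolding epi_arrow_def hom_setD(3)[OF c]
proof (intro conjI ballI impI)
 show "c \<in> Arr (qgr S)" by (rule hom_setD(1)[OF c])
 fix V g h assume g: "g \<in> QHom S Q V" and h: "h \<in> QHom S Q V"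
  and e: "g \<star>[qgr S] c = h \<star>[qgr S] c"
 have "eveq X (\<lambda>d x. qact g d (qact c d x)) (\<lambda>d x. qact h d (qact c d x))"
  using eveq_trans[OF eveq_sym[OF qgr_comp(2)[OF c g]]] qgr_comp(2)[OF c h] e by simp
 from this[unfolded eveq_def] have "eveq Q (qact g) (qact h)" unfolding eveq_def
  using surj
 proof eventually_elim
  case (elim d)
  show ?case
  proof
   fix q assume "q \<in> mcomp Q d"
   from subsetD[OF elim(2) this] obtain a where "a \<in> mcomp X d" "q = qact c d a" by (elim imageE)
   then show "qact g d q = qact h d q" using elim(1) by simp
  qed
 qed
 then show "g = h" by (rule qgr_eqI[OF g h])
qed

lemma kernel_qgrI:
 assumes m: "m \<in> QHom S K X" and \<gamma>: "\<gamma> \<in> QHom S X Y"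
  and inj: "\<forall>\<^sub>F d in at_top. inj_on (qact m d) (mcomp K d)"
  and ker: "\<forall>\<^sub>F d in at_top. \<forall>x\<in>mcomp X d. qact \<gamma> d x = \<zero>[Y] \<longleftrightarrow> x \<in> qact m d ` mcomp K d"
 shows "is_kernel (qgr S) m \<gamma>"
 unfolding is_kernel_def hom_setD(2)[OF m] hom_setD(2)[OF \<gamma>]
proof (intro conjI ballI impI)
 show "m \<in> Arr (qgr S)" "\<gamma> \<in> Arr (qgr S)" "Cod (qgr S) m = X"
  using hom_setD(1)[OF m] hom_setD(1)[OF \<gamma>] hom_setD(3)[OF m] .
 show "zero_arrow (qgr S) (\<gamma> \<star>[qgr S] m)" unfolding zero_comp_qgr[OF m \<gamma>]
  using ker qact_evhom[OF m, unfolded evhom_def]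
 proof eventually_elim
  case (elim d)
  show ?case
  proof
   fix k assume k: "k \<in> mcomp K d"
   have "qact m d k \<in> mcomp X d" using elim(2) k by (elim conjE) (rule bspec)
   from bspec[OF elim(1) this] show "qact \<gamma> d (qact m d k) = \<zero>[Y]" using imageI[OF k] by simp
  qed
 qed
 fix g assume ga: "g \<in> Arr (qgr S)" and gs: "Cod (qgr S) g = X \<and> zero_arrow (qgr S) (\<gamma> \<star>[qgr S] g)"
 define V where "V = Dom (qgr S) g"
 have g: "g \<in> QHom S V X" by (rule Arr_qgr[OF ga V_def[symmetric] conjunct1[OF gs]])
 have im: "\<forall>\<^sub>F d in at_top. \<forall>v\<in>mcomp V d. qact g d v \<in> qact m d ` mcomp K d"
  using conjunct2[OF gs, unfolded zero_comp_qgr[OF g \<gamma>]] ker qact_evhom[OF g, unfolded evhom_def]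
 proof eventually_elim
  case (elim d)
  show ?case
  proof
   fix v assume v: "v \<in> mcomp V d"
   have "qact g d v \<in> mcomp X d" using elim(3) v by (elim conjE) (rule bspec)
   from bspec[OF elim(2) this] show "qact g d v \<in> qact m d ` mcomp K d" using bspec[OF elim(1) v] by simp
  qed
 qed
 obtain \<phi> where \<phi>: "evhom S V K \<phi>" "eveq V (\<lambda>d v. qact m d (\<phi> d v)) (qact g)"
  by (rule evhom_factor_inj[OF qact_evhom[OF m] qact_evhom[OF g] hom_qgr_Obj(3)[OF m] hom_qgr_Obj(3)[OF g] inj im])
 obtain h where h: "h \<in> QHom S V K" "eveq V (qact h) \<phi>"
  by (rule qgr_full[OF hom_qgr_Obj(1)[OF g] hom_qgr_Obj(1)[OF m] \<phi>(1)])
 have mh: "m \<star>[qgr S] h = g"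
 proof (rule qgr_eqI[OF qgr_comp(1)[OF h(1) m] g])
  show "eveq V (qact (m \<star>[qgr S] h)) (qact g)"
   by (rule eveq_trans[OF qgr_comp(2)[OF h(1) m]
      eveq_trans[OF eveq_comp[OF h(2) eveq_refl qact_evhom[OF h(1)]] \<phi>(2)]])
 qed
 show "\<exists>!h. h \<in> QHom S (Dom (qgr S) g) K \<and> m \<star>[qgr S] h = g"
  unfolding V_def[symmetric]
 proof (rule ex1I[of _ h])
  show "h \<in> QHom S V K \<and> m \<star>[qgr S] h = g" using h(1) mh ..
  fix h' assume h': "h' \<in> QHom S V K \<and> m \<star>[qgr S] h' = g"
  have "\<forall>h\<in>QHom S V K. m \<star>[qgr S] h' = m \<star>[qgr S] h \<longrightarrow> h' = h"
   using mono_qgrI[OF m inj] h' hom_qgr_Obj(1)[OF g]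
   unfolding mono_arrow_def hom_setD(2)[OF m] by (simp add: qgr_simps)
  then show "h' = h" using h(1) mh h' by simp
 qed
qed

lemma cokernel_qgrI:
 assumes c: "c \<in> QHom S X Q" and f: "f \<in> QHom S W X"
  and surj: "\<forall>\<^sub>F d in at_top. mcomp Q d \<subseteq> qact c d ` mcomp X d"
  and ker: "\<forall>\<^sub>F d in at_top. \<forall>x\<in>mcomp X d. qact c d x = \<zero>[Q] \<longleftrightarrow> x \<in> qact f d ` mcomp W d"
 shows "is_cokernel (qgr S) c f"
 unfolding is_cokernel_def hom_setD(3)[OF c] hom_setD(3)[OF f]
proof (intro conjI ballI impI)
 show "c \<in> Arr (qgr S)" "f \<in> Arr (qgr S)" "Dom (qgr S) c = X"
  using hom_setD(1)[OF c] hom_setD(1)[OF f] hom_setD(2)[OF c] .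
 show "zero_arrow (qgr S) (c \<star>[qgr S] f)" unfolding zero_comp_qgr[OF f c]
  using ker qact_evhom[OF f, unfolded evhom_def] by eventually_elim blast
 fix g assume ga: "g \<in> Arr (qgr S)" and gs: "Dom (qgr S) g = X \<and> zero_arrow (qgr S) (g \<star>[qgr S] f)"
 define V where "V = Cod (qgr S) g"
 have g: "g \<in> QHom S X V" by (rule Arr_qgr[OF ga conjunct1[OF gs] V_def[symmetric]])
 have gk: "\<forall>\<^sub>F d in at_top. \<forall>x\<in>mcomp X d. qact c d x = \<zero>[Q] \<longrightarrow> qact g d x = \<zero>[V]"
  using conjunct2[OF gs, unfolded zero_comp_qgr[OF f g]] ker
  by eventually_elim (metis imageE)
 obtain \<phi> where \<phi>: "evhom S Q V \<phi>" "eveq X (\<lambda>d x. \<phi> d (qact c d x)) (qact g)"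
  by (rule evhom_factor_surj[OF qact_evhom[OF c] qact_evhom[OF g] hom_qgr_Obj(3)[OF c]
     hom_qgr_Obj(4)[OF c] hom_qgr_Obj(4)[OF g] surj gk])
 obtain h where h: "h \<in> QHom S Q V" "eveq Q (qact h) \<phi>"
  by (rule qgr_full[OF hom_qgr_Obj(2)[OF c] hom_qgr_Obj(2)[OF g] \<phi>(1)])
 have hc: "h \<star>[qgr S] c = g"
 proof (rule qgr_eqI[OF qgr_comp(1)[OF c h(1)] g])
  show "eveq X (qact (h \<star>[qgr S] c)) (qact g)"
   by (rule eveq_trans[OF qgr_comp(2)[OF c h(1)]
      eveq_trans[OF eveq_comp[OF eveq_refl h(2) qact_evhom[OF c]] \<phi>(2)]])
 qed
 show "\<exists>!h. h \<in> QHom S Q (Cod (qgr S) g) \<and> h \<star>[qgr S] c = g"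
  unfolding V_def[symmetric]
 proof (rule ex1I[of _ h])
  show "h \<in> QHom S Q V \<and> h \<star>[qgr S] c = g" using h(1) hc ..
  fix h' assume h': "h' \<in> QHom S Q V \<and> h' \<star>[qgr S] c = g"
  have "\<forall>h\<in>QHom S Q V. h' \<star>[qgr S] c = h \<star>[qgr S] c \<longrightarrow> h' = h"
   using epi_qgrI[OF c surj] h' hom_qgr_Obj(2)[OF g]
   unfolding epi_arrow_def hom_setD(3)[OF c] by (simp add: qgr_simps)
  then show "h' = h" using h(1) hc h' by simp
 qed
qed

text \<open>An element annihilated by an arrow is only seen up to multiplication by elements of high degree,
 since the category does not see finite-dimensional modules.\<close>

lemma free_qgr:
 assumes X: "X \<in> Obj (gr S)" and x: "x \<in> mcomp X d"
 obtains \<omega> where "\<omega> \<in> QHom S (rideal S \<one> 0 (- d)) X"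
  "\<forall>\<^sub>F e in at_top. \<forall>s\<in>hcomp S (e - d). qact \<omega> e (emb s) = x \<cdot>[X] s"
proof -
 let ?R = "rideal S \<one> 0 (- d)"
 obtain f where f: "f \<in> Hom S ?R X" "\<forall>s\<in>carrier S. fn f (emb s) = x \<cdot>[X] s"
  using free_hom[OF X x] by (elim bexE)
 obtain \<omega> where \<omega>: "\<omega> \<in> QHom S ?R X" "eveq ?R (qact \<omega>) (\<lambda>d. fn f)"
  by (rule qgr_of_gr[OF f(1)])
 have "\<forall>\<^sub>F e in at_top. \<forall>s\<in>hcomp S (e - d). qact \<omega> e (emb s) = x \<cdot>[X] s"
  using \<omega>(2)[unfolded eveq_def]
 proof eventually_elim
  case (elim e)
  show ?case
  proof
   fix s assume s: "s \<in> hcomp S (e - d)"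
   have "emb s \<in> mcomp ?R e" using unit_free(4)[OF s, of d] by simp
   from bspec[OF elim this] show "qact \<omega> e (emb s) = x \<cdot>[X] s"
    using bspec[OF f(2) SG.comp_closed[OF s]] by simp
  qed
 qed
 then show thesis by (rule that[OF \<omega>(1)])
qed

lemma free_component: "y \<in> mcomp (rideal S \<one> 0 (- d)) e \<Longrightarrow> \<exists>s\<in>hcomp S (e - d). y = emb s"
 using SG.comp_closed by auto

text \<open>The element x defines a map S(-d) \<rightarrow> X that becomes zero when composed with
  \<alpha>. Cancelling \<alpha> against the zero map shows that it is zero in the quotient category,
  which says that x s vanishes for all s of large degree.\<close>

lemma mono_qgrD:
 assumes mono: "mono_arrow (qgr S) \<alpha>" and \<alpha>: "\<alpha> \<in> QHom S X Y"
 shows "\<forall>\<^sub>F d in at_top. \<forall>x\<in>mcomp X d. qact \<alpha> d x = \<zero>[Y] \<longrightarrow>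
  (\<forall>\<^sub>F e in at_top. \<forall>s\<in>hcomp S (e - d). x \<cdot>[X] s = \<zero>[X])"
 using qact_evhom[OF \<alpha>, unfolded evhom_def]
proof eventually_elim
 case (elim d)
 note lin = elim[THEN conjunct2, THEN conjunct2, rule_format]
 note O = hom_qgr_Obj[OF \<alpha>]
 interpret X: graded_right_module S X by (rule O(3))
 interpret Y: graded_right_module S Y by (rule O(4))
 show ?case
 proof (intro ballI impI)
  fix x assume x: "x \<in> mcomp X d" and z: "qact \<alpha> d x = \<zero>[Y]"
  let ?R = "rideal S \<one> 0 (- d)"
  have R: "?R \<in> Obj (gr S)" by (rule rideal_Obj[OF one_hcomp])
  obtain \<omega> where \<omega>: "\<omega> \<in> QHom S ?R X"
   "\<forall>\<^sub>F e in at_top. \<forall>s\<in>hcomp S (e - d). qact \<omega> e (emb s) = x \<cdot>[X] s"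
   by (rule free_qgr[OF O(1) x])
  obtain z where z0: "z \<in> QHom S ?R X" "eveq ?R (qact z) (\<lambda>d x. \<zero>[X])"
   by (rule qgr_full[OF R O(1) zero_evhom[OF O(1)]])
  have "eveq ?R (\<lambda>e y. qact \<alpha> e (qact \<omega> e y)) (\<lambda>e y. qact \<alpha> e (qact z e y))" unfolding eveq_def
   using \<omega>(2) z0(2)[unfolded eveq_def] evhom_zero[OF qact_evhom[OF \<alpha>] O(3,4)] eventually_ge_at_top[of d]
  proof eventually_elim
   case (elim e)
   show ?case
   proof
    fix y assume y: "y \<in> mcomp ?R e"
    then obtain s where s: "s \<in> hcomp S (e - d)" "y = emb s" using free_component by blast
    have "qact \<alpha> (d + (e - d)) (x \<cdot>[X] s) = qact \<alpha> d x \<cdot>[Y] s"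
     by (rule lin[OF x _ s(1)]) (use elim(4) in simp)
    then have "qact \<alpha> e (qact \<omega> e y) = \<zero>[Y]"
     using elim(1) s z Y.zero_ract[OF SG.comp_closed[OF s(1)]] by simp
    moreover have "qact \<alpha> e (qact z e y) = \<zero>[Y]" using bspec[OF elim(2) y] elim(3) by simp
    ultimately show "qact \<alpha> e (qact \<omega> e y) = qact \<alpha> e (qact z e y)" by simp
   qed
  qed
  then have "\<alpha> \<star>[qgr S] \<omega> = \<alpha> \<star>[qgr S] z"
   by (intro qgr_eqI[OF qgr_comp(1)[OF \<omega>(1) \<alpha>] qgr_comp(1)[OF z0(1) \<alpha>]]
     eveq_trans[OF qgr_comp(2)[OF \<omega>(1) \<alpha>] eveq_trans[OF _ eveq_sym[OF qgr_comp(2)[OF z0(1) \<alpha>]]]])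
  then have "\<omega> = z"
   using mono \<omega>(1) z0(1) R unfolding mono_arrow_def hom_setD(2)[OF \<alpha>] by (simp add: qgr_simps)
  show "\<forall>\<^sub>F e in at_top. \<forall>s\<in>hcomp S (e - d). x \<cdot>[X] s = \<zero>[X]"
   using \<omega>(2) z0(2)[unfolded eveq_def] unfolding \<open>\<omega> = z\<close>
  proof eventually_elim
   case (elim e)
   show ?case
   proof
    fix s assume s: "s \<in> hcomp S (e - d)"
    have "emb s \<in> mcomp ?R e" using unit_free(4)[OF s, of d] by simp
    from bspec[OF elim(2) this] bspec[OF elim(1) s] show "x \<cdot>[X] s = \<zero>[X]" by simp
   qed
  qed
 qed
qed

text \<open>The map S(-d) \<rightarrow> X defined by x is killed by \<gamma>, hence factors through
  the kernel. The factorization is a germ and so speaks only about multiples x s of large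
  degree.\<close>

lemma kernel_qgrD:
 assumes ker: "is_kernel (qgr S) m \<gamma>" and m: "m \<in> QHom S K X" and \<gamma>: "\<gamma> \<in> QHom S X Y"
 shows "\<forall>\<^sub>F d in at_top. \<forall>x\<in>mcomp X d. qact \<gamma> d x = \<zero>[Y] \<longrightarrow>
  (\<forall>\<^sub>F e in at_top. \<forall>s\<in>hcomp S (e - d). x \<cdot>[X] s \<in> qact m e ` mcomp K e)"
 using qact_evhom[OF \<gamma>, unfolded evhom_def]
proof eventually_elim
 case (elim d)
 note lin = elim[THEN conjunct2, THEN conjunct2, rule_format]
 note O = hom_qgr_Obj[OF \<gamma>]
 interpret X: graded_right_module S X by (rule O(3))
 interpret Y: graded_right_module S Y by (rule O(4))
 show ?case
 proof (intro ballI impI)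
  fix x assume x: "x \<in> mcomp X d" and z: "qact \<gamma> d x = \<zero>[Y]"
  let ?R = "rideal S \<one> 0 (- d)"
  obtain \<omega> where \<omega>: "\<omega> \<in> QHom S ?R X"
   "\<forall>\<^sub>F e in at_top. \<forall>s\<in>hcomp S (e - d). qact \<omega> e (emb s) = x \<cdot>[X] s"
   by (rule free_qgr[OF O(1) x])
  have "zero_arrow (qgr S) (\<gamma> \<star>[qgr S] \<omega>)" unfolding zero_comp_qgr[OF \<omega>(1) \<gamma>]
   using \<omega>(2) eventually_ge_at_top[of d]
  proof eventually_elim
   case (elim e)
   show ?case
   proof
    fix y assume y: "y \<in> mcomp ?R e"
    then obtain s where s: "s \<in> hcomp S (e - d)" "y = emb s" using free_component by blast
    have "qact \<gamma> (d + (e - d)) (x \<cdot>[X] s) = qact \<gamma> d x \<cdot>[Y] s"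
     by (rule lin[OF x _ s(1)]) (use elim(2) in simp)
    then show "qact \<gamma> e (qact \<omega> e y) = \<zero>[Y]"
     using elim(1) s z Y.zero_ract[OF SG.comp_closed[OF s(1)]] by simp
   qed
  qed
  then obtain h where h: "h \<in> QHom S ?R K" "m \<star>[qgr S] h = \<omega>"
   by (rule kernel_factor[OF ker m \<gamma> \<omega>(1)])
  show "\<forall>\<^sub>F e in at_top. \<forall>s\<in>hcomp S (e - d). x \<cdot>[X] s \<in> qact m e ` mcomp K e"
   using \<omega>(2) qgr_comp(2)[OF h(1) m, unfolded eveq_def h(2)] qact_evhom[OF h(1), unfolded evhom_def]
  proof eventually_elim
   case (elim e)
   show ?case
   proof
    fix s assume s: "s \<in> hcomp S (e - d)"
    have es: "emb s \<in> mcomp ?R e" using unit_free(4)[OF s, of d] by simp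
    have "x \<cdot>[X] s = qact m e (qact h e (emb s))" using bspec[OF elim(1) s] bspec[OF elim(2) es] by simp
    moreover have "qact h e (emb s) \<in> mcomp K e" using elim(3) es by blast
    ultimately show "x \<cdot>[X] s \<in> qact m e ` mcomp K e" by (rule image_eqI)
   qed
  qed
 qed
qed

text \<open>A roof for f provides an honest arrow f' with the same image in large degrees, and the
  quotient of X by the image of f' is explicit. It serves as the test object for abstract
  epimorphisms and cokernels.\<close>

lemma image_quotient:
 assumes f: "f \<in> QHom S W X"
 obtains Q P where "P \<in> QHom S X Q" "zero_arrow (qgr S) (P \<star>[qgr S] f)"
  "\<forall>\<^sub>F d in at_top. \<forall>x\<in>mcomp X d. qact P d x = \<zero>[Q] \<longrightarrow> x \<in> qact f d ` mcomp W d"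
proof -
 obtain r where r: "r \<in> roofs (gr S) (tors S) W X" "eveq W (qact f) (act r)" by (rule hom_qgrE[OF f])
 obtain s f' where rs: "r = (s, f')" by (metis surj_pair)
 from r(1) obtain V where s: "s \<in> iso_mod (gr S) (tors S)" "s \<in> Hom S V W" "f' \<in> Hom S V X"
  unfolding rs roofs_gr by (elim exE conjE)
 obtain Q p where p: "p \<in> Hom S X Q" "\<forall>x\<in>carrier X. fn p x = \<zero>[Q] \<longleftrightarrow> x \<in> fn f' ` carrier V"
  by (rule cokernel_gr_exists[OF s(3)]) (rule that)
 obtain P where P: "P \<in> QHom S X Q" "eveq X (qact P) (\<lambda>d. fn p)" by (rule qgr_of_gr[OF p(1)])
 interpret X: graded_right_module S X by (rule hom_gr_props(3)[OF p(1)])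
 interpret V: graded_right_module S V by (rule hom_gr_props(3)[OF s(3)])
 show thesis
 proof (rule that[OF P(1)])
  show "zero_arrow (qgr S) (P \<star>[qgr S] f)" unfolding zero_comp_qgr[OF f P(1)]
   using P(2)[unfolded eveq_def] r(2)[unfolded eveq_def] roof_bij[OF s(1,2)]
  proof eventually_elim
   case (elim d)
   show ?case
   proof
    fix w assume w: "w \<in> mcomp W d"
    then obtain v where v: "v \<in> mcomp V d" "w = fn s v" by (rule bij_betwE'[OF elim(3)])
    have "qact f d w = fn f' v"
     using elim(2) w act_eq[OF s(2) elim(3) v(1), of f'] v(2) rs by simp
    moreover have "fn f' v \<in> mcomp X d" by (rule hom_gr_props(9)[OF s(3) v(1)])
    moreover from this have "fn p (fn f' v) = \<zero>[Q]"
     using p(2) X.mcomp_closed V.mcomp_closed[OF v(1)] by blast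
    ultimately show "qact P d (qact f d w) = \<zero>[Q]" using elim(1) by simp
   qed
  qed
  show "\<forall>\<^sub>F d in at_top. \<forall>x\<in>mcomp X d. qact P d x = \<zero>[Q] \<longrightarrow> x \<in> qact f d ` mcomp W d"
   using P(2)[unfolded eveq_def] r(2)[unfolded eveq_def] roof_bij[OF s(1,2)]
  proof eventually_elim
   case (elim d)
   show ?case
   proof (intro ballI impI)
    fix x assume x: "x \<in> mcomp X d" and z: "qact P d x = \<zero>[Q]"
    have "fn p x = \<zero>[Q]" using elim(1) x z by simp
    then have "x \<in> fn f' ` carrier V" using bspec[OF p(2) X.mcomp_closed[OF x]] by simp
    then obtain v where v: "v \<in> mcomp V d" "fn f' v = x" by (rule bexE[OF hom_gr_mcomp_preimage[OF s(3) x]])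
    have w: "fn s v \<in> mcomp W d" by (rule hom_gr_props(9)[OF s(2) v(1)])
    have "x = qact f d (fn s v)" using elim(2) w act_eq[OF s(2) elim(3) v(1), of f'] v(2) rs by simp
    then show "x \<in> qact f d ` mcomp W d" using w by (rule image_eqI)
   qed
  qed
 qed
qed

text \<open>Composed with c, the quotient map P by the image of c agrees with the zero map; so P is
  zero and the image is everything. Unlike in \<open>mono_qgrD\<close>, the conclusion concerns the
  elements themselves and not just their multiples.\<close>

lemma epi_qgrD:
 assumes epi: "epi_arrow (qgr S) c" and c: "c \<in> QHom S X Q"
 shows "\<forall>\<^sub>F d in at_top. mcomp Q d \<subseteq> qact c d ` mcomp X d"
proof -
 obtain R P where P: "P \<in> QHom S Q R" "zero_arrow (qgr S) (P \<star>[qgr S] c)"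
  "\<forall>\<^sub>F d in at_top. \<forall>x\<in>mcomp Q d. qact P d x = \<zero>[R] \<longrightarrow> x \<in> qact c d ` mcomp X d"
  by (rule image_quotient[OF c])
 note O = hom_qgr_Obj[OF P(1)]
 obtain z where z: "z \<in> QHom S Q R" "eveq Q (qact z) (\<lambda>d x. \<zero>[R])"
  by (rule qgr_full[OF O(1,2) zero_evhom[OF O(2)]])
 have "zero_arrow (qgr S) (z \<star>[qgr S] c)" unfolding zero_comp_qgr[OF c z(1)]
  using z(2)[unfolded eveq_def] qact_evhom[OF c, unfolded evhom_def]
 proof eventually_elim
  case (elim d)
  show ?case
  proof
   fix x assume x: "x \<in> mcomp X d"
   have "qact c d x \<in> mcomp Q d" using elim(2) x by (elim conjE) (rule bspec)
   from bspec[OF elim(1) this] show "qact z d (qact c d x) = \<zero>[R]" .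
  qed
 qed
 note zc = this[unfolded zero_arrow_qgr[OF qgr_comp(1)[OF c z(1)]]]
 note Pc = P(2)[unfolded zero_arrow_qgr[OF qgr_comp(1)[OF c P(1)]]]
 have "P \<star>[qgr S] c = z \<star>[qgr S] c"
  by (rule qgr_eqI[OF qgr_comp(1)[OF c P(1)] qgr_comp(1)[OF c z(1)] eveq_trans[OF Pc eveq_sym[OF zc]]])
 then have "P = z"
  using epi P(1) z(1) O(2) unfolding epi_arrow_def hom_setD(3)[OF c] by (simp add: qgr_simps)
 from P(3) z(2)[unfolded eveq_def] show ?thesis unfolding \<open>P = z\<close>
  by eventually_elim (rule subsetI, simp)
qed

lemma cokernel_qgrD:
 assumes cok: "is_cokernel (qgr S) c f" and c: "c \<in> QHom S X Q" and f: "f \<in> QHom S W X"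
 shows "\<forall>\<^sub>F d in at_top. \<forall>x\<in>mcomp X d. qact c d x = \<zero>[Q] \<longrightarrow> x \<in> qact f d ` mcomp W d"
proof -
 obtain R P where P: "P \<in> QHom S X R" "zero_arrow (qgr S) (P \<star>[qgr S] f)"
  "\<forall>\<^sub>F d in at_top. \<forall>x\<in>mcomp X d. qact P d x = \<zero>[R] \<longrightarrow> x \<in> qact f d ` mcomp W d"
  by (rule image_quotient[OF f])
 obtain h where h: "h \<in> QHom S Q R" "h \<star>[qgr S] c = P"
  by (rule cokernel_factor[OF cok c f P(1,2)])
 show ?thesis
  using P(3) qgr_comp(2)[OF c h(1), unfolded eveq_def h(2)] evhom_zero[OF qact_evhom[OF h(1)] hom_qgr_Obj(3,4)[OF h(1)]]
  by eventually_elim simp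
qed

text \<open>The arrow m is a kernel of both c and g. Since c f = 0, f factors through m, so g f = 0.
  Conversely, g x = 0 puts the multiples of x of large degree into the image of m, which c kills,
  and what c kills lies in the image of f.\<close>

lemma exact_qgrD:
 assumes ex: "exact_at (qgr S) f g" and f: "f \<in> QHom S W X" and g: "g \<in> QHom S X Y"
 shows "\<forall>\<^sub>F d in at_top. \<forall>w\<in>mcomp W d. qact g d (qact f d w) = \<zero>[Y]"
  and "\<forall>\<^sub>F d in at_top. \<forall>x\<in>mcomp X d. qact g d x = \<zero>[Y] \<longrightarrow>
   (\<forall>\<^sub>F e in at_top. \<forall>s\<in>hcomp S (e - d). x \<cdot>[X] s \<in> qact f e ` mcomp W e)"
proof -
 from ex obtain c m where cm: "is_cokernel (qgr S) c f" "is_kernel (qgr S) m c" "is_kernel (qgr S) m g"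
  unfolding exact_at_def by (elim conjE exE)
 define Q where "Q = Cod (qgr S) c"
 define K where "K = Dom (qgr S) m"
 have c: "c \<in> QHom S X Q"
  using cm(1) hom_setD(3)[OF f] unfolding is_cokernel_def by (intro Arr_qgr) (simp_all add: Q_def)
 have m: "m \<in> QHom S K X"
  using cm(3) hom_setD(2)[OF g] unfolding is_kernel_def by (intro Arr_qgr) (simp_all add: K_def)
 have cf: "zero_arrow (qgr S) (c \<star>[qgr S] f)" using cm(1) unfolding is_cokernel_def by (elim conjE)
 have c0: "zero_arrow (qgr S) (c \<star>[qgr S] m)" using cm(2) unfolding is_kernel_def by (elim conjE)
 have g0: "zero_arrow (qgr S) (g \<star>[qgr S] m)" using cm(3) unfolding is_kernel_def by (elim conjE)
 obtain h where h: "h \<in> QHom S W K" "m \<star>[qgr S] h = f"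
  by (rule kernel_factor[OF cm(2) m c f cf])
 show "\<forall>\<^sub>F d in at_top. \<forall>w\<in>mcomp W d. qact g d (qact f d w) = \<zero>[Y]"
  using g0[unfolded zero_comp_qgr[OF m g]] qgr_comp(2)[OF h(1) m, unfolded eveq_def h(2)]
   qact_evhom[OF h(1), unfolded evhom_def]
  by eventually_elim simp
 have "\<forall>\<^sub>F e in at_top. \<forall>x\<in>mcomp X e. x \<in> qact m e ` mcomp K e \<longrightarrow> x \<in> qact f e ` mcomp W e"
  using cokernel_qgrD[OF cm(1) c f] c0[unfolded zero_comp_qgr[OF m c]]
  by eventually_elim (metis imageE)
 note mf = this
 interpret X: graded_right_module S X by (rule hom_qgr_Obj(3)[OF g])
 show "\<forall>\<^sub>F d in at_top. \<forall>x\<in>mcomp X d. qact g d x = \<zero>[Y] \<longrightarrow>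
   (\<forall>\<^sub>F e in at_top. \<forall>s\<in>hcomp S (e - d). x \<cdot>[X] s \<in> qact f e ` mcomp W e)"
  using kernel_qgrD[OF cm(3) m g]
 proof eventually_elim
  case (elim d)
  show ?case
  proof (intro ballI impI)
   fix x assume x: "x \<in> mcomp X d" and "qact g d x = \<zero>[Y]"
   then have "\<forall>\<^sub>F e in at_top. \<forall>s\<in>hcomp S (e - d). x \<cdot>[X] s \<in> qact m e ` mcomp K e" using elim by blast
   then show "\<forall>\<^sub>F e in at_top. \<forall>s\<in>hcomp S (e - d). x \<cdot>[X] s \<in> qact f e ` mcomp W e"
    using mf
   proof eventually_elim
    case (elim e)
    show ?case
    proof
     fix s assume s: "s \<in> hcomp S (e - d)"
     have "x \<cdot>[X] s \<in> mcomp X e" using X.ract_mcomp[OF x s] by simp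
     then show "x \<cdot>[X] s \<in> qact f e ` mcomp W e" using elim s by blast
    qed
   qed
  qed
 qed
qed

lemma exact_qgrI:
 assumes c: "c \<in> QHom S X Q" and m: "m \<in> QHom S K X"
  and f: "f \<in> QHom S W X" and g: "g \<in> QHom S X Y"
  and surj: "\<forall>\<^sub>F d in at_top. mcomp Q d \<subseteq> qact c d ` mcomp X d"
  and inj: "\<forall>\<^sub>F d in at_top. inj_on (qact m d) (mcomp K d)"
  and cf: "\<forall>\<^sub>F d in at_top. \<forall>x\<in>mcomp X d. qact c d x = \<zero>[Q] \<longleftrightarrow> x \<in> qact f d ` mcomp W d"
  and mc: "\<forall>\<^sub>F d in at_top. \<forall>x\<in>mcomp X d. qact c d x = \<zero>[Q] \<longleftrightarrow> x \<in> qact m d ` mcomp K d"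
  and mg: "\<forall>\<^sub>F d in at_top. \<forall>x\<in>mcomp X d. qact g d x = \<zero>[Y] \<longleftrightarrow> x \<in> qact m d ` mcomp K d"
 shows "exact_at (qgr S) f g"
 unfolding exact_at_def
 using hom_setD(3)[OF f] hom_setD(2)[OF g] cokernel_qgrI[OF c f surj cf] kernel_qgrI[OF m c inj mc]
  kernel_qgrI[OF m g inj mg] by (intro conjI exI[of _ c] exI[of _ m]) simp_all

end

section \<open>An invariant of extensions\<close>

text \<open>A complex \<open>X\<^sub>0 \<rightarrow> \<dots> \<rightarrow> X\<^bsub>n+1\<^esub>\<close>, given in degrees at least \<open>D\<close>, that becomes exact after
 inverting \<open>\<gamma>\<close>. The products of consecutive \<open>w\<^sub>i\<close> vanish, so right multiplications by the
 \<open>w\<^sub>i\<close> make every module a complex; chasing an element of \<open>X\<^bsub>n+1\<^esub>\<close> through the exact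
 sequence computes an iterated connecting homomorphism of the homology of these complexes.\<close>

definition chain where
 "chain w n X A m D t e \<longleftrightarrow> (\<forall>i. m \<le> i \<longrightarrow> i \<le> n \<longrightarrow> e i \<in> mcomp (X i) (D + int (n - i))) \<and>
   A n D (e n) = t \<and>
   (\<forall>i. m \<le> i \<longrightarrow> i < n \<longrightarrow> A i (D + int (n - i)) (e i) = e (Suc i) \<cdot>[X (Suc i)] w (Suc i))"

text \<open>Chasing t \<gamma>^k ends in v \<gamma>^k up to a right multiple of w 1, the ambiguity
  left by the choices. Each step from X (i + 1) to X i raises the degree by one, so e 0 has degree D
  + p k + n and b has one less.\<close>

definition lifts_to where
 "lifts_to S \<gamma> p w n X A D t v k \<longleftrightarrow> (\<exists>e b. b \<in> mcomp (X 0) (D + int p * int k + int n - 1) \<and>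
   chain w n X A 0 (D + int p * int k) (t \<cdot>[X (Suc n)] (\<gamma> [^]\<^bsub>S\<^esub> k)) e \<and>
   e 0 = (v \<cdot>[X 0] (\<gamma> [^]\<^bsub>S\<^esub> k)) \<oplus>[X 0] (b \<cdot>[X 0] w 1))"

text \<open>Quantifying over all large k makes the condition independent of the degree from which
  the complex is given.\<close>

definition realizes where
 "realizes S \<gamma> p w n X A D t v \<longleftrightarrow> (\<exists>k0::nat. \<forall>k\<ge>k0. lifts_to S \<gamma> p w n X A D t v k)"

text \<open>What the lemmas on germs yield for an extension, with powers of \<gamma> as the elements
  of large degree that are tested. Surjectivity comes without such a power because epimorphisms are
  surjective in large degrees. Since \<gamma> commutes with the w i, a chain multiplied by
  \<gamma>^k is a chain again.\<close>

locale chain_data = std_algebra S F for S :: "('k::field, 's) graded_alg" (structure) and F +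
 fixes \<gamma> :: 's and p :: nat and w :: "nat \<Rightarrow> 's" and n :: nat and X :: "nat \<Rightarrow> 's gmod"
  and A :: "nat \<Rightarrow> int \<Rightarrow> 's list set \<Rightarrow> 's list set" and D0 :: int
 assumes \<gamma>: "\<gamma> \<in> hcomp S (int p)" and w: "w i \<in> hcomp S 1" and ww: "w (Suc i) \<otimes> w i = \<zero>"
  and comm: "\<gamma> \<otimes> w i = w i \<otimes> \<gamma>"
  and Xm: "i \<le> Suc n \<Longrightarrow> graded_right_module S (X i)"
  and A_deg: "D0 \<le> d \<Longrightarrow> i \<le> n \<Longrightarrow> x \<in> mcomp (X i) d \<Longrightarrow> A i d x \<in> mcomp (X (Suc i)) d"
  and A_minus: "D0 \<le> d \<Longrightarrow> i \<le> n \<Longrightarrow> x \<in> mcomp (X i) d \<Longrightarrow> y \<in> mcomp (X i) d \<Longrightarrow>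
   A i d (x \<ominus>\<^bsub>X i\<^esub> y) = A i d x \<ominus>\<^bsub>X (Suc i)\<^esub> A i d y"
  and A_lin: "D0 \<le> d \<Longrightarrow> i \<le> n \<Longrightarrow> x \<in> mcomp (X i) d \<Longrightarrow> s \<in> hcomp S (int j) \<Longrightarrow>
   A i (d + int j) (x \<cdot>[X i] s) = A i d x \<cdot>[X (Suc i)] s"
  and A_exact: "D0 \<le> d \<Longrightarrow> i < n \<Longrightarrow> x \<in> mcomp (X (Suc i)) d \<Longrightarrow> A (Suc i) d x = \<zero>[X (Suc (Suc i))] \<Longrightarrow>
   \<exists>k. \<exists>y\<in>mcomp (X i) (d + int p * int k). A i (d + int p * int k) y = x \<cdot>[X (Suc i)] (\<gamma> [^] k)"
  and A_inj: "D0 \<le> d \<Longrightarrow> x \<in> mcomp (X 0) d \<Longrightarrow> A 0 d x = \<zero>[X 1] \<Longrightarrow>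
   \<exists>k. x \<cdot>[X 0] (\<gamma> [^] (k::nat)) = \<zero>[X 0]"
  and A_surj: "D0 \<le> d \<Longrightarrow> t \<in> mcomp (X (Suc n)) d \<Longrightarrow> \<exists>x\<in>mcomp (X n) d. A n d x = t"
begin

lemma \<gamma>_closed [simp]: "\<gamma> \<in> carrier S" and w_closed [simp]: "w i \<in> carrier S"
 using \<gamma> w SG.comp_closed by blast+

lemma degree_le: "D0 \<le> D \<Longrightarrow> D0 \<le> D + int p * int k"
 by (simp add: add_increasing2)

lemma \<gamma>_pow: "\<gamma> [^] k \<in> hcomp S (int p * int k)"
proof (induction k)
 case 0 then show ?case by (simp add: one_hcomp)
next
 case (Suc k)
 have "\<gamma> [^] k \<otimes> \<gamma> \<in> hcomp S (int p * int k + int p)" by (rule mult_hcomp[OF Suc \<gamma>])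
 then show ?case by (simp add: algebra_simps)
qed

lemma \<gamma>_pow_nat: "\<gamma> [^] k \<in> hcomp S (int (p * k))"
 using \<gamma>_pow by simp

lemma pow_comm: "(\<gamma> [^] k) \<otimes> w i = w i \<otimes> (\<gamma> [^] (k::nat))"
proof (induction k)
 case (Suc k)
 have "(\<gamma> [^] Suc k) \<otimes> w i = (\<gamma> [^] k) \<otimes> (w i \<otimes> \<gamma>)" by (simp add: m_assoc comm)
 also have "\<dots> = w i \<otimes> (\<gamma> [^] k) \<otimes> \<gamma>" by (simp add: m_assoc[symmetric] Suc)
 finally show ?case by (simp add: m_assoc)
qed simp

lemma ract_pow_comm:
 assumes "graded_right_module S M" "x \<in> carrier M"
 shows "x \<cdot>[M] w i \<cdot>[M] (\<gamma> [^] (k::nat)) = x \<cdot>[M] (\<gamma> [^] k) \<cdot>[M] w i"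
proof -
 interpret M: graded_right_module S M by fact
 show ?thesis using assms(2) by (simp add: M.ract_mult[symmetric] pow_comm)
qed

lemma ract_pow_pow:
 assumes "graded_right_module S M" "x \<in> carrier M"
 shows "x \<cdot>[M] (\<gamma> [^] (k::nat)) \<cdot>[M] (\<gamma> [^] (l::nat)) = x \<cdot>[M] (\<gamma> [^] (k + l))"
proof -
 interpret M: graded_right_module S M by fact
 show ?thesis using assms(2) by (simp add: M.ract_mult[symmetric] nat_pow_mult)
qed

lemma ract_w_w:
 assumes "graded_right_module S M" "x \<in> carrier M"
 shows "x \<cdot>[M] w (Suc i) \<cdot>[M] w i = \<zero>[M]"
proof -
 interpret M: graded_right_module S M by fact
 show ?thesis using assms(2) by (simp add: M.ract_mult[symmetric] ww M.ract_zero)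
qed

lemma ract_pow_mcomp:
 assumes "graded_right_module S M" "x \<in> mcomp M d"
 shows "x \<cdot>[M] (\<gamma> [^] k) \<in> mcomp M (d + int p * int k)"
 by (rule graded_right_module.ract_mcomp[OF assms \<gamma>_pow])

lemma A_pow:
 assumes "D0 \<le> d" "i \<le> n" "x \<in> mcomp (X i) d"
 shows "A i (d + int p * int k) (x \<cdot>[X i] (\<gamma> [^] k)) = A i d x \<cdot>[X (Suc i)] (\<gamma> [^] k)"
 using A_lin[OF assms \<gamma>_pow_nat[of k]] by simp

lemma A_w:
 assumes "D0 \<le> d" "i \<le> n" "x \<in> mcomp (X i) d"
 shows "A i (d + 1) (x \<cdot>[X i] w l) = A i d x \<cdot>[X (Suc i)] w l"
 using A_lin[OF assms, of "w l" 1] w by simp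

lemma chainD:
 assumes "chain w n X A m D t e"
 shows "\<And>i. m \<le> i \<Longrightarrow> i \<le> n \<Longrightarrow> e i \<in> mcomp (X i) (D + int (n - i))" "A n D (e n) = t"
  "\<And>i. m \<le> i \<Longrightarrow> i < n \<Longrightarrow> A i (D + int (n - i)) (e i) = e (Suc i) \<cdot>[X (Suc i)] w (Suc i)"
 using assms unfolding chain_def by blast+

lemma chain_mult:
 assumes D: "D0 \<le> D" and m: "m \<le> n" and c: "chain w n X A m D t e"
 shows "chain w n X A m (D + int p * int k) (t \<cdot>[X (Suc n)] (\<gamma> [^] k)) (\<lambda>i. e i \<cdot>[X i] (\<gamma> [^] k))"
 unfolding chain_def
proof (intro conjI allI impI)
 note c' = chainD[OF c]
 have re: "D + int p * int k + int (n - i) = D + int (n - i) + int p * int k" for i by simp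
 show "e i \<cdot>[X i] (\<gamma> [^] k) \<in> mcomp (X i) (D + int p * int k + int (n - i))" if "m \<le> i" "i \<le> n" for i
  unfolding re by (rule ract_pow_mcomp[OF Xm c'(1)[OF that]]) (use that in simp)
 have "e n \<in> mcomp (X n) D" using c'(1)[of n] m by simp
 from A_pow[OF D _ this, of k] show "A n (D + int p * int k) (e n \<cdot>[X n] (\<gamma> [^] k)) = t \<cdot>[X (Suc n)] (\<gamma> [^] k)"
  using c'(2) by simp
 fix i assume i: "m \<le> i" "i < n"
 have e: "e i \<in> mcomp (X i) (D + int (n - i))" "e (Suc i) \<in> mcomp (X (Suc i)) (D + int (n - Suc i))"
  using i by (intro c'(1); simp)+
 interpret X: graded_right_module S "X (Suc i)" by (rule Xm) (use i in simp)
 have "A i (D + int (n - i) + int p * int k) (e i \<cdot>[X i] (\<gamma> [^] k)) = A i (D + int (n - i)) (e i) \<cdot>[X (Suc i)] (\<gamma> [^] k)"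
  by (rule A_pow[OF _ _ e(1)]) (use i D in simp_all)
 also have "\<dots> = e (Suc i) \<cdot>[X (Suc i)] (\<gamma> [^] k) \<cdot>[X (Suc i)] w (Suc i)"
  unfolding c'(3)[OF i] by (rule ract_pow_comm[OF X.graded_right_module_axioms X.mcomp_closed[OF e(2)]])
 finally show "A i (D + int p * int k + int (n - i)) (e i \<cdot>[X i] (\<gamma> [^] k))
   = e (Suc i) \<cdot>[X (Suc i)] (\<gamma> [^] k) \<cdot>[X (Suc i)] w (Suc i)" unfolding re .
qed

lemma chain_diff:
 assumes D: "D0 \<le> D" and c: "chain w n X A 0 D t e" and c': "chain w n X A 0 D t' e'"
 shows "chain w n X A 0 D (t \<ominus>\<^bsub>X (Suc n)\<^esub> t') (\<lambda>i. e i \<ominus>\<^bsub>X i\<^esub> e' i)"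
 unfolding chain_def
proof (intro conjI allI impI)
 note c1 = chainD[OF c] and c2 = chainD[OF c']
 show "e i \<ominus>\<^bsub>X i\<^esub> e' i \<in> mcomp (X i) (D + int (n - i))" if "0 \<le> i" "i \<le> n" for i
 proof -
  interpret X: graded_right_module S "X i" by (rule Xm) (use that in simp)
  show ?thesis unfolding X.M.minus_eq by (intro X.MG.comp_add X.MG.comp_minus c1(1) c2(1) that)
 qed
 show "A n D (e n \<ominus>\<^bsub>X n\<^esub> e' n) = t \<ominus>\<^bsub>X (Suc n)\<^esub> t'"
  using A_minus[OF D order_refl, of "e n" "e' n"] c1(1)[of n] c2(1)[of n] c1(2) c2(2) by simp
 fix i assume i: "0 \<le> i" "i < n"
 interpret X: graded_right_module S "X (Suc i)" by (rule Xm) (use i in simp)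
 have e: "e i \<in> mcomp (X i) (D + int (n - i))" "e' i \<in> mcomp (X i) (D + int (n - i))"
  "e (Suc i) \<in> carrier (X (Suc i))" "e' (Suc i) \<in> carrier (X (Suc i))"
  using i c1(1)[of i] c2(1)[of i] X.mcomp_closed[OF c1(1)[of "Suc i"]] X.mcomp_closed[OF c2(1)[of "Suc i"]] by simp_all
 have "A i (D + int (n - i)) (e i \<ominus>\<^bsub>X i\<^esub> e' i) = A i (D + int (n - i)) (e i) \<ominus>\<^bsub>X (Suc i)\<^esub> A i (D + int (n - i)) (e' i)"
  by (rule A_minus[OF _ _ e(1,2)]) (use i D in simp_all)
 then show "A i (D + int (n - i)) (e i \<ominus>\<^bsub>X i\<^esub> e' i) = (e (Suc i) \<ominus>\<^bsub>X (Suc i)\<^esub> e' (Suc i)) \<cdot>[X (Suc i)] w (Suc i)"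
  unfolding c1(3)[OF i] c2(3)[OF i] using e by (simp add: X.M.minus_eq X.add_ract X.minus_ract)
qed

text \<open>The element to lift is e (m + 1) w (m + 1). It is a cycle: its image is e (m + 2) w (m +
  2) w (m + 1) = 0, or t w n = 0 at the top. Exactness lifts it after multiplication by a power of
  \<gamma>.\<close>

lemma chain_extend:
 assumes D: "D0 \<le> D" and m: "Suc m \<le> n" and t: "t \<in> carrier (X (Suc n))" "t \<cdot>[X (Suc n)] w n = \<zero>[X (Suc n)]"
  and c: "chain w n X A (Suc m) D t e"
 shows "\<exists>k e'. chain w n X A m (D + int p * int k) (t \<cdot>[X (Suc n)] (\<gamma> [^] k)) e'"
proof -
 note c' = chainD[OF c]
 interpret X: graded_right_module S "X (Suc m)" by (rule Xm) (use m in simp)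
 interpret Y: graded_right_module S "X (Suc (Suc m))" by (rule Xm) (use m in simp)
 let ?d = "D + int (n - Suc m)"
 have e: "e (Suc m) \<in> mcomp (X (Suc m)) ?d" using c'(1)[of "Suc m"] m by simp
 have ew: "e (Suc m) \<cdot>[X (Suc m)] w (Suc m) \<in> mcomp (X (Suc m)) (?d + 1)" by (rule X.ract_mcomp[OF e w])
 have "A (Suc m) (?d + 1) (e (Suc m) \<cdot>[X (Suc m)] w (Suc m)) = A (Suc m) ?d (e (Suc m)) \<cdot>[X (Suc (Suc m))] w (Suc m)"
  by (rule A_w[OF _ _ e]) (use D m in simp_all)
 also have "\<dots> = \<zero>[X (Suc (Suc m))]"
 proof (cases "Suc m = n")
  case True
  then show ?thesis using c'(2) t(2) by simp
 next
  case False
  then have "Suc m < n" using m by simp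
  from c'(3)[OF order_refl this] c'(1)[of "Suc (Suc m)"] this show ?thesis
   using ract_w_w[OF Y.graded_right_module_axioms Y.mcomp_closed] by simp
 qed
 finally have z: "A (Suc m) (?d + 1) (e (Suc m) \<cdot>[X (Suc m)] w (Suc m)) = \<zero>[X (Suc (Suc m))]" .
 obtain k y where y: "y \<in> mcomp (X m) (?d + 1 + int p * int k)"
  "A m (?d + 1 + int p * int k) y = e (Suc m) \<cdot>[X (Suc m)] w (Suc m) \<cdot>[X (Suc m)] (\<gamma> [^] k)"
  using A_exact[OF _ _ ew z] D m by auto
 have d1: "?d + 1 + int p * int k = D + int p * int k + int (n - m)" using m by (simp add: Suc_diff_Suc)
 note cm = chainD[OF chain_mult[OF D m c, of k]]
 have "chain w n X A m (D + int p * int k) (t \<cdot>[X (Suc n)] (\<gamma> [^] k))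
   (\<lambda>i. if i = m then y else e i \<cdot>[X i] (\<gamma> [^] k))" unfolding chain_def
 proof (intro conjI allI impI)
  show "(if i = m then y else e i \<cdot>[X i] (\<gamma> [^] k)) \<in> mcomp (X i) (D + int p * int k + int (n - i))"
   if "m \<le> i" "i \<le> n" for i
   using cm(1)[of i] that y(1)[unfolded d1] by auto
  show "A n (D + int p * int k) (if n = m then y else e n \<cdot>[X n] (\<gamma> [^] k)) = t \<cdot>[X (Suc n)] (\<gamma> [^] k)"
   using cm(2) m by simp
  fix i assume i: "m \<le> i" "i < n"
  show "A i (D + int p * int k + int (n - i)) (if i = m then y else e i \<cdot>[X i] (\<gamma> [^] k))
    = (if Suc i = m then y else e (Suc i) \<cdot>[X (Suc i)] (\<gamma> [^] k)) \<cdot>[X (Suc i)] w (Suc i)"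
  proof (cases "i = m")
   case True
   then show ?thesis using y(2) ract_pow_comm[OF X.graded_right_module_axioms X.mcomp_closed[OF e], of "Suc m" k]
    unfolding d1 by simp
  next
   case False
   then show ?thesis using cm(3)[of i] i by simp
  qed
 qed
 then show ?thesis by blast
qed

lemma chain_exists:
 assumes D: "D0 \<le> D" and t: "t \<in> mcomp (X (Suc n)) D" "t \<cdot>[X (Suc n)] w n = \<zero>[X (Suc n)]"
 shows "\<exists>k e. chain w n X A 0 (D + int p * int k) (t \<cdot>[X (Suc n)] (\<gamma> [^] k)) e"
proof -
 interpret X: graded_right_module S "X (Suc n)" by (rule Xm) simp
 have tc: "t \<in> carrier (X (Suc n))" by (rule X.mcomp_closed[OF t(1)])
 \<comment> \<open>Downward induction on the index n - l; at l = 0 surjectivity of the last map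
   gives a preimage of t.\<close>
 have "\<exists>k e. chain w n X A (n - l) (D + int p * int k) (t \<cdot>[X (Suc n)] (\<gamma> [^] k)) e" if "l \<le> n" for l
  using that
 proof (induction l)
  case 0
  obtain x where x: "x \<in> mcomp (X n) D" "A n D x = t" using A_surj[OF D t(1)] by blast
  have "chain w n X A n D t (\<lambda>_. x)" unfolding chain_def using x by auto
  then show ?case using X.ract_one[OF tc] by (intro exI[of _ 0]) auto
 next
  case (Suc l)
  then obtain k e where c: "chain w n X A (n - l) (D + int p * int k) (t \<cdot>[X (Suc n)] (\<gamma> [^] k)) e" by auto
  have s: "n - l = Suc (n - Suc l)" using Suc by simp
  have D': "D0 \<le> D + int p * int k" by (rule degree_le[OF D])
  have tk: "t \<cdot>[X (Suc n)] (\<gamma> [^] k) \<cdot>[X (Suc n)] w n = \<zero>[X (Suc n)]"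
   unfolding ract_pow_comm[OF X.graded_right_module_axioms tc, symmetric] t(2) by (simp add: X.zero_ract)
  have "\<exists>k' e'. chain w n X A (n - Suc l) (D + int p * int k + int p * int k')
    (t \<cdot>[X (Suc n)] (\<gamma> [^] k) \<cdot>[X (Suc n)] (\<gamma> [^] k')) e'"
   by (rule chain_extend[OF D' _ _ tk c[unfolded s]]) (use Suc tc in \<open>simp_all add: X.ract_closed\<close>)
  then obtain k' e' where "chain w n X A (n - Suc l) (D + int p * int k + int p * int k')
    (t \<cdot>[X (Suc n)] (\<gamma> [^] k) \<cdot>[X (Suc n)] (\<gamma> [^] k')) e'" by (elim exE)
  then have "chain w n X A (n - Suc l) (D + int p * int (k + k')) (t \<cdot>[X (Suc n)] (\<gamma> [^] (k + k'))) e'"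
   unfolding ract_pow_pow[OF X.graded_right_module_axioms tc] by (simp add: algebra_simps)
  then show ?case by blast
 qed
 from this[of n] show ?thesis by simp
qed

text \<open>The usual argument that a connecting homomorphism is well defined. Over t = 0 each e m
  is, up to a power of \<gamma>, a right multiple of w (m + 1) plus a cycle. Lifting the cycle gives
  the multiplier for m - 1, and in X 0 injectivity kills the cycle.\<close>

lemma chain_zero:
 assumes D: "D0 \<le> D" and c: "chain w n X A 0 D \<zero>[X (Suc n)] e"
 shows "\<exists>k. \<exists>b\<in>mcomp (X 0) (D + int p * int k + int n - 1). e 0 \<cdot>[X 0] (\<gamma> [^] k) = b \<cdot>[X 0] w 1"
proof -
 note c' = chainD[OF c]
 let ?P = "\<lambda>m k b. b \<in> mcomp (X m) (D + int p * int k + int (n - m) - 1) \<and>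
   A m (D + int p * int k + int (n - m)) (e m \<cdot>[X m] (\<gamma> [^] k) \<ominus>\<^bsub>X m\<^esub> (b \<cdot>[X m] w (Suc m))) = \<zero>[X (Suc m)]"
 have "\<exists>k b. ?P (n - l) k b" if "l \<le> n" for l
  using that
 proof (induction l)
  case 0
  interpret X: graded_right_module S "X n" by (rule Xm) simp
  have mz: "\<ominus>\<^bsub>X n\<^esub> \<zero>[X n] = \<zero>[X n]" by (rule X.M.minus_equality) simp_all
  have "e n \<in> carrier (X n)" using X.mcomp_closed[OF c'(1)[of n]] by simp
  then have "?P n 0 \<zero>[X n]"
   using c'(2) X.MG.comp_zero by (simp add: X.ract_one X.zero_ract X.M.minus_eq mz)
  then have "\<exists>k b. ?P n k b" by blast
  then show ?case by simp
 next
  case (Suc l)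
  define m where "m = n - Suc l"
  have m: "Suc m \<le> n" "n - l = Suc m" using Suc by (simp_all add: m_def)
  interpret X: graded_right_module S "X m" by (rule Xm) (use m in simp)
  interpret Y: graded_right_module S "X (Suc m)" by (rule Xm) (use m in simp)
  interpret Z: graded_right_module S "X (Suc (Suc m))" by (rule Xm) (use m in simp)
  have "\<exists>k b. ?P (Suc m) k b" using Suc unfolding m(2) by simp
  then obtain k b where b: "b \<in> mcomp (X (Suc m)) (D + int p * int k + int (n - Suc m) - 1)"
   and z: "A (Suc m) (D + int p * int k + int (n - Suc m))
    (e (Suc m) \<cdot>[X (Suc m)] (\<gamma> [^] k) \<ominus>\<^bsub>X (Suc m)\<^esub> (b \<cdot>[X (Suc m)] w (Suc (Suc m)))) = \<zero>[X (Suc (Suc m))]"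
   by blast
  let ?d = "D + int p * int k + int (n - Suc m)"
  let ?e = "e (Suc m) \<cdot>[X (Suc m)] (\<gamma> [^] k)" and ?b = "b \<cdot>[X (Suc m)] w (Suc (Suc m))"
  have e1: "e (Suc m) \<in> mcomp (X (Suc m)) (D + int (n - Suc m))" "e m \<in> mcomp (X m) (D + int (n - m))"
   using m by (intro c'(1); simp)+
  have e2: "?e \<in> mcomp (X (Suc m)) ?d"
   using ract_pow_mcomp[OF Y.graded_right_module_axioms e1(1), of k] by (simp add: ac_simps)
  have b2: "?b \<in> mcomp (X (Suc m)) ?d" using Y.ract_mcomp[OF b w] by simp
  have eb: "?e \<ominus>\<^bsub>X (Suc m)\<^esub> ?b \<in> mcomp (X (Suc m)) ?d"
   unfolding Y.M.minus_eq by (intro Y.MG.comp_add Y.MG.comp_minus e2 b2)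
  have dd: "D0 \<le> ?d" using degree_le[OF D, of k] by simp
  have DD: "D0 \<le> D + int (n - m) + int p * int K" for K by (rule degree_le) (use D in simp)
  \<comment> \<open>The cycle at m + 1 lifts to y. Its part b w (m + 2) disappears on multiplication
    by w (m + 1), so y w (m + 1) and e m have the same image up to powers of \<gamma>: y is the next
    multiplier.\<close>
  obtain k' y where y: "y \<in> mcomp (X m) (?d + int p * int k')"
   "A m (?d + int p * int k') y = (?e \<ominus>\<^bsub>X (Suc m)\<^esub> ?b) \<cdot>[X (Suc m)] (\<gamma> [^] k')"
   using A_exact[OF dd _ eb z] m by auto
  let ?K = "k + k'"
  have cl: "e (Suc m) \<in> carrier (X (Suc m))" "b \<in> carrier (X (Suc m))" "?e \<in> carrier (X (Suc m))" "?b \<in> carrier (X (Suc m))"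
   using e1 b e2 b2 Y.mcomp_closed by blast+
  have d': "?d + int p * int k' + 1 = D + int (n - m) + int p * int ?K"
   using m by (simp add: algebra_simps Suc_diff_Suc)
  have "A m (?d + int p * int k' + 1) (y \<cdot>[X m] w (Suc m)) = A m (?d + int p * int k') y \<cdot>[X (Suc m)] w (Suc m)"
   by (rule A_w[OF degree_le[OF dd] _ y(1)]) (use m in simp_all)
  also have "\<dots> = (?e \<ominus>\<^bsub>X (Suc m)\<^esub> ?b) \<cdot>[X (Suc m)] w (Suc m) \<cdot>[X (Suc m)] (\<gamma> [^] k')"
   unfolding y(2) by (rule ract_pow_comm[symmetric, OF Y.graded_right_module_axioms Y.mcomp_closed[OF eb]])
  also have "(?e \<ominus>\<^bsub>X (Suc m)\<^esub> ?b) \<cdot>[X (Suc m)] w (Suc m) = ?e \<cdot>[X (Suc m)] w (Suc m)"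
   using cl ract_w_w[OF Y.graded_right_module_axioms cl(2), of "Suc m"]
   by (simp add: Y.M.minus_eq Y.add_ract Y.minus_ract Y.ract_closed)
  also have "\<dots> = e (Suc m) \<cdot>[X (Suc m)] w (Suc m) \<cdot>[X (Suc m)] (\<gamma> [^] k)"
   by (rule ract_pow_comm[symmetric, OF Y.graded_right_module_axioms cl(1)])
  also have "\<dots> \<cdot>[X (Suc m)] (\<gamma> [^] k') = e (Suc m) \<cdot>[X (Suc m)] w (Suc m) \<cdot>[X (Suc m)] (\<gamma> [^] ?K)"
   by (rule ract_pow_pow[OF Y.graded_right_module_axioms]) (use cl in \<open>simp add: Y.ract_closed\<close>)
  also have "\<dots> = A m (D + int (n - m)) (e m) \<cdot>[X (Suc m)] (\<gamma> [^] ?K)"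
   using c'(3)[of m] m by simp
  also have "\<dots> = A m (D + int (n - m) + int p * int ?K) (e m \<cdot>[X m] (\<gamma> [^] ?K))"
   by (rule A_pow[symmetric, OF _ _ e1(2)]) (use D m in simp_all)
  finally have yy: "A m (D + int (n - m) + int p * int ?K) (y \<cdot>[X m] w (Suc m))
    = A m (D + int (n - m) + int p * int ?K) (e m \<cdot>[X m] (\<gamma> [^] ?K))" unfolding d' .
  have yw: "y \<cdot>[X m] w (Suc m) \<in> mcomp (X m) (D + int (n - m) + int p * int ?K)"
   using X.ract_mcomp[OF y(1) w] unfolding d' .
  have em: "e m \<cdot>[X m] (\<gamma> [^] ?K) \<in> mcomp (X m) (D + int (n - m) + int p * int ?K)"
   by (rule ract_pow_mcomp[OF X.graded_right_module_axioms e1(2)])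
  have "A m (D + int (n - m) + int p * int ?K) (e m \<cdot>[X m] (\<gamma> [^] ?K) \<ominus>\<^bsub>X m\<^esub> (y \<cdot>[X m] w (Suc m))) = \<zero>[X (Suc m)]"
   using A_minus[OF DD _ em yw] Y.mcomp_closed[OF A_deg[OF DD _ em]] m(1) yy by (simp add: Y.minus_eq_zero)
  moreover have "?d + int p * int k' = D + int p * int ?K + int (n - m) - 1"
   using d' by simp
  moreover have "D + int (n - m) + int p * int ?K = D + int p * int ?K + int (n - m)" by simp
  ultimately have "?P m ?K y" using y(1) by metis
  then show ?case unfolding m_def[symmetric] by blast
 qed
 from this[of n] obtain k b where b: "b \<in> mcomp (X 0) (D + int p * int k + int n - 1)"
  "A 0 (D + int p * int k + int n) (e 0 \<cdot>[X 0] (\<gamma> [^] k) \<ominus>\<^bsub>X 0\<^esub> (b \<cdot>[X 0] w 1)) = \<zero>[X 1]" by auto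
 interpret X: graded_right_module S "X 0" by (rule Xm) simp
 let ?d = "D + int p * int k + int n"
 have e0: "e 0 \<cdot>[X 0] (\<gamma> [^] k) \<in> mcomp (X 0) ?d"
  using ract_pow_mcomp[OF X.graded_right_module_axioms c'(1)[of 0], of k] by (simp add: ac_simps)
 have bw: "b \<cdot>[X 0] w 1 \<in> mcomp (X 0) ?d" using X.ract_mcomp[OF b(1) w] by simp
 have m: "e 0 \<cdot>[X 0] (\<gamma> [^] k) \<ominus>\<^bsub>X 0\<^esub> (b \<cdot>[X 0] w 1) \<in> mcomp (X 0) ?d"
  unfolding X.M.minus_eq by (intro X.MG.comp_add X.MG.comp_minus e0 bw)
 have cl: "e 0 \<in> carrier (X 0)" "b \<in> carrier (X 0)"
  using X.mcomp_closed[OF c'(1)[of 0]] X.mcomp_closed[OF b(1)] by simp_all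
 obtain k' where "(e 0 \<cdot>[X 0] (\<gamma> [^] k) \<ominus>\<^bsub>X 0\<^esub> (b \<cdot>[X 0] w 1)) \<cdot>[X 0] (\<gamma> [^] (k'::nat)) = \<zero>[X 0]"
  using A_inj[OF _ m b(2)] degree_le[OF D, of k] by auto
 then have "e 0 \<cdot>[X 0] (\<gamma> [^] k) \<cdot>[X 0] (\<gamma> [^] k') = b \<cdot>[X 0] w 1 \<cdot>[X 0] (\<gamma> [^] k')"
  using cl by (simp add: X.M.minus_eq X.add_ract X.minus_ract X.ract_closed)
   (simp add: X.M.minus_eq[symmetric] X.minus_eq_zero X.ract_closed)
 then have "e 0 \<cdot>[X 0] (\<gamma> [^] (k + k')) = b \<cdot>[X 0] (\<gamma> [^] k') \<cdot>[X 0] w 1"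
  unfolding ract_pow_pow[OF X.graded_right_module_axioms cl(1)] ract_pow_comm[OF X.graded_right_module_axioms cl(2)] .
 moreover have "b \<cdot>[X 0] (\<gamma> [^] k') \<in> mcomp (X 0) (D + int p * int (k + k') + int n - 1)"
  using ract_pow_mcomp[OF X.graded_right_module_axioms b(1), of k'] by (simp add: algebra_simps)
 ultimately show ?thesis by blast
qed

text \<open>The difference of the two chains is a chain over 0.\<close>

lemma chain_unique:
 assumes D: "D0 \<le> D" and c: "chain w n X A 0 D t e" and c': "chain w n X A 0 D t e'"
 shows "\<exists>k. \<exists>b\<in>mcomp (X 0) (D + int p * int k + int n - 1).
  e 0 \<cdot>[X 0] (\<gamma> [^] k) = e' 0 \<cdot>[X 0] (\<gamma> [^] k) \<oplus>[X 0] b \<cdot>[X 0] w 1"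
proof -
 interpret Y: graded_right_module S "X (Suc n)" by (rule Xm) simp
 interpret X: graded_right_module S "X 0" by (rule Xm) simp
 have e: "e 0 \<in> carrier (X 0)" "e' 0 \<in> carrier (X 0)"
  using X.mcomp_closed chainD(1)[OF c, of 0] chainD(1)[OF c', of 0] by simp_all
 have "t \<in> carrier (X (Suc n))"
  using Y.mcomp_closed[OF A_deg[OF D order_refl]] chainD(1)[OF c, of n] chainD(2)[OF c] by auto
 then have "t \<ominus>\<^bsub>X (Suc n)\<^esub> t = \<zero>[X (Suc n)]" by (simp add: Y.minus_eq_zero)
 with chain_diff[OF D c c'] chain_zero[OF D] obtain k b where b: "b \<in> mcomp (X 0) (D + int p * int k + int n - 1)"
  "(e 0 \<ominus>\<^bsub>X 0\<^esub> e' 0) \<cdot>[X 0] (\<gamma> [^] k) = b \<cdot>[X 0] w 1" by fastforce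
 have bc: "b \<cdot>[X 0] w 1 \<in> carrier (X 0)" using X.mcomp_closed[OF b(1)] by (simp add: X.ract_closed)
 have "e 0 = (e 0 \<ominus>\<^bsub>X 0\<^esub> e' 0) \<oplus>[X 0] e' 0" using e by (simp add: X.M.minus_eq X.M.a_assoc X.M.l_neg)
 then have "e 0 \<cdot>[X 0] (\<gamma> [^] k) = ((e 0 \<ominus>\<^bsub>X 0\<^esub> e' 0) \<oplus>[X 0] e' 0) \<cdot>[X 0] (\<gamma> [^] k)" by simp
 also have "\<dots> = b \<cdot>[X 0] w 1 \<oplus>[X 0] e' 0 \<cdot>[X 0] (\<gamma> [^] k)"
  using e b(2) by (simp add: X.add_ract)
 finally have "e 0 \<cdot>[X 0] (\<gamma> [^] k) = e' 0 \<cdot>[X 0] (\<gamma> [^] k) \<oplus>[X 0] b \<cdot>[X 0] w 1"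
  using e bc by (simp add: X.M.a_comm X.ract_closed)
 then show ?thesis using b(1) by blast
qed

end

section \<open>Uniqueness of the invariant and invariance under morphisms\<close>

lemma degree_large:
 assumes "0 < (p::nat)"
 shows "\<exists>K::nat. \<forall>k\<ge>K. D0 \<le> (D::int) + int p * int k"
proof (intro exI[of _ "nat (D0 - D)"] allI impI)
 fix k assume k: "nat (D0 - D) \<le> k"
 have "int k \<le> int p * int k" using assms by (simp add: mult_le_cancel_right1)
 then show "D0 \<le> D + int p * int k" using k by linarith
qed

lemma eventually_nat_max:
 assumes "\<exists>K::nat. \<forall>k\<ge>K. P k" "\<exists>K::nat. \<forall>k\<ge>K. Q k"
 shows "\<exists>K::nat. \<forall>k\<ge>K. P k \<and> Q k"
proof -
 obtain K L where "\<forall>k\<ge>K. P k" "\<forall>k\<ge>L. Q k" using assms by (elim exE)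
 then show ?thesis by (intro exI[of _ "max K L"]) simp
qed

context chain_data
begin

text \<open>At a common large k both values are ends of chains over the same element t \<gamma>^k,
  and such ends differ by a multiple of w 1 after a further power of \<gamma>.\<close>

lemma realizes_unique:
 assumes p: "0 < p" and r: "realizes S \<gamma> p w n X A D t v" and r': "realizes S \<gamma> p w n X A D t v'"
  and v: "v \<in> carrier (X 0)" "v' \<in> carrier (X 0)"
 shows "\<exists>k b. b \<in> carrier (X 0) \<and> v \<cdot>[X 0] (\<gamma> [^] (k::nat)) = v' \<cdot>[X 0] (\<gamma> [^] k) \<oplus>[X 0] b \<cdot>[X 0] w 1"
proof -
 interpret X: graded_right_module S "X 0" by (rule Xm) simp
 note Xg = X.graded_right_module_axioms
 from eventually_nat_max[OF degree_large[OF p, of D0 D] eventually_nat_max[OF r[unfolded realizes_def] r'[unfolded realizes_def]]]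
 obtain K where K: "\<forall>k\<ge>K. D0 \<le> D + int p * int k \<and> lifts_to S \<gamma> p w n X A D t v k \<and> lifts_to S \<gamma> p w n X A D t v' k"
  by (elim exE)
 from mp[OF spec[OF K] order_refl, unfolded lifts_to_def] obtain e b e' b' where D: "D0 \<le> D + int p * int K"
  and b: "b \<in> mcomp (X 0) (D + int p * int K + int n - 1)" and b': "b' \<in> mcomp (X 0) (D + int p * int K + int n - 1)"
  and c: "chain w n X A 0 (D + int p * int K) (t \<cdot>[X (Suc n)] (\<gamma> [^] K)) e"
  and c': "chain w n X A 0 (D + int p * int K) (t \<cdot>[X (Suc n)] (\<gamma> [^] K)) e'"
  and e: "e 0 = (v \<cdot>[X 0] (\<gamma> [^] K)) \<oplus>[X 0] (b \<cdot>[X 0] w 1)"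
  and e': "e' 0 = (v' \<cdot>[X 0] (\<gamma> [^] K)) \<oplus>[X 0] (b' \<cdot>[X 0] w 1)" by (elim exE conjE)
 from chain_unique[OF D c c'] obtain l a where
  a: "a \<in> mcomp (X 0) (D + int p * int K + int p * int l + int n - 1)"
  and ea: "e 0 \<cdot>[X 0] (\<gamma> [^] l) = e' 0 \<cdot>[X 0] (\<gamma> [^] l) \<oplus>[X 0] a \<cdot>[X 0] w 1" by (elim exE bexE)
 have bc: "b \<in> carrier (X 0)" "b' \<in> carrier (X 0)" "a \<in> carrier (X 0)"
  using b b' a X.mcomp_closed by blast+
 let ?b = "b \<cdot>[X 0] (\<gamma> [^] l)" and ?b' = "b' \<cdot>[X 0] (\<gamma> [^] l)"
 have bl: "?b \<in> carrier (X 0)" "?b' \<in> carrier (X 0)" using bc by (simp_all add: X.ract_closed)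
 have 1: "e 0 \<cdot>[X 0] (\<gamma> [^] l) = v \<cdot>[X 0] (\<gamma> [^] (K + l)) \<oplus>[X 0] ?b \<cdot>[X 0] w 1"
  unfolding e ract_pow_pow[OF Xg v(1), symmetric] ract_pow_comm[OF Xg bc(1), symmetric]
  using v bc by (simp add: X.add_ract X.ract_closed)
 have 2: "e' 0 \<cdot>[X 0] (\<gamma> [^] l) = v' \<cdot>[X 0] (\<gamma> [^] (K + l)) \<oplus>[X 0] ?b' \<cdot>[X 0] w 1"
  unfolding e' ract_pow_pow[OF Xg v(2), symmetric] ract_pow_comm[OF Xg bc(2), symmetric]
  using v bc by (simp add: X.add_ract X.ract_closed)
 let ?V = "v \<cdot>[X 0] (\<gamma> [^] (K + l))" and ?V' = "v' \<cdot>[X 0] (\<gamma> [^] (K + l))"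
 let ?B = "(?b' \<oplus>[X 0] a) \<ominus>\<^bsub>X 0\<^esub> ?b"
 have cl: "?V \<in> carrier (X 0)" "?V' \<in> carrier (X 0)" "?b \<cdot>[X 0] w 1 \<in> carrier (X 0)"
  "?b' \<cdot>[X 0] w 1 \<in> carrier (X 0)" "a \<cdot>[X 0] w 1 \<in> carrier (X 0)"
  using v bl bc by (simp_all add: X.ract_closed)
 have "?B \<cdot>[X 0] w 1 = (?b' \<cdot>[X 0] w 1 \<oplus>[X 0] a \<cdot>[X 0] w 1) \<ominus>\<^bsub>X 0\<^esub> ?b \<cdot>[X 0] w 1"
  using bl bc by (simp add: X.M.minus_eq X.add_ract X.minus_ract)
 moreover have "?V \<oplus>[X 0] ?b \<cdot>[X 0] w 1 = ?V' \<oplus>[X 0] ?b' \<cdot>[X 0] w 1 \<oplus>[X 0] a \<cdot>[X 0] w 1"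
  using ea unfolding 1 2 .
 moreover have "x = x' \<oplus>[X 0] ((y' \<oplus>[X 0] z) \<ominus>\<^bsub>X 0\<^esub> y)"
  if "x \<oplus>[X 0] y = x' \<oplus>[X 0] y' \<oplus>[X 0] z" and c: "x \<in> carrier (X 0)" "x' \<in> carrier (X 0)" "y \<in> carrier (X 0)"
   "y' \<in> carrier (X 0)" "z \<in> carrier (X 0)" for x x' y y' z
 proof -
  have "x = (x \<oplus>[X 0] y) \<oplus>[X 0] \<ominus>\<^bsub>X 0\<^esub> y" using c by (simp add: X.M.a_assoc X.M.r_neg)
  then show ?thesis unfolding that(1) using c by (simp add: X.M.minus_eq X.M.a_assoc)
 qed
 ultimately have "?V = ?V' \<oplus>[X 0] ?B \<cdot>[X 0] w 1" using cl by metis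
 moreover have "?B \<in> carrier (X 0)" using bl bc by simp
 ultimately show ?thesis by blast
qed

end

text \<open>A morphism of complexes in degree d that is the identity at both ends. Linearity is
  recorded for elements of degree 1, the degree of the w i.\<close>

definition chain_map where
 "chain_map S n X A X' A' H d \<longleftrightarrow>
   (\<forall>i\<le>Suc n. \<forall>x\<in>mcomp (X i) d. H i d x \<in> mcomp (X' i) d) \<and>
   (\<forall>i\<le>n. \<forall>x\<in>mcomp (X i) d. H (Suc i) d (A i d x) = A' i d (H i d x)) \<and>
   (\<forall>i\<le>Suc n. \<forall>x\<in>mcomp (X i) d. \<forall>s\<in>hcomp S 1. H i (d + 1) (x \<cdot>[X i] s) = H i d x \<cdot>[X' i] s) \<and>
   (\<forall>x\<in>mcomp (X 0) d. H 0 d x = x) \<and> (\<forall>x\<in>mcomp (X (Suc n)) d. H (Suc n) d x = x)"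

lemma chain_mapD:
 assumes "chain_map S n X A X' A' H d"
 shows "i \<le> Suc n \<Longrightarrow> x \<in> mcomp (X i) d \<Longrightarrow> H i d x \<in> mcomp (X' i) d"
  and "i \<le> n \<Longrightarrow> x \<in> mcomp (X i) d \<Longrightarrow> H (Suc i) d (A i d x) = A' i d (H i d x)"
  and "i \<le> Suc n \<Longrightarrow> x \<in> mcomp (X i) d \<Longrightarrow> s \<in> hcomp S 1 \<Longrightarrow> H i (d + 1) (x \<cdot>[X i] s) = H i d x \<cdot>[X' i] s"
  and "x \<in> mcomp (X 0) d \<Longrightarrow> H 0 d x = x" and "x \<in> mcomp (X (Suc n)) d \<Longrightarrow> H (Suc n) d x = x"
proof -
 note c = assms[unfolded chain_map_def]
 show "i \<le> Suc n \<Longrightarrow> x \<in> mcomp (X i) d \<Longrightarrow> H i d x \<in> mcomp (X' i) d"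
  by (rule c[THEN conjunct1, rule_format])
 show "i \<le> n \<Longrightarrow> x \<in> mcomp (X i) d \<Longrightarrow> H (Suc i) d (A i d x) = A' i d (H i d x)"
  by (rule c[THEN conjunct2, THEN conjunct1, rule_format])
 show "i \<le> Suc n \<Longrightarrow> x \<in> mcomp (X i) d \<Longrightarrow> s \<in> hcomp S 1 \<Longrightarrow> H i (d + 1) (x \<cdot>[X i] s) = H i d x \<cdot>[X' i] s"
  by (rule c[THEN conjunct2, THEN conjunct2, THEN conjunct1, rule_format])
 show "x \<in> mcomp (X 0) d \<Longrightarrow> H 0 d x = x"
  by (rule c[THEN conjunct2, THEN conjunct2, THEN conjunct2, THEN conjunct1, rule_format])
 show "x \<in> mcomp (X (Suc n)) d \<Longrightarrow> H (Suc n) d x = x"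
  by (rule c[THEN conjunct2, THEN conjunct2, THEN conjunct2, THEN conjunct2, rule_format])
qed

lemma chain_push:
 assumes X: "chain_data S F \<gamma> p w n X A D0" and c: "chain w n X A 0 D t e" and D: "D0 \<le> D"
  and H: "\<And>d. D \<le> d \<Longrightarrow> chain_map S n X A X' A' H d"
 shows "chain w n X' A' 0 D t (\<lambda>i. H i (D + int (n - i)) (e i))"
proof -
 interpret X: chain_data S F \<gamma> p w n X A D0 by (rule X)
 note c' = X.chainD[OF c]
 note h = chain_mapD[OF H]
 have en: "e n \<in> mcomp (X n) D" using c'(1)[of n] by simp
 show ?thesis unfolding chain_def
 proof (intro conjI allI impI)
  show "H i (D + int (n - i)) (e i) \<in> mcomp (X' i) (D + int (n - i))" if "0 \<le> i" "i \<le> n" for i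
   by (rule h(1)[OF _ _ c'(1)[OF that]]) (use that in simp_all)
  have "A' n D (H n D (e n)) = H (Suc n) D (A n D (e n))"
   by (rule h(2)[symmetric, OF order_refl order_refl en])
  also have "\<dots> = t" unfolding c'(2) by (rule h(5)[OF order_refl]) (use X.A_deg[OF D order_refl en] c'(2) in simp)
  finally show "A' n D (H n (D + int (n - n)) (e n)) = t" by simp
  fix i assume i: "0 \<le> i" "i < n"
  have d: "D + int (n - i) = D + int (n - Suc i) + 1" using i by (simp add: Suc_diff_Suc)
  have "A' i (D + int (n - i)) (H i (D + int (n - i)) (e i)) = H (Suc i) (D + int (n - i)) (A i (D + int (n - i)) (e i))"
   by (rule h(2)[symmetric, OF _ _ c'(1)[OF i(1)]]) (use i in simp_all)
  also have "\<dots> = H (Suc i) (D + int (n - Suc i)) (e (Suc i)) \<cdot>[X' (Suc i)] w (Suc i)"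
   unfolding c'(3)[OF i] unfolding d by (rule h(3)[OF _ _ c'(1) X.w]) (use i in simp_all)
  finally show "A' i (D + int (n - i)) (H i (D + int (n - i)) (e i)) = H (Suc i) (D + int (n - Suc i)) (e (Suc i)) \<cdot>[X' (Suc i)] w (Suc i)" .
 qed
qed

text \<open>Forwards, a chain is pushed along the morphism. A morphism has no inverse in general, so
  backwards a chain is constructed in X by exactness; its image in X' has the same end and differs
  from the given chain by a multiple of w 1 there. Hence the chain in X already ends in v up to such
  a multiple.\<close>

lemma realizes_transfer:
 assumes X: "chain_data S F \<gamma> p w n X A D0" and X': "chain_data S F \<gamma> p w n X' A' D0'"
  and p: "0 < p" and ends: "X' 0 = X 0" "X' (Suc n) = X (Suc n)"
  and H: "\<forall>\<^sub>F d in at_top. chain_map S n X A X' A' H d"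
  and t: "t \<in> mcomp (X (Suc n)) D" "t \<cdot>[X (Suc n)] w n = \<zero>[X (Suc n)]" and v: "v \<in> carrier (X 0)"
 shows "realizes S \<gamma> p w n X A D t v \<longleftrightarrow> realizes S \<gamma> p w n X' A' D t v"
proof -
 interpret C: chain_data S F \<gamma> p w n X A D0 by (rule X)
 interpret C': chain_data S F \<gamma> p w n X' A' D0' by (rule X')
 interpret N: graded_right_module S "X 0" by (rule C.Xm) simp
 interpret M: graded_right_module S "X (Suc n)" by (rule C.Xm) simp
 note Ng = N.graded_right_module_axioms and Mg = M.graded_right_module_axioms
 have tc: "t \<in> carrier (X (Suc n))" by (rule M.mcomp_closed[OF t(1)])
 obtain Dh where Dh: "\<And>d. Dh \<le> d \<Longrightarrow> chain_map S n X A X' A' H d"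
  using H unfolding eventually_at_top_linorder by blast
 obtain K where K: "\<And>k. K \<le> k \<Longrightarrow> max D0 (max D0' Dh) \<le> D + int p * int k"
  using degree_large[OF p, of "max D0 (max D0' Dh)" D] by blast
 have H0: "H 0 d x = x" if "Dh \<le> d" "x \<in> mcomp (X 0) d" for d x
  by (rule chain_mapD(4)[OF Dh[OF that(1)] that(2)])
 have push: "chain w n X' A' 0 d s (\<lambda>i. H i (d + int (n - i)) (e i)) \<and> H 0 (d + int (n - 0)) (e 0) = e 0"
  if c: "chain w n X A 0 d s e" and d: "max D0 (max D0' Dh) \<le> d" for d s e
 proof
  show "chain w n X' A' 0 d s (\<lambda>i. H i (d + int (n - i)) (e i))"
   by (rule chain_push[OF X c _ Dh]) (use d in auto)
  show "H 0 (d + int (n - 0)) (e 0) = e 0"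
   by (rule H0[OF _ C.chainD(1)[OF c]]) (use d in auto)
 qed
 show ?thesis
 proof
  assume "realizes S \<gamma> p w n X A D t v"
  then obtain k0 where k0: "\<forall>k\<ge>k0. lifts_to S \<gamma> p w n X A D t v k" unfolding realizes_def by (elim exE)
  show "realizes S \<gamma> p w n X' A' D t v" unfolding realizes_def
  proof (intro exI[of _ "max k0 K"] allI impI)
   fix k assume k: "max k0 K \<le> k"
   then have "lifts_to S \<gamma> p w n X A D t v k" using k0 by simp
   then obtain e b where eb: "b \<in> mcomp (X 0) (D + int p * int k + int n - 1)"
    "chain w n X A 0 (D + int p * int k) (t \<cdot>[X (Suc n)] (\<gamma> [^]\<^bsub>S\<^esub> k)) e"
    "e 0 = (v \<cdot>[X 0] (\<gamma> [^]\<^bsub>S\<^esub> k)) \<oplus>[X 0] (b \<cdot>[X 0] w 1)"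
    unfolding lifts_to_def by (elim exE conjE)
   from push[OF eb(2) K] k eb
   show "lifts_to S \<gamma> p w n X' A' D t v k" unfolding lifts_to_def ends
    by (intro exI[of _ "\<lambda>i. H i (D + int p * int k + int (n - i)) (e i)"] exI[of _ b]) simp
  qed
 next
  assume "realizes S \<gamma> p w n X' A' D t v"
  then obtain k0 where k0: "\<forall>k\<ge>k0. lifts_to S \<gamma> p w n X' A' D t v k" unfolding realizes_def by (elim exE)
  \<comment> \<open>Large enough for the given chains in X' to exist and for all degrees to be in
    the range of both complexes and of H.\<close>
  define k1 where "k1 = max k0 K"
  let ?D1 = "D + int p * int k1"
  have D1: "D0 \<le> ?D1" using K[of k1] by (simp add: k1_def)
  have t1: "t \<cdot>[X (Suc n)] (\<gamma> [^]\<^bsub>S\<^esub> k1) \<in> mcomp (X (Suc n)) ?D1" by (rule C.ract_pow_mcomp[OF Mg t(1)])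
  have t1w: "t \<cdot>[X (Suc n)] (\<gamma> [^]\<^bsub>S\<^esub> k1) \<cdot>[X (Suc n)] w n = \<zero>[X (Suc n)]"
   unfolding C.ract_pow_comm[OF Mg tc, symmetric] t(2) by (simp add: M.zero_ract)
  obtain k2 e where "chain w n X A 0 (?D1 + int p * int k2) (t \<cdot>[X (Suc n)] (\<gamma> [^]\<^bsub>S\<^esub> k1) \<cdot>[X (Suc n)] (\<gamma> [^]\<^bsub>S\<^esub> k2)) e"
   using C.chain_exists[OF D1 t1 t1w] by (elim exE)
  define k3 where "k3 = k1 + k2"
  let ?D3 = "D + int p * int k3" and ?t3 = "t \<cdot>[X (Suc n)] (\<gamma> [^]\<^bsub>S\<^esub> k3)"
  have e: "chain w n X A 0 ?D3 ?t3 e"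
   using \<open>chain w n X A 0 (?D1 + int p * int k2) _ e\<close>
   unfolding k3_def C.ract_pow_pow[OF Mg tc] by (simp add: algebra_simps)
  have k3: "k0 \<le> k3" "K \<le> k3" by (simp_all add: k3_def k1_def)
  have D3: "max D0 (max D0' Dh) \<le> ?D3" by (rule K[OF k3(2)])
  obtain e' b' where b': "b' \<in> mcomp (X 0) (?D3 + int n - 1)" and e': "chain w n X' A' 0 ?D3 ?t3 e'"
   and e'0: "e' 0 = (v \<cdot>[X 0] (\<gamma> [^]\<^bsub>S\<^esub> k3)) \<oplus>[X 0] (b' \<cdot>[X 0] w 1)"
   using mp[OF spec[OF k0] k3(1), unfolded lifts_to_def ends] by (elim exE conjE)
  have "D0' \<le> ?D3" using D3 by simp
  \<comment> \<open>H is the identity on X 0, so the pushed chain still ends in e 0.\<close>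
  from C'.chain_unique[OF this conjunct1[OF push[OF e D3]] e', unfolded ends conjunct2[OF push[OF e D3]]]
  obtain l a where a: "a \<in> mcomp (X 0) (?D3 + int p * int l + int n - 1)"
   and ea: "e 0 \<cdot>[X 0] (\<gamma> [^]\<^bsub>S\<^esub> l) = e' 0 \<cdot>[X 0] (\<gamma> [^]\<^bsub>S\<^esub> l) \<oplus>[X 0] a \<cdot>[X 0] w 1" by (elim exE bexE)
  have bc: "b' \<in> carrier (X 0)" "a \<in> carrier (X 0)" using b' a N.mcomp_closed by blast+
  let ?b = "b' \<cdot>[X 0] (\<gamma> [^]\<^bsub>S\<^esub> l) \<oplus>[X 0] a"
  have bm: "?b \<in> mcomp (X 0) (?D3 + int p * int l + int n - 1)"
   using N.MG.comp_add[OF C.ract_pow_mcomp[OF Ng b', of l, THEN back_subst[of "\<lambda>d. _ \<in> mcomp (X 0) d"]] a] by simp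
  have e'l: "e' 0 \<cdot>[X 0] (\<gamma> [^]\<^bsub>S\<^esub> l) = v \<cdot>[X 0] (\<gamma> [^]\<^bsub>S\<^esub> (k3 + l)) \<oplus>[X 0] b' \<cdot>[X 0] (\<gamma> [^]\<^bsub>S\<^esub> l) \<cdot>[X 0] w 1"
   unfolding e'0 C.ract_pow_pow[OF Ng v, symmetric] C.ract_pow_comm[OF Ng bc(1), symmetric]
   using v bc by (simp add: N.add_ract N.ract_closed)
  have el: "e 0 \<cdot>[X 0] (\<gamma> [^]\<^bsub>S\<^esub> l) = v \<cdot>[X 0] (\<gamma> [^]\<^bsub>S\<^esub> (k3 + l)) \<oplus>[X 0] ?b \<cdot>[X 0] w 1"
   unfolding ea e'l using v bc by (simp add: N.add_ract N.ract_closed N.M.a_assoc)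
  define L where "L = k3 + l"
  show "realizes S \<gamma> p w n X A D t v" unfolding realizes_def
  proof (intro exI[of _ L] allI impI)
   fix k assume k: "L \<le> k"
   define j where "j = k - L"
   have kj: "k = k3 + (l + j)" "k = L + j" using k by (simp_all add: j_def L_def)
   let ?e = "\<lambda>i. e i \<cdot>[X i] (\<gamma> [^]\<^bsub>S\<^esub> (l + j))" and ?B = "?b \<cdot>[X 0] (\<gamma> [^]\<^bsub>S\<^esub> j)"
   have "chain w n X A 0 (?D3 + int p * int (l + j)) (?t3 \<cdot>[X (Suc n)] (\<gamma> [^]\<^bsub>S\<^esub> (l + j))) ?e"
    by (rule C.chain_mult[OF _ _ e]) (use D3 in simp_all)
   then have 1: "chain w n X A 0 (D + int p * int k) (t \<cdot>[X (Suc n)] (\<gamma> [^]\<^bsub>S\<^esub> k)) ?e"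
    unfolding C.ract_pow_pow[OF Mg tc] kj(1)[symmetric] by (simp add: kj(1) algebra_simps)
   have ec: "e 0 \<in> carrier (X 0)" using N.mcomp_closed C.chainD(1)[OF e, of 0] by simp
   have bC: "?b \<in> carrier (X 0)" by (rule N.mcomp_closed[OF bm])
   have "?e 0 = e 0 \<cdot>[X 0] (\<gamma> [^]\<^bsub>S\<^esub> l) \<cdot>[X 0] (\<gamma> [^]\<^bsub>S\<^esub> j)"
    by (rule C.ract_pow_pow[OF Ng ec, symmetric])
   also have "\<dots> = v \<cdot>[X 0] (\<gamma> [^]\<^bsub>S\<^esub> k) \<oplus>[X 0] ?B \<cdot>[X 0] w 1"
    unfolding el kj(2) L_def C.ract_pow_pow[OF Ng v, symmetric, of "k3 + l" j] C.ract_pow_comm[OF Ng bC, symmetric]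
    using v bC by (simp add: N.add_ract N.ract_closed)
   finally have 2: "?e 0 = v \<cdot>[X 0] (\<gamma> [^]\<^bsub>S\<^esub> k) \<oplus>[X 0] ?B \<cdot>[X 0] w 1" .
   have de: "D + int p * int k + int n - 1 = ?D3 + int p * int l + int n - 1 + int p * int j"
    by (simp add: kj(1) algebra_simps)
   have 3: "?B \<in> mcomp (X 0) (D + int p * int k + int n - 1)"
    unfolding de by (rule C.ract_pow_mcomp[OF Ng bm])
   show "lifts_to S \<gamma> p w n X A D t v k" unfolding lifts_to_def
    by (intro exI[of _ ?e] exI[of _ ?B] conjI 1 2 3)
  qed
 qed
qed

section \<open>Extensions in the quotient category\<close>

context std_algebra
begin

text \<open>The list d has the arrows 0 to n only, so the last object, of index n + 1, is not the
  domain of an entry and has to be given as M.\<close>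

definition ext_obj :: "nat \<Rightarrow> 's gmod \<Rightarrow> ('s gmod \<times> ('s gmod_arr \<times> 's gmod_arr) set \<times> 's gmod) list \<Rightarrow> nat \<Rightarrow> 's gmod" where
 "ext_obj n M d i = (if i = Suc n then M else Dom (qgr S) (d ! i))"

lemma extension_arrows:
 assumes "d \<in> extensions (qgr S) n M N" "i \<le> n"
 shows "d ! i \<in> QHom S (ext_obj n M d i) (ext_obj n M d (Suc i))"
proof (rule Arr_qgr)
 show "d ! i \<in> Arr (qgr S)" using assms by (auto simp: extensions_def)
 show "Dom (qgr S) (d ! i) = ext_obj n M d i" using assms(2) by (simp add: ext_obj_def)
 show "Cod (qgr S) (d ! i) = ext_obj n M d (Suc i)"
  using assms by (cases "i = n") (auto simp: extensions_def ext_obj_def exact_at_def)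
qed

text \<open>Only finitely many arrows are involved, so one bound D0 serves for all of them.
  Monomorphisms and exactness speak about multiples of large degree, among which are those by powers
  of \<gamma>.\<close>

lemma extension_chain_data:
 assumes d: "d \<in> extensions (qgr S) n M N" and p: "0 < p" and \<gamma>: "\<gamma> \<in> hcomp S (int p)"
  and w: "\<And>i. w i \<in> hcomp S 1" "\<And>i. w (Suc i) \<otimes> w i = \<zero>" "\<And>i. \<gamma> \<otimes> w i = w i \<otimes> \<gamma>"
 shows "\<exists>D0. chain_data S F \<gamma> p w n (ext_obj n M d) (\<lambda>i. qact (d ! i)) D0"
proof -
 let ?X = "ext_obj n M d" and ?A = "\<lambda>i. qact (d ! i)"
 note ar = extension_arrows[OF d]
 have Xm: "graded_right_module S (?X i)" if "i \<le> Suc n" for i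
  using hom_qgr_Obj(3)[OF ar[of i]] hom_qgr_Obj(4)[OF ar[of n]] that by (cases "i = Suc n") auto
 have all: "\<forall>\<^sub>F d in at_top. \<forall>i\<in>{..m}. P i d" if "\<And>i. i \<le> m \<Longrightarrow> \<forall>\<^sub>F d in at_top. P i d" for P :: "nat \<Rightarrow> int \<Rightarrow> bool" and m
  by (rule eventually_ball_finite) (use that in auto)
 have all': "\<forall>\<^sub>F d in at_top. \<forall>i\<in>{..<m}. P i d" if "\<And>i. i < m \<Longrightarrow> \<forall>\<^sub>F d in at_top. P i d" for P :: "nat \<Rightarrow> int \<Rightarrow> bool" and m
  by (rule eventually_ball_finite) (use that in auto)
 have ex: "exact_at (qgr S) (d ! i) (d ! Suc i)" if "i < n" for i using d that by (simp add: extensions_def)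
 have mono: "mono_arrow (qgr S) (d ! 0)" and epi: "epi_arrow (qgr S) (d ! n)" using d by (simp_all add: extensions_def)
 have E1: "\<forall>\<^sub>F d in at_top. \<forall>i\<in>{..n}. (\<forall>x\<in>mcomp (?X i) d. ?A i d x \<in> mcomp (?X (Suc i)) d) \<and>
   (\<forall>x\<in>mcomp (?X i) d. \<forall>y\<in>mcomp (?X i) d. ?A i d (x \<oplus>[?X i] y) = ?A i d x \<oplus>[?X (Suc i)] ?A i d y) \<and>
   (\<forall>x\<in>mcomp (?X i) d. \<forall>j\<ge>0. \<forall>s\<in>hcomp S j. ?A i (d + j) (x \<cdot>[?X i] s) = ?A i d x \<cdot>[?X (Suc i)] s)"
  (is "\<forall>\<^sub>F d in at_top. ?P1 d")
  by (rule all) (rule qact_evhom[OF ar, unfolded evhom_def])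
 have E2: "\<forall>\<^sub>F e in at_top. \<forall>i\<in>{..n}. \<forall>x\<in>mcomp (?X i) e. \<forall>y\<in>mcomp (?X i) e. ?A i e (x \<ominus>\<^bsub>?X i\<^esub> y) = ?A i e x \<ominus>\<^bsub>?X (Suc i)\<^esub> ?A i e y"
  (is "\<forall>\<^sub>F d in at_top. ?P2 d")
  by (rule all) (rule evhom_minus[OF qact_evhom[OF ar] hom_qgr_Obj(3)[OF ar] hom_qgr_Obj(4)[OF ar]])
 have E3: "\<forall>\<^sub>F e in at_top. \<forall>i\<in>{..<n}. \<forall>x\<in>mcomp (?X (Suc i)) e. ?A (Suc i) e x = \<zero>[?X (Suc (Suc i))] \<longrightarrow>
   (\<forall>\<^sub>F e' in at_top. \<forall>s\<in>hcomp S (e' - e). x \<cdot>[?X (Suc i)] s \<in> ?A i e' ` mcomp (?X i) e')"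
  (is "\<forall>\<^sub>F d in at_top. ?P3 d")
 proof (rule all')
  fix i assume i: "i < n"
  show "\<forall>\<^sub>F e in at_top. \<forall>x\<in>mcomp (?X (Suc i)) e. ?A (Suc i) e x = \<zero>[?X (Suc (Suc i))] \<longrightarrow>
   (\<forall>\<^sub>F e' in at_top. \<forall>s\<in>hcomp S (e' - e). x \<cdot>[?X (Suc i)] s \<in> ?A i e' ` mcomp (?X i) e')"
   by (rule exact_qgrD(2)[OF ex[OF i] ar ar]) (use i in simp_all)
 qed
 have E4: "\<forall>\<^sub>F e in at_top. \<forall>x\<in>mcomp (?X 0) e. ?A 0 e x = \<zero>[?X (Suc 0)] \<longrightarrow>
   (\<forall>\<^sub>F e' in at_top. \<forall>s\<in>hcomp S (e' - e). x \<cdot>[?X 0] s = \<zero>[?X 0])"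
  (is "\<forall>\<^sub>F d in at_top. ?P4 d") by (rule mono_qgrD[OF mono ar[OF le0]])
 have E5: "\<forall>\<^sub>F e in at_top. mcomp (?X (Suc n)) e \<subseteq> ?A n e ` mcomp (?X n) e"
  (is "\<forall>\<^sub>F d in at_top. ?P5 d") by (rule epi_qgrD[OF epi ar[OF order_refl]])
 from iffD1[OF eventually_at_top_linorder, OF eventually_conj[OF E1 eventually_conj[OF E2 eventually_conj[OF E3 eventually_conj[OF E4 E5]]]]]
 obtain D0 where Dall: "\<forall>e\<ge>D0. ?P1 e \<and> ?P2 e \<and> ?P3 e \<and> ?P4 e \<and> ?P5 e" by (elim exE)
 have D: "?P1 e" "?P2 e" "?P3 e" "?P4 e" "?P5 e" if "D0 \<le> e" for e
  by (insert Dall[THEN spec, THEN mp, OF that], elim conjE, assumption)+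
 have \<gamma>c: "\<gamma> \<in> carrier S" using \<gamma> SG.comp_closed by blast
 have gp: "\<gamma> [^] k \<in> hcomp S (int p * int k)" for k :: nat
 proof (induction k)
  case 0 then show ?case by (simp add: one_hcomp)
 next
  case (Suc k)
  have "\<gamma> [^] k \<otimes> \<gamma> \<in> hcomp S (int p * int k + int p)" by (rule mult_hcomp[OF Suc \<gamma>])
  then show ?case by (simp add: algebra_simps)
 qed
 \<comment> \<open>The degree p k of \<gamma>^k is unbounded because p is positive.\<close>
 have some_power: "\<exists>k::nat. P (e + int p * int k) (\<gamma> [^] k)"
  if ev: "\<forall>\<^sub>F e' in at_top. \<forall>s\<in>hcomp S (e' - e). P e' s" for P e
 proof -
  obtain E where E: "\<forall>e'\<ge>E. \<forall>s\<in>hcomp S (e' - e). P e' s"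
   using iffD1[OF eventually_at_top_linorder ev] by (elim exE)
  obtain k where "E \<le> e + int p * int k" using degree_large[OF p, of E e] by blast
  then have "\<forall>s\<in>hcomp S (e + int p * int k - e). P (e + int p * int k) s" using E by blast
  then show ?thesis using gp[of k] by (intro exI[of _ k]) simp
 qed
 have "chain_data S F \<gamma> p w n ?X ?A D0"
 proof (intro chain_data.intro chain_data_axioms.intro std_algebra_axioms \<gamma> w Xm)
  fix e i x assume a: "D0 \<le> e" "i \<le> n" "x \<in> mcomp (?X i) e"
  show "?A i e x \<in> mcomp (?X (Suc i)) e" using D(1)[OF a(1)] a by simp
  fix s j assume s: "s \<in> hcomp S (int j)"
  show "?A i (e + int j) (x \<cdot>[?X i] s) = ?A i e x \<cdot>[?X (Suc i)] s" using D(1)[OF a(1)] a s by simp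
 next
  fix e i x y assume a: "D0 \<le> e" "i \<le> n" "x \<in> mcomp (?X i) e" "y \<in> mcomp (?X i) e"
  show "?A i e (x \<ominus>\<^bsub>?X i\<^esub> y) = ?A i e x \<ominus>\<^bsub>?X (Suc i)\<^esub> ?A i e y" using D(2)[OF a(1)] a by simp
 next
  fix e i x assume a: "D0 \<le> e" "i < n" "x \<in> mcomp (?X (Suc i)) e" "?A (Suc i) e x = \<zero>[?X (Suc (Suc i))]"
  have "\<forall>\<^sub>F e' in at_top. \<forall>s\<in>hcomp S (e' - e). x \<cdot>[?X (Suc i)] s \<in> ?A i e' ` mcomp (?X i) e'"
   using D(3)[OF a(1)] a(2-4) by simp
  from some_power[OF this] obtain k where
   "x \<cdot>[?X (Suc i)] (\<gamma> [^] (k::nat)) \<in> ?A i (e + int p * int k) ` mcomp (?X i) (e + int p * int k)" by (elim exE)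
  then obtain y where "y \<in> mcomp (?X i) (e + int p * int k)" "x \<cdot>[?X (Suc i)] (\<gamma> [^] (k::nat)) = ?A i (e + int p * int k) y"
   by (elim imageE)
  then show "\<exists>k. \<exists>y\<in>mcomp (?X i) (e + int p * int k). ?A i (e + int p * int k) y = x \<cdot>[?X (Suc i)] (\<gamma> [^] k)"
   by (intro exI[of _ k] bexI[of _ y]) simp_all
 next
  fix e x assume a: "D0 \<le> e" "x \<in> mcomp (?X 0) e" "?A 0 e x = \<zero>[?X 1]"
  have "\<forall>\<^sub>F e' in at_top. \<forall>s\<in>hcomp S (e' - e). x \<cdot>[?X 0] s = \<zero>[?X 0]" using D(4)[OF a(1)] a(2,3) by simp
  from some_power[OF this] show "\<exists>k. x \<cdot>[?X 0] (\<gamma> [^] (k::nat)) = \<zero>[?X 0]" .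
 next
  fix e t assume a: "D0 \<le> e" "t \<in> mcomp (?X (Suc n)) e"
  from subsetD[OF D(5)[OF a(1)] a(2)] show "\<exists>x\<in>mcomp (?X n) e. ?A n e x = t" by (elim imageE) auto
 qed
 then show ?thesis by blast
qed

lemma extension_morphism_chain_map:
 assumes "(d, d') \<in> extension_morphism (qgr S) n M N"
 shows "\<exists>H. \<forall>\<^sub>F e in at_top. chain_map S n (ext_obj n M d) (\<lambda>i. qact (d ! i)) (ext_obj n M d') (\<lambda>i. qact (d' ! i)) H e"
proof -
 from assms obtain h where d: "d \<in> extensions (qgr S) n M N" and d': "d' \<in> extensions (qgr S) n M N"
  and h0: "h 0 = Ident (qgr S) N" and hn: "h (n + 1) = Ident (qgr S) M"
  and h: "\<forall>i\<le>n. h i \<in> QHom S (Dom (qgr S) (d ! i)) (Dom (qgr S) (d' ! i)) \<and>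
         h (i + 1) \<star>[qgr S] (d ! i) = (d' ! i) \<star>[qgr S] h i"
  unfolding extension_morphism_def by blast
 let ?X = "ext_obj n M d" and ?X' = "ext_obj n M d'"
 note ar = extension_arrows[OF d] and ar' = extension_arrows[OF d']
 have N: "?X 0 = N" "?X' 0 = N" using d d' by (simp_all add: ext_obj_def extensions_def)
 have M: "?X (Suc n) = M" "?X' (Suc n) = M" by (simp_all add: ext_obj_def)
 have NO: "N \<in> Obj (gr S)" using hom_qgr_Obj(1)[OF ar[of 0]] N by simp
 have MO: "M \<in> Obj (gr S)" using hom_qgr_Obj(2)[OF ar[of n]] M by simp
 have hh: "h i \<in> QHom S (?X i) (?X' i)" if "i \<le> Suc n" for i
 proof (cases "i = Suc n")
  case True then show ?thesis using hn qgr_ident(1)[OF MO] M by simp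
 next
  case False then show ?thesis using h that by (simp add: ext_obj_def)
 qed
 have sq: "\<forall>\<^sub>F e in at_top. \<forall>x\<in>mcomp (?X i) e. qact (h (Suc i)) e (qact (d ! i) e x) = qact (d' ! i) e (qact (h i) e x)"
  if "i \<le> n" for i
 proof -
  have i: "i \<le> Suc n" "Suc i \<le> Suc n" using that by simp_all
  have "h (Suc i) \<star>[qgr S] (d ! i) = (d' ! i) \<star>[qgr S] h i" using h that by simp
  then have "eveq (?X i) (\<lambda>e x. qact (h (Suc i)) e (qact (d ! i) e x)) (\<lambda>e x. qact (d' ! i) e (qact (h i) e x))"
   using eveq_trans[OF eveq_sym[OF qgr_comp(2)[OF ar[OF that] hh[OF i(2)]]]] qgr_comp(2)[OF hh[OF i(1)] ar'[OF that]] by simp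
  then show ?thesis unfolding eveq_def .
 qed
 have "\<forall>\<^sub>F e in at_top. \<forall>i\<in>{..n}. \<forall>x\<in>mcomp (?X i) e. qact (h (Suc i)) e (qact (d ! i) e x) = qact (d' ! i) e (qact (h i) e x)"
  by (rule eventually_ball_finite) (use sq in auto)
 moreover have "\<forall>\<^sub>F e in at_top. \<forall>i\<in>{..Suc n}. (\<forall>x\<in>mcomp (?X i) e. qact (h i) e x \<in> mcomp (?X' i) e) \<and>
   (\<forall>x\<in>mcomp (?X i) e. \<forall>y\<in>mcomp (?X i) e. qact (h i) e (x \<oplus>[?X i] y) = qact (h i) e x \<oplus>[?X' i] qact (h i) e y) \<and>
   (\<forall>x\<in>mcomp (?X i) e. \<forall>j\<ge>0. \<forall>s\<in>hcomp S j. qact (h i) (e + j) (x \<cdot>[?X i] s) = qact (h i) e x \<cdot>[?X' i] s)"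
  by (rule eventually_ball_finite) (use qact_evhom[OF hh, unfolded evhom_def] in auto)
 moreover have "\<forall>\<^sub>F e in at_top. \<forall>x\<in>mcomp (?X 0) e. qact (h 0) e x = x"
  using qgr_ident(2)[OF NO] unfolding eveq_def N h0 .
 moreover have "\<forall>\<^sub>F e in at_top. \<forall>x\<in>mcomp (?X (Suc n)) e. qact (h (Suc n)) e x = x"
  using qgr_ident(2)[OF MO] hn unfolding eveq_def M by simp
 ultimately have "\<forall>\<^sub>F e in at_top. chain_map S n ?X (\<lambda>i. qact (d ! i)) ?X' (\<lambda>i. qact (d' ! i)) (\<lambda>i. qact (h i)) e"
  unfolding chain_map_def by eventually_elim simp
 then show ?thesis by blast
qed

text \<open>Realizing v is invariant under morphisms in either direction, hence along zigzags. If
  there were only one class, d' would realize both v and v', and \<open>realizes_unique\<close>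
  would contradict \<open>ne\<close>.\<close>

lemma yoneda_Ext_not_singleton:
 assumes d: "d \<in> extensions (qgr S) n M N" and d': "d' \<in> extensions (qgr S) n M N"
  and p: "0 < p" and \<gamma>: "\<gamma> \<in> hcomp S (int p)"
  and w: "\<And>i. w i \<in> hcomp S 1" "\<And>i. w (Suc i) \<otimes> w i = \<zero>" "\<And>i. \<gamma> \<otimes> w i = w i \<otimes> \<gamma>"
  and t: "t \<in> mcomp M D" "t \<cdot>[M] w n = \<zero>[M]" and v: "v \<in> carrier N" "v' \<in> carrier N"
  and r: "realizes S \<gamma> p w n (ext_obj n M d) (\<lambda>i. qact (d ! i)) D t v"
  and r': "realizes S \<gamma> p w n (ext_obj n M d') (\<lambda>i. qact (d' ! i)) D t v'"
  and ne: "\<And>k b. b \<in> carrier N \<Longrightarrow> v \<cdot>[N] (\<gamma> [^] (k::nat)) \<noteq> v' \<cdot>[N] (\<gamma> [^] k) \<oplus>[N] b \<cdot>[N] w 1"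
 shows "\<not> is_singleton (yoneda_Ext (qgr S) n M N)"
proof
 let ?E = "extension_morphism (qgr S) n M N"
 let ?R = "rtrancl (?E \<union> ?E\<inverse>)"
 let ?r = "\<lambda>c. realizes S \<gamma> p w n (ext_obj n M c) (\<lambda>i. qact (c ! i)) D t v"
 have N: "ext_obj n M c 0 = N" if "c \<in> extensions (qgr S) n M N" for c
  using that by (simp add: ext_obj_def extensions_def)
 have M: "ext_obj n M c (Suc n) = M" for c by (simp add: ext_obj_def)
 have cd: "\<exists>D0. chain_data S F \<gamma> p w n (ext_obj n M c) (\<lambda>i. qact (c ! i)) D0" if "c \<in> extensions (qgr S) n M N" for c
  by (rule extension_chain_data[OF that p \<gamma>]) (rule w)+
 have transfer: "?r a \<longleftrightarrow> ?r b" if ab: "(a, b) \<in> ?E" for a b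
 proof -
  have a: "a \<in> extensions (qgr S) n M N" and b: "b \<in> extensions (qgr S) n M N"
   using ab by (auto simp: extension_morphism_def)
  obtain Da Db where Da: "chain_data S F \<gamma> p w n (ext_obj n M a) (\<lambda>i. qact (a ! i)) Da"
   and Db: "chain_data S F \<gamma> p w n (ext_obj n M b) (\<lambda>i. qact (b ! i)) Db"
   using cd[OF a] cd[OF b] by (elim exE)
  obtain H where H: "\<forall>\<^sub>F e in at_top. chain_map S n (ext_obj n M a) (\<lambda>i. qact (a ! i)) (ext_obj n M b) (\<lambda>i. qact (b ! i)) H e"
   using extension_morphism_chain_map[OF ab] by (elim exE)
  show ?thesis
   by (rule realizes_transfer[OF Da Db p _ _ H]) (use t v N[OF a] N[OF b] M in simp_all)
 qed
 assume "is_singleton (yoneda_Ext (qgr S) n M N)"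
 then obtain c where c: "extensions (qgr S) n M N // ?R = {c}"
  unfolding yoneda_Ext_def by (auto simp: is_singleton_def)
 have "?R `` {d} \<in> {c}" "?R `` {d'} \<in> {c}" unfolding c[symmetric] using d d' by (auto intro: quotientI)
 then have "d' \<in> ?R `` {d}" by auto
 then have "(d, d') \<in> ?R" by simp
 then have "?r d'"
 proof (induction rule: rtrancl_induct)
  case base show ?case by (rule r)
 next
  case (step y z)
  then show ?case using transfer[of y z] transfer[of z y] by blast
 qed
 obtain D0 where D0: "chain_data S F \<gamma> p w n (ext_obj n M d') (\<lambda>i. qact (d' ! i)) D0"
  using cd[OF d'] by (elim exE)
 from chain_data.realizes_unique[OF D0 p \<open>?r d'\<close> r', unfolded N[OF d'], OF v] ne show False by blast
qed

end

section \<open>Exact sequences of modules seen in the quotient category\<close>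

context std_algebra
begin

lemma eveq_image:
 assumes "eveq X (qact \<alpha>) (\<lambda>d. fn f)"
 shows "\<forall>\<^sub>F d in at_top. qact \<alpha> d ` mcomp X d = fn f ` mcomp X d"
 using assms[unfolded eveq_def] by eventually_elim (intro image_cong refl, simp)

text \<open>The arrows \<alpha> and \<beta> are given only through their germs. The cokernel c of
  the first and the kernel m of the second are honest module maps, and all conditions are checked
  degree by degree.\<close>

lemma exact_qgr_of_gr:
 assumes c: "c \<in> Hom S X Q" and m: "m \<in> Hom S K X"
  and \<alpha>: "\<alpha> \<in> QHom S W X" "eveq W (qact \<alpha>) (\<lambda>d. fn f)"
  and \<beta>: "\<beta> \<in> QHom S X Y" "eveq X (qact \<beta>) (\<lambda>d. fn g)"
  and surj: "\<And>d. mcomp Q d \<subseteq> fn c ` mcomp X d"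
  and inj: "\<And>d. inj_on (fn m) (mcomp K d)"
  and cf: "\<And>d x. x \<in> mcomp X d \<Longrightarrow> fn c x = \<zero>[Q] \<longleftrightarrow> x \<in> fn f ` mcomp W d"
  and mc: "\<And>d x. x \<in> mcomp X d \<Longrightarrow> fn c x = \<zero>[Q] \<longleftrightarrow> x \<in> fn m ` mcomp K d"
  and mg: "\<And>d x. x \<in> mcomp X d \<Longrightarrow> fn g x = \<zero>[Y] \<longleftrightarrow> x \<in> fn m ` mcomp K d"
 shows "exact_at (qgr S) \<alpha> \<beta>"
proof -
 obtain c' where c': "c' \<in> QHom S X Q" "eveq X (qact c') (\<lambda>d. fn c)" by (rule qgr_of_gr[OF c])
 obtain m' where m': "m' \<in> QHom S K X" "eveq K (qact m') (\<lambda>d. fn m)" by (rule qgr_of_gr[OF m])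
 note ec = c'(2)[unfolded eveq_def] and em = m'(2)[unfolded eveq_def] and eb = \<beta>(2)[unfolded eveq_def]
 show ?thesis
 proof (rule exact_qgrI[OF c'(1) m'(1) \<alpha>(1) \<beta>(1)])
  show "\<forall>\<^sub>F d in at_top. mcomp Q d \<subseteq> qact c' d ` mcomp X d"
   using eveq_image[OF c'(2)] by eventually_elim (use surj in simp)
  show "\<forall>\<^sub>F d in at_top. inj_on (qact m' d) (mcomp K d)"
   using em by eventually_elim (use inj in \<open>simp cong: inj_on_cong\<close>)
  show "\<forall>\<^sub>F d in at_top. \<forall>x\<in>mcomp X d. qact c' d x = \<zero>[Q] \<longleftrightarrow> x \<in> qact \<alpha> d ` mcomp W d"
   using ec eveq_image[OF \<alpha>(2)] by eventually_elim (simp add: cf)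
  show "\<forall>\<^sub>F d in at_top. \<forall>x\<in>mcomp X d. qact c' d x = \<zero>[Q] \<longleftrightarrow> x \<in> qact m' d ` mcomp K d"
   using ec eveq_image[OF m'(2)] by eventually_elim (simp add: mc)
  show "\<forall>\<^sub>F d in at_top. \<forall>x\<in>mcomp X d. qact \<beta> d x = \<zero>[Y] \<longleftrightarrow> x \<in> qact m' d ` mcomp K d"
   using eb eveq_image[OF m'(2)] by eventually_elim (simp add: mg)
 qed
qed

lemma mono_qgr_of_gr:
 assumes \<alpha>: "\<alpha> \<in> QHom S X Y" "eveq X (qact \<alpha>) (\<lambda>d. fn f)" and inj: "\<And>d. inj_on (fn f) (mcomp X d)"
 shows "mono_arrow (qgr S) \<alpha>"
proof (rule mono_qgrI[OF \<alpha>(1)])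
 show "\<forall>\<^sub>F d in at_top. inj_on (qact \<alpha> d) (mcomp X d)"
  using \<alpha>(2)[unfolded eveq_def] by eventually_elim (use inj in \<open>simp cong: inj_on_cong\<close>)
qed

lemma epi_qgr_of_gr:
 assumes \<alpha>: "\<alpha> \<in> QHom S X Y" "eveq X (qact \<alpha>) (\<lambda>d. fn f)" and surj: "\<And>d. mcomp Y d \<subseteq> fn f ` mcomp X d"
 shows "epi_arrow (qgr S) \<alpha>"
proof (rule epi_qgrI[OF \<alpha>(1)])
 show "\<forall>\<^sub>F d in at_top. mcomp Y d \<subseteq> qact \<alpha> d ` mcomp X d"
  using eveq_image[OF \<alpha>(2)] by eventually_elim (use surj in simp)
qed

end

section \<open>Exact zero divisors\<close>

text \<open>Such a pair arises from a factorization \<open>f = u v = v u\<close> of a central regular element by passing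
 to the quotient by \<open>f\<close>.\<close>

locale exact_zero_divisors = std_algebra S F for S :: "('k::field, 's) graded_alg" (structure) and F +
 fixes u v h :: 's and p :: nat
 assumes u: "u \<in> hcomp S 1" and v: "v \<in> hcomp S 1" and h: "h \<in> hcomp S (int p)" and p: "0 < p"
  and uv: "u \<otimes> v = \<zero>" and vu: "v \<otimes> u = \<zero>"
  and ann_u: "s \<in> carrier S \<Longrightarrow> u \<otimes> s = \<zero> \<Longrightarrow> \<exists>b\<in>carrier S. s = v \<otimes> b"
  and ann_v: "s \<in> carrier S \<Longrightarrow> v \<otimes> s = \<zero> \<Longrightarrow> \<exists>b\<in>carrier S. s = u \<otimes> b"
  and hu: "h \<otimes> u = u \<otimes> h" and hv: "h \<otimes> v = v \<otimes> h"
begin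

definition W :: "nat \<Rightarrow> 's" where "W i = (if even i then v else u)"

text \<open>The shifts make the maps preserve degrees: left multiplication by W i sends P i = S(i)
  to P (i + 1) = S(i + 1), and I i is its image inside P (i + 1).\<close>

definition I :: "nat \<Rightarrow> 's gmod" where "I i = rideal S (W i) 1 (int i + 1)"

definition P :: "nat \<Rightarrow> 's gmod" where "P i = rideal S \<one> 0 (int i)"

lemma W_hcomp: "W i \<in> hcomp S 1" by (simp add: W_def u v)

lemma W_closed [simp]: "W i \<in> carrier S" by (rule SG.comp_closed[OF W_hcomp])

lemma WW: "W (Suc i) \<otimes> W i = \<zero>" by (simp add: W_def uv vu)

lemma W2: "W (Suc (Suc i)) = W i" by (simp add: W_def)

lemma hW: "h \<otimes> W i = W i \<otimes> h" by (simp add: W_def hu hv)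

lemma h_closed [simp]: "h \<in> carrier S" by (rule SG.comp_closed[OF h])

lemma hpow: "h [^] k \<in> hcomp S (int p * int k)"
proof (induction k)
 case 0 then show ?case by (simp add: one_hcomp)
next
 case (Suc k)
 have "h [^] k \<otimes> h \<in> hcomp S (int p * int k + int p)" by (rule mult_hcomp[OF Suc h])
 then show ?case by (simp add: algebra_simps)
qed

lemma hpow_W: "(h [^] (k::nat)) \<otimes> W i = W i \<otimes> (h [^] k)"
proof (induction k)
 case (Suc k)
 have "(h [^] Suc k) \<otimes> W i = (h [^] k) \<otimes> (W i \<otimes> h)" by (simp add: m_assoc hW)
 also have "\<dots> = W i \<otimes> (h [^] k) \<otimes> h" by (simp add: m_assoc[symmetric] Suc)
 finally show ?case by (simp add: m_assoc)
qed simp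

text \<open>The factor given by the annihilator condition need not be homogeneous, but its component
  of degree e - 1 has the same product with W i.\<close>

lemma ann_W:
 assumes s: "s \<in> hcomp S e" and z: "W (Suc i) \<otimes> s = \<zero>"
 shows "\<exists>b\<in>hcomp S (e - 1). s = W i \<otimes> b"
proof -
 have sc: "s \<in> carrier S" by (rule SG.comp_closed[OF s])
 have "\<exists>b\<in>carrier S. s = W i \<otimes> b"
  using ann_u[OF sc] ann_v[OF sc] z by (cases "even i") (simp_all add: W_def)
 then obtain b where b: "b \<in> carrier S" "s = W i \<otimes> b" by (elim bexE)
 have "s = cmp S (hcomp S) (W i \<otimes> b) e" using SG.cmp_homog[OF s, of e] b by simp
 also have "\<dots> = W i \<otimes> cmp S (hcomp S) b (e - 1)" by (rule cmp_mult_left[OF W_hcomp b(1)])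
 finally show ?thesis using SG.cmp_props(1)[OF b(1)] by (intro bexI[of _ "cmp S (hcomp S) b (e - 1)"])
qed

lemma mcomp_P: "x \<in> mcomp (P i) d \<longleftrightarrow> (\<exists>s\<in>hcomp S (d + int i). x = emb s)"
 using SG.comp_closed by (auto simp: P_def image_iff)

lemma mcomp_I: "x \<in> mcomp (I i) d \<longleftrightarrow> (\<exists>s\<in>hcomp S (d + int i). x = emb (W i \<otimes> s))"
 by (auto simp: I_def image_iff)

lemma carrier_I: "x \<in> carrier (I i) \<longleftrightarrow> (\<exists>s\<in>carrier S. x = emb (W i \<otimes> s))"
 by (auto simp: I_def image_iff)

lemma zero_PI [simp]: "\<zero>[P i] = emb \<zero>" "\<zero>[I i] = emb \<zero>"
 by (simp_all add: P_def I_def)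

lemma I_Obj: "I i \<in> Obj (gr S)" unfolding I_def by (rule rideal_Obj[OF W_hcomp])

text \<open>With z = 1 this is the inclusion of the image, with z = -1 its negative.\<close>

lemma inclusion:
 assumes z: "z \<in> hcomp S 0"
 shows "\<exists>f\<in>Hom S (I i) (P (Suc i)). \<forall>s\<in>carrier S. fn f (emb (W i \<otimes> s)) = emb (z \<otimes> (W i \<otimes> s))"
 unfolding I_def P_def
 by (rule rideal_hom[OF W_hcomp one_hcomp z, where b = "z \<otimes> W i"])
  (use mult_hcomp[OF z W_hcomp, of i] SG.comp_closed[OF z] in simp_all)

lemma projection:
 "\<exists>f\<in>Hom S (P i) (I i). \<forall>s\<in>carrier S. fn f (emb s) = emb (W i \<otimes> s)"
proof -
 have "\<exists>f\<in>Hom S (P i) (I i). \<forall>s\<in>carrier S. fn f (emb (\<one> \<otimes> s)) = emb (W i \<otimes> (\<one> \<otimes> s))"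
  unfolding I_def P_def
  by (rule rideal_hom[OF one_hcomp W_hcomp W_hcomp, where b = \<one>]) (use one_hcomp in simp_all)
 then show ?thesis by (elim bexE, intro bexI) simp_all
qed

lemma multiplication:
 "\<exists>f\<in>Hom S (P i) (P (Suc i)). \<forall>s\<in>carrier S. fn f (emb s) = emb (W i \<otimes> s)"
proof -
 have "\<exists>f\<in>Hom S (P i) (P (Suc i)). \<forall>s\<in>carrier S. fn f (emb (\<one> \<otimes> s)) = emb (W i \<otimes> (\<one> \<otimes> s))"
  unfolding P_def
  by (rule rideal_hom[OF one_hcomp one_hcomp W_hcomp, where b = "W i"]) (use W_hcomp in simp_all)
 then show ?thesis by (elim bexE, intro bexI) simp_all
qed

definition R :: "nat \<Rightarrow> nat \<Rightarrow> 's gmod" where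
 "R n i = (if i = 0 then I 0 else if i = Suc n then I n else P i)"

definition T :: "'s \<Rightarrow> nat \<Rightarrow> 's" where "T z i = (if i = 0 then z else W i)"

text \<open>The periodic resolution \<open>0 \<rightarrow> v S \<rightarrow> S \<rightarrow> \<dots> \<rightarrow> S \<rightarrow> W\<^sub>n S \<rightarrow> 0\<close>, whose first map is
 multiplied by the sign \<open>z\<close>.\<close>

lemma resolution_arrows:
 assumes n: "1 \<le> n" and i: "i \<le> n" and z: "z \<in> hcomp S 0"
 shows "\<exists>f\<in>Hom S (R n i) (R n (Suc i)). \<forall>d. \<forall>x\<in>mcomp (R n i) d. fn f x = emb (T z i \<otimes> unemb x)"
proof -
 have A: "\<exists>f\<in>Hom S (I 0) (P (Suc 0)). \<forall>d. \<forall>x\<in>mcomp (I 0) d. fn f x = emb (z \<otimes> unemb x)"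
  using inclusion[OF z, of 0] by (elim bexE, intro bexI) (auto simp: mcomp_I SG.comp_closed)
 have B: "\<exists>f\<in>Hom S (P i) (I i). \<forall>d. \<forall>x\<in>mcomp (P i) d. fn f x = emb (W i \<otimes> unemb x)"
  using projection[of i] by (elim bexE, intro bexI) (auto simp: mcomp_P SG.comp_closed)
 have C: "\<exists>f\<in>Hom S (P i) (P (Suc i)). \<forall>d. \<forall>x\<in>mcomp (P i) d. fn f x = emb (W i \<otimes> unemb x)"
  using multiplication[of i] by (elim bexE, intro bexI) (auto simp: mcomp_P SG.comp_closed)
 consider "i = 0" | "i \<noteq> 0" "i = n" | "i \<noteq> 0" "i \<noteq> n" by blast
 then show ?thesis
 proof cases
  case 1 then show ?thesis using A n by (simp add: R_def T_def)
 next
  case 2 then show ?thesis using B by (simp add: R_def T_def)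
 next
  case 3 then show ?thesis using C i by (simp add: R_def T_def)
 qed
qed

text \<open>Arrows of the quotient category are known by their germs, so the sequence is specified
  by requiring each germ to be left multiplication by \<open>T z i\<close>.\<close>

definition resolution where
 "resolution n z d \<longleftrightarrow> length d = Suc n \<and> (\<forall>i\<le>n. d ! i \<in> QHom S (R n i) (R n (Suc i)) \<and>
   (\<exists>f\<in>Hom S (R n i) (R n (Suc i)). eveq (R n i) (qact (d ! i)) (\<lambda>e. fn f) \<and>
    (\<forall>e. \<forall>x\<in>mcomp (R n i) e. fn f x = emb (T z i \<otimes> unemb x))))"

lemma resolutionD:
 assumes "resolution n z d" "i \<le> n"
 shows "\<exists>f :: 's gmod_arr. eveq (R n i) (qact (d ! i)) (\<lambda>e. fn f) \<and> (\<forall>e. \<forall>x\<in>mcomp (R n i) e. fn f x = emb (T z i \<otimes> unemb x))"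
proof -
 have "\<exists>f\<in>Hom S (R n i) (R n (Suc i)). eveq (R n i) (qact (d ! i)) (\<lambda>e. fn f) \<and>
    (\<forall>e. \<forall>x\<in>mcomp (R n i) e. fn f x = emb (T z i \<otimes> unemb x))"
  using assms by (simp add: resolution_def)
 then show ?thesis by (elim bexE) (rule exI)
qed

lemma resolution_exists:
 assumes n: "1 \<le> n" and z: "z \<in> hcomp S 0"
 shows "\<exists>d. resolution n z d"
proof -
 have "\<exists>\<alpha>. i \<le> n \<longrightarrow> \<alpha> \<in> QHom S (R n i) (R n (Suc i)) \<and>
   (\<exists>f\<in>Hom S (R n i) (R n (Suc i)). eveq (R n i) (qact \<alpha>) (\<lambda>e. fn f) \<and>
    (\<forall>e. \<forall>x\<in>mcomp (R n i) e. fn f x = emb (T z i \<otimes> unemb x)))" for i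
 proof (cases "i \<le> n")
  case True
  obtain f where f: "f \<in> Hom S (R n i) (R n (Suc i))"
   "\<forall>d. \<forall>x\<in>mcomp (R n i) d. fn f x = emb (T z i \<otimes> unemb x)" using resolution_arrows[OF n True z] by (elim bexE)
  obtain \<alpha> where \<alpha>: "\<alpha> \<in> QHom S (R n i) (R n (Suc i))" "eveq (R n i) (qact \<alpha>) (\<lambda>d. fn f)" by (rule qgr_of_gr[OF f(1)])
  show ?thesis by (intro exI[of _ \<alpha>] impI conjI bexI[of _ f] \<alpha> f)
 qed simp
 then have "\<exists>\<alpha>. \<forall>i. i \<le> n \<longrightarrow> \<alpha> i \<in> QHom S (R n i) (R n (Suc i)) \<and>
   (\<exists>f\<in>Hom S (R n i) (R n (Suc i)). eveq (R n i) (qact (\<alpha> i)) (\<lambda>e. fn f) \<and>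
    (\<forall>e. \<forall>x\<in>mcomp (R n i) e. fn f x = emb (T z i \<otimes> unemb x)))" by (intro choice allI)
 then obtain \<alpha> where \<alpha>: "\<forall>i. i \<le> n \<longrightarrow> \<alpha> i \<in> QHom S (R n i) (R n (Suc i)) \<and>
   (\<exists>f\<in>Hom S (R n i) (R n (Suc i)). eveq (R n i) (qact (\<alpha> i)) (\<lambda>e. fn f) \<and>
    (\<forall>e. \<forall>x\<in>mcomp (R n i) e. fn f x = emb (T z i \<otimes> unemb x)))" by (elim exE)
 have "map \<alpha> [0..<Suc n] ! i = \<alpha> i" if "i \<le> n" for i using that by (subst nth_map) (simp_all del: upt_Suc)
 then have "resolution n z (map \<alpha> [0..<Suc n])" unfolding resolution_def
  using \<alpha> by (simp del: upt_Suc)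
 then show ?thesis by (intro exI)
qed

text \<open>This is the exactness of multiplication by u and v in turn. The sign z in the first map
  does not change the image, because z is its own inverse and commutes with v.\<close>

lemma image_T:
 assumes n: "i < n" and z: "z \<in> hcomp S 0" "z \<otimes> z = \<one>" "z \<otimes> v = v \<otimes> z" and s: "s \<in> hcomp S (d + int (Suc i))"
 shows "emb s \<in> (\<lambda>x. emb (T z i \<otimes> unemb x)) ` mcomp (R n i) d \<longleftrightarrow> W (Suc i) \<otimes> s = \<zero>"
proof
 have zc: "z \<in> carrier S" using SG.comp_closed[OF z(1)] .
 assume "emb s \<in> (\<lambda>x. emb (T z i \<otimes> unemb x)) ` mcomp (R n i) d"
 then obtain x where x: "x \<in> mcomp (R n i) d" "emb s = emb (T z i \<otimes> unemb x)" by (elim imageE)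
 show "W (Suc i) \<otimes> s = \<zero>"
 proof (cases "i = 0")
  case True
  then obtain b where b: "b \<in> hcomp S (d + int i)" "x = emb (v \<otimes> b)"
   using x(1) by (auto simp: R_def mcomp_I W_def)
  have bc: "b \<in> carrier S" "v \<in> carrier S" "u \<in> carrier S" using b(1) u v SG.comp_closed by blast+
  have "s = z \<otimes> v \<otimes> b" using x(2) b True bc zc by (simp add: T_def m_assoc)
  then have "s = v \<otimes> z \<otimes> b" by (simp only: z(3))
  then have "u \<otimes> s = u \<otimes> v \<otimes> (z \<otimes> b)" using bc zc by (simp add: m_assoc)
  then show ?thesis using True bc zc by (simp add: uv W_def)
 next
  case False
  then obtain b where b: "b \<in> hcomp S (d + int i)" "x = emb b"
   using x(1) n by (auto simp: R_def mcomp_P)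
  have bc: "b \<in> carrier S" using b(1) by (rule SG.comp_closed)
  have "s = W i \<otimes> b" using x(2) b False by (simp add: T_def)
  then show ?thesis using bc by (simp add: m_assoc[symmetric] WW)
 qed
next
 have zc: "z \<in> carrier S" using SG.comp_closed[OF z(1)] .
 assume "W (Suc i) \<otimes> s = \<zero>"
 from ann_W[OF s this] obtain b where b: "b \<in> hcomp S (d + int (Suc i) - 1)" "s = W i \<otimes> b" by (elim bexE)
 have b1: "b \<in> hcomp S (d + int i)" using b(1) by simp
 have bc: "b \<in> carrier S" "v \<in> carrier S" using b1 v SG.comp_closed by blast+
 show "emb s \<in> (\<lambda>x. emb (T z i \<otimes> unemb x)) ` mcomp (R n i) d"
 proof (cases "i = 0")
  case True
  have zb: "z \<otimes> b \<in> hcomp S (d + int 0)" using mult_hcomp[OF z(1) b1] True by simp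
  have "emb (v \<otimes> (z \<otimes> b)) \<in> mcomp (R n i) d"
   unfolding True R_def using zb by (auto simp: mcomp_I W_def)
  moreover have "z \<otimes> (v \<otimes> (z \<otimes> b)) = s"
  proof -
   have "z \<otimes> (v \<otimes> (z \<otimes> b)) = z \<otimes> v \<otimes> z \<otimes> b" using zc bc by (simp add: m_assoc)
   also have "\<dots> = v \<otimes> (z \<otimes> z) \<otimes> b" unfolding z(3) using zc bc by (simp add: m_assoc)
   finally show ?thesis using True b(2) z(2) bc by (simp add: W_def)
  qed
  ultimately show ?thesis unfolding True T_def by (intro image_eqI[of _ _ "emb (v \<otimes> (z \<otimes> b))"]) simp_all
 next
  case False
  have "emb b \<in> mcomp (R n i) d" using False n b1 by (auto simp: R_def mcomp_P)
  then show ?thesis using False b(2) unfolding T_def by (intro image_eqI[of _ _ "emb b"]) simp_all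
 qed
qed

lemma resolution_extension:
 assumes n: "1 \<le> n" and z: "z \<in> hcomp S 0" "z \<otimes> z = \<one>" "z \<otimes> v = v \<otimes> z" and r: "resolution n z d"
 shows "d \<in> extensions (qgr S) n (I n) (I 0)"
proof -
 have zc: "z \<in> carrier S" using SG.comp_closed[OF z(1)] .
 have len: "length d = Suc n" using r by (simp add: resolution_def)
 have ar: "d ! i \<in> QHom S (R n i) (R n (Suc i))" if "i \<le> n" for i
  using r that by (simp add: resolution_def)
 note fex = resolutionD[OF r]
 have O0: "R n 0 = I 0" and On: "R n (Suc n) = I n" by (simp_all add: R_def)
 have "mono_arrow (qgr S) (d ! 0)"
 proof -
  obtain f :: "'s gmod_arr" where f: "eveq (R n 0) (qact (d ! 0)) (\<lambda>e. fn f)"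
   "\<forall>e. \<forall>x\<in>mcomp (R n 0) e. fn f x = emb (T z 0 \<otimes> unemb x)" using fex[OF le0] by (elim exE conjE)
  show ?thesis
  proof (rule mono_qgr_of_gr[OF ar[OF le0] f(1)], rule inj_onI)
   fix e x y assume x: "x \<in> mcomp (R n 0) e" and y: "y \<in> mcomp (R n 0) e" and e: "fn f x = fn f y"
   obtain s t where s: "s \<in> carrier S" "x = emb (v \<otimes> s)" and t: "t \<in> carrier S" "y = emb (v \<otimes> t)"
    using x y SG.comp_closed unfolding O0 mcomp_I by (auto simp: W_def)
   have vs: "v \<otimes> s \<in> carrier S" "v \<otimes> t \<in> carrier S" using s t SG.comp_closed[OF v] by simp_all
   have "z \<otimes> (v \<otimes> s) = z \<otimes> (v \<otimes> t)" using e f(2) x y s t by (simp add: T_def)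
   then have "z \<otimes> (z \<otimes> (v \<otimes> s)) = z \<otimes> (z \<otimes> (v \<otimes> t))" by simp
   then have "v \<otimes> s = v \<otimes> t" using vs zc z(2) by (simp add: m_assoc[symmetric])
   then show "x = y" using s t by simp
  qed
 qed
 moreover have "epi_arrow (qgr S) (d ! n)"
 proof -
  obtain f :: "'s gmod_arr" where f: "eveq (R n n) (qact (d ! n)) (\<lambda>e. fn f)"
   "\<forall>e. \<forall>x\<in>mcomp (R n n) e. fn f x = emb (T z n \<otimes> unemb x)" using fex[OF order_refl] by (elim exE conjE)
  show ?thesis
  proof (rule epi_qgr_of_gr[OF ar[OF order_refl] f(1)], rule subsetI)
   fix e x assume "x \<in> mcomp (R n (Suc n)) e"
   then obtain s where s: "s \<in> hcomp S (e + int n)" "x = emb (W n \<otimes> s)" unfolding On mcomp_I by (elim bexE)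
   have "emb s \<in> mcomp (R n n) e" using s n by (auto simp: R_def mcomp_P)
   then show "x \<in> fn f ` mcomp (R n n) e"
    using f(2) s n by (intro image_eqI[of _ _ "emb s"]) (simp_all add: T_def)
  qed
 qed
 moreover have "exact_at (qgr S) (d ! i) (d ! Suc i)" if i: "i < n" for i
 proof -
  have i': "i \<le> n" "Suc i \<le> n" using i by simp_all
  obtain f :: "'s gmod_arr" where f: "eveq (R n i) (qact (d ! i)) (\<lambda>e. fn f)"
   "\<forall>e. \<forall>x\<in>mcomp (R n i) e. fn f x = emb (T z i \<otimes> unemb x)" using fex[OF i'(1)] by (elim exE conjE)
  obtain g :: "'s gmod_arr" where g: "eveq (R n (Suc i)) (qact (d ! Suc i)) (\<lambda>e. fn g)"
   "\<forall>e. \<forall>x\<in>mcomp (R n (Suc i)) e. fn g x = emb (T z (Suc i) \<otimes> unemb x)" using fex[OF i'(2)] by (elim exE conjE)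
  have Oi: "R n (Suc i) = P (Suc i)" using i by (simp add: R_def)
  \<comment> \<open>Multiplication by W (i + 1), with its image as target, serves as cokernel c; the
    inclusion of the image of W i serves as kernel m.\<close>
  obtain c where c: "c \<in> Hom S (P (Suc i)) (I (Suc i))" "\<And>s. s \<in> carrier S \<Longrightarrow> fn c (emb s) = emb (W (Suc i) \<otimes> s)"
   using projection[of "Suc i"] by (elim bexE) simp
  obtain m where m: "m \<in> Hom S (I i) (P (Suc i))" "\<And>s. s \<in> carrier S \<Longrightarrow> fn m (emb (W i \<otimes> s)) = emb (\<one> \<otimes> (W i \<otimes> s))"
   using inclusion[OF one_hcomp, of i] by (elim bexE) simp
  have m': "fn m x = x" if "x \<in> carrier (I i)" for x using that m(2) by (auto simp: carrier_I)
  have mI: "fn m ` mcomp (I i) e = mcomp (I i) e" for e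
  proof -
   have "fn m ` mcomp (I i) e = (\<lambda>x. x) ` mcomp (I i) e"
    by (rule image_cong[OF refl], rule m') (auto simp: mcomp_I carrier_I SG.comp_closed)
   then show ?thesis by simp
  qed
  have fim: "fn f ` mcomp (R n i) e = (\<lambda>x. emb (T z i \<otimes> unemb x)) ` mcomp (R n i) e" for e
   by (rule image_cong[OF refl]) (rule f(2)[rule_format])
  have mim: "emb s \<in> mcomp (I i) e \<longleftrightarrow> W (Suc i) \<otimes> s = \<zero>" if s: "s \<in> hcomp S (e + int (Suc i))" for s e
  proof
   assume "emb s \<in> mcomp (I i) e"
   then obtain b where "b \<in> hcomp S (e + int i)" "emb s = emb (W i \<otimes> b)" unfolding mcomp_I by (elim bexE)
   then show "W (Suc i) \<otimes> s = \<zero>" using SG.comp_closed by (simp add: m_assoc[symmetric] WW)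
  next
   assume "W (Suc i) \<otimes> s = \<zero>"
   from ann_W[OF s this] obtain b where "b \<in> hcomp S (e + int (Suc i) - 1)" "s = W i \<otimes> b" by (elim bexE)
   then show "emb s \<in> mcomp (I i) e" unfolding mcomp_I by (intro bexI[of _ b]) simp_all
  qed
  have cz: "fn c (emb s) = \<zero>[I (Suc i)] \<longleftrightarrow> W (Suc i) \<otimes> s = \<zero>" if "s \<in> carrier S" for s using that by (simp add: c)
  have zO: "\<zero>[R n k] = emb \<zero>" for k by (simp add: R_def)
  show ?thesis
  proof (rule exact_qgr_of_gr[OF c(1) m(1) ar[OF i'(1), unfolded Oi] f(1) ar[OF i'(2), unfolded Oi] g(1)[unfolded Oi]])
   show "mcomp (I (Suc i)) e \<subseteq> fn c ` mcomp (P (Suc i)) e" for e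
   proof
    fix x assume "x \<in> mcomp (I (Suc i)) e"
    then obtain s where s: "s \<in> hcomp S (e + int (Suc i))" "x = emb (W (Suc i) \<otimes> s)" unfolding mcomp_I by (elim bexE)
    then have "emb s \<in> mcomp (P (Suc i)) e" by (auto simp: mcomp_P)
    then show "x \<in> fn c ` mcomp (P (Suc i)) e"
     using c(2) s SG.comp_closed[OF s(1)] by (intro image_eqI[of _ _ "emb s"]) simp_all
   qed
   show "inj_on (fn m) (mcomp (I i) e)" for e
   proof (rule inj_onI)
    fix x y assume "x \<in> mcomp (I i) e" "y \<in> mcomp (I i) e" and e: "fn m x = fn m y"
    then have "x \<in> carrier (I i)" "y \<in> carrier (I i)" by (auto simp: mcomp_I carrier_I SG.comp_closed)
    then show "x = y" using e m' by simp
   qed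
   fix e x assume "x \<in> mcomp (P (Suc i)) e"
   then obtain s where s: "s \<in> hcomp S (e + int (Suc i))" "x = emb s" unfolding mcomp_P by (elim bexE)
   have sc: "s \<in> carrier S" by (rule SG.comp_closed[OF s(1)])
   have xO: "x \<in> mcomp (R n (Suc i)) e" unfolding Oi mcomp_P using s by (intro bexI[of _ s])
   show "fn c x = \<zero>[I (Suc i)] \<longleftrightarrow> x \<in> fn f ` mcomp (R n i) e"
    unfolding s(2) cz[OF sc] fim by (rule image_T[OF i z s(1), symmetric])
   show "fn c x = \<zero>[I (Suc i)] \<longleftrightarrow> x \<in> fn m ` mcomp (I i) e"
    unfolding s(2) cz[OF sc] mI by (rule mim[OF s(1), symmetric])
   have "fn g x = \<zero>[R n (Suc (Suc i))] \<longleftrightarrow> W (Suc i) \<otimes> s = \<zero>"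
    unfolding g(2)[rule_format, OF xO] zO using s(2) by (simp add: T_def)
   then show "fn g x = \<zero>[R n (Suc (Suc i))] \<longleftrightarrow> x \<in> fn m ` mcomp (I i) e"
    unfolding s(2) mI mim[OF s(1)] .
  qed
 qed
 moreover have "set d \<subseteq> Arr (qgr S)"
  using ar hom_setD(1) len by (fastforce simp: in_set_conv_nth less_Suc_eq_le)
 ultimately show ?thesis unfolding extensions_def
  using len hom_setD(2)[OF ar[OF le0]] hom_setD(3)[OF ar[OF order_refl]] O0 On by simp
qed

text \<open>The chain can be written down: e i = h^k for i > 0 and e 0 = z v h^k, with correction
  term 0. As w i = W (i + 1), the condition reads W i h^k = h^k W (i + 2), which holds since W has
  period 2 and h commutes with it. The generator W n of I n has degree -n, being the image of 1 in
  S(n).\<close>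

lemma resolution_realizes:
 assumes n: "1 \<le> n" and z: "z \<in> hcomp S 0" "z \<otimes> z = \<one>" "z \<otimes> v = v \<otimes> z" and r: "resolution n z d"
 shows "realizes S h p (\<lambda>i. W (Suc i)) n (ext_obj n (I n) d) (\<lambda>i. qact (d ! i)) (- int n) (emb (W n)) (emb (z \<otimes> v))"
proof -
 have zc: "z \<in> carrier S" using SG.comp_closed[OF z(1)] .
 have vc: "v \<in> carrier S" by (rule SG.comp_closed[OF v])
 have ar: "d ! i \<in> QHom S (R n i) (R n (Suc i))" if "i \<le> n" for i
  using r that by (simp add: resolution_def)
 have X: "ext_obj n (I n) d i = R n i" if "i \<le> Suc n" for i
  using hom_setD(2)[OF ar[of i]] that by (cases "i = Suc n") (simp_all add: ext_obj_def R_def)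
 have ag: "\<forall>\<^sub>F e in at_top. \<forall>x\<in>mcomp (R n i) e. qact (d ! i) e x = emb (T z i \<otimes> unemb x)" if i: "i \<le> n" for i
 proof -
  obtain f :: "'s gmod_arr" where f: "eveq (R n i) (qact (d ! i)) (\<lambda>e. fn f)"
   "\<forall>e. \<forall>x\<in>mcomp (R n i) e. fn f x = emb (T z i \<otimes> unemb x)"
   using resolutionD[OF r i] by (elim exE conjE)
  show ?thesis using f(1)[unfolded eveq_def] by eventually_elim (use f(2) in simp)
 qed
 have "\<forall>\<^sub>F e in at_top. \<forall>i\<in>{..n}. \<forall>x\<in>mcomp (R n i) e. qact (d ! i) e x = emb (T z i \<otimes> unemb x)"
  by (rule eventually_ball_finite) (use ag in auto)
 then obtain E where E0: "\<forall>e\<ge>E. \<forall>i\<in>{..n}. \<forall>x\<in>mcomp (R n i) e. qact (d ! i) e x = emb (T z i \<otimes> unemb x)"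
  unfolding eventually_at_top_linorder by (elim exE)
 have E: "qact (d ! i) e x = emb (T z i \<otimes> unemb x)" if "E \<le> e" "i \<le> n" "x \<in> mcomp (R n i) e" for e i x
  using E0 that by simp
 obtain K where K: "\<forall>k\<ge>K. E \<le> - int n + int p * int k" using degree_large[OF p, of E "- int n"] by (elim exE)
 show ?thesis unfolding realizes_def
 proof (intro exI[of _ K] allI impI)
  fix k assume k: "K \<le> k"
  let ?D = "- int n + int p * int k" and ?h = "h [^] k"
  \<comment> \<open>At i = 0 the sign cancels: the first map multiplies by z once more, and z z =
    1.\<close>
  let ?e = "\<lambda>i. if i = 0 then emb (z \<otimes> (v \<otimes> ?h)) else emb ?h"
  have hc: "?h \<in> carrier S" by simp
  have ED: "E \<le> ?D + int j" for j using K k by (simp add: add_increasing2)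
  have e0: "z \<otimes> (v \<otimes> ?h) = v \<otimes> (z \<otimes> ?h)"
  proof -
   have "z \<otimes> (v \<otimes> ?h) = z \<otimes> v \<otimes> ?h" using zc vc by (simp add: m_assoc)
   then show ?thesis unfolding z(3) using zc vc by (simp add: m_assoc)
  qed
  have zh: "z \<otimes> ?h \<in> hcomp S (int p * int k)" using mult_hcomp[OF z(1) hpow[of k]] by simp
  have mem: "?e i \<in> mcomp (R n i) (?D + int (n - i))" if i: "i \<le> n" for i
  proof (cases "i = 0")
   case True
   then show ?thesis unfolding R_def e0 using zh by (auto simp: mcomp_I W_def)
  next
   case False
   then show ?thesis using i hpow[of k] by (auto simp: R_def mcomp_P of_nat_diff)
  qed
  have val: "qact (d ! i) (?D + int (n - i)) (?e i) = emb (W i \<otimes> ?h)" if i: "i \<le> n" for i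
  proof -
   have "qact (d ! i) (?D + int (n - i)) (?e i) = emb (T z i \<otimes> unemb (?e i))" by (rule E[OF ED i mem[OF i]])
   also have "T z i \<otimes> unemb (?e i) = W i \<otimes> ?h"
   proof (cases "i = 0")
    case True
    have "z \<otimes> (z \<otimes> (v \<otimes> ?h)) = v \<otimes> ?h" using zc vc z(2) by (simp add: m_assoc[symmetric])
    then show ?thesis using True by (simp add: T_def W_def)
   qed (simp add: T_def)
   finally show ?thesis .
  qed
  have Xz: "zero (R n i) = emb \<zero>" "add (R n i) x y = emb (unemb x \<oplus> unemb y)"
   "ract (R n i) x a = emb (unemb x \<otimes> a)" for i x y a by (simp_all add: R_def P_def I_def)
  note [simp] = Xz
  have ch: "chain (\<lambda>i. W (Suc i)) n (ext_obj n (I n) d) (\<lambda>i. qact (d ! i)) 0 ?D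
    (emb (W n) \<cdot>[ext_obj n (I n) d (Suc n)] ?h) ?e"
   unfolding chain_def
  proof (intro conjI allI impI)
   show "?e i \<in> mcomp (ext_obj n (I n) d i) (?D + int (n - i))" if "0 \<le> i" "i \<le> n" for i
    using mem[OF that(2)] X[of i] that(2) by simp
   show "qact (d ! n) ?D (?e n) = emb (W n) \<cdot>[ext_obj n (I n) d (Suc n)] ?h"
    using val[OF order_refl] X[OF order_refl] by simp
   fix i assume i: "0 \<le> i" "i < n"
   show "qact (d ! i) (?D + int (n - i)) (?e i) = ?e (Suc i) \<cdot>[ext_obj n (I n) d (Suc i)] W (Suc (Suc i))"
    using val[of i] X[of "Suc i"] i by (simp add: W2 hpow_W)
  qed
  have b: "emb \<zero> \<in> mcomp (ext_obj n (I n) d 0) (?D + int n - 1)"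
   using X[of 0] SG.comp_zero by (auto simp: R_def mcomp_I intro!: bexI[of _ \<zero>])
  have "?e 0 = (emb (z \<otimes> v) \<cdot>[ext_obj n (I n) d 0] ?h) \<oplus>[ext_obj n (I n) d 0]
    (emb \<zero> \<cdot>[ext_obj n (I n) d 0] W (Suc 1))"
   using X[of 0] zc vc by (simp add: m_assoc)
  with ch b show "lifts_to S h p (\<lambda>i. W (Suc i)) n (ext_obj n (I n) d) (\<lambda>i. qact (d ! i)) (- int n) (emb (W n)) (emb (z \<otimes> v)) k"
   unfolding lifts_to_def
   by (intro exI[of _ ?e] exI[of _ "emb \<zero>"] conjI)
 qed
qed

text \<open>The sequences with z = 1 and z = -1 realize v and -v. The ambiguity consists of the
  products of elements of v S with w 1 = W 2 = v, so \<open>ne\<close> is precisely what keeps the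
  two apart.\<close>

lemma Ext_not_singleton:
 assumes n: "1 \<le> n"
  and ne: "\<And>k b. b \<in> carrier S \<Longrightarrow> v \<otimes> (h [^] (k::nat)) \<noteq> \<ominus> (v \<otimes> (h [^] k)) \<oplus> v \<otimes> b \<otimes> v"
 shows "\<not> is_singleton (yoneda_Ext (qgr S) n (I n) (I 0))"
proof -
 have vc: "v \<in> carrier S" by (rule SG.comp_closed[OF v])
 have z1: "\<one> \<in> hcomp S 0" "\<one> \<otimes> \<one> = \<one>" "\<one> \<otimes> v = v \<otimes> \<one>" using one_hcomp vc by simp_all
 have z2: "\<ominus> \<one> \<in> hcomp S 0" "(\<ominus> \<one>) \<otimes> (\<ominus> \<one>) = \<one>" "(\<ominus> \<one>) \<otimes> v = v \<otimes> (\<ominus> \<one>)"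
  using SG.comp_minus[OF one_hcomp] vc by (simp_all add: l_minus r_minus)
 obtain d where d: "resolution n \<one> d" using resolution_exists[OF n z1(1)] by (elim exE)
 obtain d' where d': "resolution n (\<ominus> \<one>) d'" using resolution_exists[OF n z2(1)] by (elim exE)
 show ?thesis
 proof (rule yoneda_Ext_not_singleton[OF resolution_extension[OF n z1 d] resolution_extension[OF n z2 d'] p h, where w = "\<lambda>i. W (Suc i)"])
  show "W (Suc i) \<in> hcomp S 1" for i by (rule W_hcomp)
  show "W (Suc (Suc i)) \<otimes> W (Suc i) = \<zero>" for i by (rule WW)
  show "h \<otimes> W (Suc i) = W (Suc i) \<otimes> h" for i by (rule hW)
  show "emb (W n) \<in> mcomp (I n) (- int n)" using one_hcomp by (auto simp: mcomp_I intro!: bexI[of _ \<one>])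
  show "emb (W n) \<cdot>[I n] W (Suc n) = \<zero>[I n]" using WW[of "Suc n"] by (simp add: I_def W2)
  show "emb (\<one> \<otimes> v) \<in> carrier (I 0)" using vc by (auto simp: carrier_I W_def intro!: bexI[of _ \<one>])
  show "emb ((\<ominus> \<one>) \<otimes> v) \<in> carrier (I 0)"
   using vc by (auto simp: carrier_I W_def l_minus r_minus intro!: bexI[of _ "\<ominus> \<one>"])
  show "realizes S h p (\<lambda>i. W (Suc i)) n (ext_obj n (I n) d) (\<lambda>i. qact (d ! i)) (- int n) (emb (W n)) (emb (\<one> \<otimes> v))"
   by (rule resolution_realizes[OF n z1 d])
  show "realizes S h p (\<lambda>i. W (Suc i)) n (ext_obj n (I n) d') (\<lambda>i. qact (d' ! i)) (- int n) (emb (W n)) (emb ((\<ominus> \<one>) \<otimes> v))"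
   by (rule resolution_realizes[OF n z2 d'])
  fix k :: nat and b assume "b \<in> carrier (I 0)"
  then obtain a where a: "a \<in> carrier S" "b = emb (v \<otimes> a)" by (auto simp: carrier_I W_def)
  show "emb (\<one> \<otimes> v) \<cdot>[I 0] (h [^] k) \<noteq> emb ((\<ominus> \<one>) \<otimes> v) \<cdot>[I 0] (h [^] k) \<oplus>[I 0] b \<cdot>[I 0] W (Suc 1)"
   using ne[OF a(1), of k] a vc by (simp add: I_def W_def l_minus)
 qed
qed

text \<open>The supremum in \<open>gldim\<close> runs over n \<ge> 1, and each such n
  contributes.\<close>

lemma gldim_infinite:
 assumes ne: "\<And>k b. b \<in> carrier S \<Longrightarrow> v \<otimes> (h [^] (k::nat)) \<noteq> \<ominus> (v \<otimes> (h [^] k)) \<oplus> v \<otimes> b \<otimes> v"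
 shows "\<not> graded_isolated_singularity S"
proof -
 have "enat n \<le> gldim (qgr S)" if "1 \<le> n" for n
 proof -
  have "\<exists>M\<in>Obj (qgr S). \<exists>N\<in>Obj (qgr S). \<not> is_singleton (yoneda_Ext (qgr S) n M N)"
   using Ext_not_singleton[OF that ne] I_Obj qgr_simps(1) by metis
  then show ?thesis unfolding gldim_def using that by (intro Sup_upper) blast
 qed
 then have "gldim (qgr S) = \<infinity>"
  by (metis enat_ile enat_ord_simps(1) not_infinity_eq order_refl Suc_n_not_le_n le_add1 plus_1_eq_Suc)
 then show ?thesis by (simp add: graded_isolated_singularity_def)
qed

end

section \<open>Free algebras and quotients\<close>

lemma free_alg_simps [simp]:
 "carrier free_alg = {f. finite {w. f w \<noteq> 0}}" "one free_alg = (\<lambda>w. if w = [] then 1 else 0)"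
 "zero free_alg = (\<lambda>w. 0)" "add free_alg f g = (\<lambda>w. f w + g w)"
 "monoid.mult free_alg f g = (\<lambda>w. \<Sum>i\<le>length w. f (take i w) * g (drop i w))"
 "ascale free_alg c f = (\<lambda>w. c * f w)"
 by (simp_all add: free_alg_def)

lemma finite_support_mult:
 fixes f g :: "'v list \<Rightarrow> 'k::field"
 assumes "finite {w. f w \<noteq> 0}" "finite {w. g w \<noteq> 0}"
 shows "finite {w. (\<Sum>i\<le>length w. f (take i w) * g (drop i w)) \<noteq> 0}"
proof (rule finite_subset)
 show "{w. (\<Sum>i\<le>length w. f (take i w) * g (drop i w)) \<noteq> 0} \<subseteq> (\<lambda>(u, v). u @ v) ` ({w. f w \<noteq> 0} \<times> {w. g w \<noteq> 0})"
 proof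
  fix w assume "w \<in> {w. (\<Sum>i\<le>length w. f (take i w) * g (drop i w)) \<noteq> 0}"
  then obtain i where "f (take i w) * g (drop i w) \<noteq> 0" by (metis (mono_tags, lifting) mem_Collect_eq sum.neutral)
  then show "w \<in> (\<lambda>(u, v). u @ v) ` ({w. f w \<noteq> 0} \<times> {w. g w \<noteq> 0})"
   by (intro image_eqI[of _ _ "(take i w, drop i w)"]) auto
 qed
qed (use assms in auto)

text \<open>Both sides sum over the ways to cut w into three pieces, indexed by the two cuts on the
  left and by the lengths of the first two pieces on the right.\<close>

lemma free_alg_assoc:
 fixes f g h :: "'v list \<Rightarrow> 'k::field"
 shows "(\<Sum>i\<le>length w. (\<Sum>j\<le>length (take i w). f (take j (take i w)) * g (drop j (take i w))) * h (drop i w))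
  = (\<Sum>j\<le>length w. f (take j w) * (\<Sum>k\<le>length (drop j w). g (take k (drop j w)) * h (drop k (drop j w))))"
  (is "?L = ?R")
proof -
 let ?n = "length w"
 have "?L = (\<Sum>i\<le>?n. \<Sum>j\<le>i. f (take j w) * g (take (i - j) (drop j w)) * h (drop i w))"
  by (rule sum.cong[OF refl]) (simp add: sum_distrib_right drop_take min_absorb2 min_absorb1)
 also have "\<dots> = (\<Sum>(i, j)\<in>Sigma {..?n} (\<lambda>i. {..i}). f (take j w) * g (take (i - j) (drop j w)) * h (drop i w))"
  by (simp add: sum.Sigma)
 also have "\<dots> = (\<Sum>(j, k)\<in>Sigma {..?n} (\<lambda>j. {..?n - j}). f (take j w) * g (take k (drop j w)) * h (drop (k + j) w))"
  by (rule sum.reindex_bij_witness[of _ "\<lambda>(j, k). (k + j, j)" "\<lambda>(i, j). (j, i - j)"]) auto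
 also have "\<dots> = ?R"
  by (simp add: sum.Sigma[symmetric] sum_distrib_left mult.assoc)
 finally show ?thesis .
qed

lemma ring_free_alg: "ring (free_alg :: ('k::field, 'v list \<Rightarrow> 'k) graded_alg)"
proof (rule ringI)
 show "abelian_group (free_alg :: ('k, 'v list \<Rightarrow> 'k) graded_alg)"
 proof (rule abelian_groupI)
  fix f g :: "'v list \<Rightarrow> 'k" assume fg: "f \<in> carrier free_alg" "g \<in> carrier free_alg"
  have "{w. f w + g w \<noteq> 0} \<subseteq> {w. f w \<noteq> 0} \<union> {w. g w \<noteq> 0}" by auto
  then show "f \<oplus>[free_alg] g \<in> carrier free_alg" using fg finite_subset by fastforce
  show "\<exists>h\<in>carrier free_alg. h \<oplus>[free_alg] f = \<zero>[free_alg]"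
   using fg by (intro bexI[of _ "\<lambda>w. - f w"]) auto
 qed (auto simp: ac_simps)
 show "monoid (free_alg :: ('k, 'v list \<Rightarrow> 'k) graded_alg)"
 proof (rule monoidI)
  fix f g h :: "'v list \<Rightarrow> 'k" assume "f \<in> carrier free_alg" "g \<in> carrier free_alg"
  then show "f \<otimes>[free_alg] g \<in> carrier free_alg" using finite_support_mult by simp
  show "f \<otimes>[free_alg] g \<otimes>[free_alg] h = f \<otimes>[free_alg] (g \<otimes>[free_alg] h)"
   by (intro ext) (use free_alg_assoc[where f = f and g = g and h = h] in simp)
 next
  fix f :: "'v list \<Rightarrow> 'k" assume "f \<in> carrier free_alg"
  have "(\<Sum>i\<le>length w. (if take i w = [] then 1 else 0) * f (drop i w)) = f w" for w
  proof -
   have "(\<Sum>i\<le>length w. (if take i w = [] then 1 else 0) * f (drop i w)) = (\<Sum>i\<in>{0}. (if take i w = [] then 1 else 0) * f (drop i w))"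
    by (rule sum.mono_neutral_right) auto
   then show ?thesis by simp
  qed
  then show "\<one>\<^bsub>free_alg\<^esub> \<otimes>[free_alg] f = f" by (intro ext) simp
  have "(\<Sum>i\<le>length w. f (take i w) * (if drop i w = [] then 1 else 0)) = f w" for w
  proof -
   have "(\<Sum>i\<le>length w. f (take i w) * (if drop i w = [] then 1 else 0)) = (\<Sum>i\<in>{length w}. f (take i w) * (if drop i w = [] then 1 else 0))"
    by (rule sum.mono_neutral_right) auto
   then show ?thesis by simp
  qed
  then show "f \<otimes>[free_alg] \<one>\<^bsub>free_alg\<^esub> = f" by (intro ext) simp
 qed simp
qed (simp_all add: algebra_simps sum.distrib)

definition free_mono :: "'v list \<Rightarrow> 'v list \<Rightarrow> 'k::field" where
 "free_mono w = (\<lambda>w'. if w' = w then 1 else 0)"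

text \<open>Only the cut after the first letter contributes to the product.\<close>

lemma free_mono_Cons: "free_mono (v # w) = free_var v \<otimes>[free_alg] (free_mono w :: _ \<Rightarrow> 'k::field)"
proof
 fix w'
 have "(\<Sum>i\<le>length w'. free_var v (take i w') * (free_mono w (drop i w') :: 'k))
   = (\<Sum>i\<in>(if w' = v # w then {1} else {}). free_var v (take i w') * free_mono w (drop i w'))"
 proof (rule sum.mono_neutral_right)
  show "\<forall>i\<in>{..length w'} - (if w' = v # w then {1} else {}). free_var v (take i w') * free_mono w (drop i w') = (0 :: 'k)"
  proof
   fix i assume i: "i \<in> {..length w'} - (if w' = v # w then {1} else {})"
   show "free_var v (take i w') * free_mono w (drop i w') = (0 :: 'k)"
   proof (rule ccontr)
    assume "\<not> ?thesis"
    then have "take i w' = [v]" "drop i w' = w" by (auto simp: free_var_def free_mono_def split: if_splits)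
    then have "w' = v # w" "i = 1" using i append_take_drop_id[of i w'] by (auto dest: arg_cong[of _ _ length] simp: min_def)
    then show False using i by simp
   qed
  qed
 qed auto
 then show "free_mono (v # w) w' = (free_var v \<otimes>[free_alg] (free_mono w :: _ \<Rightarrow> 'k)) w'"
  by (auto simp: free_mono_def free_var_def)
qed

lemma free_var_closed: "free_var v \<in> carrier free_alg"
 by (simp add: free_var_def)

lemma free_mono_closed: "free_mono w \<in> carrier free_alg"
 by (simp add: free_mono_def)

lemma free_alg_scale:
 fixes f :: "'v list \<Rightarrow> 'k::field"
 shows "ascale free_alg c f = ascale free_alg c (one free_alg) \<otimes>[free_alg] f"
proof
 fix w
 have "(\<Sum>i\<le>length w. (c * (if take i w = [] then 1 else 0)) * f (drop i w)) = (\<Sum>i\<in>{0}. (c * (if take i w = [] then 1 else 0)) * f (drop i w))"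
  by (rule sum.mono_neutral_right) auto
 then show "ascale free_alg c f w = (ascale free_alg c (one free_alg) \<otimes>[free_alg] f) w" by simp
qed

lemma free_alg_scalar_closed: "ascale free_alg c (one free_alg) \<in> carrier free_alg"
 by simp

text \<open>The support is finite: splitting off one word at a time writes f as a sum of scalar
  multiples of words, and a word is a product of variables.\<close>

lemma free_alg_induct [consumes 1, case_names scalar var add mult]:
 fixes f :: "'v list \<Rightarrow> 'k::field"
 assumes f: "f \<in> carrier free_alg" and sc: "\<And>c. P (ascale free_alg c (one free_alg))" and var: "\<And>v. P (free_var v)"
  and add: "\<And>f g. f \<in> carrier free_alg \<Longrightarrow> g \<in> carrier free_alg \<Longrightarrow> P f \<Longrightarrow> P g \<Longrightarrow> P (f \<oplus>[free_alg] g)"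
  and mult: "\<And>f g. f \<in> carrier free_alg \<Longrightarrow> g \<in> carrier free_alg \<Longrightarrow> P f \<Longrightarrow> P g \<Longrightarrow> P (f \<otimes>[free_alg] g)"
 shows "P f"
proof -
 have mono: "P (free_mono w)" for w
 proof (induction w)
  case Nil
  have "free_mono [] = ascale free_alg 1 (one free_alg)" by (auto simp: free_mono_def)
  then show ?case using sc by metis
 next
  case (Cons v w)
  show ?case unfolding free_mono_Cons by (rule mult[OF free_var_closed free_mono_closed var Cons])
 qed
 have "\<forall>f. {w. f w \<noteq> 0} \<subseteq> T \<longrightarrow> P f" if "finite T" for T
  using that
 proof induction
  case empty
  have "P f" if "{w. f w \<noteq> 0} \<subseteq> {}" for f
  proof -
   have "f = ascale free_alg 0 (one free_alg)" using that by auto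
   then show ?thesis using sc by metis
  qed
  then show ?case by blast
 next
  case (insert w T)
  have "P f" if s: "{u. f u \<noteq> 0} \<subseteq> insert w T" for f
  proof -
   let ?g = "f(w := 0)" and ?m = "ascale free_alg (f w) (free_mono w)"
   have sg: "{u. ?g u \<noteq> 0} \<subseteq> T" using s by auto
   have e: "f = ?g \<oplus>[free_alg] ?m" by (auto simp: free_mono_def)
   have "P ?g" using insert.IH sg by blast
   moreover have "P ?m" unfolding free_alg_scale[of _ "free_mono w"]
    by (rule mult[OF free_alg_scalar_closed free_mono_closed sc mono])
   moreover have "?g \<in> carrier free_alg" using finite_subset[OF sg insert.hyps(1)] by simp
   moreover have "?m \<in> carrier free_alg" by (simp add: free_mono_def)
   ultimately have "P (?g \<oplus>[free_alg] ?m)" by (intro add)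
   then show ?thesis using e by metis
  qed
  then show ?case by blast
 qed
 from this[of "{w. f w \<noteq> 0}"] f show ?thesis by simp
qed

text \<open>A word with a cut is the same as a pair of words. Pairs outside A \<times> B contribute
  nothing, so finite sums suffice on both sides.\<close>

lemma sum_splits:
 fixes F :: "'v list \<Rightarrow> 'v list \<Rightarrow> 'r::comm_monoid_add"
 assumes fin: "finite A" "finite B" "finite T" and T: "\<And>u v. u \<in> A \<Longrightarrow> v \<in> B \<Longrightarrow> u @ v \<in> T"
  and z: "\<And>u v. u \<notin> A \<or> v \<notin> B \<Longrightarrow> F u v = 0"
 shows "(\<Sum>w\<in>T. \<Sum>i\<le>length w. F (take i w) (drop i w)) = (\<Sum>u\<in>A. \<Sum>v\<in>B. F u v)"
proof -
 let ?S = "Sigma T (\<lambda>w. {..length w})"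
 have "(\<Sum>w\<in>T. \<Sum>i\<le>length w. F (take i w) (drop i w)) = (\<Sum>(w, i)\<in>?S. F (take i w) (drop i w))"
  using fin by (simp add: sum.Sigma)
 also have "\<dots> = (\<Sum>(u, v)\<in>A \<times> B. F u v)"
 proof (rule sum.reindex_bij_witness_not_neutral[of "{(w, i) \<in> ?S. \<not> (take i w \<in> A \<and> drop i w \<in> B)}" "{}" _
    "\<lambda>(u, v). (u @ v, length u)" "\<lambda>(w, i). (take i w, drop i w)"])
  have "finite ?S" using fin by auto
  then show "finite {(w, i) \<in> ?S. \<not> (take i w \<in> A \<and> drop i w \<in> B)}" by (rule rev_finite_subset) auto
 qed (use T z in auto)
 also have "\<dots> = (\<Sum>u\<in>A. \<Sum>v\<in>B. F u v)" by (simp add: sum.cartesian_product)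
 finally show ?thesis .
qed

text \<open>The universal property of the free algebra: sc is a central ring homomorphism and g
  prescribes the images of the variables. The target is a type of class \<open>ring_1\<close>, so
  that evaluation is a plain sum of products.\<close>

locale free_evaluation =
 fixes sc :: "'k::field \<Rightarrow> 'r::ring_1" and g :: "'v \<Rightarrow> 'r"
 assumes sc_add: "sc (a + b) = sc a + sc b" and sc_mult: "sc (a * b) = sc a * sc b" and sc_one: "sc 1 = 1"
  and sc_comm: "sc a * r = r * sc a"
begin

definition ev :: "('v list \<Rightarrow> 'k) \<Rightarrow> 'r" where
 "ev f = (\<Sum>w | f w \<noteq> 0. sc (f w) * prod_list (map g w))"

lemma sc_zero: "sc 0 = 0" using sc_add[of 0 0] by simp

lemma sc_sum: "sc (sum f A) = (\<Sum>i\<in>A. sc (f i))"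
 by (induction A rule: infinite_finite_induct) (simp_all add: sc_zero sc_add)

lemma ev_eq:
 assumes "finite T" "{w. f w \<noteq> 0} \<subseteq> T"
 shows "ev f = (\<Sum>w\<in>T. sc (f w) * prod_list (map g w))"
 unfolding ev_def by (rule sum.mono_neutral_left) (use assms in \<open>auto simp: sc_zero\<close>)

lemma ev_add:
 assumes "f \<in> carrier free_alg" "f' \<in> carrier free_alg"
 shows "ev (f \<oplus>[free_alg] f') = ev f + ev f'"
proof -
 let ?T = "{w. f w \<noteq> 0} \<union> {w. f' w \<noteq> 0}"
 have fin: "finite ?T" using assms by simp
 have s: "{w. f w + f' w \<noteq> 0} \<subseteq> ?T" by auto
 show ?thesis using ev_eq[OF fin s] ev_eq[OF fin Un_upper1] ev_eq[OF fin Un_upper2]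
  by (simp add: sc_add distrib_right sum.distrib)
qed

lemma ev_mult:
 assumes "f \<in> carrier free_alg" "f' \<in> carrier free_alg"
 shows "ev (f \<otimes>[free_alg] f') = ev f * ev f'"
proof -
 let ?A = "{w. f w \<noteq> 0}" and ?B = "{w. f' w \<noteq> 0}"
 let ?h = "f \<otimes>[free_alg] f'"
 let ?T = "{w. ?h w \<noteq> 0} \<union> (\<lambda>(u, v). u @ v) ` (?A \<times> ?B)"
 have fin: "finite ?A" "finite ?B" using assms by simp_all
 have fT: "finite ?T" using fin finite_support_mult[of f f'] by simp
 let ?F = "\<lambda>u v. sc (f u) * prod_list (map g u) * (sc (f' v) * prod_list (map g v))"
 have "ev ?h = (\<Sum>w\<in>?T. sc (?h w) * prod_list (map g w))" by (rule ev_eq[OF fT Un_upper1])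
 also have "\<dots> = (\<Sum>w\<in>?T. \<Sum>i\<le>length w. ?F (take i w) (drop i w))"
 proof (rule sum.cong[OF refl])
  fix w
  have "sc (f u * f' v) * prod_list (map g (u @ v)) = ?F u v" for u v
   by (simp add: sc_mult mult.assoc) (metis sc_comm mult.assoc)
  from this[of "take i w" "drop i w" for i] show "sc (?h w) * prod_list (map g w) = (\<Sum>i\<le>length w. ?F (take i w) (drop i w))"
   by (simp add: sc_sum sum_distrib_right del: map_append)
 qed
 also have "\<dots> = (\<Sum>u\<in>?A. \<Sum>v\<in>?B. ?F u v)"
  by (rule sum_splits[OF fin fT]) (auto simp: sc_zero)
 also have "\<dots> = ev f * ev f'" by (simp add: ev_def sum_product)
 finally show ?thesis .
qed

lemma ev_one: "ev (one free_alg) = 1"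
 using ev_eq[of "{[]}" "one free_alg"] by (simp add: sc_one)

lemma ev_var: "ev (free_var v) = g v"
 using ev_eq[of "{[v]}" "free_var v"] by (simp add: sc_one free_var_def)

lemma ev_scale:
 assumes "f \<in> carrier free_alg" shows "ev (ascale free_alg c f) = sc c * ev f"
proof -
 have "{w. c * f w \<noteq> 0} \<subseteq> {w. f w \<noteq> 0}" by auto
 then have "ev (ascale free_alg c f) = (\<Sum>w | f w \<noteq> 0. sc (c * f w) * prod_list (map g w))"
  using ev_eq[of "{w. f w \<noteq> 0}" "ascale free_alg c f"] assms by simp
 then show ?thesis by (simp add: ev_def sum_distrib_left sc_mult mult.assoc)
qed

lemma ev_ker_ideal: "ideal {f \<in> carrier free_alg. ev f = 0} (free_alg :: ('k, 'v list \<Rightarrow> 'k) graded_alg)"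
proof (rule idealI[OF ring_free_alg])
 let ?K = "{f \<in> carrier free_alg. ev f = 0}"
 interpret R: ring "free_alg :: ('k, 'v list \<Rightarrow> 'k) graded_alg" by (rule ring_free_alg)
 have "additive_subgroup ?K free_alg"
 proof (rule additive_subgroup.intro, rule R.add.subgroupI)
  have "\<zero>[free_alg] \<in> ?K" by (simp add: ev_def)
  then show "?K \<noteq> {}" by blast
  fix a b assume a: "a \<in> ?K" and "b \<in> ?K"
  then show "a \<oplus>[free_alg] b \<in> ?K" using ev_add[of a b] R.add.m_closed[of a b] by simp
  have ac: "a \<in> carrier free_alg" using a by simp
  have z: "ev \<zero>[free_alg] = 0" by (simp add: ev_def)
  have "ev (\<ominus>\<^bsub>free_alg\<^esub> a) + ev a = 0"
   using ev_add[OF R.a_inv_closed[OF ac] ac] R.l_neg[OF ac] z by (simp del: free_alg_simps)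
  then show "\<ominus>\<^bsub>free_alg\<^esub> a \<in> ?K" using a R.a_inv_closed[OF ac] by (simp del: free_alg_simps)
 qed auto
 then show "subgroup ?K (add_monoid free_alg)" by (rule additive_subgroup.a_subgroup)
 fix a x :: "'v list \<Rightarrow> 'k" assume a: "a \<in> ?K" and x: "x \<in> carrier free_alg"
 then show "x \<otimes>[free_alg] a \<in> ?K" "a \<otimes>[free_alg] x \<in> ?K"
  using ev_mult[of a x] ev_mult[of x a] R.m_closed[of a x] R.m_closed[of x a] by (simp_all del: free_alg_simps)
qed

end

declare free_alg_simps [simp del]

text \<open>Of the algebra structure only the rule c a = (c 1) a is demanded, which makes the scalar
  action on cosets well defined. Both the free algebra and B are instances.\<close>

locale alg_quotient = ideal I S for I and S :: "('k::field, 'a) graded_alg" (structure) +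
 assumes scale: "a \<in> carrier S \<Longrightarrow> c \<bullet> a = (c \<bullet> \<one>) \<otimes> a" and scalar_closed [simp]: "c \<bullet> \<one> \<in> carrier S"
begin

abbreviation "Q \<equiv> graded_quotient S I"

lemma quot_simps: "carrier Q = carrier (S Quot I)" "monoid.mult Q = monoid.mult (S Quot I)" "one Q = one (S Quot I)"
 "zero Q = zero (S Quot I)" "add Q = add (S Quot I)" "hcomp Q i = (+>) I ` hcomp S i"
 by (simp_all add: graded_quotient_def ring.defs graded_alg.defs)

lemma quot_carrier: "carrier Q = (+>) I ` carrier S"
 by (auto simp: quot_simps FactRing_simps)

lemma quot_closed [simp]: "a \<in> carrier S \<Longrightarrow> I +> a \<in> carrier Q"
 by (simp add: quot_carrier)

lemma quot_add: "a \<in> carrier S \<Longrightarrow> b \<in> carrier S \<Longrightarrow> (I +> a) \<oplus>[Q] (I +> b) = I +> (a \<oplus> b)"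
 using ring_hom_add[OF rcos_ring_hom] by (simp add: quot_simps)

lemma quot_mult: "a \<in> carrier S \<Longrightarrow> b \<in> carrier S \<Longrightarrow> (I +> a) \<otimes>[Q] (I +> b) = I +> (a \<otimes> b)"
 using ring_hom_mult[OF rcos_ring_hom] by (simp add: quot_simps)

lemma quot_one: "\<one>\<^bsub>Q\<^esub> = I +> \<one>"
 using ring_hom_one[OF rcos_ring_hom] by (simp add: quot_simps)

lemma quot_eq_zero: "a \<in> carrier S \<Longrightarrow> I +> a = \<zero>[Q] \<longleftrightarrow> a \<in> I"
 using a_rcos_self a_rcos_const by (auto simp: quot_simps FactRing_simps)

lemma quot_zero: "\<zero>[Q] = I +> \<zero>"
 using quot_eq_zero[of \<zero>] additive_subgroup.zero_closed[OF additive_subgroup_axioms] by simp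

lemma quot_ring: "ring Q"
proof -
 interpret F: ring "S Quot I" by (rule quotient_is_ring)
 show ?thesis
 proof (rule ringI)
  show "abelian_group Q"
  proof (rule abelian_groupI)
   fix x assume "x \<in> carrier Q"
   then show "\<exists>y\<in>carrier Q. y \<oplus>[Q] x = \<zero>[Q]"
    using F.l_neg[of x] F.a_inv_closed[of x] by (auto simp: quot_simps)
  qed (auto simp: quot_simps F.a_ac)
  show "monoid Q" by (rule monoidI) (auto simp: quot_simps F.m_assoc)
 qed (auto simp: quot_simps F.l_distr F.r_distr)
qed

lemma quot_minus: "a \<in> carrier S \<Longrightarrow> \<ominus>\<^bsub>Q\<^esub> (I +> a) = I +> (\<ominus> a)"
 using quot_add[of "\<ominus> a" a] quot_zero abelian_group.minus_equality[OF ring.is_abelian_group[OF quot_ring]]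
 by (simp add: l_neg)

lemma quot_eq: "a \<in> carrier S \<Longrightarrow> b \<in> carrier S \<Longrightarrow> I +> a = I +> b \<longleftrightarrow> a \<ominus> b \<in> I"
proof -
 assume c: "a \<in> carrier S" "b \<in> carrier S"
 interpret Q: ring Q by (rule quot_ring)
 have "(I +> a) \<ominus>\<^bsub>Q\<^esub> (I +> b) = I +> (a \<ominus> b)"
  using c by (simp add: Q.minus_eq minus_eq quot_minus quot_add)
 then have "(I +> a) \<ominus>\<^bsub>Q\<^esub> (I +> b) = \<zero>[Q] \<longleftrightarrow> a \<ominus> b \<in> I" using quot_eq_zero c by simp
 moreover have "(I +> a) \<ominus>\<^bsub>Q\<^esub> (I +> b) = \<zero>[Q] \<longleftrightarrow> I +> a = I +> b"
  using c Q.r_right_minus_eq[of "I +> a" "I +> b"] by simp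
 ultimately show ?thesis by simp
qed

lemma quot_scale:
 assumes a: "a \<in> carrier S" shows "c \<bullet>\<^bsub>Q\<^esub> (I +> a) = I +> (c \<bullet> a)"
proof -
 have cl: "c \<bullet> b \<in> carrier S" if "b \<in> carrier S" for b using that scale[OF that] by simp
 have eq: "I +> (c \<bullet> b) = I +> (c \<bullet> a)" if b: "b \<in> I +> a" for b
 proof -
  have bc: "b \<in> carrier S" using b a by (meson a_r_coset_subset_G a_subset subsetD)
  have "I +> b = I +> a" by (rule a_repr_independence[OF b a a_subgroup, symmetric])
  then show ?thesis
   unfolding scale[OF bc] scale[OF a] quot_mult[OF scalar_closed bc, symmetric] quot_mult[OF scalar_closed a, symmetric]
   by (rule arg_cong)
 qed
 have "c \<bullet>\<^bsub>Q\<^esub> (I +> a) = (\<Union>b\<in>I +> a. I +> (c \<bullet> b))"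
  by (simp add: graded_quotient_def ring.defs graded_alg.defs)
 also have "\<dots> = I +> (c \<bullet> a)" by (rule UN_constant_eq[OF a_rcos_self[OF a]], rule ballI) (rule eq)
 finally show ?thesis .
qed

end

lemma (in graded_algebra) scale_one_mult: "a \<in> carrier S \<Longrightarrow> c \<bullet> a = (c \<bullet> \<one>) \<otimes> a"
 using ascale_mult_left[of \<one> a c] by simp

lemma (in graded_algebra) mult_scale_one: "a \<in> carrier S \<Longrightarrow> c \<bullet> a = a \<otimes> (c \<bullet> \<one>)"
 using ascale_mult_right[of a \<one> c] by simp

text \<open>That I contains the components of its elements is the kernel condition of
  \<open>grading_image\<close>.\<close>

lemma (in graded_algebra) quotient_algebra:
 assumes I: "ideal I S" and hom: "\<And>a i. a \<in> I \<Longrightarrow> cmp S (hcomp S) a i \<in> I"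
 shows "alg_quotient I S" and "graded_algebra (graded_quotient S I)"
proof -
 show "alg_quotient I S"
  by (intro alg_quotient.intro alg_quotient_axioms.intro I scale_one_mult ascale_closed one_closed)
 then interpret Q: alg_quotient I S .
 interpret QR: ring Q.Q by (rule Q.quot_ring)
 have rep: "\<exists>a\<in>carrier S. x = I +> a" if "x \<in> carrier Q.Q" for x
  using that unfolding Q.quot_carrier by (elim imageE) (rule bexI)
 have hrep: "\<exists>a\<in>hcomp S i. x = I +> a" if "x \<in> hcomp Q.Q i" for x i
  using that unfolding Q.quot_simps(6) by (elim imageE) (rule bexI)
 have himg: "I +> a \<in> hcomp Q.Q i" if "a \<in> hcomp S i" for a i
  unfolding Q.quot_simps(6) using that by (rule imageI)
 show "graded_algebra Q.Q"
 proof (intro graded_algebra.intro graded_algebra_axioms.intro Q.quot_ring)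
  have "hcomp Q.Q = (\<lambda>i. (+>) I ` hcomp S i)" by (rule ext) (rule Q.quot_simps(6))
  moreover have "grading Q.Q (\<lambda>i. (+>) I ` hcomp S i)"
  proof (rule grading_image[OF SG.graded_group_axioms QR.is_abelian_group Q.quot_carrier[symmetric]])
   fix a i assume a: "a \<in> carrier S" "I +> a = \<zero>[Q.Q]"
   then have "a \<in> I" using Q.quot_eq_zero by blast
   from hom[OF this] show "I +> cmp S (hcomp S) a i = \<zero>[Q.Q]"
    using Q.quot_eq_zero[OF SG.cmp_closed[OF a(1)]] by blast
  qed (rule Q.quot_add[symmetric])
  ultimately show "grading Q.Q (hcomp Q.Q)" by simp
  show "\<one>\<^bsub>Q.Q\<^esub> \<in> hcomp Q.Q 0" unfolding Q.quot_one by (rule himg[OF one_hcomp])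
  fix x c d assume "x \<in> carrier Q.Q"
  from rep[OF this] obtain a where a: "a \<in> carrier S" "x = I +> a" by (elim bexE)
  have [simp]: "e \<bullet> a \<in> carrier S" for e by (rule ascale_closed[OF a(1)])
  have sa: "e \<bullet>\<^bsub>Q.Q\<^esub> x = I +> (e \<bullet> a)" for e unfolding a(2) by (rule Q.quot_scale[OF a(1)])
  show "c \<bullet>\<^bsub>Q.Q\<^esub> x \<in> carrier Q.Q" unfolding sa by (rule Q.quot_closed) simp
  show "(c + d) \<bullet>\<^bsub>Q.Q\<^esub> x = c \<bullet>\<^bsub>Q.Q\<^esub> x \<oplus>[Q.Q] d \<bullet>\<^bsub>Q.Q\<^esub> x"
   unfolding sa add_ascale[OF a(1)] by (rule Q.quot_add[symmetric]) simp_all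
  show "(c * d) \<bullet>\<^bsub>Q.Q\<^esub> x = c \<bullet>\<^bsub>Q.Q\<^esub> d \<bullet>\<^bsub>Q.Q\<^esub> x"
   unfolding sa ascale_ascale[OF a(1)] by (rule Q.quot_scale[symmetric]) simp
  show "1 \<bullet>\<^bsub>Q.Q\<^esub> x = x" unfolding sa ascale_one[OF a(1)] by (rule a(2)[symmetric])
  fix y assume "y \<in> carrier Q.Q"
  from rep[OF this] obtain b where b: "b \<in> carrier S" "y = I +> b" by (elim bexE)
  have [simp]: "e \<bullet> b \<in> carrier S" for e by (rule ascale_closed[OF b(1)])
  have sb: "e \<bullet>\<^bsub>Q.Q\<^esub> y = I +> (e \<bullet> b)" for e unfolding b(2) by (rule Q.quot_scale[OF b(1)])
  show "c \<bullet>\<^bsub>Q.Q\<^esub> (x \<oplus>[Q.Q] y) = c \<bullet>\<^bsub>Q.Q\<^esub> x \<oplus>[Q.Q] c \<bullet>\<^bsub>Q.Q\<^esub> y"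
   unfolding sa sb unfolding a(2) b(2) Q.quot_add[OF a(1) b(1)] Q.quot_scale[OF a_closed[OF a(1) b(1)]] ascale_add[OF a(1) b(1)]
   by (rule Q.quot_add[symmetric]) simp_all
  show "c \<bullet>\<^bsub>Q.Q\<^esub> (x \<otimes>[Q.Q] y) = (c \<bullet>\<^bsub>Q.Q\<^esub> x) \<otimes>[Q.Q] y"
   unfolding sa unfolding a(2) b(2) Q.quot_mult[OF a(1) b(1)] Q.quot_scale[OF m_closed[OF a(1) b(1)]] ascale_mult_left[OF a(1) b(1)]
   by (rule Q.quot_mult[symmetric]) (simp_all add: b)
  show "c \<bullet>\<^bsub>Q.Q\<^esub> (x \<otimes>[Q.Q] y) = x \<otimes>[Q.Q] (c \<bullet>\<^bsub>Q.Q\<^esub> y)"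
   unfolding sb unfolding a(2) b(2) Q.quot_mult[OF a(1) b(1)] Q.quot_scale[OF m_closed[OF a(1) b(1)]] ascale_mult_right[OF a(1) b(1)]
   by (rule Q.quot_mult[symmetric]) (simp_all add: a)
 next
  fix x i c assume "x \<in> hcomp Q.Q i"
  from hrep[OF this] obtain a where a: "a \<in> hcomp S i" "x = I +> a" by (elim bexE)
  show "c \<bullet>\<^bsub>Q.Q\<^esub> x \<in> hcomp Q.Q i"
   unfolding a(2) Q.quot_scale[OF SG.comp_closed[OF a(1)]] by (rule himg[OF ascale_hcomp[OF a(1)]])
  fix y j assume "y \<in> hcomp Q.Q j"
  from hrep[OF this] obtain b where b: "b \<in> hcomp S j" "y = I +> b" by (elim bexE)
  show "x \<otimes>[Q.Q] y \<in> hcomp Q.Q (i + j)"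
   unfolding a(2) b(2) Q.quot_mult[OF SG.comp_closed[OF a(1)] SG.comp_closed[OF b(1)]]
   by (rule himg[OF mult_hcomp[OF a(1) b(1)]])
 qed
qed

section \<open>The skew plane\<close>

abbreviation \<A> where "\<A> \<equiv> skew_plane"

lemma skew_quotient: "alg_quotient skew_rel_ideal (free_alg :: ('k::field, xvar list \<Rightarrow> 'k) graded_alg)"
proof (intro alg_quotient.intro alg_quotient_axioms.intro)
 interpret F: ring "free_alg :: ('k, xvar list \<Rightarrow> 'k) graded_alg" by (rule ring_free_alg)
 show "ideal skew_rel_ideal (free_alg :: ('k, xvar list \<Rightarrow> 'k) graded_alg)"
  unfolding skew_rel_ideal_def
  by (rule F.genideal_ideal) (intro insert_subsetI empty_subsetI F.a_closed F.m_closed free_var_closed)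
qed (rule free_alg_scale free_alg_scalar_closed)+

lemma skew_plane_rel:
 "(x1 \<otimes>[\<A>] x2) \<oplus>[\<A>] (x2 \<otimes>[\<A>] x1) = (\<zero>[\<A>] :: (xvar list \<Rightarrow> 'k::field) set)"
proof -
 interpret Q: alg_quotient skew_rel_ideal "free_alg :: ('k, xvar list \<Rightarrow> 'k) graded_alg" by (rule skew_quotient)
 let ?r = "free_var X1 \<otimes>[free_alg] free_var X2 \<oplus>[free_alg] free_var X2 \<otimes>[free_alg] (free_var X1 :: xvar list \<Rightarrow> 'k)"
 have c: "free_var X1 \<otimes>[free_alg] (free_var X2 :: xvar list \<Rightarrow> 'k) \<in> carrier free_alg"
  "free_var X2 \<otimes>[free_alg] (free_var X1 :: xvar list \<Rightarrow> 'k) \<in> carrier free_alg"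
  by (rule Q.m_closed free_var_closed)+
 have "?r \<in> skew_rel_ideal" unfolding skew_rel_ideal_def
  by (rule Q.genideal_self'[OF Q.a_closed[OF c]])
 then have "skew_rel_ideal +>\<^bsub>free_alg\<^esub> ?r = \<zero>[Q.Q]" using Q.quot_eq_zero[OF Q.a_closed[OF c]] by blast
 then show ?thesis unfolding skew_plane_def x1_def x2_def Q.quot_mult[OF free_var_closed free_var_closed] Q.quot_add[OF c] .
qed

lemma skew_plane_gens:
 "(x1 :: (xvar list \<Rightarrow> 'k::field) set) \<in> hcomp \<A> 1" "(x2 :: (xvar list \<Rightarrow> 'k::field) set) \<in> hcomp \<A> 1"
proof -
 interpret Q: alg_quotient skew_rel_ideal "free_alg :: ('k, xvar list \<Rightarrow> 'k) graded_alg" by (rule skew_quotient)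
 have "free_var v \<in> hcomp (free_alg :: ('k, xvar list \<Rightarrow> 'k) graded_alg) 1" for v
  by (simp add: free_alg_def free_var_def)
 then show "(x1 :: (xvar list \<Rightarrow> 'k) set) \<in> hcomp \<A> 1" "(x2 :: (xvar list \<Rightarrow> 'k) set) \<in> hcomp \<A> 1"
  unfolding skew_plane_def Q.quot_simps x1_def x2_def by (auto intro: imageI)
qed

lemma skew_plane_induct [consumes 1, case_names scalar x1 x2 add mult]:
 fixes a :: "(xvar list \<Rightarrow> 'k::field) set"
 assumes a: "a \<in> carrier \<A>" and sc: "\<And>c. P (ascale \<A> c (one \<A>))" and x1: "P x1" and x2: "P x2"
  and add: "\<And>a b. a \<in> carrier \<A> \<Longrightarrow> b \<in> carrier \<A> \<Longrightarrow> P a \<Longrightarrow> P b \<Longrightarrow> P (a \<oplus>[\<A>] b)"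
  and mult: "\<And>a b. a \<in> carrier \<A> \<Longrightarrow> b \<in> carrier \<A> \<Longrightarrow> P a \<Longrightarrow> P b \<Longrightarrow> P (a \<otimes>[\<A>] b)"
 shows "P a"
proof -
 interpret Q: alg_quotient skew_rel_ideal "free_alg :: ('k, xvar list \<Rightarrow> 'k) graded_alg" by (rule skew_quotient)
 let ?q = "\<lambda>f. skew_rel_ideal +>\<^bsub>free_alg\<^esub> f"
 have "P (?q f)" if "f \<in> carrier free_alg" for f
  using that
 proof (induction rule: free_alg_induct)
  case (scalar c)
  have "?q (ascale free_alg c (one free_alg)) = ascale \<A> c (one \<A>)"
   unfolding skew_plane_def Q.quot_one by (rule Q.quot_scale[symmetric, OF Q.one_closed])
  then show ?case using sc by metis
 next
  case (var v)
  show ?case using x1 x2 unfolding x1_def x2_def by (cases v) simp_all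
 next
  case (add f g)
  have "?q (f \<oplus>[free_alg] g) = ?q f \<oplus>[\<A>] ?q g"
   unfolding skew_plane_def by (rule Q.quot_add[symmetric, OF add(1,2)])
  then show ?case using assms(5)[unfolded skew_plane_def, OF Q.quot_closed[OF add(1)] Q.quot_closed[OF add(2)] add(3,4)]
   unfolding skew_plane_def by metis
 next
  case (mult f g)
  have "?q (f \<otimes>[free_alg] g) = ?q f \<otimes>[\<A>] ?q g"
   unfolding skew_plane_def by (rule Q.quot_mult[symmetric, OF mult(1,2)])
  then show ?case using assms(6)[unfolded skew_plane_def, OF Q.quot_closed[OF mult(1)] Q.quot_closed[OF mult(2)] mult(3,4)]
   unfolding skew_plane_def by metis
 qed
 moreover obtain f where "f \<in> carrier free_alg" "a = ?q f"
  using a unfolding skew_plane_def Q.quot_carrier by (elim imageE)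
 ultimately show ?thesis by metis
qed

text \<open>Evaluation on the free algebra sends the defining relation to p q + q p = 0, so its
  kernel contains the ideal and the value depends only on the coset.\<close>

lemma skew_plane_rep:
 fixes sc :: "'k::field \<Rightarrow> 'r::ring_1"
 assumes ev: "free_evaluation sc" and pq: "p * q + q * p = 0"
 shows "\<exists>\<rho> :: (xvar list \<Rightarrow> 'k) set \<Rightarrow> 'r. \<rho> x1 = p \<and> \<rho> x2 = q \<and> (\<forall>c. \<rho> (ascale \<A> c (one \<A>)) = sc c) \<and>
  (\<forall>a\<in>carrier \<A>. \<forall>b\<in>carrier \<A>. \<rho> (a \<oplus>[\<A>] b) = \<rho> a + \<rho> b \<and> \<rho> (a \<otimes>[\<A>] b) = \<rho> a * \<rho> b)"
proof -
 define g where "g = case_xvar p q"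
 interpret E: free_evaluation sc g by (rule ev)
 interpret Q: alg_quotient skew_rel_ideal "free_alg :: ('k, xvar list \<Rightarrow> 'k) graded_alg" by (rule skew_quotient)
 let ?q = "\<lambda>f. skew_rel_ideal +>\<^bsub>free_alg\<^esub> f"
 define \<rho> where "\<rho> X = E.ev (SOME f. f \<in> carrier free_alg \<and> X = ?q f)" for X
 let ?r = "free_var X1 \<otimes>[free_alg] free_var X2 \<oplus>[free_alg] free_var X2 \<otimes>[free_alg] (free_var X1 :: xvar list \<Rightarrow> 'k)"
 have c: "free_var X1 \<otimes>[free_alg] (free_var X2 :: xvar list \<Rightarrow> 'k) \<in> carrier free_alg"
  "free_var X2 \<otimes>[free_alg] (free_var X1 :: xvar list \<Rightarrow> 'k) \<in> carrier free_alg"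
  by (rule Q.m_closed free_var_closed)+
 have "E.ev ?r = 0"
  using pq by (simp add: E.ev_add[OF c] E.ev_mult[OF free_var_closed free_var_closed] E.ev_var) (simp add: g_def)
 then have ker: "skew_rel_ideal \<subseteq> {f \<in> carrier free_alg. E.ev f = 0}"
  unfolding skew_rel_ideal_def by (intro Q.genideal_minimal[OF E.ev_ker_ideal]) (use Q.a_closed[OF c] in blast)
 have \<rho>: "\<rho> (?q f) = E.ev f" if f: "f \<in> carrier free_alg" for f
 proof -
  define f' where "f' = (SOME f'. f' \<in> carrier free_alg \<and> ?q f = ?q f')"
  have "f' \<in> carrier free_alg \<and> ?q f = ?q f'" unfolding f'_def by (rule someI[of _ f]) (use f in blast)
  then have f': "f' \<in> carrier free_alg" "?q f = ?q f'" by blast+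
  then have "f \<ominus>\<^bsub>free_alg\<^esub> f' \<in> skew_rel_ideal" using Q.quot_eq[OF f f'(1)] by blast
  then have m: "f \<ominus>\<^bsub>free_alg\<^esub> f' \<in> carrier free_alg" "E.ev (f \<ominus>\<^bsub>free_alg\<^esub> f') = 0" using ker by blast+
  have "(f \<ominus>\<^bsub>free_alg\<^esub> f') \<oplus>[free_alg] f' = f" using f f'(1) by algebra
  then have "E.ev f = E.ev f'" using E.ev_add[OF m(1) f'(1)] m(2) by (metis add_0)
  then show ?thesis unfolding \<rho>_def f'_def[symmetric] by simp
 qed
 show ?thesis
 proof (intro exI[of _ \<rho>] conjI allI ballI)
  show "\<rho> x1 = p" "\<rho> x2 = q" by (simp_all add: x1_def x2_def \<rho>[OF free_var_closed] E.ev_var) (simp_all add: g_def)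
  show "\<rho> (ascale \<A> c (one \<A>)) = sc c" for c
   unfolding skew_plane_def Q.quot_one Q.quot_scale[OF Q.one_closed] \<rho>[OF free_alg_scalar_closed]
    E.ev_scale[OF Q.one_closed] E.ev_one by simp
  fix a b :: "(xvar list \<Rightarrow> 'k) set" assume "a \<in> carrier \<A>" "b \<in> carrier \<A>"
  then obtain f f' where f: "f \<in> carrier free_alg" "f' \<in> carrier free_alg" and ab: "a = ?q f" "b = ?q f'"
   unfolding skew_plane_def Q.quot_carrier by (elim imageE)
  show "\<rho> (a \<oplus>[\<A>] b) = \<rho> a + \<rho> b"
   unfolding ab skew_plane_def Q.quot_add[OF f] \<rho>[OF Q.a_closed[OF f]] \<rho>[OF f(1)] \<rho>[OF f(2)] by (rule E.ev_add[OF f])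
  show "\<rho> (a \<otimes>[\<A>] b) = \<rho> a * \<rho> b"
   unfolding ab skew_plane_def Q.quot_mult[OF f] \<rho>[OF Q.m_closed[OF f]] \<rho>[OF f(1)] \<rho>[OF f(2)] by (rule E.ev_mult[OF f])
 qed
qed

primrec words :: "('a, 'm) ring_scheme \<Rightarrow> 'a set \<Rightarrow> nat \<Rightarrow> 'a set" where
 "words R X 0 = {\<one>\<^bsub>R\<^esub>}"
| "words R X (Suc j) = (\<lambda>(x, w). x \<otimes>[R] w) ` (X \<times> words R X j)"

text \<open>Words of length j in the generators span the part of degree j: all words together span a
  subalgebra, and a word is homogeneous of degree its length. A word of length m \<ge> j begins with
  a word of length j, which gives \<open>F_gen\<close>.\<close>

lemma (in graded_algebra) std_algebraI:
 assumes X: "finite X" "X \<subseteq> hcomp S 1"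
  and gen: "\<And>T. T \<subseteq> carrier S \<Longrightarrow> (\<And>c. c \<bullet> \<one> \<in> T) \<Longrightarrow> X \<subseteq> T \<Longrightarrow> (\<And>a b. a \<in> T \<Longrightarrow> b \<in> T \<Longrightarrow> a \<oplus> b \<in> T) \<Longrightarrow>
   (\<And>a b. a \<in> T \<Longrightarrow> b \<in> T \<Longrightarrow> a \<otimes> b \<in> T) \<Longrightarrow> carrier S \<subseteq> T"
 shows "std_algebra S (words S X)"
proof -
 interpret R: graded_right_module S "reg S 0" by (rule reg_module)
 let ?F = "words S X" and ?U = "\<Union>j. words S X j"
 have Xc: "x \<in> carrier S" if "x \<in> X" for x using that X(2) SG.comp_closed by blast
 have Fh: "?F j \<subseteq> hcomp S (int j)" for j
 proof (induction j)
  case (Suc j)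
  show ?case
  proof
   fix w assume "w \<in> ?F (Suc j)"
   then obtain x w' where "x \<in> X" "w' \<in> ?F j" "w = x \<otimes> w'" by auto
   then show "w \<in> hcomp S (int (Suc j))" using mult_hcomp[of x 1 w' "int j"] X(2) Suc by auto
  qed
 qed (simp add: one_hcomp)
 have Fc: "w \<in> carrier S" if "w \<in> ?F j" for w j using that Fh[of j] SG.comp_closed by blast
 have Uc: "?U \<subseteq> carrier (reg S 0)" using Fc by auto
 have fin: "finite (?F j)" for j by (induction j) (simp_all add: X(1))
 have app: "w \<otimes> w' \<in> ?F (j + k)" if "w \<in> ?F j" "w' \<in> ?F k" for j k w w'
  using that(1)
 proof (induction j arbitrary: w)
  case 0 then show ?case using that(2) Fc[OF that(2)] by simp
 next
  case (Suc j)
  then obtain x w'' where w: "x \<in> X" "w'' \<in> ?F j" "w = x \<otimes> w''" by auto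
  then have "w \<otimes> w' = x \<otimes> (w'' \<otimes> w')" using Xc[OF w(1)] Fc[OF w(2)] Fc[OF that(2)] by (simp add: m_assoc)
  then show ?case using w(1) Suc.IH[OF w(2)] by (auto intro!: image_eqI[of _ _ "(x, w'' \<otimes> w')"])
 qed
 have split: "\<exists>a\<in>?F j. \<exists>b\<in>?F k. w = a \<otimes> b" if "w \<in> ?F (j + k)" for j k w
  using that
 proof (induction j arbitrary: w)
  case 0 then show ?case using Fc[of w k] by (auto intro!: bexI[of _ w])
 next
  case (Suc j)
  then obtain x w'' where w: "x \<in> X" "w'' \<in> ?F (j + k)" "w = x \<otimes> w''" by auto
  obtain a b where ab: "a \<in> ?F j" "b \<in> ?F k" "w'' = a \<otimes> b" using Suc.IH[OF w(2)] by blast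
  have "w = x \<otimes> a \<otimes> b" using w ab Xc Fc by (simp add: m_assoc)
  moreover have "x \<otimes> a \<in> ?F (Suc j)" using w(1) ab(1) by auto
  ultimately show ?case using ab(2) by blast
 qed
 have sA: "scal S \<subseteq> carrier S" by (rule scal_closed)
 have s1: "\<one> \<in> scal S" unfolding scal_def using ascale_one[OF one_closed] by (metis rangeI)
 note add = R.lspan_add[OF sA]
 let ?L = "lspan (reg S 0) (scal S) ?U"
 have Lc: "x \<in> carrier S" if "x \<in> ?L" for x using R.lspan_closed[OF that sA Uc] by simp
 have UL: "w \<in> ?L" if "w \<in> ?U" for w
 proof -
  have "w \<in> carrier S" using that Fc by blast
  then show ?thesis using R.lspan_base[OF sA Uc that s1] by simp
 qed
 have sc: "x \<otimes> a \<in> ?L" if "x \<in> ?L" "a \<in> scal S" for x a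
  using R.lspan_ract[OF sA Uc that(1)] that(2) sA scal_mult by auto
 \<comment> \<open>Moving a word past a coefficient uses that scalars are central.\<close>
 have wr: "x \<otimes> g \<in> ?L" if x: "x \<in> ?L" and g: "g \<in> ?U" for x g
  using x
 proof (induction rule: lspan.induct)
  case zero
  have "g \<in> carrier S" using g Uc by auto
  then show ?case using lspan.zero[of "reg S 0"] by simp
 next
  case (step x g' a)
  obtain j k where jk: "g \<in> ?F j" "g' \<in> ?F k" using g step(2) by (elim UN_E)
  obtain c where c: "a = c \<bullet> \<one>" using step(3) by (auto simp: scal_def)
  have cl: "x \<in> carrier S" "g \<in> carrier S" "g' \<in> carrier S" "a \<in> carrier S"
   using Lc[OF step(1)] Fc[OF jk(1)] Fc[OF jk(2)] step(3) sA by auto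
  have "a \<otimes> g = g \<otimes> a"
   unfolding c scale_one_mult[OF cl(2), symmetric] mult_scale_one[OF cl(2), symmetric] ..
  then have "g' \<otimes> a \<otimes> g = g' \<otimes> g \<otimes> a" using cl by (simp add: m_assoc)
  then have e: "(x \<oplus> g' \<otimes> a) \<otimes> g = x \<otimes> g \<oplus> g' \<otimes> g \<otimes> a" using cl by (simp add: l_distr)
  have "g' \<otimes> g \<in> ?U" using app[OF jk(2,1)] by blast
  from sc[OF UL[OF this] step(3)] add[OF Uc step.IH] e show ?case by simp
 qed
 have mult: "x \<otimes> y \<in> ?L" if x: "x \<in> ?L" and "y \<in> ?L" for x y
  using that(2)
 proof (induction rule: lspan.induct)
  case zero
  then show ?case using lspan.zero[of "reg S 0"] Lc[OF x] by simp
 next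
  case (step y g a)
  have cl: "y \<in> carrier S" "g \<in> carrier S" "a \<in> carrier S" using Lc[OF step(1)] step(2,3) Uc sA by auto
  have "x \<otimes> (y \<oplus> g \<otimes> a) = x \<otimes> y \<oplus> x \<otimes> g \<otimes> a" using cl Lc[OF x] by (simp add: r_distr m_assoc)
  then show ?case using add[OF Uc step.IH sc[OF wr[OF x step(2)] step(3)]] by simp
 qed
 have all: "carrier S \<subseteq> ?L"
 proof (rule gen)
  show "?L \<subseteq> carrier S" using Lc by blast
  have "\<one> \<in> ?U" by (rule UN_I[of 0]) simp_all
  then show "c \<bullet> \<one> \<in> ?L" for c using sc[OF UL, of \<one> "c \<bullet> \<one>"] by (simp add: scal_def ascale_closed)
  have "x \<in> ?U" if "x \<in> X" for x
   using that Xc[OF that] by (intro UN_I[of 1]) (auto intro!: image_eqI[of _ _ "(x, \<one>)"])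
  then show "X \<subseteq> ?L" using UL by blast
  show "a \<oplus> b \<in> ?L" if "a \<in> ?L" "b \<in> ?L" for a b using add[OF Uc that] by simp
 qed (rule mult)
 \<comment> \<open>The component of degree i collects the words of length i; in negative degrees
   there are none.\<close>
 have comp: "cmp S (hcomp S) x i \<in> (if i < 0 then {\<zero>} else lspan (reg S 0) (scal S) (?F (nat i)))" if "x \<in> ?L" for x i
  using that
 proof (induction rule: lspan.induct)
  case zero
  then show ?case using lspan.zero[of "reg S 0" "scal S" "?F (nat i)"] by (simp add: SG.cmp_zero)
 next
  case (step x g a)
  obtain j where j: "g \<in> ?F j" using step(2) by blast
  have "g \<otimes> a \<in> hcomp S (int j + 0)" by (rule mult_hcomp) (use j Fh scal_hcomp[OF step(3)] in auto)
  then have ga: "g \<otimes> a \<in> hcomp S (int j)" by simp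
  have "cmp S (hcomp S) (x \<oplus> g \<otimes> a) i = cmp S (hcomp S) x i \<oplus> (if i = int j then g \<otimes> a else \<zero>)"
   using SG.cmp_add[OF Lc[OF step(1)] SG.comp_closed[OF ga]] SG.cmp_homog[OF ga] by simp
  then show ?case
   using step.IH SG.cmp_closed[OF Lc[OF step(1)], of i] lspan.step[of _ "reg S 0" "scal S" "?F j" g a] j step(3) SG.comp_closed[OF ga]
   by (auto split: if_splits)
 qed
 have span: "a \<in> lspan (reg S 0) (scal S) (?F j)" if "a \<in> hcomp S (int j)" for a j
  using comp[of a "int j"] SG.cmp_homog[OF that, of "int j"] all SG.comp_closed[OF that] by auto
 show ?thesis
 proof (intro std_algebra.intro graded_algebra_axioms std_algebra_axioms.intro fin Fh span)
  show "a = \<zero>" if "i < 0" "a \<in> hcomp S i" for i a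
   using comp[of a i] SG.cmp_homog[OF that(2), of i] all SG.comp_closed[OF that(2)] that(1) by auto
  fix a m j assume a: "a \<in> hcomp S (int m)" and jm: "j \<le> m"
  have Fj: "?F j \<subseteq> carrier (reg S 0)" using Fc by auto
  have W: "w \<in> lspan (reg S 0) (carrier S) (?F j)" if w: "w \<in> ?F m" for w
  proof -
   obtain b c where bc: "b \<in> ?F j" "c \<in> ?F (m - j)" "w = b \<otimes> c" using split[of w j "m - j"] w jm by auto
   then show ?thesis using R.lspan_base[OF subset_refl Fj bc(1) Fc[OF bc(2)]] by simp
  qed
  from span[OF a] show "a \<in> lspan (reg S 0) (carrier S) (?F j)"
  proof (induction rule: lspan.induct)
   case zero show ?case by (rule lspan.zero)
  next
   case (step x g c)
   have ac: "c \<in> carrier S" by (rule subsetD[OF sA step(3)])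
   show ?case
    by (rule R.lspan_add[OF subset_refl Fj step.IH])
     (rule R.lspan_ract[OF subset_refl Fj W[OF step(2)] ac], rule m_closed[OF _ ac])
  qed
 qed
qed

section \<open>The double Ore extension\<close>

text \<open>Here a, b, p, q stand for x_1, x_2, y_1, y_2, and the mixed relations are those given by
  \<sigma>.\<close>

locale ore_plane = ring R for R (structure) +
 fixes a b p q
 assumes gens [simp]: "a \<in> carrier R" "b \<in> carrier R" "p \<in> carrier R" "q \<in> carrier R"
  and ba: "b \<otimes> a = \<ominus> (a \<otimes> b)" and qp: "q \<otimes> p = \<ominus> (p \<otimes> q)"
  and pa: "p \<otimes> a = a \<otimes> p \<oplus> b \<otimes> p \<oplus> a \<otimes> q" and qa: "q \<otimes> a = b \<otimes> p"
  and pb: "p \<otimes> b = a \<otimes> q" and qb: "q \<otimes> b = \<ominus> (b \<otimes> p) \<oplus> b \<otimes> q \<oplus> \<ominus> (a \<otimes> q)"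
begin

text \<open>In terms of X and Z = x_1 - x_2 the relations simplify: y_1 Z = X y_1 and y_2 X = -Z
  y_2, and X commutes with Y.\<close>

definition X where "X = a \<oplus> b"
definition Z where "Z = a \<ominus> b"
definition Y where "Y = p \<oplus> q"
definition h where "h = X \<otimes> p \<oplus> Z \<otimes> q"

lemma closed [simp]: "X \<in> carrier R" "Z \<in> carrier R" "Y \<in> carrier R" "h \<in> carrier R"
 by (simp_all add: X_def Z_def Y_def h_def)

lemma XX: "X \<otimes> X = a \<otimes> a \<oplus> b \<otimes> b"
proof -
 have "X \<otimes> X = a \<otimes> a \<oplus> a \<otimes> b \<oplus> (b \<otimes> a \<oplus> b \<otimes> b)" unfolding X_def using gens by algebra
 also have "\<dots> = a \<otimes> a \<oplus> b \<otimes> b" unfolding ba using gens m_closed by algebra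
 finally show ?thesis .
qed

text \<open>Both squares lose their mixed terms by anticommutation. This equality is what makes X^2
  commute with y_1 and y_2, and h with X.\<close>

lemma ZZ: "Z \<otimes> Z = X \<otimes> X"
proof -
 have "Z \<otimes> Z = a \<otimes> a \<ominus> a \<otimes> b \<ominus> (b \<otimes> a \<ominus> b \<otimes> b)" unfolding Z_def using gens by algebra
 also have "\<dots> = a \<otimes> a \<oplus> b \<otimes> b" unfolding ba using gens by algebra
 finally show ?thesis unfolding XX .
qed

lemma YY: "Y \<otimes> Y = p \<otimes> p \<oplus> q \<otimes> q"
proof -
 have "Y \<otimes> Y = p \<otimes> p \<oplus> p \<otimes> q \<oplus> (q \<otimes> p \<oplus> q \<otimes> q)" unfolding Y_def using gens by algebra
 also have "\<dots> = p \<otimes> p \<oplus> q \<otimes> q" unfolding qp using gens by algebra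
 finally show ?thesis .
qed

lemma pZ: "p \<otimes> Z = X \<otimes> p"
proof -
 have "p \<otimes> Z = p \<otimes> a \<ominus> p \<otimes> b" unfolding Z_def using gens by algebra
 also have "\<dots> = X \<otimes> p" unfolding pa pb X_def using gens by algebra
 finally show ?thesis .
qed

lemma qX: "q \<otimes> X = \<ominus> (Z \<otimes> q)"
proof -
 have "q \<otimes> X = q \<otimes> a \<oplus> q \<otimes> b" unfolding X_def using gens by algebra
 also have "\<dots> = \<ominus> (Z \<otimes> q)" unfolding qa qb Z_def using gens by algebra
 finally show ?thesis .
qed

lemma pX: "p \<otimes> X = X \<otimes> p \<oplus> (X \<oplus> Z) \<otimes> q"
proof -
 have "p \<otimes> X = p \<otimes> a \<oplus> p \<otimes> b" unfolding X_def using gens by algebra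
 also have "\<dots> = X \<otimes> p \<oplus> (X \<oplus> Z) \<otimes> q" unfolding pa pb Z_def X_def using gens by algebra
 finally show ?thesis .
qed

lemma qZ: "q \<otimes> Z = (X \<ominus> Z) \<otimes> p \<oplus> Z \<otimes> q"
proof -
 have "q \<otimes> Z = q \<otimes> a \<ominus> q \<otimes> b" unfolding Z_def using gens by algebra
 also have "\<dots> = (X \<ominus> Z) \<otimes> p \<oplus> Z \<otimes> q" unfolding qa qb Z_def X_def using gens by algebra
 finally show ?thesis .
qed

lemma YX: "Y \<otimes> X = X \<otimes> Y"
proof -
 have "Y \<otimes> X = p \<otimes> X \<oplus> q \<otimes> X" unfolding Y_def using gens closed by algebra
 also have "\<dots> = X \<otimes> Y" unfolding pX qX Y_def using gens closed by algebra
 finally show ?thesis .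
qed

lemma p_XX: "p \<otimes> (X \<otimes> X) = X \<otimes> X \<otimes> p"
proof -
 have "p \<otimes> (X \<otimes> X) = p \<otimes> X \<otimes> X" by (simp add: m_assoc)
 also have "\<dots> = (X \<otimes> p \<oplus> (X \<oplus> Z) \<otimes> q) \<otimes> X" by (simp only: pX)
 also have "\<dots> = X \<otimes> (p \<otimes> X) \<oplus> (X \<oplus> Z) \<otimes> (q \<otimes> X)" using gens closed by algebra
 also have "\<dots> = X \<otimes> X \<otimes> p \<oplus> X \<otimes> X \<otimes> q \<ominus> Z \<otimes> Z \<otimes> q" unfolding pX qX using gens closed by algebra
 also have "\<dots> = X \<otimes> X \<otimes> p" unfolding ZZ using gens closed by algebra
 finally show ?thesis .
qed

lemma q_XX: "q \<otimes> (X \<otimes> X) = X \<otimes> X \<otimes> q"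
proof -
 have "q \<otimes> (X \<otimes> X) = q \<otimes> X \<otimes> X" by (simp add: m_assoc)
 also have "\<dots> = \<ominus> (Z \<otimes> q) \<otimes> X" by (simp only: qX)
 also have "\<dots> = \<ominus> (Z \<otimes> (q \<otimes> X))" using gens closed by algebra
 also have "\<dots> = Z \<otimes> Z \<otimes> q" unfolding qX using gens closed by algebra
 finally show ?thesis unfolding ZZ .
qed

lemma a_XX: "a \<otimes> (X \<otimes> X) = X \<otimes> X \<otimes> a" and b_XX: "b \<otimes> (X \<otimes> X) = X \<otimes> X \<otimes> b"
proof -
 have "a \<otimes> (b \<otimes> b) = \<ominus> (b \<otimes> a) \<otimes> b" unfolding ba using gens by algebra
 also have "\<dots> = \<ominus> (b \<otimes> (a \<otimes> b))" using gens by algebra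
 also have "\<dots> = b \<otimes> b \<otimes> a" using arg_cong[OF ba, of "\<lambda>t. b \<otimes> t"] gens by (simp add: m_assoc r_minus)
 finally have 1: "a \<otimes> (b \<otimes> b) = b \<otimes> b \<otimes> a" .
 have "b \<otimes> (a \<otimes> a) = \<ominus> (a \<otimes> b) \<otimes> a" unfolding ba[symmetric] using gens by algebra
 also have "\<dots> = \<ominus> (a \<otimes> (b \<otimes> a))" using gens by algebra
 also have "\<dots> = a \<otimes> a \<otimes> b" unfolding ba using gens by algebra
 finally have 2: "b \<otimes> (a \<otimes> a) = a \<otimes> a \<otimes> b" .
 show "a \<otimes> (X \<otimes> X) = X \<otimes> X \<otimes> a" "b \<otimes> (X \<otimes> X) = X \<otimes> X \<otimes> b"
  unfolding XX using 1 2 by (simp_all add: l_distr r_distr m_assoc)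
qed

lemma p_qq: "q \<otimes> (q \<otimes> p) = p \<otimes> (q \<otimes> q)" and q_pp: "q \<otimes> (p \<otimes> p) = p \<otimes> p \<otimes> q"
proof -
 have "q \<otimes> (q \<otimes> p) = q \<otimes> \<ominus> (p \<otimes> q)" by (simp only: qp)
 also have "\<dots> = \<ominus> (q \<otimes> p \<otimes> q)" using gens by algebra
 also have "\<dots> = p \<otimes> (q \<otimes> q)" unfolding qp using gens by algebra
 finally show "q \<otimes> (q \<otimes> p) = p \<otimes> (q \<otimes> q)" .
 have "q \<otimes> (p \<otimes> p) = q \<otimes> p \<otimes> p" using gens by algebra
 also have "\<dots> = \<ominus> (p \<otimes> q) \<otimes> p" by (simp only: qp)
 also have "\<dots> = \<ominus> (p \<otimes> (q \<otimes> p))" using gens by algebra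
 also have "\<dots> = p \<otimes> p \<otimes> q" unfolding qp using gens by algebra
 finally show "q \<otimes> (p \<otimes> p) = p \<otimes> p \<otimes> q" .
qed

lemma p_YY: "p \<otimes> (Y \<otimes> Y) = Y \<otimes> Y \<otimes> p" and q_YY: "q \<otimes> (Y \<otimes> Y) = Y \<otimes> Y \<otimes> q"
 unfolding YY using p_qq q_pp by (simp_all add: l_distr r_distr m_assoc)

lemma X_YY: "X \<otimes> (Y \<otimes> Y) = Y \<otimes> Y \<otimes> X"
proof -
 have "Y \<otimes> Y \<otimes> X = Y \<otimes> (X \<otimes> Y)" by (simp add: m_assoc YX)
 also have "\<dots> = X \<otimes> Y \<otimes> Y" by (simp add: m_assoc[symmetric] YX)
 finally show ?thesis by (simp add: m_assoc)
qed

text \<open>The unwanted terms of y_1^2 Z and y_2^2 Z cancel in the sum, by y_2 y_1 = -y_1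
  y_2.\<close>

lemma Z_YY: "Z \<otimes> (Y \<otimes> Y) = Y \<otimes> Y \<otimes> Z"
proof -
 have "p \<otimes> p \<otimes> Z = p \<otimes> X \<otimes> p" using pZ by (simp add: m_assoc)
 also have "\<dots> = X \<otimes> (p \<otimes> p) \<oplus> (X \<oplus> Z) \<otimes> (q \<otimes> p)" unfolding pX using gens closed by algebra
 finally have 1: "p \<otimes> p \<otimes> Z = X \<otimes> (p \<otimes> p) \<oplus> (X \<oplus> Z) \<otimes> (q \<otimes> p)" .
 have "q \<otimes> q \<otimes> Z = q \<otimes> (q \<otimes> Z)" by (simp add: m_assoc)
 also have "\<dots> = (q \<otimes> X) \<otimes> p \<ominus> (q \<otimes> Z) \<otimes> p \<oplus> (q \<otimes> Z) \<otimes> q"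
  unfolding arg_cong[OF qZ, of "\<lambda>t. q \<otimes> t"] using gens closed by algebra
 also have "\<dots> = Z \<otimes> (q \<otimes> q) \<ominus> X \<otimes> (p \<otimes> p) \<oplus> Z \<otimes> (p \<otimes> p) \<ominus> Z \<otimes> (q \<otimes> p) \<ominus> Z \<otimes> (q \<otimes> p) \<oplus> X \<otimes> (p \<otimes> q) \<ominus> Z \<otimes> (p \<otimes> q)"
  unfolding qX qZ using gens closed by algebra
 finally have 2: "q \<otimes> q \<otimes> Z = \<dots>" .
 have "Y \<otimes> Y \<otimes> Z = p \<otimes> p \<otimes> Z \<oplus> q \<otimes> q \<otimes> Z" unfolding YY by (simp add: l_distr)
 also have "\<dots> = Z \<otimes> (Y \<otimes> Y)" unfolding 1 2 YY qp using gens closed by algebra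
 finally show ?thesis ..
qed

text \<open>Moving X to the left through h leaves the extra terms X^2 y_2 and -Z^2 y_2, which cancel
  by \<open>ZZ\<close>.\<close>

lemma hX: "h \<otimes> X = X \<otimes> h"
proof -
 have "h \<otimes> X = X \<otimes> (p \<otimes> X) \<oplus> Z \<otimes> (q \<otimes> X)" unfolding h_def using gens closed(1-2) by algebra
 also have "\<dots> = X \<otimes> X \<otimes> p \<oplus> X \<otimes> X \<otimes> q \<oplus> X \<otimes> Z \<otimes> q \<ominus> Z \<otimes> Z \<otimes> q" unfolding pX qX using gens closed(1-2) by algebra
 also have "\<dots> = X \<otimes> h" unfolding ZZ h_def using gens closed(1-2) by algebra
 finally show ?thesis .
qed

lemma hY: "h \<otimes> Y = Y \<otimes> h"
proof -
 have "Y \<otimes> h = (Y \<otimes> X) \<otimes> p \<oplus> (p \<otimes> Z \<oplus> q \<otimes> Z) \<otimes> q" unfolding h_def Y_def using gens closed(1-2) by algebra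
 also have "\<dots> = X \<otimes> (p \<otimes> p) \<oplus> X \<otimes> (q \<otimes> p) \<oplus> X \<otimes> (p \<otimes> q) \<oplus> X \<otimes> (p \<otimes> q) \<ominus> Z \<otimes> (p \<otimes> q) \<oplus> Z \<otimes> (q \<otimes> q)"
  unfolding YX pZ qZ unfolding Y_def using gens closed(1-2) by algebra
 also have "\<dots> = X \<otimes> (p \<otimes> p) \<oplus> X \<otimes> (p \<otimes> q) \<oplus> Z \<otimes> (q \<otimes> p) \<oplus> Z \<otimes> (q \<otimes> q)"
  unfolding qp using gens closed(1-2) by algebra
 also have "\<dots> = h \<otimes> Y" unfolding h_def Y_def using gens closed(1-2) by algebra
 finally show ?thesis ..
qed

end

text \<open>The generators are recovered from X and Z only after doubling; the factor 2 is removed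
  later, where scalars are available.\<close>

lemma (in ore_plane) double_gens: "a \<oplus> a = X \<oplus> Z" "b \<oplus> b = X \<oplus> \<ominus> Z"
 unfolding X_def Z_def using gens by algebra+

text \<open>The double Ore extension of the theorem, with y_1, y_2 written p, q and with the entries
  of \<sigma> as four separate maps.\<close>

locale skew_ore = graded_algebra B for B :: "('k::{alg_closed_field, field_char_0}, 'b) graded_alg" (structure) +
 fixes \<iota> :: "(xvar list \<Rightarrow> 'k) set \<Rightarrow> 'b" and p q :: 'b and s11 s12 s21 s22 :: "(xvar list \<Rightarrow> 'k) set \<Rightarrow> (xvar list \<Rightarrow> 'k) set"
 assumes A: "graded_algebra (\<A> :: ('k, (xvar list \<Rightarrow> 'k) set) graded_alg)"
  and \<iota>: "\<iota> \<in> graded_algebra_hom \<A> B"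
  and p: "p \<in> hcomp B 1" and q: "q \<in> hcomp B 1"
  and gen: "generate_ring B (\<iota> ` carrier \<A> \<union> {p, q}) = carrier B"
  and s_closed: "a \<in> carrier \<A> \<Longrightarrow> s11 a \<in> carrier \<A> \<and> s12 a \<in> carrier \<A> \<and>
   s21 a \<in> carrier \<A> \<and> s22 a \<in> carrier \<A>"
  and s_scalar: "s11 (c \<bullet>\<^bsub>\<A>\<^esub> \<one>\<^bsub>\<A>\<^esub>) = c \<bullet>\<^bsub>\<A>\<^esub> \<one>\<^bsub>\<A>\<^esub>"
   "s12 (c \<bullet>\<^bsub>\<A>\<^esub> \<one>\<^bsub>\<A>\<^esub>) = \<zero>[\<A>]" "s21 (c \<bullet>\<^bsub>\<A>\<^esub> \<one>\<^bsub>\<A>\<^esub>) = \<zero>[\<A>]"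
   "s22 (c \<bullet>\<^bsub>\<A>\<^esub> \<one>\<^bsub>\<A>\<^esub>) = c \<bullet>\<^bsub>\<A>\<^esub> \<one>\<^bsub>\<A>\<^esub>"
  and s_add: "a \<in> carrier \<A> \<Longrightarrow> a' \<in> carrier \<A> \<Longrightarrow> s11 (a \<oplus>[\<A>] a') = s11 a \<oplus>[\<A>] s11 a' \<and>
   s12 (a \<oplus>[\<A>] a') = s12 a \<oplus>[\<A>] s12 a' \<and> s21 (a \<oplus>[\<A>] a') = s21 a \<oplus>[\<A>] s21 a' \<and>
   s22 (a \<oplus>[\<A>] a') = s22 a \<oplus>[\<A>] s22 a'"
  and s_mult: "a \<in> carrier \<A> \<Longrightarrow> a' \<in> carrier \<A> \<Longrightarrow>
   s11 (a \<otimes>[\<A>] a') = s11 a \<otimes>[\<A>] s11 a' \<oplus>[\<A>] s12 a \<otimes>[\<A>] s21 a' \<and>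
   s12 (a \<otimes>[\<A>] a') = s11 a \<otimes>[\<A>] s12 a' \<oplus>[\<A>] s12 a \<otimes>[\<A>] s22 a' \<and>
   s21 (a \<otimes>[\<A>] a') = s21 a \<otimes>[\<A>] s11 a' \<oplus>[\<A>] s22 a \<otimes>[\<A>] s21 a' \<and>
   s22 (a \<otimes>[\<A>] a') = s21 a \<otimes>[\<A>] s12 a' \<oplus>[\<A>] s22 a \<otimes>[\<A>] s22 a'"
  and qp_rel: "q \<otimes> p = \<ominus> (p \<otimes> q)"
  and basis: "t \<in> carrier B \<Longrightarrow> \<exists>!c :: nat \<times> nat \<Rightarrow> (xvar list \<Rightarrow> 'k) set. range c \<subseteq> carrier \<A> \<and>
   finite {n. c n \<noteq> \<zero>[\<A>]} \<and> t = (\<Oplus>n\<in>{n. c n \<noteq> \<zero>[\<A>]}. \<iota> (c n) \<otimes> (p [^] fst n \<otimes> q [^] snd n))"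
  and p_comm: "a \<in> carrier \<A> \<Longrightarrow> p \<otimes> \<iota> a = \<iota> (s11 a) \<otimes> p \<oplus> \<iota> (s12 a) \<otimes> q"
  and q_comm: "a \<in> carrier \<A> \<Longrightarrow> q \<otimes> \<iota> a = \<iota> (s21 a) \<otimes> p \<oplus> \<iota> (s22 a) \<otimes> q"
  and s_x1: "s11 x1 = x1 \<oplus>[\<A>] x2" "s12 x1 = x1" "s21 x1 = x2" "s22 x1 = \<zero>[\<A>]"
  and s_x2: "s11 x2 = \<zero>[\<A>]" "s12 x2 = x1" "s21 x2 = \<ominus>\<^bsub>\<A>\<^esub> x2" "s22 x2 = \<ominus>\<^bsub>\<A>\<^esub> x1 \<oplus>[\<A>] x2"
begin

abbreviation A :: "('k, (xvar list \<Rightarrow> 'k) set) graded_alg" where "A \<equiv> skew_plane"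

sublocale A: graded_algebra "skew_plane :: ('k, (xvar list \<Rightarrow> 'k) set) graded_alg" by (rule A)

lemma pq_closed [simp]: "p \<in> carrier B" "q \<in> carrier B" using p q SG.comp_closed by blast+

lemma x_closed [simp]: "x1 \<in> carrier A" "x2 \<in> carrier A" using skew_plane_gens A.SG.comp_closed by blast+

lemma \<iota>_ring_hom: "ring_hom_ring A B \<iota>"
 by (rule ring_hom_ringI2[OF A.ring_axioms ring_axioms]) (use \<iota> in \<open>simp add: graded_algebra_hom_def\<close>)

sublocale \<iota>: ring_hom_ring "skew_plane :: ('k, (xvar list \<Rightarrow> 'k) set) graded_alg" B \<iota> by (rule \<iota>_ring_hom)

lemma \<iota>_scale: "a \<in> carrier A \<Longrightarrow> \<iota> (c \<bullet>\<^bsub>A\<^esub> a) = c \<bullet> \<iota> a"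
 using \<iota> by (simp add: graded_algebra_hom_def)

lemma \<iota>_hcomp: "a \<in> hcomp A i \<Longrightarrow> \<iota> a \<in> hcomp B i"
proof -
 have "\<iota> ` hcomp A i \<subseteq> hcomp B i" using \<iota> unfolding graded_algebra_hom_def by simp
 then show "a \<in> hcomp A i \<Longrightarrow> \<iota> a \<in> hcomp B i" by (rule subsetD) (rule imageI)
qed

sublocale P: ore_plane B "\<iota> x1" "\<iota> x2" p q
proof
 have "\<iota> (x1 \<otimes>[A] x2 \<oplus>[A] x2 \<otimes>[A] x1) = \<zero>" unfolding skew_plane_rel by simp
 then have "\<iota> x2 \<otimes> \<iota> x1 \<oplus> \<iota> x1 \<otimes> \<iota> x2 = \<zero>" by (simp add: a_comm)
 then show "\<iota> x2 \<otimes> \<iota> x1 = \<ominus> (\<iota> x1 \<otimes> \<iota> x2)" by (intro minus_equality[symmetric]) simp_all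
 show "q \<otimes> p = \<ominus> (p \<otimes> q)" by (rule qp_rel)
 show "p \<otimes> \<iota> x1 = \<iota> x1 \<otimes> p \<oplus> \<iota> x2 \<otimes> p \<oplus> \<iota> x1 \<otimes> q" "q \<otimes> \<iota> x1 = \<iota> x2 \<otimes> p"
  using p_comm[of x1] q_comm[of x1] by (simp_all add: s_x1 l_distr)
 show "p \<otimes> \<iota> x2 = \<iota> x1 \<otimes> q" using p_comm[of x2] by (simp add: s_x2)
 have "q \<otimes> \<iota> x2 = \<ominus> (\<iota> x2) \<otimes> p \<oplus> (\<ominus> (\<iota> x1) \<oplus> \<iota> x2) \<otimes> q" using q_comm[of x2] by (simp add: s_x2)
 also have "\<dots> = \<ominus> (\<iota> x2 \<otimes> p) \<oplus> \<iota> x2 \<otimes> q \<oplus> \<ominus> (\<iota> x1 \<otimes> q)"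
  using \<iota>.hom_closed[OF x_closed(1)] \<iota>.hom_closed[OF x_closed(2)] pq_closed by algebra
 finally show "q \<otimes> \<iota> x2 = \<ominus> (\<iota> x2 \<otimes> p) \<oplus> \<iota> x2 \<otimes> q \<oplus> \<ominus> (\<iota> x1 \<otimes> q)" .
qed simp_all

lemma B_induct [consumes 1, case_names scalar x1 x2 p q add mult]:
 assumes b: "b \<in> carrier B" and sc: "\<And>c. Q (c \<bullet> \<one>)" and x1: "Q (\<iota> x1)" and x2: "Q (\<iota> x2)" and Qp: "Q p" and Qq: "Q q"
  and add: "\<And>a b. a \<in> carrier B \<Longrightarrow> b \<in> carrier B \<Longrightarrow> Q a \<Longrightarrow> Q b \<Longrightarrow> Q (a \<oplus> b)"
  and mult: "\<And>a b. a \<in> carrier B \<Longrightarrow> b \<in> carrier B \<Longrightarrow> Q a \<Longrightarrow> Q b \<Longrightarrow> Q (a \<otimes> b)"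
 shows "Q b"
proof -
 have QA: "Q (\<iota> a)" if "a \<in> carrier A" for a
  using that
 proof (induction rule: skew_plane_induct)
  case (scalar c) show ?case using sc[of c] by (simp add: \<iota>_scale)
 next
  case (add a b) then show ?case using assms(7)[of "\<iota> a" "\<iota> b"] by simp
 next
  case (mult a b) then show ?case using assms(8)[of "\<iota> a" "\<iota> b"] by simp
 qed (rule x1 x2)+
 have "Q b \<and> b \<in> carrier B" if "b \<in> generate_ring B (\<iota> ` carrier A \<union> {p, q})"
  using that
 proof (induction rule: generate_ring.induct)
  case one
  then show ?case using sc[of 1] by (simp add: ascale_one)
 next
  case (incl h)
  then show ?case using QA Qp Qq by auto
 next
  case (a_inv h)
  \<comment> \<open>Negation is multiplication by the scalar -1, which reduces it to the case of
    products.\<close>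
  have "\<ominus> h = ((- 1) \<bullet> \<one>) \<otimes> h" using a_inv by (simp add: ascale_minus ascale_one l_minus)
  then show ?case using mult[of "(- 1) \<bullet> \<one>" h] sc[of "- 1"] a_inv by (simp add: ascale_closed)
 next
  case (eng_add h1 h2) then show ?case using add by simp
 next
  case (eng_mult h1 h2) then show ?case using mult by simp
 qed
 then show ?thesis using b gen by simp
qed

section \<open>Coefficients with respect to the basis y_1^i y_2^j\<close>

abbreviation M :: "nat \<times> nat \<Rightarrow> 'b" where "M n \<equiv> p [^] fst n \<otimes> q [^] snd n"

definition fin :: "(nat \<times> nat \<Rightarrow> (xvar list \<Rightarrow> 'k) set) \<Rightarrow> bool" where
 "fin c \<longleftrightarrow> range c \<subseteq> carrier A \<and> finite {n. c n \<noteq> \<zero>[A]}"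

text \<open>The expansion with coefficients c. The basis property says that \<open>Ex\<close> is a
  bijection from finitely supported families onto B; its inverse is \<open>coef\<close>.\<close>

definition Ex :: "(nat \<times> nat \<Rightarrow> (xvar list \<Rightarrow> 'k) set) \<Rightarrow> 'b" where
 "Ex c = (\<Oplus>n\<in>{n. c n \<noteq> \<zero>[A]}. \<iota> (c n) \<otimes> M n)"

definition single :: "nat \<times> nat \<Rightarrow> (xvar list \<Rightarrow> 'k) set \<Rightarrow> nat \<times> nat \<Rightarrow> (xvar list \<Rightarrow> 'k) set" where
 "single n a = (\<lambda>m. if m = n then a else \<zero>[A])"

lemma finD: "fin c \<Longrightarrow> c n \<in> carrier A" by (auto simp: fin_def)

lemma Ex_super:
 assumes c: "fin c" and F: "finite F" "{n. c n \<noteq> \<zero>[A]} \<subseteq> F"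
 shows "Ex c = (\<Oplus>n\<in>F. \<iota> (c n) \<otimes> M n)"
 unfolding Ex_def by (rule add.finprod_mono_neutral_cong_left) (use F finD[OF c] in auto)

lemma Ex_closed: assumes "fin c" shows "Ex c \<in> carrier B"
 unfolding Ex_def by (rule finsum_closed) (use finD[OF assms] in auto)

lemma Ex_add:
 assumes c: "fin c" and d: "fin d"
 shows "fin (\<lambda>n. c n \<oplus>[A] d n)" and "Ex (\<lambda>n. c n \<oplus>[A] d n) = Ex c \<oplus> Ex d"
proof -
 let ?F = "{n. c n \<noteq> \<zero>[A]} \<union> {n. d n \<noteq> \<zero>[A]}"
 have F: "finite ?F" using c d by (simp add: fin_def)
 have s: "{n. c n \<oplus>[A] d n \<noteq> \<zero>[A]} \<subseteq> ?F" by auto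
 show f: "fin (\<lambda>n. c n \<oplus>[A] d n)"
  unfolding fin_def using finite_subset[OF s F] finD[OF c] finD[OF d] by auto
 have "Ex (\<lambda>n. c n \<oplus>[A] d n) = (\<Oplus>n\<in>?F. \<iota> (c n) \<otimes> M n \<oplus> \<iota> (d n) \<otimes> M n)"
  unfolding Ex_super[OF f F s] by (rule finsum_cong') (use finD[OF c] finD[OF d] in \<open>auto simp: l_distr\<close>)
 also have "\<dots> = Ex c \<oplus> Ex d"
  unfolding Ex_super[OF c F Un_upper1] Ex_super[OF d F Un_upper2]
  by (rule finsum_addf) (use finD[OF c] finD[OF d] in auto)
 finally show "Ex (\<lambda>n. c n \<oplus>[A] d n) = Ex c \<oplus> Ex d" .
qed

lemma Ex_single:
 assumes a: "a \<in> carrier A" shows "fin (single n a)" and "Ex (single n a) = \<iota> a \<otimes> M n"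
proof -
 show f: "fin (single n a)" unfolding fin_def single_def using a by auto
 have s: "{m. single n a m \<noteq> \<zero>[A]} \<subseteq> {n}" by (auto simp: single_def)
 show "Ex (single n a) = \<iota> a \<otimes> M n"
  unfolding Ex_super[OF f _ s, simplified] using a by (simp add: single_def)
qed

lemma Ex_ex1: "b \<in> carrier B \<Longrightarrow> \<exists>!c. fin c \<and> b = Ex c"
 using basis[of b] unfolding fin_def Ex_def by (simp add: conj_assoc)

lemma Ex_inj: "fin c \<Longrightarrow> fin d \<Longrightarrow> Ex c = Ex d \<Longrightarrow> c = d"
 using Ex_ex1[OF Ex_closed[of c]] by metis

definition coef :: "'b \<Rightarrow> nat \<times> nat \<Rightarrow> (xvar list \<Rightarrow> 'k) set" where
 "coef b = (THE c. fin c \<and> b = Ex c)"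

lemma coef: assumes "b \<in> carrier B" shows "fin (coef b)" "Ex (coef b) = b"
proof -
 have "fin (coef b) \<and> b = Ex (coef b)" unfolding coef_def by (rule theI'[OF Ex_ex1[OF assms]])
 then show "fin (coef b)" "Ex (coef b) = b" by simp_all
qed

lemma coef_Ex: "fin c \<Longrightarrow> coef (Ex c) = c"
 by (rule Ex_inj[OF coef(1)[OF Ex_closed] _ coef(2)[OF Ex_closed]])

lemma coef_add: "a \<in> carrier B \<Longrightarrow> b \<in> carrier B \<Longrightarrow> coef (a \<oplus> b) = (\<lambda>n. coef a n \<oplus>[A] coef b n)"
 using coef_Ex[OF Ex_add(1)[OF coef(1) coef(1)], of a b] Ex_add(2)[OF coef(1) coef(1), of a b] by (simp add: coef(2))

lemma coef_single: "a \<in> carrier A \<Longrightarrow> coef (\<iota> a \<otimes> M n) = single n a"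
 using coef_Ex[OF Ex_single(1)] by (simp add: Ex_single(2))

lemma fin_zero: "fin (\<lambda>_. \<zero>[A])" by (auto simp: fin_def)

lemma coef_zero: "coef \<zero> = (\<lambda>_. \<zero>[A])"
proof -
 have "Ex (\<lambda>_. \<zero>[A]) = \<zero>" by (simp add: Ex_def)
 then show ?thesis using coef_Ex[OF fin_zero] by simp
qed

lemma basis_induct [consumes 1, case_names zero add]:
 assumes b: "b \<in> carrier B" and z: "Q \<zero>"
  and step: "\<And>a n b. a \<in> carrier A \<Longrightarrow> b \<in> carrier B \<Longrightarrow> Q b \<Longrightarrow> Q (\<iota> a \<otimes> M n \<oplus> b)"
 shows "Q b"
proof -
 note c = finD[OF coef(1)[OF b]]
 have "Q (\<Oplus>n\<in>F. \<iota> (coef b n) \<otimes> M n) \<and> (\<Oplus>n\<in>F. \<iota> (coef b n) \<otimes> M n) \<in> carrier B" if "finite F" for F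
  using that
 proof induction
  case empty then show ?case using z by simp
 next
  case (insert n F)
  have "(\<Oplus>n\<in>insert n F. \<iota> (coef b n) \<otimes> M n) = \<iota> (coef b n) \<otimes> M n \<oplus> (\<Oplus>n\<in>F. \<iota> (coef b n) \<otimes> M n)"
   by (rule finsum_insert) (use insert c in auto)
  then show ?case using step[OF c[of n], of "\<Oplus>n\<in>F. \<iota> (coef b n) \<otimes> M n" n] insert.IH c[of n] by simp
 qed
 from this[of "{n. coef b n \<noteq> \<zero>[A]}"] coef[OF b] show ?thesis by (simp add: fin_def Ex_def)
qed

text \<open>By \<open>P.XX\<close> and \<open>P.YY\<close> this is the element x_1^2 + x_2^2 + y_1^2
  + y_2^2 of the theorem.\<close>

definition f where "f = P.X \<otimes> P.X \<oplus> P.Y \<otimes> P.Y"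

lemma f_closed [simp]: "f \<in> carrier B" by (simp add: f_def)

lemma scalar_closed [simp]: "c \<bullet> \<one> \<in> carrier B" by (rule ascale_closed) simp

lemma scalar_central: "b \<in> carrier B \<Longrightarrow> (c \<bullet> \<one>) \<otimes> b = b \<otimes> (c \<bullet> \<one>)"
 using scale_one_mult[of b c] mult_scale_one[of b c] by simp

text \<open>Multiplication by the scalar 1/2 undoes the doubling.\<close>

lemma double_cancel:
 assumes "s \<in> carrier B" "t \<in> carrier B" "s \<oplus> s = t \<oplus> t" shows "s = t"
proof -
 have "r = (1 / 2) \<bullet> (r \<oplus> r)" if "r \<in> carrier B" for r
 proof -
  have "(1 / 2) \<bullet> (r \<oplus> r) = (1 / 2 + 1 / 2) \<bullet> r"
   unfolding add_ascale[OF that] ascale_add[OF that that] ..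
  moreover have "1 / 2 + 1 / 2 = (1 :: 'k)" by simp
  ultimately show ?thesis using that by (simp add: ascale_one)
 qed
 then show ?thesis using assms by metis
qed

lemma f_comm:
 assumes t: "t \<in> carrier B" and X: "t \<otimes> (P.X \<otimes> P.X) = P.X \<otimes> P.X \<otimes> t" and Y: "t \<otimes> (P.Y \<otimes> P.Y) = P.Y \<otimes> P.Y \<otimes> t"
 shows "t \<otimes> f = f \<otimes> t"
proof -
 have c: "P.X \<otimes> P.X \<in> carrier B" "P.Y \<otimes> P.Y \<in> carrier B" by simp_all
 show ?thesis unfolding f_def r_distr[OF c t] l_distr[OF c t] X Y ..
qed

lemma double_comm:
 assumes "t \<in> carrier B" "s \<in> carrier B" "(t \<oplus> t) \<otimes> s = s \<otimes> (t \<oplus> t)" shows "t \<otimes> s = s \<otimes> t"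
proof (rule double_cancel)
 have "t \<otimes> s \<oplus> t \<otimes> s = (t \<oplus> t) \<otimes> s" by (rule l_distr[symmetric, OF assms(1,1,2)])
 also have "\<dots> = s \<otimes> (t \<oplus> t)" by (rule assms(3))
 also have "\<dots> = s \<otimes> t \<oplus> s \<otimes> t" by (rule r_distr[OF assms(1,1,2)])
 finally show "t \<otimes> s \<oplus> t \<otimes> s = s \<otimes> t \<oplus> s \<otimes> t" .
qed (use assms in simp_all)

text \<open>Commuting with f passes to sums and products, so generators suffice. X^2 and Y^2 commute
  with each of them; for Y^2 and the x_i this is deduced from X and Z by doubling.\<close>

lemma f_central: assumes "t \<in> carrier B" shows "t \<otimes> f = f \<otimes> t"
 using assms
proof (induction rule: B_induct)
 case (scalar c) show ?case by (rule scalar_central) simp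
next
 let ?Y = "P.Y \<otimes> P.Y"
 have Yc: "?Y \<in> carrier B" by simp
 note XY = P.X_YY P.Z_YY
 case x1
 have "(\<iota> x1 \<oplus> \<iota> x1) \<otimes> ?Y = ?Y \<otimes> (\<iota> x1 \<oplus> \<iota> x1)"
  unfolding P.double_gens l_distr[OF P.closed(1,2) Yc] r_distr[OF P.closed(1,2) Yc] XY ..
 then show ?case by (rule f_comm[OF P.gens(1) P.a_XX double_comm[OF P.gens(1) Yc]])
next
 let ?Y = "P.Y \<otimes> P.Y"
 have Yc: "?Y \<in> carrier B" by simp
 case x2
 have m: "\<ominus> P.Z \<in> carrier B" by simp
 have "(\<iota> x2 \<oplus> \<iota> x2) \<otimes> ?Y = ?Y \<otimes> (\<iota> x2 \<oplus> \<iota> x2)"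
  unfolding P.double_gens l_distr[OF P.closed(1) m Yc] r_distr[OF P.closed(1) m Yc] l_minus[OF P.closed(2) Yc] r_minus[OF Yc P.closed(2)]
   P.X_YY P.Z_YY ..
 then show ?case by (rule f_comm[OF P.gens(2) P.b_XX double_comm[OF P.gens(2) Yc]])
next
 case p show ?case by (intro f_comm P.gens P.p_XX P.p_YY)
next
 case q show ?case by (intro f_comm P.gens P.q_XX P.q_YY)
next
 case (add a b)
 show ?case unfolding l_distr[OF add(1,2) f_closed] r_distr[OF add(1,2) f_closed] add(3,4) ..
next
 case (mult a b)
 have "a \<otimes> b \<otimes> f = a \<otimes> (b \<otimes> f)" by (rule m_assoc[OF mult(1,2) f_closed])
 also have "\<dots> = a \<otimes> f \<otimes> b" unfolding mult(4) by (rule m_assoc[symmetric, OF mult(1) f_closed mult(2)])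
 also have "\<dots> = f \<otimes> (a \<otimes> b)" unfolding mult(3) by (rule m_assoc[OF f_closed mult(1,2)])
 finally show ?case .
qed

lemma pp_M: "p \<otimes> p \<otimes> M n = M (fst n + 2, snd n)"
proof -
 have "p [^] (fst n + 2) = p \<otimes> p \<otimes> p [^] fst n"
  using nat_pow_mult[of p 2 "fst n"] by (simp add: numeral_2_eq_2 add.commute)
 then show ?thesis by (simp add: m_assoc)
qed

lemma qq_M: "q \<otimes> q \<otimes> M n = M (fst n, snd n + 2)"
proof -
 have "q \<otimes> q \<otimes> p [^] i = p [^] i \<otimes> (q \<otimes> q)" for i :: nat
 proof (induction i)
  case (Suc i)
  have "q \<otimes> q \<otimes> p [^] Suc i = (q \<otimes> q \<otimes> p [^] i) \<otimes> p" by (simp add: m_assoc)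
  also have "\<dots> = p [^] i \<otimes> (q \<otimes> (q \<otimes> p))" unfolding Suc by (simp add: m_assoc)
  finally show ?case by (simp add: P.p_qq m_assoc)
 qed simp
 moreover have "q [^] (snd n + 2) = q \<otimes> q \<otimes> q [^] snd n"
  using nat_pow_mult[of q 2 "snd n"] by (simp add: numeral_2_eq_2 add.commute)
 ultimately show ?thesis by (simp add: m_assoc[symmetric])
qed

definition sq where "sq = x1 \<otimes>[A] x1 \<oplus>[A] x2 \<otimes>[A] x2"

text \<open>The coefficients of \<open>b f\<close> in terms of those of \<open>b\<close>.\<close>

definition shift_f :: "(nat \<times> nat \<Rightarrow> (xvar list \<Rightarrow> 'k) set) \<Rightarrow> nat \<times> nat \<Rightarrow> (xvar list \<Rightarrow> 'k) set" where
 "shift_f c n = c n \<otimes>[A] sq \<oplus>[A] ((if 2 \<le> fst n then c (fst n - 2, snd n) else \<zero>[A]) \<oplus>[A]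
   (if 2 \<le> snd n then c (fst n, snd n - 2) else \<zero>[A]))"

lemma sq_closed [simp]: "sq \<in> carrier A" by (simp add: sq_def)

lemma shift_f_add:
 assumes c: "fin c" and d: "fin d"
 shows "shift_f (\<lambda>n. c n \<oplus>[A] d n) = (\<lambda>n. shift_f c n \<oplus>[A] shift_f d n)"
proof
 fix n :: "nat \<times> nat"
 note cl = finD[OF c] finD[OF d]
 let ?P = "\<lambda>c :: nat \<times> nat \<Rightarrow> (xvar list \<Rightarrow> 'k) set. if 2 \<le> fst n then c (fst n - 2, snd n) else \<zero>[A]"
 let ?R = "\<lambda>c :: nat \<times> nat \<Rightarrow> (xvar list \<Rightarrow> 'k) set. if 2 \<le> snd n then c (fst n, snd n - 2) else \<zero>[A]"
 have 1: "?P (\<lambda>n. c n \<oplus>[A] d n) = ?P c \<oplus>[A] ?P d" "?R (\<lambda>n. c n \<oplus>[A] d n) = ?R c \<oplus>[A] ?R d"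
  using cl by simp_all
 have 2: "?P c \<in> carrier A" "?P d \<in> carrier A" "?R c \<in> carrier A" "?R d \<in> carrier A" using cl by simp_all
 have "(u \<oplus>[A] u') \<otimes>[A] sq \<oplus>[A] ((v \<oplus>[A] v') \<oplus>[A] (w \<oplus>[A] w'))
   = (u \<otimes>[A] sq \<oplus>[A] (v \<oplus>[A] w)) \<oplus>[A] (u' \<otimes>[A] sq \<oplus>[A] (v' \<oplus>[A] w'))"
  if "u \<in> carrier A" "u' \<in> carrier A" "v \<in> carrier A" "v' \<in> carrier A" "w \<in> carrier A" "w' \<in> carrier A" for u u' v v' w w'
  using that sq_closed by (simp add: A.l_distr A.a_ac)
 from this[OF cl(1)[of n] cl(2)[of n] 2]
 show "shift_f (\<lambda>n. c n \<oplus>[A] d n) n = shift_f c n \<oplus>[A] shift_f d n"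
  unfolding shift_f_def 1 .
qed

text \<open>Since f is central, it can be moved between the coefficient and the monomial. There
  x_1^2 + x_2^2 multiplies the coefficient from the right, while y_1^2 and y_2^2 raise an exponent
  by 2, as y_2^2 commutes with y_1.\<close>

lemma mult_f:
 assumes "b \<in> carrier B"
 shows "coef (b \<otimes> f) = shift_f (coef b)"
 using assms
proof (induction rule: basis_induct)
 case zero
 have "shift_f (\<lambda>_. \<zero>[A]) = (\<lambda>_. \<zero>[A])" unfolding shift_f_def by (rule ext) simp
 then show ?case by (simp add: coef_zero)
next
 case (add a n b)
 let ?t = "\<iota> a \<otimes> M n"
 have a [simp]: "a \<in> carrier A" by fact
 have t: "?t \<in> carrier B" by simp
 let ?m1 = "(fst n + 2, snd n)" and ?m2 = "(fst n, snd n + 2)"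
 have "?t \<otimes> f = \<iota> a \<otimes> (f \<otimes> M n)" using f_central[of "M n"] by (simp add: m_assoc)
 also have "\<dots> = \<iota> (a \<otimes>[A] sq) \<otimes> M n \<oplus> (\<iota> a \<otimes> (p \<otimes> p \<otimes> M n) \<oplus> \<iota> a \<otimes> (q \<otimes> q \<otimes> M n))"
  unfolding f_def P.XX P.YY sq_def by (simp add: l_distr r_distr m_assoc a_assoc)
 finally have "?t \<otimes> f = \<iota> (a \<otimes>[A] sq) \<otimes> M n \<oplus> (\<iota> a \<otimes> M ?m1 \<oplus> \<iota> a \<otimes> M ?m2)"
  unfolding pp_M qq_M .
 then have "coef (?t \<otimes> f) = (\<lambda>m. single n (a \<otimes>[A] sq) m \<oplus>[A] (single ?m1 a m \<oplus>[A] single ?m2 a m))"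
  by (simp only: coef_add coef_single a sq_closed A.m_closed \<iota>.hom_closed m_closed nat_pow_closed pq_closed add.m_closed)
 also have "\<dots> = shift_f (single n a)"
 proof
  fix m
  have "single n (a \<otimes>[A] sq) m = single n a m \<otimes>[A] sq" by (simp add: single_def)
  moreover have "single ?m1 a m = (if 2 \<le> fst m then single n a (fst m - 2, snd m) else \<zero>[A])"
   by (cases n; cases m) (auto simp: single_def)
  moreover have "single ?m2 a m = (if 2 \<le> snd m then single n a (fst m, snd m - 2) else \<zero>[A])"
   by (cases n; cases m) (auto simp: single_def)
  ultimately show "single n (a \<otimes>[A] sq) m \<oplus>[A] (single ?m1 a m \<oplus>[A] single ?m2 a m) = shift_f (single n a) m"
   unfolding shift_f_def by simp
 qed
 finally have 1: "coef (?t \<otimes> f) = shift_f (single n a)" .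
 have "coef ((?t \<oplus> b) \<otimes> f) = (\<lambda>m. shift_f (single n a) m \<oplus>[A] shift_f (coef b) m)"
  using add t by (simp add: l_distr coef_add 1 del: f_def)
 also have "\<dots> = shift_f (\<lambda>m. single n a m \<oplus>[A] coef b m)"
  by (rule shift_f_add[symmetric, OF Ex_single(1)[OF a] coef(1)[OF add(2)]])
 also have "(\<lambda>m. single n a m \<oplus>[A] coef b m) = coef (?t \<oplus> b)"
  unfolding coef_add[OF t add(2)] coef_single[OF a] ..
 finally show ?case .
qed

text \<open>If \<open>y\<^sub>1\<^sup>i y\<^sub>2\<^sup>j\<close> occurs in \<open>b\<close> with \<open>i\<close> maximal, its coefficient is that of \<open>y\<^sub>1\<^bsup>i+2\<^esup> y\<^sub>2\<^sup>j\<close> in \<open>b f\<close>.\<close>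

lemma f_regular:
 assumes b: "b \<in> carrier B" and z: "b \<otimes> f = \<zero>" shows "b = \<zero>"
proof (rule ccontr)
 assume nz: "b \<noteq> \<zero>"
 let ?c = "coef b"
 let ?S = "{n. ?c n \<noteq> \<zero>[A]}"
 have fin: "finite ?S" using coef(1)[OF b] by (simp add: fin_def)
 have "?S \<noteq> {}"
 proof
  assume "?S = {}"
  have "Ex ?c = \<zero>" unfolding Ex_def \<open>?S = {}\<close> by simp
  then show False using coef(2)[OF b] nz by simp
 qed
 then have "Max (fst ` ?S) \<in> fst ` ?S" using fin by (intro Max_in) simp_all
 then obtain n where n: "Max (fst ` ?S) = fst n" "n \<in> ?S" by (elim imageE)
 have max: "fst m \<le> fst n" if "?c m \<noteq> \<zero>[A]" for m
  unfolding n(1)[symmetric] by (rule Max_ge) (use fin that in auto)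
 have big: "?c m = \<zero>[A]" if "fst n < fst m" for m
 proof (rule ccontr)
  assume "?c m \<noteq> \<zero>[A]"
  from max[OF this] that show False by simp
 qed
 \<comment> \<open>The two other contributions to the coefficient at (i + 2, j) come from exponents
   of y_1 beyond the maximum.\<close>
 have b1: "?c (fst n + 2, snd n) = \<zero>[A]" and b2: "?c (fst n + 2, snd n - 2) = \<zero>[A]" by (rule big, simp)+
 have "shift_f ?c (fst n + 2, snd n) = ?c n" unfolding shift_f_def fst_conv snd_conv b1 b2
  using finD[OF coef(1)[OF b], of n] by simp
 moreover have "shift_f ?c = (\<lambda>_. \<zero>[A])" unfolding mult_f[OF b, symmetric] z by (rule coef_zero)
 ultimately have "?c n = \<zero>[A]" by simp
 then show False using n(2) by simp
qed

end

section \<open>The matrix representation\<close>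

text \<open>Two by two matrices as a type of class \<open>ring_1\<close>, the kind of target that
  \<open>free_evaluation\<close> asks for.\<close>

datatype 'a mat2 = Mat (m11: 'a) (m12: 'a) (m21: 'a) (m22: 'a)

instantiation mat2 :: (field) ring_1
begin

definition "0 = Mat 0 0 0 0"
definition "1 = Mat 1 0 0 1"
definition "A + B = Mat (m11 A + m11 B) (m12 A + m12 B) (m21 A + m21 B) (m22 A + m22 B)"
definition "- A = Mat (- m11 A) (- m12 A) (- m21 A) (- m22 A)"
definition "A - B = Mat (m11 A - m11 B) (m12 A - m12 B) (m21 A - m21 B) (m22 A - m22 B)"
definition "A * B = Mat (m11 A * m11 B + m12 A * m21 B) (m11 A * m12 B + m12 A * m22 B)
 (m21 A * m11 B + m22 A * m21 B) (m21 A * m12 B + m22 A * m22 B)"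

instance
 by standard (auto simp: zero_mat2_def one_mat2_def plus_mat2_def uminus_mat2_def minus_mat2_def times_mat2_def
   algebra_simps intro!: mat2.expand)

end

lemmas mat2_simps = zero_mat2_def one_mat2_def plus_mat2_def uminus_mat2_def minus_mat2_def times_mat2_def

definition scalar_mat :: "'a::field \<Rightarrow> 'a mat2" where "scalar_mat c = Mat c 0 0 c"

lemma scalar_mat_evaluation: "free_evaluation scalar_mat"
 by unfold_locales (simp_all add: scalar_mat_def mat2_simps)

lemma scalar_mat_power: "scalar_mat c ^ k = scalar_mat (c ^ k)"
 by (induction k) (simp_all add: scalar_mat_def mat2_simps)

context skew_ore
begin

definition i :: 'k where "i = (SOME c. c * c = - 1)"

lemma ii: "i * i = - 1"
proof -
 have "\<exists>c :: 'k. c ^ 2 = - 1" using nth_root_exists[of 2 "- 1 :: 'k"] by simp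
 then have "\<exists>c :: 'k. c * c = - 1" by (simp add: power2_eq_square)
 then show ?thesis unfolding i_def by (rule someI_ex)
qed

text \<open>In matrix units, x_1 and x_2 act as E12 + E21 and E12 - E21, so X and Z act as 2 E12 and
  2 E21. The y_j act as i times the x_j, whence Y acts as i X, u as X + i Y = 0 and v as 2 X = 4
  E12. From E12 E21 + E21 E12 = 1 it follows that h acts as the scalar 2 i.\<close>

abbreviation A1 :: "'k mat2" where "A1 \<equiv> Mat 0 1 1 0"
abbreviation A2 :: "'k mat2" where "A2 \<equiv> Mat 0 1 (- 1) 0"
abbreviation P' :: "'k mat2" where "P' \<equiv> Mat 0 i i 0"
abbreviation Q' :: "'k mat2" where "Q' \<equiv> Mat 0 i (- i) 0"

definition \<rho> :: "(xvar list \<Rightarrow> 'k) set \<Rightarrow> 'k mat2" where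
 "\<rho> = (SOME \<rho>. \<rho> x1 = A1 \<and> \<rho> x2 = A2 \<and> (\<forall>c. \<rho> (c \<bullet>\<^bsub>A\<^esub> \<one>\<^bsub>A\<^esub>) = scalar_mat c) \<and>
  (\<forall>a\<in>carrier A. \<forall>b\<in>carrier A. \<rho> (a \<oplus>[A] b) = \<rho> a + \<rho> b \<and> \<rho> (a \<otimes>[A] b) = \<rho> a * \<rho> b))"

lemma \<rho>: "\<rho> x1 = A1" "\<rho> x2 = A2" "\<rho> (c \<bullet>\<^bsub>A\<^esub> \<one>\<^bsub>A\<^esub>) = scalar_mat c"
 "a \<in> carrier A \<Longrightarrow> b \<in> carrier A \<Longrightarrow> \<rho> (a \<oplus>[A] b) = \<rho> a + \<rho> b"
 "a \<in> carrier A \<Longrightarrow> b \<in> carrier A \<Longrightarrow> \<rho> (a \<otimes>[A] b) = \<rho> a * \<rho> b"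
proof -
 have "A1 * A2 + A2 * A1 = 0" by (simp add: mat2_simps)
 from someI_ex[OF skew_plane_rep[OF scalar_mat_evaluation this], folded \<rho>_def]
 show "\<rho> x1 = A1" "\<rho> x2 = A2" "\<rho> (c \<bullet>\<^bsub>A\<^esub> \<one>\<^bsub>A\<^esub>) = scalar_mat c"
  "a \<in> carrier A \<Longrightarrow> b \<in> carrier A \<Longrightarrow> \<rho> (a \<oplus>[A] b) = \<rho> a + \<rho> b"
  "a \<in> carrier A \<Longrightarrow> b \<in> carrier A \<Longrightarrow> \<rho> (a \<otimes>[A] b) = \<rho> a * \<rho> b" by blast+
qed

lemma \<rho>_zero: "\<rho> \<zero>[A] = 0" using \<rho>(4)[of "\<zero>[A]" "\<zero>[A]"] by simp

lemma \<rho>_one: "\<rho> \<one>\<^bsub>A\<^esub> = 1" using \<rho>(3)[of 1] by (simp add: A.ascale_one scalar_mat_def one_mat2_def)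

lemma \<rho>_minus: "a \<in> carrier A \<Longrightarrow> \<rho> (\<ominus>\<^bsub>A\<^esub> a) = - \<rho> a"
 using \<rho>(4)[of "\<ominus>\<^bsub>A\<^esub> a" a] by (simp add: A.l_neg \<rho>_zero eq_neg_iff_add_eq_0)

text \<open>The commutation rules of y_1 and y_2 with A must hold for the matrices as well. They
  pass to products because \<sigma> is a homomorphism into matrices over A, so the generators
  suffice.\<close>

lemma \<rho>_comm:
 assumes "a \<in> carrier A"
 shows "P' * \<rho> a = \<rho> (s11 a) * P' + \<rho> (s12 a) * Q' \<and> Q' * \<rho> a = \<rho> (s21 a) * P' + \<rho> (s22 a) * Q'"
 using assms
proof (induction rule: skew_plane_induct)
 case (scalar c)
 show ?case by (simp add: s_scalar \<rho> \<rho>_zero) (simp add: scalar_mat_def mat2_simps)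
next
 case x1
 show ?case by (simp add: s_x1 \<rho> \<rho>_zero) (simp add: mat2_simps)
next
 case x2
 show ?case by (simp add: s_x2 \<rho> \<rho>_zero \<rho>_minus) (simp add: mat2_simps)
next
 case (add a b)
 have cl: "s11 a \<in> carrier A" "s12 a \<in> carrier A" "s21 a \<in> carrier A" "s22 a \<in> carrier A"
  "s11 b \<in> carrier A" "s12 b \<in> carrier A" "s21 b \<in> carrier A" "s22 b \<in> carrier A"
  using s_closed[OF add(1)] s_closed[OF add(2)] by simp_all
 show ?case using add s_add[OF add(1,2)] cl by (simp add: \<rho> distrib_left distrib_right)
next
 case (mult a b)
 have cl: "s11 a \<in> carrier A" "s12 a \<in> carrier A" "s21 a \<in> carrier A" "s22 a \<in> carrier A"
  "s11 b \<in> carrier A" "s12 b \<in> carrier A" "s21 b \<in> carrier A" "s22 b \<in> carrier A"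
  using s_closed[OF mult(1)] s_closed[OF mult(2)] by simp_all
 have "P' * (\<rho> a * \<rho> b) = \<rho> (s11 a) * (P' * \<rho> b) + \<rho> (s12 a) * (Q' * \<rho> b)"
  "Q' * (\<rho> a * \<rho> b) = \<rho> (s21 a) * (P' * \<rho> b) + \<rho> (s22 a) * (Q' * \<rho> b)"
  using mult(3) by (simp_all add: mult.assoc[symmetric] distrib_right)
 then show ?case using mult(1,2,4) s_mult[OF mult(1,2)] cl by (simp add: \<rho> distrib_left distrib_right mult.assoc)
qed

abbreviation M' :: "nat \<times> nat \<Rightarrow> 'k mat2" where "M' n \<equiv> P' ^ fst n * Q' ^ snd n"

text \<open>The representation of A, extended to B by means of the basis. Additivity is immediate
  from that of the coefficients; multiplicativity is what the lemmas up to
  \<open>\<Theta>_mult\<close> establish.\<close>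

definition \<Theta> :: "'b \<Rightarrow> 'k mat2" where
 "\<Theta> b = (\<Sum>n | coef b n \<noteq> \<zero>[A]. \<rho> (coef b n) * M' n)"

lemma \<Theta>_super:
 assumes "finite F" "{n. coef b n \<noteq> \<zero>[A]} \<subseteq> F"
 shows "\<Theta> b = (\<Sum>n\<in>F. \<rho> (coef b n) * M' n)"
 unfolding \<Theta>_def by (rule sum.mono_neutral_left) (use assms in \<open>auto simp: \<rho>_zero\<close>)

lemma \<Theta>_add:
 assumes a: "a \<in> carrier B" and b: "b \<in> carrier B" shows "\<Theta> (a \<oplus> b) = \<Theta> a + \<Theta> b"
proof -
 let ?F = "{n. coef a n \<noteq> \<zero>[A]} \<union> {n. coef b n \<noteq> \<zero>[A]}"
 note fa = coef(1)[OF a] and fb = coef(1)[OF b]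
 have F: "finite ?F" using fa fb by (simp add: fin_def)
 have s: "{n. coef (a \<oplus> b) n \<noteq> \<zero>[A]} \<subseteq> ?F" unfolding coef_add[OF a b] by auto
 show ?thesis unfolding \<Theta>_super[OF F s] \<Theta>_super[OF F Un_upper1] \<Theta>_super[OF F Un_upper2] coef_add[OF a b]
  using finD[OF fa] finD[OF fb] by (simp add: \<rho> distrib_right sum.distrib)
qed

lemma \<Theta>_single: assumes "a \<in> carrier A" shows "\<Theta> (\<iota> a \<otimes> M n) = \<rho> a * M' n"
proof -
 have s: "{m. coef (\<iota> a \<otimes> M n) m \<noteq> \<zero>[A]} \<subseteq> {n}" unfolding coef_single[OF assms] by (auto simp: single_def)
 show ?thesis unfolding \<Theta>_super[OF finite.insertI[OF finite.emptyI] s] coef_single[OF assms] by (simp add: single_def)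
qed

lemma \<Theta>_zero: "\<Theta> \<zero> = 0" by (simp add: \<Theta>_def coef_zero)

lemma \<Theta>_one: "\<Theta> \<one> = 1"
 using \<Theta>_single[of "\<one>\<^bsub>A\<^esub>" "(0, 0)"] by (simp add: \<rho>_one)

text \<open>Compatibility with left multiplication by t is additive in the other factor, so the
  terms a y_1^i y_2^j suffice.\<close>

lemma \<Theta>_left:
 assumes t: "t \<in> carrier B" and step: "\<And>a n. a \<in> carrier A \<Longrightarrow> \<Theta> (t \<otimes> (\<iota> a \<otimes> M n)) = m * \<Theta> (\<iota> a \<otimes> M n)"
  and b: "b \<in> carrier B"
 shows "\<Theta> (t \<otimes> b) = m * \<Theta> b"
 using b
proof (induction rule: basis_induct)
 case zero then show ?case using t by (simp add: \<Theta>_zero)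
next
 case (add a n b)
 have c: "\<iota> a \<otimes> M n \<in> carrier B" using add(1) by simp
 have c': "t \<otimes> (\<iota> a \<otimes> M n) \<in> carrier B" "t \<otimes> b \<in> carrier B" using t c add(2) by (simp_all only: m_closed)
 show ?case unfolding r_distr[OF c add(2) t] \<Theta>_add[OF c'] \<Theta>_add[OF c add(2)] step[OF add(1)] add(3)
  by (simp add: distrib_left)
qed

lemma \<Theta>_A:
 assumes a: "a \<in> carrier A" and b: "b \<in> carrier B" shows "\<Theta> (\<iota> a \<otimes> b) = \<rho> a * \<Theta> b"
proof (rule \<Theta>_left[OF _ _ b])
 fix a' n assume a': "a' \<in> carrier A"
 have "\<iota> a \<otimes> (\<iota> a' \<otimes> M n) = \<iota> (a \<otimes>[A] a') \<otimes> M n" using a a' by (simp add: m_assoc)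
 then show "\<Theta> (\<iota> a \<otimes> (\<iota> a' \<otimes> M n)) = \<rho> a * \<Theta> (\<iota> a' \<otimes> M n)"
  unfolding \<Theta>_single[OF a'] using \<Theta>_single[of "a \<otimes>[A] a'" n] a a' by (simp add: \<rho> mult.assoc)
qed (use a in simp)

lemma p_M: "p \<otimes> M n = M (Suc (fst n), snd n)"
proof -
 have "p [^] Suc (fst n) = p \<otimes> p [^] fst n" by (rule nat_pow_Suc2) simp
 then show ?thesis by (simp add: m_assoc)
qed

lemma \<Theta>_p_M: "\<Theta> (p \<otimes> M n) = P' * M' n"
 unfolding p_M using \<Theta>_single[of "\<one>\<^bsub>A\<^esub>" "(Suc (fst n), snd n)"] by (simp add: \<rho>_one mult.assoc)

text \<open>Each step past y_1 costs a sign. \<open>Q_pow\<close> is the same computation for the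
  matrices, and comparing the two gives \<open>\<Theta>_q_M\<close>.\<close>

lemma q_pow: "q \<otimes> p [^] (k::nat) = ((- 1) ^ k) \<bullet> (p [^] k \<otimes> q)"
proof (induction k)
 case 0 then show ?case by (simp add: ascale_one)
next
 case (Suc k)
 have c: "p [^] k \<in> carrier B" "p [^] k \<otimes> q \<in> carrier B" by simp_all
 have "q \<otimes> p [^] Suc k = q \<otimes> p [^] k \<otimes> p" by (simp add: m_assoc)
 also have "\<dots> = ((- 1) ^ k) \<bullet> (p [^] k \<otimes> q \<otimes> p)"
  unfolding Suc by (rule ascale_mult_left[symmetric]) simp_all
 also have "p [^] k \<otimes> q \<otimes> p = \<ominus> (p [^] Suc k \<otimes> q)" by (simp add: m_assoc qp_rel r_minus)
 also have "((- 1) ^ k) \<bullet> (\<ominus> (p [^] Suc k \<otimes> q)) = ((- 1) ^ k) \<bullet> ((- 1) \<bullet> (p [^] Suc k \<otimes> q))"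
  using ascale_minus[of "p [^] Suc k \<otimes> q" 1] by (simp add: ascale_one)
 also have "\<dots> = ((- 1) ^ k * (- 1)) \<bullet> (p [^] Suc k \<otimes> q)" by (rule ascale_ascale[symmetric]) simp
 finally show ?case by (simp add: mult.commute)
qed

lemma Q_pow: "Q' * P' ^ k = scalar_mat ((- 1) ^ k) * (P' ^ k * Q')"
proof (induction k)
 case 0 then show ?case by (simp add: scalar_mat_def one_mat2_def[symmetric])
next
 case (Suc k)
 have QP: "Q' * P' = scalar_mat (- 1) * (P' * Q')" by (simp add: scalar_mat_def mat2_simps)
 interpret E: free_evaluation "scalar_mat :: 'k \<Rightarrow> _" by (rule scalar_mat_evaluation)
 have "Q' * P' ^ Suc k = Q' * P' ^ k * P'" by (simp add: power_commutes mult.assoc)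
 also have "\<dots> = scalar_mat ((- 1) ^ k) * (P' ^ k * (Q' * P'))" unfolding Suc by (simp add: mult.assoc)
 also have "\<dots> = scalar_mat ((- 1) ^ k) * (scalar_mat (- 1) * (P' ^ k * (P' * Q')))"
  unfolding QP by (simp only: mult.assoc[symmetric] E.sc_comm[of "- 1" "P' ^ k"])
 also have "\<dots> = scalar_mat ((- 1) ^ Suc k) * (P' ^ Suc k * Q')"
  by (simp add: mult.assoc[symmetric] E.sc_mult[symmetric] power_commutes mult.commute)
 finally show ?case .
qed

lemma \<Theta>_q_M: "\<Theta> (q \<otimes> M n) = Q' * M' n"
proof -
 let ?e = "((- 1) ^ fst n) \<bullet>\<^bsub>A\<^esub> \<one>\<^bsub>A\<^esub>"
 have qS: "q [^] Suc (snd n) = q \<otimes> q [^] snd n" by (rule nat_pow_Suc2) simp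
 have e: "?e \<in> carrier A" by (rule A.ascale_closed) simp
 have "q \<otimes> M n = q \<otimes> p [^] fst n \<otimes> q [^] snd n" by (simp add: m_assoc)
 also have "\<dots> = ((- 1) ^ fst n) \<bullet> (p [^] fst n \<otimes> q \<otimes> q [^] snd n)"
  unfolding q_pow by (rule ascale_mult_left[symmetric]) simp_all
 also have "\<dots> = \<iota> ?e \<otimes> (p [^] fst n \<otimes> q \<otimes> q [^] snd n)"
  by (subst scale_one_mult) (simp_all add: \<iota>_scale)
 also have "\<dots> = \<iota> ?e \<otimes> M (fst n, Suc (snd n))" unfolding fst_conv snd_conv qS by (simp add: m_assoc)
 finally have "\<Theta> (q \<otimes> M n) = scalar_mat ((- 1) ^ fst n) * (P' ^ fst n * (Q' * Q' ^ snd n))"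
  using \<Theta>_single[OF e, of "(fst n, Suc (snd n))"] by (simp add: \<rho>)
 then show ?thesis using Q_pow[of "fst n"] by (simp add: mult.assoc[symmetric])
qed

lemma \<Theta>_p: assumes b: "b \<in> carrier B" shows "\<Theta> (p \<otimes> b) = P' * \<Theta> b"
proof (rule \<Theta>_left[OF _ _ b])
 fix a n assume a: "a \<in> carrier A"
 have s: "s11 a \<in> carrier A" "s12 a \<in> carrier A" using s_closed[OF a] by simp_all
 have "p \<otimes> (\<iota> a \<otimes> M n) = (p \<otimes> \<iota> a) \<otimes> M n" using a by (simp add: m_assoc)
 also have "\<dots> = \<iota> (s11 a) \<otimes> (p \<otimes> M n) \<oplus> \<iota> (s12 a) \<otimes> (q \<otimes> M n)"
  unfolding p_comm[OF a] using s by (simp add: l_distr m_assoc)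
 finally have "\<Theta> (p \<otimes> (\<iota> a \<otimes> M n)) = \<rho> (s11 a) * (P' * M' n) + \<rho> (s12 a) * (Q' * M' n)"
  using s by (simp add: \<Theta>_add \<Theta>_A \<Theta>_p_M \<Theta>_q_M)
 then show "\<Theta> (p \<otimes> (\<iota> a \<otimes> M n)) = P' * \<Theta> (\<iota> a \<otimes> M n)"
  unfolding \<Theta>_single[OF a] using \<rho>_comm[OF a] by (simp add: mult.assoc[symmetric] distrib_right)
qed simp

lemma \<Theta>_q: assumes b: "b \<in> carrier B" shows "\<Theta> (q \<otimes> b) = Q' * \<Theta> b"
proof (rule \<Theta>_left[OF _ _ b])
 fix a n assume a: "a \<in> carrier A"
 have s: "s21 a \<in> carrier A" "s22 a \<in> carrier A" using s_closed[OF a] by simp_all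
 have "q \<otimes> (\<iota> a \<otimes> M n) = (q \<otimes> \<iota> a) \<otimes> M n" using a by (simp add: m_assoc)
 also have "\<dots> = \<iota> (s21 a) \<otimes> (p \<otimes> M n) \<oplus> \<iota> (s22 a) \<otimes> (q \<otimes> M n)"
  unfolding q_comm[OF a] using s by (simp add: l_distr m_assoc)
 finally have "\<Theta> (q \<otimes> (\<iota> a \<otimes> M n)) = \<rho> (s21 a) * (P' * M' n) + \<rho> (s22 a) * (Q' * M' n)"
  using s by (simp add: \<Theta>_add \<Theta>_A \<Theta>_p_M \<Theta>_q_M)
 then show "\<Theta> (q \<otimes> (\<iota> a \<otimes> M n)) = Q' * \<Theta> (\<iota> a \<otimes> M n)"
  unfolding \<Theta>_single[OF a] using \<rho>_comm[OF a] by (simp add: mult.assoc[symmetric] distrib_right)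
qed simp

text \<open>Elements whose left multiplication corresponds to multiplication by some matrix are
  closed under sums and products and include scalars and generators. Evaluation at 1 identifies the
  matrix of a as \<Theta> a.\<close>

lemma \<Theta>_mult:
 assumes a: "a \<in> carrier B" and b: "b \<in> carrier B" shows "\<Theta> (a \<otimes> b) = \<Theta> a * \<Theta> b"
proof -
 have "\<exists>m. \<forall>b\<in>carrier B. \<Theta> (a \<otimes> b) = m * \<Theta> b"
  using a
 proof (induction rule: B_induct)
  case (scalar c)
  have "c \<bullet> \<one> = \<iota> (c \<bullet>\<^bsub>A\<^esub> \<one>\<^bsub>A\<^esub>)" by (simp add: \<iota>_scale)
  then show ?case using \<Theta>_A[of "c \<bullet>\<^bsub>A\<^esub> \<one>\<^bsub>A\<^esub>"] A.ascale_closed[OF A.one_closed] by metis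
 next
  case x1 show ?case using \<Theta>_A[OF x_closed(1)] by blast
 next
  case x2 show ?case using \<Theta>_A[OF x_closed(2)] by blast
 next
  case p show ?case using \<Theta>_p by blast
 next
  case q show ?case using \<Theta>_q by blast
 next
  case (add a b)
  then obtain m m' where m: "\<forall>c\<in>carrier B. \<Theta> (a \<otimes> c) = m * \<Theta> c" "\<forall>c\<in>carrier B. \<Theta> (b \<otimes> c) = m' * \<Theta> c" by (elim exE)
  have "\<forall>c\<in>carrier B. \<Theta> ((a \<oplus> b) \<otimes> c) = (m + m') * \<Theta> c"
   using m add(1,2) by (simp add: l_distr \<Theta>_add distrib_right)
  then show ?case by (rule exI)
 next
  case (mult a b)
  then obtain m m' where m: "\<forall>c\<in>carrier B. \<Theta> (a \<otimes> c) = m * \<Theta> c" "\<forall>c\<in>carrier B. \<Theta> (b \<otimes> c) = m' * \<Theta> c" by (elim exE)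
  have "\<forall>c\<in>carrier B. \<Theta> ((a \<otimes> b) \<otimes> c) = (m * m') * \<Theta> c"
   using m mult(1,2) by (simp add: m_assoc mult.assoc)
  then show ?case by (rule exI)
 qed
 then obtain m where m: "\<forall>b\<in>carrier B. \<Theta> (a \<otimes> b) = m * \<Theta> b" by (elim exE)
 from m[rule_format, OF one_closed] have "\<Theta> a = m" using a by (simp add: \<Theta>_one)
 with m b show ?thesis by blast
qed

end

lemma (in ring) factor_difference:
 assumes "x \<in> carrier R" "w \<in> carrier R" "w \<otimes> x = x \<otimes> w"
 shows "(x \<oplus> w) \<otimes> (x \<oplus> \<ominus> w) = x \<otimes> x \<oplus> \<ominus> (w \<otimes> w)" "(x \<oplus> \<ominus> w) \<otimes> (x \<oplus> w) = x \<otimes> x \<oplus> \<ominus> (w \<otimes> w)"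
proof -
 have "(x \<oplus> w) \<otimes> (x \<oplus> \<ominus> w) = x \<otimes> x \<oplus> \<ominus> (x \<otimes> w) \<oplus> (w \<otimes> x \<oplus> \<ominus> (w \<otimes> w))" using assms(1,2) by algebra
 also have "\<dots> = x \<otimes> x \<oplus> \<ominus> (w \<otimes> w)" unfolding assms(3) using assms(1,2) by algebra
 finally show "(x \<oplus> w) \<otimes> (x \<oplus> \<ominus> w) = x \<otimes> x \<oplus> \<ominus> (w \<otimes> w)" .
 have "(x \<oplus> \<ominus> w) \<otimes> (x \<oplus> w) = x \<otimes> x \<oplus> x \<otimes> w \<oplus> (\<ominus> (w \<otimes> x) \<oplus> \<ominus> (w \<otimes> w))" using assms(1,2) by algebra
 also have "\<dots> = x \<otimes> x \<oplus> \<ominus> (w \<otimes> w)" unfolding assms(3) using assms(1,2) by algebra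
 finally show "(x \<oplus> \<ominus> w) \<otimes> (x \<oplus> w) = x \<otimes> x \<oplus> \<ominus> (w \<otimes> w)" .
qed

lemma (in ring) add_minus_cancel: "x \<in> carrier R \<Longrightarrow> y \<in> carrier R \<Longrightarrow> x \<oplus> (y \<oplus> \<ominus> x) = y"
 by algebra

lemma (in ring) central_multiple_ideal:
 assumes z: "z \<in> carrier R" and c: "\<And>t. t \<in> carrier R \<Longrightarrow> t \<otimes> z = z \<otimes> t"
 shows "Idl {z} = (\<lambda>t. z \<otimes> t) ` carrier R"
proof
 have "ideal ((\<lambda>t. z \<otimes> t) ` carrier R) R"
 proof (rule idealI[OF ring_axioms])
  show "subgroup ((\<lambda>t. z \<otimes> t) ` carrier R) (add_monoid R)"
  proof (rule add.subgroupI)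
   show "(\<lambda>t. z \<otimes> t) ` carrier R \<noteq> {}" by blast
   fix a assume "a \<in> (\<lambda>t. z \<otimes> t) ` carrier R"
   then obtain t where t: "a = z \<otimes> t" "t \<in> carrier R" by (elim imageE)
   then show "\<ominus> a \<in> (\<lambda>t. z \<otimes> t) ` carrier R" using z by (intro image_eqI[of _ _ "\<ominus> t"]) (simp_all add: r_minus)
   fix b assume "b \<in> (\<lambda>t. z \<otimes> t) ` carrier R"
   then obtain s where s: "b = z \<otimes> s" "s \<in> carrier R" by (elim imageE)
   show "a \<oplus> b \<in> (\<lambda>t. z \<otimes> t) ` carrier R" using t s z by (intro image_eqI[of _ _ "t \<oplus> s"]) (simp_all add: r_distr)
  qed (use z in auto)
  fix a x assume "a \<in> (\<lambda>t. z \<otimes> t) ` carrier R" and x: "x \<in> carrier R"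
  then obtain t where t: "a = z \<otimes> t" "t \<in> carrier R" by (elim imageE)
  have "x \<otimes> a = z \<otimes> (x \<otimes> t)" unfolding t(1) using z x t(2) c[OF x] by (simp add: m_assoc[symmetric])
  then show "x \<otimes> a \<in> (\<lambda>t. z \<otimes> t) ` carrier R" using x t(2) by (intro image_eqI[of _ _ "x \<otimes> t"]) simp_all
  show "a \<otimes> x \<in> (\<lambda>t. z \<otimes> t) ` carrier R" using z x t by (intro image_eqI[of _ _ "t \<otimes> x"]) (simp_all add: m_assoc)
 qed
 then show "Idl {z} \<subseteq> (\<lambda>t. z \<otimes> t) ` carrier R"
  by (rule genideal_minimal) (use z in \<open>auto intro!: image_eqI[of _ _ \<one>]\<close>)
 show "(\<lambda>t. z \<otimes> t) ` carrier R \<subseteq> Idl {z}"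
 proof
  fix a assume "a \<in> (\<lambda>t. z \<otimes> t) ` carrier R"
  then obtain t where t: "a = z \<otimes> t" "t \<in> carrier R" by (elim imageE)
  show "a \<in> Idl {z}" unfolding t(1)
   by (rule ideal.I_r_closed[OF genideal_ideal genideal_self'[OF z] t(2)]) (use z in simp)
 qed
qed

section \<open>Factorization of f and the conclusion\<close>

context skew_ore
begin

text \<open>This is i Y, with square -Y^2, so that f = X^2 - w^2 splits into (X + w) (X -
  w).\<close>

definition w where "w = (i \<bullet> \<one>) \<otimes> P.Y"
definition u where "u = P.X \<oplus> w"
definition v where "v = P.X \<oplus> \<ominus> w"

lemma w_closed [simp]: "w \<in> carrier B" by (simp add: w_def)

lemma uv_closed [simp]: "u \<in> carrier B" "v \<in> carrier B" by (simp_all add: u_def v_def)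

lemma wX: "w \<otimes> P.X = P.X \<otimes> w"
proof -
 have "w \<otimes> P.X = (i \<bullet> \<one>) \<otimes> P.X \<otimes> P.Y" unfolding w_def by (simp add: m_assoc P.YX)
 also have "\<dots> = P.X \<otimes> w" unfolding w_def scalar_central[OF P.closed(1)] by (simp add: m_assoc)
 finally show ?thesis .
qed

lemma ww: "w \<otimes> w = \<ominus> (P.Y \<otimes> P.Y)"
proof -
 have "w \<otimes> w = (i \<bullet> \<one>) \<otimes> (P.Y \<otimes> (i \<bullet> \<one>)) \<otimes> P.Y" unfolding w_def by (simp add: m_assoc)
 also have "\<dots> = (i \<bullet> \<one>) \<otimes> (i \<bullet> \<one>) \<otimes> (P.Y \<otimes> P.Y)"
  unfolding scalar_central[OF P.closed(3), symmetric] by (simp add: m_assoc)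
 also have "(i \<bullet> \<one>) \<otimes> (i \<bullet> \<one>) = (i * i) \<bullet> \<one>"
  using scale_one_mult[of "i \<bullet> \<one>" i] ascale_ascale[of \<one> i i] by simp
 also have "\<dots> = \<ominus> \<one>" unfolding ii by (simp add: ascale_minus ascale_one)
 finally show ?thesis by (simp add: l_minus)
qed

lemma uv: "u \<otimes> v = f" "v \<otimes> u = f"
 unfolding u_def v_def factor_difference[OF P.closed(1) w_closed wX] ww f_def by simp_all

lemma hw: "P.h \<otimes> w = w \<otimes> P.h"
proof -
 have "P.h \<otimes> w = (P.h \<otimes> (i \<bullet> \<one>)) \<otimes> P.Y" unfolding w_def by (simp add: m_assoc)
 also have "\<dots> = (i \<bullet> \<one>) \<otimes> (P.h \<otimes> P.Y)"
  unfolding scalar_central[OF P.closed(4), symmetric] by (simp add: m_assoc)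
 finally show ?thesis unfolding w_def P.hY by (simp add: m_assoc)
qed

lemma huv: "P.h \<otimes> u = u \<otimes> P.h" "P.h \<otimes> v = v \<otimes> P.h"
 unfolding u_def v_def by (simp_all add: l_distr r_distr r_minus l_minus hw P.hX)

lemma hcomps: "u \<in> hcomp B 1" "v \<in> hcomp B 1" "P.h \<in> hcomp B 2" "f \<in> hcomp B 2"
proof -
 have x: "\<iota> x1 \<in> hcomp B 1" "\<iota> x2 \<in> hcomp B 1" using skew_plane_gens \<iota>_hcomp by blast+
 have X: "P.X \<in> hcomp B 1" "P.Z \<in> hcomp B 1" "P.Y \<in> hcomp B 1"
  unfolding P.X_def P.Z_def P.Y_def minus_eq by (intro SG.comp_add SG.comp_minus x p q)+
 have "w \<in> hcomp B (0 + 1)" unfolding w_def by (rule mult_hcomp[OF ascale_hcomp[OF one_hcomp] X(3)])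
 then have w: "w \<in> hcomp B 1" by simp
 show "u \<in> hcomp B 1" "v \<in> hcomp B 1" unfolding u_def v_def by (intro SG.comp_add SG.comp_minus X w)+
 have "P.h \<in> hcomp B (1 + 1)" unfolding P.h_def by (intro SG.comp_add mult_hcomp X p q)
 then show "P.h \<in> hcomp B 2" by simp
 have "f \<in> hcomp B (1 + 1)" unfolding f_def by (intro SG.comp_add mult_hcomp X)
 then show "f \<in> hcomp B 2" by simp
qed

text \<open>Multiplying by the cofactor v turns the relation into f b = 0, and f is central and
  regular.\<close>

lemma u_cancel: assumes b: "b \<in> carrier B" and z: "u \<otimes> b = \<zero>" shows "b = \<zero>"
proof (rule f_regular[OF b])
 have "b \<otimes> f = v \<otimes> u \<otimes> b" unfolding uv by (rule f_central[OF b])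
 then show "b \<otimes> f = \<zero>" using b z by (simp add: m_assoc)
qed

lemma v_cancel: assumes b: "b \<in> carrier B" and z: "v \<otimes> b = \<zero>" shows "b = \<zero>"
proof (rule f_regular[OF b])
 have "b \<otimes> f = u \<otimes> v \<otimes> b" unfolding uv by (rule f_central[OF b])
 then show "b \<otimes> f = \<zero>" using b z by (simp add: m_assoc)
qed

lemma cancel_eq:
 assumes "t = u \<or> t = v" "b \<in> carrier B" "c \<in> carrier B" "t \<otimes> b = t \<otimes> c" shows "b = c"
proof -
 have t: "t \<in> carrier B" using assms(1) by auto
 have "t \<otimes> (b \<ominus> c) = \<zero>" using assms(2-4) t by (simp add: minus_eq r_distr r_minus r_neg)
 then have "b \<ominus> c = \<zero>" using assms(1-3) u_cancel v_cancel by (metis minus_closed)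
 then show ?thesis using assms(2,3) r_right_minus_eq by simp
qed

lemma \<Theta>_minus: "a \<in> carrier B \<Longrightarrow> \<Theta> (\<ominus> a) = - \<Theta> a"
 using \<Theta>_add[of "\<ominus> a" a] by (simp add: l_neg \<Theta>_zero eq_neg_iff_add_eq_0)

lemma \<Theta>_\<iota>: "a \<in> carrier A \<Longrightarrow> \<Theta> (\<iota> a) = \<rho> a"
 using \<Theta>_A[of a \<one>] by (simp add: \<Theta>_one)

lemma \<Theta>_gens: "\<Theta> (\<iota> x1) = A1" "\<Theta> (\<iota> x2) = A2" "\<Theta> p = P'" "\<Theta> q = Q'" "\<Theta> (c \<bullet> \<one>) = scalar_mat c"
proof -
 show "\<Theta> (\<iota> x1) = A1" "\<Theta> (\<iota> x2) = A2" by (simp_all add: \<Theta>_\<iota> \<rho>)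
 show "\<Theta> p = P'" "\<Theta> q = Q'" using \<Theta>_p[OF one_closed] \<Theta>_q[OF one_closed] by (simp_all add: \<Theta>_one)
 have "c \<bullet> \<one> = \<iota> (c \<bullet>\<^bsub>A\<^esub> \<one>\<^bsub>A\<^esub>)" by (simp add: \<iota>_scale)
 then show "\<Theta> (c \<bullet> \<one>) = scalar_mat c" using \<Theta>_\<iota>[OF A.ascale_closed[OF A.one_closed], of c] by (simp add: \<rho>)
qed

lemma \<Theta>_values: "\<Theta> u = 0" "\<Theta> v = Mat 0 4 0 0" "\<Theta> P.h = scalar_mat (2 * i)"
proof -
 have X: "\<Theta> P.X = Mat 0 2 0 0" unfolding P.X_def by (simp add: \<Theta>_add \<Theta>_gens) (simp add: mat2_simps)
 have Z: "\<Theta> P.Z = Mat 0 0 2 0" unfolding P.Z_def minus_eq by (simp add: \<Theta>_add \<Theta>_minus \<Theta>_gens) (simp add: mat2_simps)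
 have Y: "\<Theta> P.Y = Mat 0 (2 * i) 0 0" unfolding P.Y_def by (simp add: \<Theta>_add \<Theta>_gens) (simp add: mat2_simps)
 have w: "\<Theta> w = Mat 0 (- 2) 0 0" unfolding w_def
  by (simp add: \<Theta>_mult \<Theta>_gens Y) (simp add: scalar_mat_def mat2_simps mult.left_commute[of i] ii)
 show "\<Theta> u = 0" unfolding u_def by (simp add: \<Theta>_add X w) (simp add: mat2_simps)
 show "\<Theta> v = Mat 0 4 0 0" unfolding v_def by (simp add: \<Theta>_add \<Theta>_minus X w) (simp add: mat2_simps)
 show "\<Theta> P.h = scalar_mat (2 * i)" unfolding P.h_def
  by (simp add: \<Theta>_add \<Theta>_mult X Z \<Theta>_gens) (simp add: scalar_mat_def mat2_simps)
qed

lemma \<Theta>_power: "a \<in> carrier B \<Longrightarrow> \<Theta> (a [^] (k::nat)) = \<Theta> a ^ k"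
 by (induction k) (simp_all add: \<Theta>_one \<Theta>_mult power_commutes)

text \<open>Applying \<Theta> removes u c, and \<Theta> b times a multiple of E12 has zero first
  column, whereas the left-hand side becomes 2 (2 i)^k times the identity.\<close>

lemma power_h_not_in:
 assumes b: "b \<in> carrier B" and c: "c \<in> carrier B"
 shows "(P.h [^] (k::nat)) \<oplus> (P.h [^] k) \<noteq> b \<otimes> v \<oplus> u \<otimes> c"
proof
 assume e: "(P.h [^] k) \<oplus> (P.h [^] k) = b \<otimes> v \<oplus> u \<otimes> c"
 have i0: "i \<noteq> 0" using ii by auto
 have "\<Theta> ((P.h [^] k) \<oplus> (P.h [^] k)) = \<Theta> (b \<otimes> v \<oplus> u \<otimes> c)" unfolding e ..
 then have "scalar_mat ((2 * i) ^ k) + scalar_mat ((2 * i) ^ k) = \<Theta> b * Mat 0 4 0 0"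
  using b c by (simp add: \<Theta>_add \<Theta>_mult \<Theta>_power \<Theta>_values scalar_mat_power)
 then have "2 * (2 * i) ^ k = 0" by (simp add: scalar_mat_def mat2_simps)
 then show False using i0 by simp
qed

theorem not_isolated: "\<not> graded_isolated_singularity (graded_quotient B (Idl {f}))"
proof -
 define I where "I = Idl {f}"
 have I_eq: "I = (\<lambda>t. f \<otimes> t) ` carrier B" unfolding I_def by (rule central_multiple_ideal[OF f_closed f_central])
 have ideal: "ideal I B" unfolding I_def by (rule genideal_ideal) simp
 have hom: "cmp B (hcomp B) a j \<in> I" if "a \<in> I" for a j
 proof -
  obtain t where t: "a = f \<otimes> t" "t \<in> carrier B" using \<open>a \<in> I\<close> unfolding I_eq by (elim imageE)
  show ?thesis unfolding t(1) cmp_mult_left[OF hcomps(4) t(2)] I_eq by (rule imageI[OF SG.cmp_closed[OF t(2)]])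
 qed
 interpret Q: alg_quotient I B by (rule quotient_algebra(1)[OF ideal hom])
 interpret S: graded_algebra Q.Q by (rule quotient_algebra(2)[OF ideal hom])
 let ?g = "\<lambda>b. I +> b"
 let ?X = "?g ` {\<iota> x1, \<iota> x2, p, q}"
 have rep: "\<exists>b\<in>carrier B. s = ?g b" if "s \<in> carrier Q.Q" for s
  using that unfolding Q.quot_carrier by (elim imageE) (rule bexI)
 have ghom: "?g b \<in> hcomp Q.Q j" if "b \<in> hcomp B j" for b j
  unfolding Q.quot_simps(6) using that by (rule imageI)
 have gz: "?g b = \<zero>[Q.Q] \<longleftrightarrow> (\<exists>t\<in>carrier B. b = f \<otimes> t)" if "b \<in> carrier B" for b
 proof (rule trans[OF Q.quot_eq_zero[OF that]])
  show "b \<in> I \<longleftrightarrow> (\<exists>t\<in>carrier B. b = f \<otimes> t)" unfolding I_eq by (rule image_iff)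
 qed
 have gf: "?g f = \<zero>[Q.Q]" unfolding gz[OF f_closed] by (rule bexI[of _ \<one>]) simp_all
 have "std_algebra Q.Q (words Q.Q ?X)"
 proof (rule S.std_algebraI)
  show "?X \<subseteq> hcomp Q.Q 1"
  proof
   fix s assume "s \<in> ?X"
   then obtain b where b: "s = ?g b" "b \<in> {\<iota> x1, \<iota> x2, p, q}" by (elim imageE)
   have "b \<in> hcomp B 1" using b(2) p q \<iota>_hcomp[OF skew_plane_gens(1)] \<iota>_hcomp[OF skew_plane_gens(2)] by auto
   then show "s \<in> hcomp Q.Q 1" unfolding b(1) by (rule ghom)
  qed
  fix T assume T: "T \<subseteq> carrier Q.Q" and sc: "\<And>c. c \<bullet>\<^bsub>Q.Q\<^esub> \<one>\<^bsub>Q.Q\<^esub> \<in> T" and X: "?X \<subseteq> T"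
   and add: "\<And>a b. a \<in> T \<Longrightarrow> b \<in> T \<Longrightarrow> a \<oplus>[Q.Q] b \<in> T" and mult: "\<And>a b. a \<in> T \<Longrightarrow> b \<in> T \<Longrightarrow> a \<otimes>[Q.Q] b \<in> T"
  have gT: "?g b \<in> T" if "b \<in> carrier B" for b
   using that
  proof (induction rule: B_induct)
   case (scalar c)
   show ?case using sc[of c] unfolding Q.quot_one Q.quot_scale[OF one_closed] .
  next
   case (add a b)
   show ?case using \<open>\<And>a b. a \<in> T \<Longrightarrow> b \<in> T \<Longrightarrow> a \<oplus>[Q.Q] b \<in> T\<close>[OF add(3,4)] unfolding Q.quot_add[OF add(1,2)] .
  next
   case (mult a b)
   show ?case using \<open>\<And>a b. a \<in> T \<Longrightarrow> b \<in> T \<Longrightarrow> a \<otimes>[Q.Q] b \<in> T\<close>[OF mult(3,4)] unfolding Q.quot_mult[OF mult(1,2)] .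
  qed (use X in simp_all)
  show "carrier Q.Q \<subseteq> T"
  proof
   fix s assume "s \<in> carrier Q.Q"
   from rep[OF this] obtain b where "b \<in> carrier B" "s = ?g b" by (elim bexE)
   then show "s \<in> T" using gT by simp
  qed
 qed simp
 then interpret S: std_algebra Q.Q "words Q.Q ?X" .
 \<comment> \<open>If t b lies in the ideal of f, then t b = f c = t t' c, and t can be
   cancelled.\<close>
 have ann: "\<exists>b\<in>carrier Q.Q. s = ?g t' \<otimes>[Q.Q] b"
  if s: "s \<in> carrier Q.Q" and z: "?g t \<otimes>[Q.Q] s = \<zero>[Q.Q]" and t: "t = u \<and> t' = v \<or> t = v \<and> t' = u" for s t t'
 proof -
  have tc: "t \<in> carrier B" "t' \<in> carrier B" "t \<otimes> t' = f" "t = u \<or> t = v" using t uv by auto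
  obtain b where b: "b \<in> carrier B" "s = ?g b" using rep[OF s] by (elim bexE)
  have "?g (t \<otimes> b) = \<zero>[Q.Q]" using z unfolding b(2) Q.quot_mult[OF tc(1) b(1)] .
  from iffD1[OF gz[OF m_closed[OF tc(1) b(1)]] this] obtain c where c: "c \<in> carrier B" "t \<otimes> b = f \<otimes> c" by (elim bexE)
  have "t \<otimes> b = t \<otimes> (t' \<otimes> c)" unfolding c(2) tc(3)[symmetric] using tc(1,2) c(1) by (simp add: m_assoc)
  then have "b = t' \<otimes> c" by (rule cancel_eq[OF tc(4) b(1) m_closed[OF tc(2) c(1)]])
  then have "s = ?g t' \<otimes>[Q.Q] ?g c" unfolding b(2) Q.quot_mult[OF tc(2) c(1)] by simp
  then show ?thesis using Q.quot_closed[OF c(1)] by (rule bexI)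
 qed
 interpret E: exact_zero_divisors Q.Q "words Q.Q ?X" "?g u" "?g v" "?g P.h" 2
 proof
  show "?g u \<in> hcomp Q.Q 1" "?g v \<in> hcomp Q.Q 1" by (intro ghom hcomps)+
  show "?g P.h \<in> hcomp Q.Q (int 2)" using ghom[OF hcomps(3)] by simp
  show "?g u \<otimes>[Q.Q] ?g v = \<zero>[Q.Q]" "?g v \<otimes>[Q.Q] ?g u = \<zero>[Q.Q]"
   using gf by (simp_all add: Q.quot_mult uv)
  show "?g P.h \<otimes>[Q.Q] ?g u = ?g u \<otimes>[Q.Q] ?g P.h" "?g P.h \<otimes>[Q.Q] ?g v = ?g v \<otimes>[Q.Q] ?g P.h"
   by (simp_all add: Q.quot_mult huv)
 qed (use ann in simp_all)
 have "\<not> graded_isolated_singularity Q.Q"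
 proof (rule E.gldim_infinite)
  fix k :: nat and s assume "s \<in> carrier Q.Q"
  from rep[OF this] obtain b where b: "b \<in> carrier B" "s = ?g b" by (elim bexE)
  have pow: "?g P.h [^]\<^bsub>Q.Q\<^esub> k = ?g (P.h [^] k)"
   by (induction k) (simp_all add: Q.quot_one Q.quot_mult)
  let ?h = "P.h [^] k"
  have hc: "?h \<in> carrier B" by simp
  show "?g v \<otimes>[Q.Q] (?g P.h [^]\<^bsub>Q.Q\<^esub> k) \<noteq> \<ominus>\<^bsub>Q.Q\<^esub> (?g v \<otimes>[Q.Q] (?g P.h [^]\<^bsub>Q.Q\<^esub> k)) \<oplus>[Q.Q] ?g v \<otimes>[Q.Q] s \<otimes>[Q.Q] ?g v"
  proof
   assume "?g v \<otimes>[Q.Q] (?g P.h [^]\<^bsub>Q.Q\<^esub> k) = \<ominus>\<^bsub>Q.Q\<^esub> (?g v \<otimes>[Q.Q] (?g P.h [^]\<^bsub>Q.Q\<^esub> k)) \<oplus>[Q.Q] ?g v \<otimes>[Q.Q] s \<otimes>[Q.Q] ?g v"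
   then have "?g (v \<otimes> ?h) = ?g (\<ominus> (v \<otimes> ?h) \<oplus> v \<otimes> b \<otimes> v)"
    unfolding pow b(2) using b(1) by (simp add: Q.quot_mult Q.quot_add Q.quot_minus)
   then have "v \<otimes> ?h \<ominus> (\<ominus> (v \<otimes> ?h) \<oplus> v \<otimes> b \<otimes> v) \<in> I"
    using b(1) by (subst (asm) Q.quot_eq) simp_all
   then obtain c where c: "v \<otimes> ?h \<ominus> (\<ominus> (v \<otimes> ?h) \<oplus> v \<otimes> b \<otimes> v) = f \<otimes> c" "c \<in> carrier B" unfolding I_eq by (elim imageE)
   \<comment> \<open>Collecting the terms behind a common left factor v and writing f as v u allows
     v to be cancelled, which gives 2 h^k = b v + u c.\<close>
   have "v \<otimes> ((?h \<oplus> ?h) \<oplus> \<ominus> (b \<otimes> v)) = v \<otimes> ?h \<ominus> (\<ominus> (v \<otimes> ?h) \<oplus> v \<otimes> b \<otimes> v)"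
    using b(1) by (simp add: minus_eq r_distr r_minus minus_add a_assoc m_assoc)
   also have "\<dots> = v \<otimes> (u \<otimes> c)" unfolding c(1) uv(2)[symmetric] using c(2) by (simp add: m_assoc)
   finally have e: "v \<otimes> ((?h \<oplus> ?h) \<oplus> \<ominus> (b \<otimes> v)) = v \<otimes> (u \<otimes> c)" .
   have "(?h \<oplus> ?h) \<oplus> \<ominus> (b \<otimes> v) = u \<otimes> c"
    by (rule cancel_eq[OF _ _ _ e]) (use b c in simp_all)
   then have "b \<otimes> v \<oplus> ((?h \<oplus> ?h) \<oplus> \<ominus> (b \<otimes> v)) = b \<otimes> v \<oplus> u \<otimes> c" by simp
   moreover have "b \<otimes> v \<oplus> ((?h \<oplus> ?h) \<oplus> \<ominus> (b \<otimes> v)) = ?h \<oplus> ?h"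
    by (rule add_minus_cancel) (use b(1) in simp_all)
   ultimately show False using power_h_not_in[OF b(1) c(2), of k] by simp
  qed
 qed
 then show ?thesis unfolding I_def .
qed

end

theorem proposition5p12:
  fixes B :: "('k::{alg_closed_field, field_char_0}, 'b) graded_alg"
    and \<iota> :: "(xvar list \<Rightarrow> 'k) set \<Rightarrow> 'b"
    and y :: "nat \<Rightarrow> 'b"
    and \<sigma> :: "nat \<Rightarrow> nat \<Rightarrow> (xvar list \<Rightarrow> 'k) set \<Rightarrow> (xvar list \<Rightarrow> 'k) set"
  assumes "double_ore_extension skew_plane \<iota> B y (- 1) 0 \<sigma>"
    and "y 1 \<in> hcomp B 1" and "y 2 \<in> hcomp B 1"
    and "\<sigma> 1 1 x1 = x1 \<oplus>\<^bsub>skew_plane\<^esub> x2" and "\<sigma> 1 2 x1 = x1"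
    and "\<sigma> 2 1 x1 = x2" and "\<sigma> 2 2 x1 = \<zero>\<^bsub>skew_plane\<^esub>"
    and "\<sigma> 1 1 x2 = \<zero>\<^bsub>skew_plane\<^esub>" and "\<sigma> 1 2 x2 = x1"
    and "\<sigma> 2 1 x2 = \<ominus>\<^bsub>skew_plane\<^esub> x2"
    and "\<sigma> 2 2 x2 = \<ominus>\<^bsub>skew_plane\<^esub> x1 \<oplus>\<^bsub>skew_plane\<^esub> x2"
  shows "\<not> graded_isolated_singularity (graded_quotient B (Idl\<^bsub>B\<^esub>
           {\<iota> x1 [^]\<^bsub>B\<^esub> (2::nat) \<oplus>\<^bsub>B\<^esub> \<iota> x2 [^]\<^bsub>B\<^esub> (2::nat) \<oplus>\<^bsub>B\<^esub>
            y 1 [^]\<^bsub>B\<^esub> (2::nat) \<oplus>\<^bsub>B\<^esub> y 2 [^]\<^bsub>B\<^esub> (2::nat)}))"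
proof -
 note d = assms(1)[unfolded double_ore_extension_def]
 have A: "graded_algebra (\<A> :: ('k, (xvar list \<Rightarrow> 'k) set) graded_alg)" and B: "graded_algebra B"
  and m: "matrix_hom \<A> \<sigma>" and r: "right_double_ore \<A> \<iota> B y (- 1) 0 \<sigma>"
  and io: "\<iota> \<in> graded_algebra_hom \<A> B"
  and g: "generate_ring B (\<iota> ` carrier \<A> \<union> {y 1, y 2}) = carrier B" by (insert d, elim conjE, assumption)+
 interpret A: graded_algebra "\<A> :: ('k, (xvar list \<Rightarrow> 'k) set) graded_alg" by (rule A)
 interpret B: graded_algebra B by (rule B)
 have yc: "y 1 \<in> carrier B" "y 2 \<in> carrier B" using assms(2,3) B.SG.comp_closed by blast+
 have rel: "y 2 \<otimes>[B] y 1 = (- 1) \<bullet>\<^bsub>B\<^esub> (y 1 \<otimes>[B] y 2) \<oplus>[B] 0 \<bullet>\<^bsub>B\<^esub> (y 1 \<otimes>[B] y 1)"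
  and basis: "\<forall>b\<in>carrier B. \<exists>!c :: nat \<times> nat \<Rightarrow> _. range c \<subseteq> carrier \<A> \<and> finite {n. c n \<noteq> \<zero>[\<A>]} \<and>
    b = (\<Oplus>\<^bsub>B\<^esub>n\<in>{n. c n \<noteq> \<zero>[\<A>]}. \<iota> (c n) \<otimes>[B] (y 1 [^]\<^bsub>B\<^esub> fst n \<otimes>[B] y 2 [^]\<^bsub>B\<^esub> snd n))"
  and yi: "\<forall>i\<in>{1, 2}. \<forall>a\<in>carrier \<A>. y i \<otimes>[B] \<iota> a = \<iota> (\<sigma> i 1 a) \<otimes>[B] y 1 \<oplus>[B] \<iota> (\<sigma> i 2 a) \<otimes>[B] y 2"
  by (insert r[unfolded right_double_ore_def], elim conjE, assumption)+
 have one2: "(1::nat) \<in> {1, 2}" "(2::nat) \<in> {1, 2}" by simp_all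
 have \<sigma>: "\<sigma> i j a \<in> carrier \<A>"
   "\<sigma> i j (c \<bullet>\<^bsub>\<A>\<^esub> \<one>\<^bsub>\<A>\<^esub>) = c \<bullet>\<^bsub>\<A>\<^esub> (if i = j then \<one>\<^bsub>\<A>\<^esub> else \<zero>[\<A>])"
   "\<sigma> i j (a \<oplus>[\<A>] b) = \<sigma> i j a \<oplus>[\<A>] \<sigma> i j b"
   "\<sigma> i j (a \<otimes>[\<A>] b) = \<sigma> i 1 a \<otimes>[\<A>] \<sigma> 1 j b \<oplus>[\<A>] \<sigma> i 2 a \<otimes>[\<A>] \<sigma> 2 j b"
  if "i \<in> {1, 2}" "j \<in> {1, 2}" "a \<in> carrier \<A>" "b \<in> carrier \<A>" for i j a b c
 proof -
  note mm = m[unfolded matrix_hom_def, THEN bspec, OF that(1), THEN bspec, OF that(2)]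
  show "\<sigma> i j a \<in> carrier \<A>" using conjunct1[OF mm] that(3) by (rule funcset_mem)
  show "\<sigma> i j (c \<bullet>\<^bsub>\<A>\<^esub> \<one>\<^bsub>\<A>\<^esub>) = c \<bullet>\<^bsub>\<A>\<^esub> (if i = j then \<one>\<^bsub>\<A>\<^esub> else \<zero>[\<A>])"
   using mm A.one_closed by (simp del: One_nat_def)
  show "\<sigma> i j (a \<oplus>[\<A>] b) = \<sigma> i j a \<oplus>[\<A>] \<sigma> i j b"
   "\<sigma> i j (a \<otimes>[\<A>] b) = \<sigma> i 1 a \<otimes>[\<A>] \<sigma> 1 j b \<oplus>[\<A>] \<sigma> i 2 a \<otimes>[\<A>] \<sigma> 2 j b"
   using mm that(3,4) by (simp_all del: One_nat_def)
 qed
 interpret S: skew_ore B \<iota> "y 1" "y 2" "\<sigma> 1 1" "\<sigma> 1 2" "\<sigma> 2 1" "\<sigma> 2 2"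
 proof (intro skew_ore.intro skew_ore_axioms.intro A B io assms(2-11) g)
  fix a a' :: "(xvar list \<Rightarrow> 'k) set" assume a: "a \<in> carrier \<A>"
  show "\<sigma> 1 1 a \<in> carrier \<A> \<and> \<sigma> 1 2 a \<in> carrier \<A> \<and> \<sigma> 2 1 a \<in> carrier \<A> \<and> \<sigma> 2 2 a \<in> carrier \<A>"
   by (intro conjI \<sigma>(1)[OF _ _ a a] one2)
  show "y 1 \<otimes>[B] \<iota> a = \<iota> (\<sigma> 1 1 a) \<otimes>[B] y 1 \<oplus>[B] \<iota> (\<sigma> 1 2 a) \<otimes>[B] y 2"
   "y 2 \<otimes>[B] \<iota> a = \<iota> (\<sigma> 2 1 a) \<otimes>[B] y 1 \<oplus>[B] \<iota> (\<sigma> 2 2 a) \<otimes>[B] y 2"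
   by (rule yi[THEN bspec, OF one2(1), THEN bspec, OF a], rule yi[THEN bspec, OF one2(2), THEN bspec, OF a])
  assume a': "a' \<in> carrier \<A>"
  show "\<sigma> 1 1 (a \<oplus>[\<A>] a') = \<sigma> 1 1 a \<oplus>[\<A>] \<sigma> 1 1 a' \<and>
   \<sigma> 1 2 (a \<oplus>[\<A>] a') = \<sigma> 1 2 a \<oplus>[\<A>] \<sigma> 1 2 a' \<and>
   \<sigma> 2 1 (a \<oplus>[\<A>] a') = \<sigma> 2 1 a \<oplus>[\<A>] \<sigma> 2 1 a' \<and>
   \<sigma> 2 2 (a \<oplus>[\<A>] a') = \<sigma> 2 2 a \<oplus>[\<A>] \<sigma> 2 2 a'"
   by (intro conjI \<sigma>(3)[OF _ _ a a'] one2)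
  show "\<sigma> 1 1 (a \<otimes>[\<A>] a') = \<sigma> 1 1 a \<otimes>[\<A>] \<sigma> 1 1 a' \<oplus>[\<A>] \<sigma> 1 2 a \<otimes>[\<A>] \<sigma> 2 1 a' \<and>
   \<sigma> 1 2 (a \<otimes>[\<A>] a') = \<sigma> 1 1 a \<otimes>[\<A>] \<sigma> 1 2 a' \<oplus>[\<A>] \<sigma> 1 2 a \<otimes>[\<A>] \<sigma> 2 2 a' \<and>
   \<sigma> 2 1 (a \<otimes>[\<A>] a') = \<sigma> 2 1 a \<otimes>[\<A>] \<sigma> 1 1 a' \<oplus>[\<A>] \<sigma> 2 2 a \<otimes>[\<A>] \<sigma> 2 1 a' \<and>
   \<sigma> 2 2 (a \<otimes>[\<A>] a') = \<sigma> 2 1 a \<otimes>[\<A>] \<sigma> 1 2 a' \<oplus>[\<A>] \<sigma> 2 2 a \<otimes>[\<A>] \<sigma> 2 2 a'"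
   by (intro conjI \<sigma>(4)[OF _ _ a a'] one2)
 next
  fix c :: 'k
  note sc = \<sigma>(2)[OF _ _ A.one_closed A.one_closed, of _ _ c]
  show "\<sigma> 1 1 (c \<bullet>\<^bsub>\<A>\<^esub> \<one>\<^bsub>\<A>\<^esub>) = c \<bullet>\<^bsub>\<A>\<^esub> \<one>\<^bsub>\<A>\<^esub>"
   "\<sigma> 1 2 (c \<bullet>\<^bsub>\<A>\<^esub> \<one>\<^bsub>\<A>\<^esub>) = \<zero>[\<A>]" "\<sigma> 2 1 (c \<bullet>\<^bsub>\<A>\<^esub> \<one>\<^bsub>\<A>\<^esub>) = \<zero>[\<A>]"
   "\<sigma> 2 2 (c \<bullet>\<^bsub>\<A>\<^esub> \<one>\<^bsub>\<A>\<^esub>) = c \<bullet>\<^bsub>\<A>\<^esub> \<one>\<^bsub>\<A>\<^esub>"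
   using sc[OF one2(1) one2(1)] sc[OF one2(1) one2(2)] sc[OF one2(2) one2(1)] sc[OF one2(2) one2(2)]
   by (simp_all add: A.ascale_zero)
 next
  show "y 2 \<otimes>[B] y 1 = \<ominus>\<^bsub>B\<^esub> (y 1 \<otimes>[B] y 2)"
   unfolding rel using yc by (simp add: B.ascale_minus B.ascale_one B.zero_ascale del: One_nat_def)
  fix t assume "t \<in> carrier B"
  then show "\<exists>!c :: nat \<times> nat \<Rightarrow> (xvar list \<Rightarrow> 'k) set. range c \<subseteq> carrier \<A> \<and> finite {n. c n \<noteq> \<zero>[\<A>]} \<and>
    t = (\<Oplus>\<^bsub>B\<^esub>n\<in>{n. c n \<noteq> \<zero>[\<A>]}. \<iota> (c n) \<otimes>[B] (y 1 [^]\<^bsub>B\<^esub> fst n \<otimes>[B] y 2 [^]\<^bsub>B\<^esub> snd n))"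
   by (rule basis[THEN bspec])
 qed
 have sq: "b [^]\<^bsub>B\<^esub> (2::nat) = b \<otimes>[B] b" if "b \<in> carrier B" for b
  using that by (simp add: numeral_2_eq_2)
 have "\<iota> x1 [^]\<^bsub>B\<^esub> (2::nat) \<oplus>[B] \<iota> x2 [^]\<^bsub>B\<^esub> (2::nat) \<oplus>[B] y 1 [^]\<^bsub>B\<^esub> (2::nat) \<oplus>[B] y 2 [^]\<^bsub>B\<^esub> (2::nat) = S.f"
  unfolding S.f_def S.P.XX S.P.YY sq[OF yc(1)] sq[OF yc(2)] sq[OF S.P.gens(1)] sq[OF S.P.gens(2)]
  by (rule B.a_assoc) (use yc in simp_all)
 then show ?thesis using S.not_isolated by simp
qed

end
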